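(* Let $n\ge1$. Let $U\subseteq\mathrm{Hol}(\mathbb B^n,\mathbb C^n)$ be an open set containing $\mathcal S_n^0$ and let $\Phi:U\to\mathbb C$ be a continuous functional. Let $F\in\mathcal S_n^0$ be an extremal function for $\Phi$, i.e. $\mathrm{Re}\,\Phi(f)\le\mathrm{Re}\,\Phi(F)$ for every $f\in\mathcal S_n^0$, and suppose that $\Phi$ is complex differentiable at $F$ with complex derivative $L$ at $F$. Suppose that $L$ is not constant on $\mathcal S_n^0$. If $G(z,t)$ is a Herglotz vector field in the class $\mathcal M_n$ such that $F=f^G$, then $G(\cdot,t)$ is a support point of the class $\mathcal M_n$ for a.e. $t\ge0$.
   Context: $\mathbb B^n=\{z\in\mathbb C^n:\|z\|<1\}$ is the Euclidean unit ball, $\mathrm{Hol}(\mathbb B^n,\mathbb C^n)$ is the Fréchet space of holomorphic maps $\mathbb B^n\to\mathbb C^n$ with the compact-open topology, $\langle\cdot,\cdot\rangle$ is the standard Euclidean (Hermitian) inner product of $\mathbb C^n$, $\mathbb R^+=(0,\infty)$, and $df_z$ is the complex derivative of $f$ at $z$. $\mathcal M_n=\{h\in\mathrm{Hol}(\mathbb B^n,\mathbb C^n): h(0)=0,\ dh_0=-\mathrm{id},\ \mathrm{Re}\,\langle h(z),z\rangle\le 0 \text{ for all } z\in\mathbb B^n\}$. A Herglotz vector field in the class $\mathcal M_n$ is a mapping $G:\mathbb B^n\times\mathbb R^+\to\mathbb C^n$ such that $G(z,\cdot)$ is measurable on $\mathbb R^+$ for every $z\in\mathbb B^n$ and $G(\cdot,t)\in\mathcal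 M_n$ for a.e. $t\in\mathbb R^+$. For such $G$, $\varphi^G_t$ denotes the unique (locally absolutely continuous in $t$) solution of $\dot\varphi_t(z)=G(\varphi_t(z),t)$ for a.e. $t\ge 0$, $\varphi_0(z)=z\in\mathbb B^n$. The limit $f^G:=\lim_{t\to\infty}e^t\varphi^G_t$ exists locally uniformly in $\mathbb B^n$, and $\mathcal S_n^0:=\{f^G : G \text{ a Herglotz vector field in the class } \mathcal M_n\}$. Complex derivative: let $U\subseteq\mathrm{Hol}(\mathbb B^n,\mathbb C^n)$ be open and $\Phi:U\to\mathbb C$ continuous. $\Phi$ is differentiable at $f\in U$ along $h\in\mathrm{Hol}(\mathbb B^n,\mathbb C^n)$ if $\Lambda(f;h):=\lim_{\mathbb C\ni\delta\to0}\frac{\Phi(f+\delta h)-\Phi(f)}{\delta}$ exists. $\Phi$ is complex differentiable at $F\in U$ if there is an open neighborhood $V\subseteq U$ of $F$ such that $\Phi$ is differentiable at every $f\in V$ along every $h\in\mathrm{Hol}(\mathbb B^n,\mathbb C^n)$ and $\Lambda:V\times\mathrm{Hol}(\mathbb B^n,\mathbb C^n)\to\mathbb C$ is continuous; then $L:=\Lambda(F;\cdot)$, a continuous linear functional, is called the complex derivative of $\Phi$ at $F$. Support point: for $\mathcal A\subseteq\mathrm{Hol}(\mathbb B^n,\mathbb C^n)$, a function $g\in\mathcal A$ is a support point of $\mathcal A$ if there is a continuous linear functional $\ell:\mathrm{Hol}(\mathbb B^n,\mathbb C^n)\to\mathbb C$ such that $\mathrm{Re}\,\ell(h)\le\mathrm{Re}\,\ell(g)$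 for every $h\in\mathcal A$ and $\ell$ is not constant on $\mathcal A$. *)

theory Defs
  imports "HOL-Analysis.Analysis"
begin

text \<open>The complex space \<open>\<complex>\<^sup>n\<close> with \<open>n \<ge> 1\<close> is the type \<^typ>\<open>complex^'n\<close>, whose library norm is
  the Euclidean one; the unit ball is \<^term>\<open>ball 0 1\<close>.\<close>

definition hinner :: "complex^'n \<Rightarrow> complex^'n \<Rightarrow> complex" where
  "hinner z w = (\<Sum>i\<in>UNIV. z $ i * cnj (w $ i))"

text \<open>A real derivative given by a complex matrix is a complex derivative.\<close>

definition holomorphic_map_on :: "(complex^'n \<Rightarrow> complex^'n) \<Rightarrow> (complex^'n) set \<Rightarrow> bool" where
  "holomorphic_map_on f S \<longleftrightarrow>
     (\<forall>z\<in>S. \<exists>A :: complex^'n^'n. (f has_derivative (\<lambda>v. A *v v)) (at z))"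

text \<open>Functions in HOL are total, so a map defined on the unit ball is represented by its extension
  by \<open>0\<close>; this makes equality, and the pointwise vector space operations, those of maps on the
  ball.\<close>

definition Hol :: "(complex^'n \<Rightarrow> complex^'n) set" where
  "Hol = {f. holomorphic_map_on f (ball 0 1) \<and> (\<forall>z. z \<notin> ball 0 1 \<longrightarrow> f z = 0)}"

definition compact_open_topology :: "(complex^'n \<Rightarrow> complex^'n) topology" where
  "compact_open_topology =
     topology_generated_by
       {{f \<in> Hol. f ` K \<subseteq> W} | K W. compact K \<and> K \<subseteq> ball 0 1 \<and> open W}"

definition continuous_linear_functional :: "((complex^'n \<Rightarrow> complex^'n) \<Rightarrow> complex) \<Rightarrow> bool" where
  "continuous_linear_functional l \<longleftrightarrow>
     continuous_map compact_open_topology euclidean l \<and>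
     (\<forall>f\<in>Hol. \<forall>g\<in>Hol. l (\<lambda>z. f z + g z) = l f + l g) \<and>
     (\<forall>c. \<forall>f\<in>Hol. l (\<lambda>z. c *s f z) = c * l f)"

definition class_M :: "(complex^'n \<Rightarrow> complex^'n) set" where
  "class_M = {h \<in> Hol. h 0 = 0 \<and> (h has_derivative (\<lambda>v. - v)) (at 0) \<and>
                       (\<forall>z\<in>ball 0 1. Re (hinner (h z) z) \<le> 0)}"

definition Herglotz_field :: "(complex^'n \<Rightarrow> real \<Rightarrow> complex^'n) \<Rightarrow> bool" where
  "Herglotz_field G \<longleftrightarrow>
     (\<forall>z\<in>ball 0 1. G z \<in> borel_measurable (lebesgue_on {0<..})) \<and>
     (AE t in lebesgue_on {0<..}. (\<lambda>z. G z t) \<in> class_M)"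

text \<open>The usual epsilon-delta definition, where \<open>d\<close> ranges over the finite families of
  non-overlapping compact subintervals of \<open>{a..b}\<close>.\<close>

definition abs_continuous_on_interval :: "real \<Rightarrow> real \<Rightarrow> (real \<Rightarrow> 'a::real_normed_vector) \<Rightarrow> bool" where
  "abs_continuous_on_interval a b f \<longleftrightarrow>
     (\<forall>\<epsilon>>0. \<exists>\<delta>>0. \<forall>d. d division_of \<Union>d \<and> \<Union>d \<subseteq> {a..b} \<and> (\<Sum>k\<in>d. Sup k - Inf k) < \<delta> \<longrightarrow>
        (\<Sum>k\<in>d. norm (f (Sup k) - f (Inf k))) < \<epsilon>)"

definition Loewner_flow ::
    "(complex^'n \<Rightarrow> real \<Rightarrow> complex^'n) \<Rightarrow> (real \<Rightarrow> complex^'n \<Rightarrow> complex^'n) \<Rightarrow> bool" where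
  "Loewner_flow G \<phi> \<longleftrightarrow>
     (\<forall>z\<in>ball 0 1.
        \<phi> 0 z = z \<and>
        (\<forall>t\<ge>0. \<phi> t z \<in> ball 0 1) \<and>
        (\<forall>T\<ge>0. abs_continuous_on_interval 0 T (\<lambda>t. \<phi> t z)) \<and>
        (AE t in lebesgue_on {0<..}. ((\<lambda>s. \<phi> s z) has_vector_derivative G (\<phi> t z) t) (at t)))"

text \<open>\<open>is_f_of G f\<close> states that \<open>f\<close> is the map \<open>f\<^sup>G\<close>, the locally uniform limit of \<open>e\<^sup>t \<phi>\<^sub>t\<close> on the
  unit ball, extended by \<open>0\<close>.  The flow \<open>\<phi>\<close> of a Herglotz field is unique for \<open>t \<ge> 0\<close> on the ball.\<close>

definition is_f_of ::
    "(complex^'n \<Rightarrow> real \<Rightarrow> complex^'n) \<Rightarrow> (complex^'n \<Rightarrow> complex^'n) \<Rightarrow> bool" where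
  "is_f_of G f \<longleftrightarrow>
     (\<exists>\<phi>. Loewner_flow G \<phi> \<and>
        (\<forall>K. compact K \<and> K \<subseteq> ball 0 1 \<longrightarrow> uniform_limit K (\<lambda>t z. exp t *\<^sub>R \<phi> t z) f at_top)) \<and>
     (\<forall>z. z \<notin> ball 0 1 \<longrightarrow> f z = 0)"

definition class_S0 :: "(complex^'n \<Rightarrow> complex^'n) set" where
  "class_S0 = {f. \<exists>G. Herglotz_field G \<and> is_f_of G f}"

definition differentiable_along ::
    "((complex^'n \<Rightarrow> complex^'n) \<Rightarrow> complex) \<Rightarrow> (complex^'n \<Rightarrow> complex^'n) \<Rightarrow>
      (complex^'n \<Rightarrow> complex^'n) \<Rightarrow> bool" where
  "differentiable_along \<Phi> f h \<longleftrightarrow>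
     (\<exists>l. ((\<lambda>\<delta>. (\<Phi> (\<lambda>z. f z + \<delta> *s h z) - \<Phi> f) / \<delta>) \<longlongrightarrow> l) (at 0))"

definition directional_derivative ::
    "((complex^'n \<Rightarrow> complex^'n) \<Rightarrow> complex) \<Rightarrow> (complex^'n \<Rightarrow> complex^'n) \<Rightarrow>
      (complex^'n \<Rightarrow> complex^'n) \<Rightarrow> complex" where
  "directional_derivative \<Phi> f h =
     Lim (at 0) (\<lambda>\<delta>. (\<Phi> (\<lambda>z. f z + \<delta> *s h z) - \<Phi> f) / \<delta>)"

definition complex_differentiable_at ::
    "((complex^'n \<Rightarrow> complex^'n) \<Rightarrow> complex) \<Rightarrow> (complex^'n \<Rightarrow> complex^'n) set \<Rightarrow>
      (complex^'n \<Rightarrow> complex^'n) \<Rightarrow> bool" where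
  "complex_differentiable_at \<Phi> U F \<longleftrightarrow>
     (\<exists>V. openin compact_open_topology V \<and> F \<in> V \<and> V \<subseteq> U \<and>
        (\<forall>f\<in>V. \<forall>h\<in>Hol. differentiable_along \<Phi> f h) \<and>
        continuous_map (prod_topology (subtopology compact_open_topology V) compact_open_topology)
          euclidean (\<lambda>(f, h). directional_derivative \<Phi> f h))"

definition support_point ::
    "(complex^'n \<Rightarrow> complex^'n) set \<Rightarrow> (complex^'n \<Rightarrow> complex^'n) \<Rightarrow> bool" where
  "support_point A g \<longleftrightarrow> g \<in> A \<and>
     (\<exists>l. continuous_linear_functional l \<and> (\<forall>h\<in>A. Re (l h) \<le> Re (l g)) \<and> \<not> l constant_on A)"

end

theory Submission
  imports Defs "HOL-Complex_Analysis.Conformal_Mappings"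
begin

text \<open>Let \<open>\<phi>\<^sub>s\<^sub>,\<^sub>t\<close> be the transition maps of \<open>G\<close> and \<open>F\<^sub>s = lim e\<^sup>t \<phi>\<^sub>s\<^sub>,\<^sub>t\<close>, so that \<open>F = F\<^sub>a \<circ> \<phi>\<^sub>0\<^sub>,\<^sub>a\<close>.  Replacing
  \<open>G\<close> by \<open>h \<in> \<M>\<^sub>n\<close> on the time interval \<open>[a, a + \<epsilon>]\<close> yields an element of \<open>S\<^sub>n\<^sup>0\<close>, which for a.e. \<open>a\<close> has
  the form \<open>F + \<epsilon> (T h - T G\<^sub>a) + o(\<epsilon>)\<close> with \<open>T p = (dF\<^sub>a \<cdot> p) \<circ> \<phi>\<^sub>0\<^sub>,\<^sub>a\<close>.  Extremality of \<open>F\<close> gives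
  \<open>Re L(T h) \<le> Re L(T G\<^sub>a)\<close>, so \<open>G\<^sub>a\<close> maximizes \<open>L \<circ> T\<close> over \<open>\<M>\<^sub>n\<close>.

  If \<open>L \<circ> T\<close> were constant on \<open>\<M>\<^sub>n\<close>, it would vanish on all maps of order at least two at the origin,
  since small multiples of these (after a dilation) are admissible perturbations of \<open>-id\<close>.  As \<open>dF\<^sub>a\<close> is
  invertible, \<open>L\<close> then vanishes on all \<open>q \<circ> \<phi>\<^sub>0\<^sub>,\<^sub>a\<close> with \<open>q\<close> of order at least two.  These compositions are
  dense among the maps of order at least two: one goes back from \<open>a\<close> to \<open>0\<close> in small steps, inverting
  \<open>\<phi>\<^sub>s\<^sub>,\<^sub>t\<close> near the support of \<open>L\<close> and approximating by polynomials.  Hence \<open>L\<close> would be constant on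
  \<open>S\<^sub>n\<^sup>0\<close>.\<close>

subsection \<open>Absolute continuity and Lebesgue points\<close>

text \<open>Two difficulties shape the proof. First, holomorphy in the initial value is not
  immediate for an equation that is merely measurable in time. It is read off from the hypotheses:
  after a shift of time and a continuation by the field \<open>-z\<close>, every transition map and
  every \<open>F\<^sub>s\<close> is a real multiple of a member of \<open>class_S0\<close>, and this
  class lies in the open set \<open>U\<close>, hence in \<open>Hol\<close>. Second, the needle
  variation moves \<open>F\<close> in a direction that changes with \<epsilon>, while the difference
  quotients of \<Phi> are taken along fixed directions. Joint continuity of \<Lambda> bridges this
  gap by a mean value estimate on complex segments; the same estimate yields the additivity of
  \<open>L\<close>.

  The growth constants depend on a radius below 1, not on the field. They come from one-variable
  estimates on complex lines. The decisive one says that \<open>h + id\<close> has a Lipschitz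
  constant of order \<mu> on the ball of radius \<mu>. Along decaying trajectories this is
  integrable in time, so \<open>e\<^sup>t\<close> times the distance of two trajectories stays
  comparable to its initial value. The limits, their univalence and the invertibility of
  \<open>dF\<^sub>a\<close> rest on this.\<close>

lemma division_of_real_interval:
  fixes d :: "real set set"
  assumes "d division_of \<Union>d" "\<Union>d \<subseteq> {a..b}" "k \<in> d"
  shows "Sup k \<in> {a..b}" "Inf k \<in> {a..b}" "Inf k \<le> Sup k"
proof -
  obtain u v where "k = cbox u v" "k \<noteq> {}"
    using division_ofD(3,4)[OF assms(1) assms(3)] by blast
  moreover have "k \<subseteq> {a..b}"
    using assms by auto
  ultimately show "Sup k \<in> {a..b}" "Inf k \<in> {a..b}" "Inf k \<le> Sup k"
    by auto
qed

lemma abs_continuous_on_interval_subset: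
  assumes "abs_continuous_on_interval a b f" "{c..d} \<subseteq> {a..b}"
  shows "abs_continuous_on_interval c d f"
  using assms unfolding abs_continuous_on_interval_def by (meson order_trans)

text \<open>Sums of increments over a division inherit the pointwise comparison. This single rule
  covers Lipschitz maps and products with bounded or Lipschitz factors.\<close>

lemma abs_continuous_on_interval_dominated:
  fixes f :: "real \<Rightarrow> 'a::real_normed_vector" and g :: "real \<Rightarrow> 'b::real_normed_vector"
  assumes f: "abs_continuous_on_interval a b f"
    and g: "\<And>s t. s \<in> {a..b} \<Longrightarrow> t \<in> {a..b} \<Longrightarrow> norm (g s - g t) \<le> C * norm (f s - f t) + D * \<bar>s - t\<bar>"
    and "C \<ge> 0" "D \<ge> 0"
  shows "abs_continuous_on_interval a b g"
  unfolding abs_continuous_on_interval_def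
proof (intro allI impI)
  fix \<epsilon> :: real assume "\<epsilon> > 0"
  define e1 where "e1 = \<epsilon> / (2 * (C + 1))"
  define e2 where "e2 = \<epsilon> / (2 * (D + 1))"
  have e: "e1 > 0" "e2 > 0"
    using \<open>\<epsilon> > 0\<close> assms by (auto simp: e1_def e2_def)
  obtain \<delta> where \<delta>: "\<delta> > 0"
    "\<And>d. d division_of \<Union>d \<and> \<Union>d \<subseteq> {a..b} \<and> (\<Sum>k\<in>d. Sup k - Inf k) < \<delta> \<Longrightarrow>
        (\<Sum>k\<in>d. norm (f (Sup k) - f (Inf k))) < e1"
    using f e(1) unfolding abs_continuous_on_interval_def by blast
  show "\<exists>\<delta>>0. \<forall>d. d division_of \<Union> d \<and> \<Union> d \<subseteq> {a..b} \<and> (\<Sum>k\<in>d. Sup k - Inf k) < \<delta> \<longrightarrow>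
           (\<Sum>k\<in>d. norm (g (Sup k) - g (Inf k))) < \<epsilon>"
  proof (intro exI[of _ "min \<delta> e2"] conjI allI impI)
    show "min \<delta> e2 > 0" using \<delta> e by auto
    fix d :: "real set set"
    assume d: "d division_of \<Union> d \<and> \<Union> d \<subseteq> {a..b} \<and> (\<Sum>k\<in>d. Sup k - Inf k) < min \<delta> e2"
    have "norm (g (Sup k) - g (Inf k)) \<le> C * norm (f (Sup k) - f (Inf k)) + D * (Sup k - Inf k)" if "k \<in> d" for k
      using g[of "Sup k" "Inf k"] division_of_real_interval[of d a b k] d that by auto
    then have "(\<Sum>k\<in>d. norm (g (Sup k) - g (Inf k))) \<le> (\<Sum>k\<in>d. C * norm (f (Sup k) - f (Inf k)) + D * (Sup k - Inf k))"
      by (rule sum_mono)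
    also have "\<dots> = C * (\<Sum>k\<in>d. norm (f (Sup k) - f (Inf k))) + D * (\<Sum>k\<in>d. Sup k - Inf k)"
      by (simp add: sum.distrib sum_distrib_left)
    also have "\<dots> \<le> C * e1 + D * e2"
      using \<delta>(2)[of d] d assms(3,4) by (intro add_mono mult_left_mono) auto
    also have "\<dots> < \<epsilon>"
    proof -
      have "C * e1 < \<epsilon> / 2" "D * e2 < \<epsilon> / 2"
        using \<open>\<epsilon> > 0\<close> assms(3,4) by (auto simp: e1_def e2_def field_simps)
      then show ?thesis by simp
    qed
    finally show "(\<Sum>k\<in>d. norm (g (Sup k) - g (Inf k))) < \<epsilon>" .
  qed
qed

lemma abs_continuous_on_interval_lipschitz:
  fixes g :: "real \<Rightarrow> 'b::real_normed_vector"
  assumes "D-lipschitz_on {a..b} g"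
  shows "abs_continuous_on_interval a b g"
proof (rule abs_continuous_on_interval_dominated[where f = "\<lambda>_. 0::real" and C = 0])
  show "abs_continuous_on_interval a b (\<lambda>_. 0::real)"
    by (auto simp: abs_continuous_on_interval_def intro: exI[of _ 1])
  show "D \<ge> 0" using assms lipschitz_on_nonneg by blast
qed (use assms in \<open>auto simp: lipschitz_on_def dist_norm\<close>)

lemma abs_continuous_on_interval_diff:
  fixes f g :: "real \<Rightarrow> 'a::real_normed_vector"
  assumes f: "abs_continuous_on_interval a b f" and g: "abs_continuous_on_interval a b g"
  shows "abs_continuous_on_interval a b (\<lambda>t. f t - g t)"
  unfolding abs_continuous_on_interval_def
proof (intro allI impI)
  fix \<epsilon> :: real assume "\<epsilon> > 0"
  then have "\<epsilon> / 2 > 0" by simp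
  note \<epsilon> = this
  obtain \<delta>1 where 1: "\<delta>1 > 0"
    "\<And>d. d division_of \<Union>d \<and> \<Union>d \<subseteq> {a..b} \<and> (\<Sum>k\<in>d. Sup k - Inf k) < \<delta>1 \<Longrightarrow>
        (\<Sum>k\<in>d. norm (f (Sup k) - f (Inf k))) < \<epsilon> / 2"
    using f \<epsilon> unfolding abs_continuous_on_interval_def by blast
  obtain \<delta>2 where 2: "\<delta>2 > 0"
    "\<And>d. d division_of \<Union>d \<and> \<Union>d \<subseteq> {a..b} \<and> (\<Sum>k\<in>d. Sup k - Inf k) < \<delta>2 \<Longrightarrow>
        (\<Sum>k\<in>d. norm (g (Sup k) - g (Inf k))) < \<epsilon> / 2"
    using g \<epsilon> unfolding abs_continuous_on_interval_def by blast
  note \<delta> = 1(1) 2(1) 1(2) 2(2)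
  show "\<exists>\<delta>>0. \<forall>d. d division_of \<Union> d \<and> \<Union> d \<subseteq> {a..b} \<and> (\<Sum>k\<in>d. Sup k - Inf k) < \<delta> \<longrightarrow>
           (\<Sum>k\<in>d. norm ((f (Sup k) - g (Sup k)) - (f (Inf k) - g (Inf k)))) < \<epsilon>"
  proof (intro exI[of _ "min \<delta>1 \<delta>2"] conjI allI impI)
    fix d :: "real set set"
    assume d: "d division_of \<Union> d \<and> \<Union> d \<subseteq> {a..b} \<and> (\<Sum>k\<in>d. Sup k - Inf k) < min \<delta>1 \<delta>2"
    have "(\<Sum>k\<in>d. norm ((f (Sup k) - g (Sup k)) - (f (Inf k) - g (Inf k)))) \<le>
        (\<Sum>k\<in>d. norm (f (Sup k) - f (Inf k)) + norm (g (Sup k) - g (Inf k)))"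
    proof (rule sum_mono)
      fix k
      have "(f (Sup k) - g (Sup k)) - (f (Inf k) - g (Inf k)) = (f (Sup k) - f (Inf k)) - (g (Sup k) - g (Inf k))"
        by simp
      then show "norm ((f (Sup k) - g (Sup k)) - (f (Inf k) - g (Inf k))) \<le>
          norm (f (Sup k) - f (Inf k)) + norm (g (Sup k) - g (Inf k))"
        by (simp only: norm_triangle_ineq4)
    qed
    also have "\<dots> = (\<Sum>k\<in>d. norm (f (Sup k) - f (Inf k))) + (\<Sum>k\<in>d. norm (g (Sup k) - g (Inf k)))"
      by (rule sum.distrib)
    also have "\<dots> < \<epsilon>" using \<delta>(3)[of d] \<delta>(4)[of d] d by auto
    finally show "(\<Sum>k\<in>d. norm ((f (Sup k) - g (Sup k)) - (f (Inf k) - g (Inf k)))) < \<epsilon>" .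
  qed (use \<delta> in auto)
qed

text \<open>Cousin's lemma replaces the usual Vitali argument: the tags in the exceptional null set
  contribute little by absolute continuity, the other tags by differentiability.\<close>

lemma abs_continuous_nonincreasing:
  fixes f :: "real \<Rightarrow> real"
  assumes f: "abs_continuous_on_interval a b f" and "a \<le> b"
    and ae: "AE t in lebesgue. t \<in> {a<..<b} \<longrightarrow> (\<exists>D\<le>0. (f has_real_derivative D) (at t))"
  shows "f b \<le> f a"
proof (rule field_le_epsilon)
  fix \<epsilon>' :: real assume "\<epsilon>' > 0"
  define \<epsilon> where "\<epsilon> = \<epsilon>' / 2"
  define \<eta> where "\<eta> = \<epsilon> / (b - a + 1)"
  have pos: "\<epsilon> > 0" "\<eta> > 0"
    using \<open>\<epsilon>' > 0\<close> \<open>a \<le> b\<close> by (auto simp: \<epsilon>_def \<eta>_def)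
  obtain \<delta> where \<delta>: "\<delta> > 0"
    "\<And>d. d division_of \<Union>d \<and> \<Union>d \<subseteq> {a..b} \<and> (\<Sum>k\<in>d. Sup k - Inf k) < \<delta> \<Longrightarrow>
        (\<Sum>k\<in>d. norm (f (Sup k) - f (Inf k))) < \<epsilon>"
    using f pos unfolding abs_continuous_on_interval_def by blast
  \<comment> \<open>The endpoints join the exceptional set because the derivative is controlled on
    the open interval only.\<close>
  define N where "N = {t. \<not> (t \<in> {a<..<b} \<longrightarrow> (\<exists>D\<le>0. (f has_real_derivative D) (at t)))} \<union> {a, b}"
  have "negligible {t. \<not> (t \<in> {a<..<b} \<longrightarrow> (\<exists>D\<le>0. (f has_real_derivative D) (at t)))}"
    using ae by (simp add: eventually_ae_filter_negligible) (metis (mono_tags, lifting) mem_Collect_eq negligible_subset subsetI)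
  then have "negligible N"
    by (simp add: N_def negligible_Un)
  then have N: "N \<in> sets lebesgue" "emeasure lebesgue N = 0"
    by (simp_all add: negligible_iff_null_sets null_sets_def)
  \<comment> \<open>An open set of measure below \<delta> around the null set; every division
    interval whose tag is exceptional will be forced into it.\<close>
  obtain T where T: "open T" "N \<subseteq> T" "T - N \<in> lmeasurable" "emeasure lebesgue (T - N) < ennreal \<delta>"
    using sets_lebesgue_outer_open[OF N(1) \<delta>(1)] .
  have TN: "T = (T - N) \<union> N" using T(2) by auto
  have Tm: "T \<in> lmeasurable"
    by (subst TN) (use T(3) \<open>negligible N\<close> negligible_imp_measurable in blast)
  have "measure lebesgue T \<le> measure lebesgue (T - N) + measure lebesgue N"
    by (subst TN, rule measure_Un_le) (use T N in auto)
  also have "measure lebesgue N = 0" using \<open>negligible N\<close> negligible_imp_measure0 by blast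
  also have "measure lebesgue (T - N) + 0 < \<delta>"
    using T(3,4) \<delta>(1) by (simp add: emeasure_eq_measure2[OF T(3)] ennreal_less_iff)
  finally have mT: "measure lebesgue T < \<delta>" .
  have "\<exists>\<rho>>0. \<forall>u v. u \<le> t \<longrightarrow> t \<le> v \<longrightarrow> t - u < \<rho> \<longrightarrow> v - t < \<rho> \<longrightarrow> f v - f u \<le> \<eta> * (v - u)"
    if "t \<in> {a..b} - N" for t
  proof -
    have "t \<in> {a<..<b}" "\<exists>D\<le>0. (f has_real_derivative D) (at t)"
      using that by (auto simp: N_def)
    then obtain D where D: "D \<le> 0" "(f has_derivative (\<lambda>h. D * h)) (at t)"
      unfolding has_field_derivative_def by blast
    obtain \<rho> where \<rho>: "\<rho> > 0" "\<And>s. norm (s - t) < \<rho> \<Longrightarrow> norm (f s - f t - D * (s - t)) \<le> \<eta> * norm (s - t)"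
      using D(2) pos(2) unfolding has_derivative_at_alt by blast
    show ?thesis
    proof (intro exI[of _ \<rho>] conjI allI impI \<rho>(1))
      fix u v assume "u \<le> t" "t \<le> v" "t - u < \<rho>" "v - t < \<rho>"
      then have 1: "\<bar>f v - f t - D * (v - t)\<bar> \<le> \<eta> * (v - t)" "\<bar>f u - f t - D * (u - t)\<bar> \<le> \<eta> * (t - u)"
        using \<rho>(2)[of v] \<rho>(2)[of u] by auto
      have 2: "D * (v - t) \<le> 0" "D * (t - u) \<le> 0"
        using D(1) \<open>u \<le> t\<close> \<open>t \<le> v\<close> by (auto simp: mult_le_0_iff)
      show "f v - f u \<le> \<eta> * (v - u)"
        using 1 2 by (auto simp: algebra_simps)
    qed
  qed
  then obtain \<rho> where \<rho>: "\<And>t. t \<in> {a..b} - N \<Longrightarrow> \<rho> t > 0"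
    "\<And>t u v. t \<in> {a..b} - N \<Longrightarrow> u \<le> t \<Longrightarrow> t \<le> v \<Longrightarrow> t - u < \<rho> t \<Longrightarrow> v - t < \<rho> t \<Longrightarrow> f v - f u \<le> \<eta> * (v - u)"
    by metis
  \<comment> \<open>An exceptional tag confines its interval to \<open>T\<close>, any other tag in
    the interval confines it to the range of the derivative estimate. The last case only serves to
    make \<gamma> a gauge.\<close>
  define \<gamma> where "\<gamma> t = (if t \<in> N then T else if t \<in> {a..b} then ball t (\<rho> t) else ball t 1)" for t
  have "gauge \<gamma>"
    using T \<rho>(1) by (auto simp: gauge_def \<gamma>_def)
  then obtain p where p: "p tagged_division_of {a..b}" "\<gamma> fine p"
    using fine_division_exists_real by blast
  note pD = tagged_division_ofD[OF p(1)]
  define q where "q = {x \<in> p. fst x \<in> N}"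
  have "finite p" "q \<subseteq> p" using pD by (auto simp: q_def)
  have qp: "q tagged_partial_division_of {a..b}"
    using p(1) \<open>q \<subseteq> p\<close> tagged_partial_division_subset tagged_division_of_def by blast
  have qd: "q tagged_division_of (\<Union>(snd ` q))" "(snd ` q) division_of \<Union>(snd ` q)"
    using qp by (auto intro: tagged_partial_division_of_Union_self partial_division_of_tagged_division)
  have form: "\<exists>u v. k = {u..v} \<and> u \<le> x \<and> x \<le> v" if "(x, k) \<in> p" for x k
    using pD(2,4)[OF that] by auto
  have "(\<Sum>k\<in>snd ` q. Sup k - Inf k) < \<delta>"
  proof -
    have "Sup k - Inf k = measure lebesgue k" if "k \<in> snd ` q" for k
      using form that \<open>q \<subseteq> p\<close> by fastforce
    then have "(\<Sum>k\<in>snd ` q. Sup k - Inf k) = (\<Sum>k\<in>snd ` q. measure lebesgue k)"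
      by simp
    also have "\<dots> = measure lebesgue (\<Union>(snd ` q))"
    proof (rule measure_negligible_finite_Union[symmetric])
      show "finite (snd ` q)" using \<open>finite p\<close> \<open>q \<subseteq> p\<close> finite_subset by blast
      show "S \<in> lmeasurable" if "S \<in> snd ` q" for S
        using form that \<open>q \<subseteq> p\<close> by fastforce
      show "pairwise (\<lambda>S T. negligible (S \<inter> T)) (snd ` q)"
        unfolding pairwise_def
      proof (intro ballI impI)
        fix S T assume ST: "S \<in> snd ` q" "T \<in> snd ` q" "S \<noteq> T"
        have "interior (S \<inter> T) = {}"
          using division_ofD(5)[OF qd(2) ST] by simp
        moreover have "convex S" "convex T"
          using division_ofD(4)[OF qd(2)] ST by (metis convex_box(1))+
        then have "convex (S \<inter> T)" by (rule convex_Int)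
        ultimately
        show "negligible (S \<inter> T)"
          using negligible_convex_interior by blast
      qed
    qed
    also have "\<dots> \<le> measure lebesgue T"
    proof (rule measure_mono_fmeasurable)
      show "\<Union>(snd ` q) \<subseteq> T"
        using p(2) by (fastforce simp: fine_def \<gamma>_def q_def split: if_splits)
      show "\<Union>(snd ` q) \<in> sets lebesgue"
      proof (rule sets.finite_Union)
        show "finite (snd ` q)" using \<open>finite p\<close> \<open>q \<subseteq> p\<close> finite_subset by blast
        show "snd ` q \<subseteq> sets lebesgue" using form \<open>q \<subseteq> p\<close> by fastforce
      qed
    qed (rule Tm)
    finally show ?thesis using mT by simp
  qed
  moreover have "\<Union>(snd ` q) \<subseteq> {a..b}"
    using pD(3) \<open>q \<subseteq> p\<close> by fastforce
  ultimately have "(\<Sum>k\<in>snd ` q. norm (f (Sup k) - f (Inf k))) < \<epsilon>"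
    using \<delta>(2)[of "snd ` q"] qd(2) by blast
  \<comment> \<open>Passing from tagged pairs to intervals requires a summand that vanishes on
    intervals without interior. It does on single points, while \<open>Sup\<close> and
    \<open>Inf\<close> of the empty set give no information; hence the case distinction.\<close>
  moreover have "(\<Sum>(x,k)\<in>q. norm (f (Sup k) - f (Inf k))) = (\<Sum>k\<in>snd ` q. norm (f (Sup k) - f (Inf k)))"
  proof -
    have "(\<Sum>(x,k)\<in>q. norm (f (Sup k) - f (Inf k))) = (\<Sum>(x,k)\<in>q. if k = {} then 0 else norm (f (Sup k) - f (Inf k)))"
      using form \<open>q \<subseteq> p\<close> by (intro sum.cong) fastforce+
    also have "\<dots> = (\<Sum>k\<in>snd ` q. if k = {} then 0 else norm (f (Sup k) - f (Inf k)))"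
      by (rule sum.over_tagged_division_lemma[OF qd(1)]) (auto simp: box_eq_empty)
    also have "\<dots> = (\<Sum>k\<in>snd ` q. norm (f (Sup k) - f (Inf k)))"
      using form \<open>q \<subseteq> p\<close> by (intro sum.cong) fastforce+
    finally show ?thesis .
  qed
  moreover have "(\<Sum>(x,k)\<in>q. f (Sup k) - f (Inf k)) \<le> (\<Sum>(x,k)\<in>q. norm (f (Sup k) - f (Inf k)))"
    by (rule sum_mono) auto
  ultimately have 1: "(\<Sum>(x,k)\<in>q. f (Sup k) - f (Inf k)) < \<epsilon>" by linarith
  have "(\<Sum>(x,k)\<in>p - q. f (Sup k) - f (Inf k)) \<le> (\<Sum>(x,k)\<in>p - q. \<eta> * (Sup k - Inf k))"
  proof (rule sum_mono, clarify)
    fix x k assume xk: "(x, k) \<in> p" "(x, k) \<notin> q"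
    then have x: "x \<in> {a..b} - N" using pD(2)[OF xk(1)] pD(3)[OF xk(1)] by (auto simp: q_def)
    then have "k \<subseteq> ball x (\<rho> x)"
      using p(2) xk(1) by (fastforce simp: fine_def \<gamma>_def split: if_splits)
    moreover obtain u v where uv: "k = {u..v}" "u \<le> x" "x \<le> v" using form[OF xk(1)] by blast
    ultimately have "u \<in> ball x (\<rho> x)" "v \<in> ball x (\<rho> x)"
      by (meson atLeastAtMost_iff order_refl order_trans subsetD)+
    then show "f (Sup k) - f (Inf k) \<le> \<eta> * (Sup k - Inf k)"
      using \<rho>(2)[OF x uv(2,3)] uv by (auto simp: dist_real_def)
  qed
  also have "\<dots> \<le> (\<Sum>(x,k)\<in>p. \<eta> * (Sup k - Inf k))"
  proof (rule sum_mono2)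
    show "0 \<le> (case x of (x, k) \<Rightarrow> \<eta> * (Sup k - Inf k))" if "x \<in> p - (p - q)" for x
      using form[of "fst x" "snd x"] that pos(2) by (fastforce simp: case_prod_beta)
  qed (use \<open>finite p\<close> in auto)
  also have "\<dots> = \<eta> * (\<Sum>(x,k)\<in>p. Sup k - Inf k)"
    by (simp add: sum_distrib_left case_prod_beta)
  also have "\<dots> = \<eta> * (b - a)"
    using additive_tagged_division_1[OF \<open>a \<le> b\<close> p(1), of "\<lambda>x. x"] by simp
  also have "\<dots> \<le> \<epsilon>"
    using pos \<open>a \<le> b\<close> by (simp add: \<eta>_def field_simps)
  finally have 2: "(\<Sum>(x,k)\<in>p - q. f (Sup k) - f (Inf k)) \<le> \<epsilon>" .
  have "f b - f a = (\<Sum>(x,k)\<in>p. f (Sup k) - f (Inf k))"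
    using additive_tagged_division_1[OF \<open>a \<le> b\<close> p(1), of f] by simp
  also have "\<dots> = (\<Sum>(x,k)\<in>p - q. f (Sup k) - f (Inf k)) + (\<Sum>(x,k)\<in>q. f (Sup k) - f (Inf k))"
    by (rule sum.subset_diff[OF \<open>q \<subseteq> p\<close> \<open>finite p\<close>])
  finally show "f b \<le> f a + \<epsilon>'"
    using 1 2 by (simp add: \<epsilon>_def)
qed

text \<open>Projecting \<open>f\<close> on the direction \<open>u\<close> of its total increment
  reduces the vector case to the scalar one: \<open>u \<bullet> f - g\<close> has nonpositive
  derivative almost everywhere.\<close>

lemma abs_continuous_increment_le:
  fixes f :: "real \<Rightarrow> 'a::real_inner" and g :: "real \<Rightarrow> real"
  assumes f: "abs_continuous_on_interval a b f" and "a \<le> b"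
    and g: "D-lipschitz_on {a..b} g"
    and g': "\<And>t. t \<in> {a<..<b} \<Longrightarrow> (g has_real_derivative g' t) (at t)"
    and ae: "AE t in lebesgue. t \<in> {a<..<b} \<longrightarrow> (\<exists>d. norm d \<le> g' t \<and> (f has_vector_derivative d) (at t))"
  shows "norm (f b - f a) \<le> g b - g a"
proof -
  define u where "u = sgn (f b - f a)"
  define F where "F t = u \<bullet> f t - g t" for t
  have u: "norm u \<le> 1" by (simp add: u_def norm_sgn)
  have "F b \<le> F a"
  proof (rule abs_continuous_nonincreasing[where f = F and a = a and b = b])
    show "abs_continuous_on_interval a b F"
    proof (rule abs_continuous_on_interval_dominated[OF f, where C = 1 and D = D])
      fix s t assume st: "s \<in> {a..b}" "t \<in> {a..b}"
      have "norm (F s - F t) \<le> \<bar>u \<bullet> (f s - f t)\<bar> + \<bar>g s - g t\<bar>"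
        by (simp add: F_def inner_diff_right)
      also have "\<bar>u \<bullet> (f s - f t)\<bar> \<le> norm u * norm (f s - f t)" by (rule Cauchy_Schwarz_ineq2)
      also have "\<dots> \<le> 1 * norm (f s - f t)" using u by (intro mult_right_mono) auto
      also have "\<bar>g s - g t\<bar> \<le> D * \<bar>s - t\<bar>" using lipschitz_onD[OF g st] by (simp add: dist_real_def)
      finally show "norm (F s - F t) \<le> 1 * norm (f s - f t) + D * \<bar>s - t\<bar>" by simp
    qed (use g lipschitz_on_nonneg in auto)
    show "AE t in lebesgue. t \<in> {a<..<b} \<longrightarrow> (\<exists>D\<le>0. (F has_real_derivative D) (at t))"
      using ae
    proof (eventually_elim, intro impI)
      fix t assume "t \<in> {a<..<b} \<longrightarrow> (\<exists>d. norm d \<le> g' t \<and> (f has_vector_derivative d) (at t))" "t \<in> {a<..<b}"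
      then obtain d where d: "norm d \<le> g' t" "(f has_vector_derivative d) (at t)" and t: "t \<in> {a<..<b}" by blast
      have "((\<lambda>t. u \<bullet> f t) has_vector_derivative (u \<bullet> d)) (at t)"
        using bounded_linear.has_vector_derivative[OF bounded_linear_inner_right d(2)] .
      then have "(F has_real_derivative (u \<bullet> d - g' t)) (at t)"
        unfolding F_def using g'[OF t]
        by (intro derivative_intros) (auto simp: has_real_derivative_iff_has_vector_derivative)
      moreover have "u \<bullet> d \<le> norm d"
        using Cauchy_Schwarz_ineq2[of u d] u mult_right_mono[OF u norm_ge_zero[of d]] by linarith
      ultimately show "\<exists>D\<le>0. (F has_real_derivative D) (at t)"
        using d(1) by (intro exI[of _ "u \<bullet> d - g' t"]) auto
    qed
  qed (fact \<open>a \<le> b\<close>)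
  moreover have "u \<bullet> (f b - f a) = norm (f b - f a)"
    by (cases "f b = f a") (simp_all add: u_def sgn_div_norm dot_square_norm power2_eq_square)
  ultimately show ?thesis by (simp add: F_def inner_diff_right)
qed

section \<open>Lebesgue points of bounded measurable functions on the line\<close>

lemma bounded_measurable_integrable_interval:
  fixes g :: "real \<Rightarrow> 'a::euclidean_space"
  assumes g: "g \<in> borel_measurable lebesgue" "\<And>t. t \<in> {u..v} \<Longrightarrow> norm (g t) \<le> M"
  shows "g integrable_on {u..v}"
proof (rule measurable_bounded_by_integrable_imp_integrable[where g = "\<lambda>_. M"])
  show "g \<in> borel_measurable (lebesgue_on {u..v})"
    using g(1) measurable_restrict_space1 by blast
qed (use g in \<open>auto intro: integrable_const_ivl\<close>)

text \<open>A Vitali argument. The bad points lie in the set where \<open>g < p\<close>; cover them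
  by disjoint intervals inside a slightly larger open set \<open>T\<close>, each with mean value
  above \<open>q\<close>. Such a mean can only come from the small excess \<open>Z\<close> of
  \<open>T\<close>, which therefore bounds the total length of the intervals.\<close>

lemma negligible_upper_differentiation:
  fixes g :: "real \<Rightarrow> real"
  assumes g: "g \<in> borel_measurable lebesgue" "\<And>t. \<bar>g t\<bar> \<le> M" and "p < q"
  shows "negligible {t. g t < p \<and> (\<forall>d>0. \<exists>u v. u \<le> t \<and> t \<le> v \<and> u < v \<and> v - u < d \<and> q * (v - u) < integral {u..v} g)}"
    (is "negligible ?E")
proof -
  have int: "g integrable_on {u..v}" for u v
    using g by (intro bounded_measurable_integrable_interval) auto
  have "M \<ge> 0" using g(2)[of 0] by linarith
  have "negligible (?E \<inter> {-n<..<n})" for n :: real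
    unfolding negligible_outer_le
  proof (intro allI impI)
    fix e :: real assume "e > 0"
    \<comment> \<open>\<open>C\<close> dominates \<open>g - p\<close>, so that
      \<open>g \<le> p + C * indicator Z\<close> on \<open>T\<close>. The choice of \<epsilon> makes
      \<open>C * \<epsilon> = (q - p) * e\<close>, which is exactly the balance needed for total
      length at most \<open>e\<close>.\<close>
    define C where "C = M + \<bar>p\<bar> + 1"
    define \<epsilon> where "\<epsilon> = e * (q - p) / C"
    have "C > 0" "\<epsilon> > 0" using \<open>M \<ge> 0\<close> \<open>e > 0\<close> \<open>p < q\<close> by (auto simp: C_def \<epsilon>_def)
    define E' where "E' = {t. g t < p} \<inter> {-n<..<n}"
    have E': "E' \<in> sets lebesgue"
    proof -
      have "{t \<in> space lebesgue. g t < p} \<in> sets lebesgue"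
        using g(1) by (intro borel_measurable_less) auto
      then show ?thesis by (auto simp: E'_def)
    qed
    obtain T where T: "open T" "E' \<subseteq> T" "T - E' \<in> lmeasurable" "emeasure lebesgue (T - E') < ennreal \<epsilon>"
      using sets_lebesgue_outer_open[OF E' \<open>\<epsilon> > 0\<close>] .
    define Z where "Z = T - E'"
    have Z: "Z \<in> lmeasurable" "measure lebesgue Z \<le> \<epsilon>"
      using T(3,4) \<open>\<epsilon> > 0\<close> by (auto simp: Z_def emeasure_eq_measure2 ennreal_less_iff)
    define K where "K = {(c, r). r > 0 \<and> cball c r \<subseteq> T \<and> q * (2 * r) < integral (cball c r) g}"
    obtain I where I: "countable I" "I \<subseteq> K"
        "pairwise (\<lambda>i j. disjnt (cball (fst i) (snd i)) (cball (fst j) (snd j))) I"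
        and neg: "negligible (?E \<inter> {-n<..<n} - (\<Union>i\<in>I. cball (fst i) (snd i)))"
    proof (rule Vitali_covering_theorem_cballs[of K snd "?E \<inter> {-n<..<n}" fst])
      show "0 < snd i" if "i \<in> K" for i using that by (auto simp: K_def)
      fix x d :: real assume x: "x \<in> ?E \<inter> {-n<..<n}" and "d > 0"
      then have "x \<in> T" using T(2) by (auto simp: E'_def)
      then obtain \<rho> where \<rho>: "\<rho> > 0" "ball x \<rho> \<subseteq> T" using T(1) openE by blast
      obtain u v where uv: "u \<le> x" "x \<le> v" "u < v" "v - u < min d \<rho>" "q * (v - u) < integral {u..v} g"
      proof -
        have "\<forall>d>0. \<exists>u v. u \<le> x \<and> x \<le> v \<and> u < v \<and> v - u < d \<and> q * (v - u) < integral {u..v} g"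
          using x by auto
        then show ?thesis using \<open>d > 0\<close> \<rho>(1) that by (metis min_less_iff_conj)
      qed
      have cb: "cball ((u+v)/2) ((v-u)/2) = {u..v}"
        by (simp add: cball_eq_atLeastAtMost field_simps)
      have "{u..v} \<subseteq> T"
        using uv \<rho>(2) by (force simp: dist_real_def)
      then have "((u+v)/2, (v-u)/2) \<in> K"
        using uv by (simp add: K_def cb) (simp add: field_simps)
      then show "\<exists>i. i \<in> K \<and> x \<in> cball (fst i) (snd i) \<and> snd i < d"
        using uv cb by (intro exI[of _ "((u+v)/2, (v-u)/2)"]) auto
    qed (rule that)
    let ?B = "\<lambda>i. cball (fst i) (snd i) :: real set"
    have bound: "(\<Sum>i\<in>J. 2 * snd i) \<le> e" if J: "finite J" "J \<subseteq> I" for J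
    proof -
      have Zi: "Z \<inter> ?B i \<in> lmeasurable" for i
        using Z(1) by (intro fmeasurable_Int_fmeasurable) auto
      have 1: "q * (2 * snd i) \<le> p * (2 * snd i) + C * measure lebesgue (Z \<inter> ?B i)" if "i \<in> J" for i
      proof -
        have iK: "snd i > 0" "?B i \<subseteq> T" "q * (2 * snd i) < integral (?B i) g"
          using that J(2) I(2) by (fastforce simp: K_def)+
        have ivl: "?B i = {fst i - snd i .. fst i + snd i}"
          by (simp add: cball_eq_atLeastAtMost)
        have indi: "(indicator Z :: real \<Rightarrow> real) integrable_on ?B i"
        proof -
          have "(indicator Z :: real \<Rightarrow> real) \<in> borel_measurable lebesgue" using Z(1) by auto
          then show ?thesis unfolding ivl
            by (rule bounded_measurable_integrable_interval[where M = 1]) (auto simp: indicator_def)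
        qed
        have "integral (?B i) g \<le> integral (?B i) (\<lambda>t. p + C * indicator Z t)"
        proof (rule integral_le)
          show "g integrable_on ?B i" unfolding ivl by (rule int)
          show "(\<lambda>t. p + C * indicator Z t) integrable_on ?B i"
            using indi unfolding ivl by (intro integrable_add integrable_const_ivl integrable_on_mult_right)
          fix t assume "t \<in> ?B i"
          then have "t \<in> T" using iK by auto
          then show "g t \<le> p + C * indicator Z t"
            using g(2)[of t] by (auto simp: Z_def C_def E'_def indicator_def)
        qed
        also have "\<dots> = p * (2 * snd i) + C * integral (?B i) (indicator Z)"
        proof -
          have "integral (?B i) (\<lambda>t. p + C * indicator Z t) = integral (?B i) (\<lambda>t. p) + integral (?B i) (\<lambda>t. C * indicator Z t)"
            using indi unfolding ivl by (intro Henstock_Kurzweil_Integration.integral_add integrable_const_ivl integrable_on_mult_right)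
          moreover have "integral (?B i) (\<lambda>t. p) = p * (2 * snd i)"
            unfolding ivl using iK(1) by simp
          ultimately show ?thesis by simp
        qed
        also have "integral (?B i) (indicator Z) = measure lebesgue (Z \<inter> ?B i)"
          by (rule Equivalence_Lebesgue_Henstock_Integration.integral_indicator[OF Zi])
        finally show ?thesis using iK(3) by simp
      qed
      have "(\<Sum>i\<in>J. measure lebesgue (Z \<inter> ?B i)) = measure lebesgue (\<Union>i\<in>J. Z \<inter> ?B i)"
      proof (rule measure_negligible_finite_Union_image[symmetric, OF J(1) Zi])
        have "pairwise (\<lambda>i j. disjnt (?B i) (?B j)) J"
          using I(3) J(2) pairwise_subset by blast
        then show "pairwise (\<lambda>x y. negligible (Z \<inter> ?B x \<inter> (Z \<inter> ?B y))) J"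
        proof (rule pairwise_mono)
          fix x y assume "disjnt (?B x) (?B y)"
          then have "Z \<inter> ?B x \<inter> (Z \<inter> ?B y) = {}" by (auto simp: disjnt_def)
          then show "negligible (Z \<inter> ?B x \<inter> (Z \<inter> ?B y))" by (simp only: negligible_empty)
        qed auto
      qed
      also have "\<dots> \<le> measure lebesgue Z"
        using Z(1) Zi J(1) by (intro measure_mono_fmeasurable) (blast intro!: sets.finite_UN dest: fmeasurableD)+
      finally have 2: "(\<Sum>i\<in>J. measure lebesgue (Z \<inter> ?B i)) \<le> \<epsilon>" using Z(2) by simp
      have "q * (\<Sum>i\<in>J. 2 * snd i) \<le> p * (\<Sum>i\<in>J. 2 * snd i) + C * (\<Sum>i\<in>J. measure lebesgue (Z \<inter> ?B i))"
        using sum_mono[OF 1] by (simp add: sum.distrib sum_distrib_left)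
      also have "\<dots> \<le> p * (\<Sum>i\<in>J. 2 * snd i) + C * \<epsilon>"
        using 2 \<open>C > 0\<close> by simp
      also have "C * \<epsilon> = (q - p) * e"
        using \<open>C > 0\<close> by (simp add: \<epsilon>_def)
      finally have "(q - p) * (\<Sum>i\<in>J. 2 * snd i) \<le> (q - p) * e"
        by (simp add: left_diff_distrib)
      then show ?thesis using \<open>p < q\<close> by simp
    qed
    \<comment> \<open>The bound for finite disjoint subfamilies passes to the countable union by
      monotone approximation.\<close>
    have W: "\<Union>(?B ` I) \<in> lmeasurable" "measure lebesgue (\<Union>(?B ` I)) \<le> e"
    proof -
      have *: "measure lebesgue (\<Union>\<D>) \<le> e" if \<D>: "\<D> \<subseteq> ?B ` I" "finite \<D>" for \<D>
      proof -
        obtain J where J: "J \<subseteq> I" "finite J" "\<D> = ?B ` J"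
          using \<D> by (meson finite_subset_image)
        have "measure lebesgue (\<Union>(?B ` J)) \<le> (\<Sum>i\<in>J. measure lebesgue (?B i))"
          using J by (intro measure_UNION_le) auto
        also have "\<dots> = (\<Sum>i\<in>J. 2 * snd i)"
        proof (rule sum.cong)
          fix i assume "i \<in> J"
          then have "snd i > 0" using J I(2) by (auto simp: K_def)
          then show "measure lebesgue (?B i) = 2 * snd i"
            by (simp add: cball_eq_atLeastAtMost)
        qed simp
        finally show ?thesis using bound[OF J(2,1)] J(3) by simp
      qed
      show "\<Union>(?B ` I) \<in> lmeasurable"
        by (rule fmeasurable_Union_bound[of "?B ` I" lebesgue e]) (use I(1) * in auto)
      show "measure lebesgue (\<Union>(?B ` I)) \<le> e"
        by (rule measure_Union_bound[of "?B ` I" lebesgue e]) (use I(1) * in auto)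
    qed
    let ?R = "?E \<inter> {-n<..<n} - \<Union>(?B ` I)"
    have "measure lebesgue (\<Union>(?B ` I) \<union> ?R) \<le> measure lebesgue (\<Union>(?B ` I)) + measure lebesgue ?R"
      using W(1) neg negligible_imp_sets by (intro measure_Un_le) auto
    also have "measure lebesgue ?R = 0" using neg negligible_imp_measure0 by blast
    finally show "\<exists>T. ?E \<inter> {-n<..<n} \<subseteq> T \<and> T \<in> lmeasurable \<and> measure lebesgue T \<le> e"
      using W fmeasurable.Un[OF W(1) negligible_imp_measurable[OF neg]]
      by (intro exI[of _ "\<Union>(?B ` I) \<union> ?R"]) auto
  qed
  then have "negligible (\<Union>n::nat. ?E \<inter> {- real n<..<real n})"
    by (intro negligible_countable_Union) auto
  moreover have "?E \<subseteq> (\<Union>n::nat. ?E \<inter> {- real n<..<real n})"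
  proof
    fix t assume t: "t \<in> ?E"
    obtain n :: nat where "\<bar>t\<bar> < real n" using reals_Archimedean2 by blast
    with t show "t \<in> (\<Union>n::nat. ?E \<inter> {- real n<..<real n})" by (intro UN_I[of n]) auto
  qed
  ultimately show ?thesis using negligible_subset by blast
qed

text \<open>If the upper estimate failed at \<open>t\<close>, two rationals \<open>p < q\<close>
  between \<open>h t\<close> and \<open>h t + e\<close> would put \<open>t\<close> into one of
  countably many negligible sets. The lower estimate is the upper one for \<open>- g\<close>.
  Intervals only have to contain \<open>t\<close>, so one-sided intervals starting at
  \<open>t\<close> are included.\<close>

lemma lebesgue_differentiation_real:
  fixes g :: "real \<Rightarrow> real"
  assumes g: "g \<in> borel_measurable lebesgue" "\<And>t. \<bar>g t\<bar> \<le> M"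
  shows "AE t in lebesgue. \<forall>e>0. \<exists>d>0. \<forall>u v. u \<le> t \<longrightarrow> t \<le> v \<longrightarrow> v - u < d \<longrightarrow>
           \<bar>integral {u..v} g - (v - u) * g t\<bar> \<le> e * (v - u)"
proof -
  define E where "E h p q = {t. h t < p \<and> (\<forall>d>0. \<exists>u v. u \<le> t \<and> t \<le> v \<and> u < v \<and> v - u < d \<and>
      q * (v - u) < integral {u..v} h)}" for h :: "real \<Rightarrow> real" and p q
  have neg: "negligible (E h p q)" if "h \<in> borel_measurable lebesgue" "\<And>t. \<bar>h t\<bar> \<le> M" "p < q" for h p q
    unfolding E_def by (rule negligible_upper_differentiation[OF that])
  define S :: "(real \<times> real) set" where "S = {(p, q). p \<in> \<rat> \<and> q \<in> \<rat> \<and> p < q}"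
  have S: "countable S"
    by (rule countable_subset[of _ "\<rat> \<times> \<rat>"]) (auto simp: S_def countable_rat)
  define N where "N = (\<Union>(p,q)\<in>S. E g p q \<union> E (\<lambda>t. - g t) p q)"
  have "negligible N"
    unfolding N_def
  proof (rule negligible_countable_Union)
    show "countable ((\<lambda>(p, q). E g p q \<union> E (\<lambda>t. - g t) p q) ` S)" using S by simp
    fix A assume "A \<in> (\<lambda>(p, q). E g p q \<union> E (\<lambda>t. - g t) p q) ` S"
    then obtain p q where "p < q" "A = E g p q \<union> E (\<lambda>t. - g t) p q" by (auto simp: S_def)
    then show "negligible A" using g by (auto intro!: negligible_Un neg)
  qed
  have upper: "\<exists>d>0. \<forall>u v. u \<le> t \<longrightarrow> t \<le> v \<longrightarrow> v - u < d \<longrightarrow> integral {u..v} h \<le> (h t + e) * (v - u)"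
    if "e > 0" "\<And>p q. (p, q) \<in> S \<Longrightarrow> t \<notin> E h p q" for h t and e :: real
  proof -
    obtain p where p: "p \<in> \<rat>" "h t < p" "p < h t + e"
      using Rats_dense_in_real[of "h t" "h t + e"] \<open>e > 0\<close> by auto
    obtain q where q: "q \<in> \<rat>" "p < q" "q < h t + e"
      using Rats_dense_in_real[OF p(3)] by auto
    have "t \<notin> E h p q" using that(2) p q by (auto simp: S_def)
    then obtain d where d: "d > 0" "\<And>u v. u \<le> t \<Longrightarrow> t \<le> v \<Longrightarrow> u < v \<Longrightarrow> v - u < d \<Longrightarrow> integral {u..v} h \<le> q * (v - u)"
      using p(2) unfolding E_def mem_Collect_eq by (meson not_le)
    show ?thesis
    proof (intro exI[of _ d] conjI d(1) allI impI)
      fix u v assume uv: "u \<le> t" "t \<le> v" "v - u < d"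
      show "integral {u..v} h \<le> (h t + e) * (v - u)"
      proof (cases "u < v")
        case True
        have "q * (v - u) \<le> (h t + e) * (v - u)" using q(3) True by (intro mult_right_mono) auto
        then show ?thesis using d(2)[OF uv(1,2) True uv(3)] by simp
      next
        case False
        then have "u = v" using uv by simp
        then show ?thesis by simp
      qed
    qed
  qed
  have "\<forall>e>0. \<exists>d>0. \<forall>u v. u \<le> t \<longrightarrow> t \<le> v \<longrightarrow> v - u < d \<longrightarrow>
           \<bar>integral {u..v} g - (v - u) * g t\<bar> \<le> e * (v - u)" if "t \<notin> N" for t
  proof (intro allI impI)
    fix e :: real assume "e > 0"
    have "t \<notin> E g p q" "t \<notin> E (\<lambda>t. - g t) p q" if "(p, q) \<in> S" for p q
      using \<open>t \<notin> N\<close> that by (auto simp: N_def)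
    note up = upper[OF \<open>e > 0\<close> this(1)] upper[OF \<open>e > 0\<close> this(2)]
    from up(1) obtain d1 where d1: "d1 > 0"
      "\<And>u v. u \<le> t \<Longrightarrow> t \<le> v \<Longrightarrow> v - u < d1 \<Longrightarrow> integral {u..v} g \<le> (g t + e) * (v - u)"
      by blast
    from up(2) obtain d2 where d2: "d2 > 0"
      "\<And>u v. u \<le> t \<Longrightarrow> t \<le> v \<Longrightarrow> v - u < d2 \<Longrightarrow> integral {u..v} (\<lambda>t. - g t) \<le> (- g t + e) * (v - u)"
      by blast
    note d = d1(1) d2(1) d1(2) d2(2)
    show "\<exists>d>0. \<forall>u v. u \<le> t \<longrightarrow> t \<le> v \<longrightarrow> v - u < d \<longrightarrow>
           \<bar>integral {u..v} g - (v - u) * g t\<bar> \<le> e * (v - u)"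
    proof (intro exI[of _ "min d1 d2"] conjI allI impI)
      fix u v assume uv: "u \<le> t" "t \<le> v" "v - u < min d1 d2"
      have "integral {u..v} g \<le> (g t + e) * (v - u)" "- integral {u..v} g \<le> (- g t + e) * (v - u)"
        using d(3)[OF uv(1,2)] d(4)[OF uv(1,2)] uv(3) by simp_all
      then show "\<bar>integral {u..v} g - (v - u) * g t\<bar> \<le> e * (v - u)"
        by (simp add: abs_le_iff algebra_simps)
    qed (use d in auto)
  qed
  then show ?thesis
    using \<open>negligible N\<close> unfolding eventually_ae_filter_negligible by (intro exI[of _ N]) blast
qed

lemma lebesgue_differentiation:
  fixes g :: "real \<Rightarrow> 'a::euclidean_space"
  assumes g: "g \<in> borel_measurable lebesgue" "\<And>t. norm (g t) \<le> M"
  shows "AE t in lebesgue. \<forall>e>0. \<exists>d>0. \<forall>u v. u \<le> t \<longrightarrow> t \<le> v \<longrightarrow> v - u < d \<longrightarrow>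
           norm (integral {u..v} g - (v - u) *\<^sub>R g t) \<le> e * (v - u)"
proof -
  have int: "g integrable_on {u..v}" for u v
    using g by (intro bounded_measurable_integrable_interval) auto
  have "AE t in lebesgue. \<forall>b\<in>Basis. \<forall>e>0. \<exists>d>0. \<forall>u v. u \<le> t \<longrightarrow> t \<le> v \<longrightarrow> v - u < d \<longrightarrow>
           \<bar>integral {u..v} (\<lambda>t. g t \<bullet> b) - (v - u) * (g t \<bullet> b)\<bar> \<le> e * (v - u)"
  proof (rule AE_finite_allI[OF finite_Basis])
    fix b :: 'a assume b: "b \<in> Basis"
    show "AE t in lebesgue. \<forall>e>0. \<exists>d>0. \<forall>u v. u \<le> t \<longrightarrow> t \<le> v \<longrightarrow> v - u < d \<longrightarrow>
           \<bar>integral {u..v} (\<lambda>t. g t \<bullet> b) - (v - u) * (g t \<bullet> b)\<bar> \<le> e * (v - u)"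
    proof (rule lebesgue_differentiation_real)
      show "(\<lambda>t. g t \<bullet> b) \<in> borel_measurable lebesgue" using g(1) by measurable
      show "\<bar>g t \<bullet> b\<bar> \<le> M" for t using Basis_le_norm[OF b, of "g t"] g(2)[of t] by linarith
    qed
  qed
  then show ?thesis
  proof (eventually_elim, intro allI impI)
    fix t and e :: real
    assume t: "\<forall>b\<in>Basis. \<forall>e>0. \<exists>d>0. \<forall>u v. u \<le> t \<longrightarrow> t \<le> v \<longrightarrow> v - u < d \<longrightarrow>
           \<bar>integral {u..v} (\<lambda>t. g t \<bullet> b) - (v - u) * (g t \<bullet> b)\<bar> \<le> e * (v - u)" and "e > 0"
    define e' where "e' = e / DIM('a)"
    have "e' > 0" using \<open>e > 0\<close> by (simp add: e'_def)
    then have "\<forall>b\<in>Basis. \<exists>d>0. \<forall>u v. u \<le> t \<longrightarrow> t \<le> v \<longrightarrow> v - u < d \<longrightarrow>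
           \<bar>integral {u..v} (\<lambda>t. g t \<bullet> b) - (v - u) * (g t \<bullet> b)\<bar> \<le> e' * (v - u)"
      using t by blast
    from bchoice[OF this] obtain d where d: "\<And>b. b \<in> Basis \<Longrightarrow> d b > 0"
      "\<And>b u v. b \<in> Basis \<Longrightarrow> u \<le> t \<Longrightarrow> t \<le> v \<Longrightarrow> v - u < d b \<Longrightarrow>
           \<bar>integral {u..v} (\<lambda>t. g t \<bullet> b) - (v - u) * (g t \<bullet> b)\<bar> \<le> e' * (v - u)"
      by blast
    show "\<exists>d>0. \<forall>u v. u \<le> t \<longrightarrow> t \<le> v \<longrightarrow> v - u < d \<longrightarrow>
           norm (integral {u..v} g - (v - u) *\<^sub>R g t) \<le> e * (v - u)"
    proof (intro exI[of _ "Min (d ` Basis)"] conjI allI impI)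
      show "Min (d ` Basis) > 0" using d(1) by simp
      fix u v assume uv: "u \<le> t" "t \<le> v" "v - u < Min (d ` Basis)"
      have "norm (integral {u..v} g - (v - u) *\<^sub>R g t) \<le> (\<Sum>b\<in>Basis. \<bar>(integral {u..v} g - (v - u) *\<^sub>R g t) \<bullet> b\<bar>)"
        by (rule norm_le_l1)
      also have "\<dots> \<le> (\<Sum>b\<in>(Basis::'a set). e' * (v - u))"
      proof (rule sum_mono)
        fix b :: 'a assume b: "b \<in> Basis"
        have "integral {u..v} g \<bullet> b = integral {u..v} (\<lambda>t. g t \<bullet> b)"
          using integral_component_eq[OF int, of u v b] by simp
        then show "\<bar>(integral {u..v} g - (v - u) *\<^sub>R g t) \<bullet> b\<bar> \<le> e' * (v - u)"
          using d(2)[OF b uv(1,2)] uv(3) b by (simp add: inner_diff_left)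
      qed
      also have "\<dots> = e * (v - u)" by (simp add: e'_def)
      finally show "norm (integral {u..v} g - (v - u) *\<^sub>R g t) \<le> e * (v - u)" .
    qed
  qed
qed

lemma AE_indefinite_integral_has_vector_derivative:
  fixes g :: "real \<Rightarrow> 'a::euclidean_space"
  assumes g: "g \<in> borel_measurable lebesgue" "\<And>t. norm (g t) \<le> M"
  shows "AE t in lebesgue. t > a \<longrightarrow> ((\<lambda>s. integral {a..s} g) has_vector_derivative g t) (at t)"
  using lebesgue_differentiation[OF g]
proof (eventually_elim, intro impI)
  fix t
  assume t: "\<forall>e>0. \<exists>d>0. \<forall>u v. u \<le> t \<longrightarrow> t \<le> v \<longrightarrow> v - u < d \<longrightarrow>
           norm (integral {u..v} g - (v - u) *\<^sub>R g t) \<le> e * (v - u)" and "t > a"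
  have int: "g integrable_on {u..v}" for u v
    using g by (intro bounded_measurable_integrable_interval) auto
  show "((\<lambda>s. integral {a..s} g) has_vector_derivative g t) (at t)"
    unfolding has_vector_derivative_def has_derivative_at_alt
  proof (intro conjI allI impI)
    show "bounded_linear (\<lambda>x. x *\<^sub>R g t)" by (rule bounded_linear_scaleR_left)
    fix e :: real assume "e > 0"
    then obtain d where d: "d > 0" "\<And>u v. u \<le> t \<Longrightarrow> t \<le> v \<Longrightarrow> v - u < d \<Longrightarrow>
           norm (integral {u..v} g - (v - u) *\<^sub>R g t) \<le> e * (v - u)" using t by meson
    show "\<exists>d>0. \<forall>y. norm (y - t) < d \<longrightarrow>
      norm (integral {a..y} g - integral {a..t} g - (y - t) *\<^sub>R g t) \<le> e * norm (y - t)"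
    proof (intro exI[of _ "min d (t - a)"] conjI allI impI)
      fix y assume y: "norm (y - t) < min d (t - a)"
      show "norm (integral {a..y} g - integral {a..t} g - (y - t) *\<^sub>R g t) \<le> e * norm (y - t)"
      proof (cases "y \<le> t")
        case True
        then have "integral {a..y} g + integral {y..t} g = integral {a..t} g"
          using y int by (intro Henstock_Kurzweil_Integration.integral_combine) auto
        then have "integral {a..y} g - integral {a..t} g - (y - t) *\<^sub>R g t = - (integral {y..t} g - (t - y) *\<^sub>R g t)"
          by (simp add: algebra_simps)
        then show ?thesis using d(2)[of y t] True y by (simp only: norm_minus_cancel) auto
      next
        case False
        then have "integral {a..t} g + integral {t..y} g = integral {a..y} g"
          using \<open>t > a\<close> int by (intro Henstock_Kurzweil_Integration.integral_combine) auto
        then have "integral {a..y} g - integral {a..t} g - (y - t) *\<^sub>R g t = integral {t..y} g - (y - t) *\<^sub>R g t"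
          by (simp add: algebra_simps)
        then show ?thesis using d(2)[of t y] False y by auto
      qed
    qed (use d \<open>t > a\<close> in auto)
  qed
qed

subsection \<open>Holomorphic maps in several variables\<close>

lemma norm_vector_scalar_mult: "norm (c *s v) = norm c * norm (v :: complex^'n)"
  by (simp add: norm_vec_def norm_mult L2_set_right_distrib)

lemma scaleR_eq_vector_scalar_mult: "r *\<^sub>R v = complex_of_real r *s (v :: complex^'n)"
  unfolding vec_eq_iff vector_scaleR_component vector_smult_component by (simp add: scaleR_conv_of_real)

lemma norm_le_card_times_component:
  fixes x :: "complex^'n"
  assumes "\<And>i. norm (x $ i) \<le> B"
  shows "norm x \<le> real CARD('n) * B"
proof -
  have "norm x \<le> (\<Sum>i\<in>UNIV. norm (x $ i))"
    by (simp add: norm_vec_def L2_set_le_sum)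
  also have "\<dots> \<le> (\<Sum>i\<in>(UNIV::'n set). B)" by (rule sum_mono) (rule assms)
  also have "\<dots> = real CARD('n) * B" by simp
  finally show ?thesis .
qed

lemma lim_1_over_Suc: "(\<lambda>m. 1 / real (Suc m)) \<longlonglongrightarrow> 0"
  using LIMSEQ_inverse_real_of_nat by (simp add: inverse_eq_divide)

lemma linear_axis: "linear (\<lambda>x. axis i x :: complex^'n)"
  by (rule linearI) (auto simp: vec_eq_iff axis_def)

lemma has_derivative_vec_lambda:
  fixes f :: "'a::euclidean_space \<Rightarrow> complex^'n"
  assumes "\<And>i. ((\<lambda>x. f x $ i) has_derivative f' i) F"
  shows "(f has_derivative (\<lambda>h. \<chi> i. f' i h)) F"
proof -
  have eq: "(\<Sum>i\<in>UNIV. axis i (y i)) = (\<chi> i. y i)" for y :: "'n \<Rightarrow> complex"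
    by (simp add: vec_eq_iff axis_def)
  have "((\<lambda>x. \<Sum>i\<in>UNIV. axis i (f x $ i)) has_derivative (\<lambda>h. \<Sum>i\<in>UNIV. axis i (f' i h))) F"
    by (intro has_derivative_sum bounded_linear.has_derivative[OF _ assms])
       (simp add: linear_axis linear_conv_bounded_linear[symmetric])
  then show ?thesis by (simp add: eq)
qed

lemma has_derivative_if_quadratic:
  assumes D: "bounded_linear D" and "\<rho> > 0"
    and b: "\<And>v. norm v < \<rho> \<Longrightarrow> norm (f (z + v) - f z - D v) \<le> C * norm v ^ 2"
  shows "(f has_derivative D) (at z)"
  unfolding has_derivative_at_alt
proof (intro conjI allI impI D)
  fix e :: real assume "e > 0"
  define d where "d = min \<rho> (e / (\<bar>C\<bar> + 1))"
  have "d > 0" using \<open>e > 0\<close> \<open>\<rho> > 0\<close> by (simp add: d_def)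
  show "\<exists>d>0. \<forall>y. norm (y - z) < d \<longrightarrow> norm (f y - f z - D (y - z)) \<le> e * norm (y - z)"
  proof (intro exI[of _ d] conjI allI impI \<open>d > 0\<close>)
    fix y assume y: "norm (y - z) < d"
    have "norm (f y - f z - D (y - z)) \<le> C * norm (y - z) ^ 2"
      using b[of "y - z"] y by (simp add: d_def)
    also have "\<dots> \<le> (\<bar>C\<bar> + 1) * norm (y - z) * norm (y - z)"
      by (simp add: power2_eq_square mult.assoc mult_right_mono)
    also have "\<dots> \<le> e * norm (y - z)"
    proof (rule mult_right_mono)
      have "(\<bar>C\<bar> + 1) * norm (y - z) \<le> (\<bar>C\<bar> + 1) * (e / (\<bar>C\<bar> + 1))"
        using y by (intro mult_left_mono) (auto simp: d_def)
      then show "(\<bar>C\<bar> + 1) * norm (y - z) \<le> e" by simp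
    qed simp
    finally show "norm (f y - f z - D (y - z)) \<le> e * norm (y - z)" .
  qed
qed

text \<open>Cauchy's inequality needs continuity on a closed disc, so it is applied at radii
  \<open>r < \<rho>\<close>, and then \<open>r\<close> tends to \<rho>.\<close>

lemma taylor_coefficient_bound:
  fixes g :: "complex \<Rightarrow> complex"
  assumes hol: "g holomorphic_on ball 0 \<rho>" and "\<rho> > 0" and b: "\<And>\<zeta>. norm \<zeta> < \<rho> \<Longrightarrow> norm (g \<zeta>) \<le> M"
  shows "norm ((deriv ^^ j) g 0 / fact j) \<le> M / \<rho> ^ j"
proof -
  have "M \<ge> 0" using order_trans[OF norm_ge_zero b[of 0]] \<open>\<rho> > 0\<close> by simp
  have *: "norm ((deriv ^^ j) g 0 / fact j) * r ^ j \<le> M" if "0 < r" "r < \<rho>" for r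
  proof -
    have "norm ((deriv ^^ j) g 0) \<le> fact j * M / r ^ j"
    proof (rule Cauchy_inequality)
      show "g holomorphic_on ball 0 r" using hol that by (auto intro: holomorphic_on_subset)
      show "continuous_on (cball 0 r) g"
        using hol that by (intro holomorphic_on_imp_continuous_on) (auto intro: holomorphic_on_subset)
      show "norm (g x) \<le> M" if "norm (0 - x) = r" for x
        using b[of x] that \<open>r < \<rho>\<close> by simp
    qed (fact that)
    then show ?thesis using that by (simp add: norm_divide field_simps)
  qed
  have "((\<lambda>r. norm ((deriv ^^ j) g 0 / fact j) * r ^ j) \<longlongrightarrow> norm ((deriv ^^ j) g 0 / fact j) * \<rho> ^ j) (at_left \<rho>)"
    by (intro tendsto_intros)
  moreover have "\<forall>\<^sub>F r in at_left \<rho>. norm ((deriv ^^ j) g 0 / fact j) * r ^ j \<le> M"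
    using eventually_at_left_real[OF \<open>\<rho> > 0\<close>] by eventually_elim (use * in auto)
  ultimately have "norm ((deriv ^^ j) g 0 / fact j) * \<rho> ^ j \<le> M"
    by (intro tendsto_upperbound) auto
  then show ?thesis using \<open>\<rho> > 0\<close> by (simp add: field_simps)
qed

text \<open>By the coefficient bounds the tail of the power series is dominated by a geometric
  series of ratio \<open>norm \<zeta> / \<rho>\<close>.\<close>

lemma taylor_remainder_bound:
  fixes g :: "complex \<Rightarrow> complex"
  assumes hol: "g holomorphic_on ball 0 \<rho>" and "\<rho> > 0" and b: "\<And>\<zeta>. norm \<zeta> < \<rho> \<Longrightarrow> norm (g \<zeta>) \<le> M"
    and \<zeta>: "norm \<zeta> < \<rho>"
  shows "norm (g \<zeta> - (\<Sum>j<k. (deriv ^^ j) g 0 / fact j * \<zeta> ^ j)) \<le> M * (norm \<zeta> / \<rho>) ^ k / (1 - norm \<zeta> / \<rho>)"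
proof -
  define \<theta> where "\<theta> = norm \<zeta> / \<rho>"
  have \<theta>: "0 \<le> \<theta>" "\<theta> < 1" using \<zeta> \<open>\<rho> > 0\<close> by (auto simp: \<theta>_def)
  define a where "a j = (deriv ^^ j) g 0 / fact j * \<zeta> ^ j" for j
  have "a sums g \<zeta>"
    using holomorphic_power_series[OF hol, of \<zeta>] \<zeta> unfolding a_def by simp
  then have "(\<lambda>j. a (j + k)) sums (g \<zeta> - (\<Sum>j<k. a j))"
    by (rule sums_split_initial_segment)
  then have eq: "g \<zeta> - (\<Sum>j<k. a j) = (\<Sum>j. a (j + k))" by (simp add: sums_iff)
  have na: "norm (a j) \<le> M * \<theta> ^ j" for j
  proof -
    have "norm (a j) = norm ((deriv ^^ j) g 0 / fact j) * norm \<zeta> ^ j"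
      by (simp add: a_def norm_mult norm_divide norm_power)
    also have "\<dots> \<le> M / \<rho> ^ j * norm \<zeta> ^ j"
      by (intro mult_right_mono taylor_coefficient_bound[OF hol \<open>\<rho> > 0\<close> b]) auto
    finally show ?thesis by (simp add: \<theta>_def power_divide)
  qed
  have "(\<lambda>j. M * \<theta> ^ k * \<theta> ^ j) sums (M * \<theta> ^ k * (1 / (1 - \<theta>)))"
    using \<theta> by (intro sums_mult geometric_sums) auto
  then have s: "summable (\<lambda>j. M * \<theta> ^ k * \<theta> ^ j)" "(\<Sum>j. M * \<theta> ^ k * \<theta> ^ j) = M * \<theta> ^ k / (1 - \<theta>)"
    by (auto simp: sums_iff)
  have "norm (\<Sum>j. a (j + k)) \<le> (\<Sum>j. M * \<theta> ^ k * \<theta> ^ j)"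
  proof (rule norm_suminf_le[OF _ s(1)])
    show "norm (a (j + k)) \<le> M * \<theta> ^ k * \<theta> ^ j" for j
      using na[of "j + k"] by (simp add: power_add mult_ac)
  qed
  then show ?thesis using s(2) eq by (simp add: a_def \<theta>_def)
qed

section \<open>Calculus of holomorphic maps and of scalar complex differentiability\<close>

definition cdiff_at :: "(complex^'n \<Rightarrow> complex) \<Rightarrow> complex^'n \<Rightarrow> bool" where
  "cdiff_at g z \<longleftrightarrow> (\<exists>D. (g has_derivative D) (at z) \<and> (\<forall>c v. D (c *s v) = c * D v))"

text \<open>A real linear map commuting with complex scalars is complex linear, hence given by a
  matrix. In this form the closure properties need only homogeneity of the derivative.\<close>

lemma holomorphic_map_on_iff:
  "holomorphic_map_on f S \<longleftrightarrow>
     (\<forall>z\<in>S. \<exists>D. (f has_derivative D) (at z) \<and> (\<forall>c v. D (c *s v) = c *s D v))"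
  unfolding holomorphic_map_on_def
proof (intro ball_cong refl iffI)
  fix z
  assume "\<exists>A. (f has_derivative (*v) A) (at z)"
  then show "\<exists>D. (f has_derivative D) (at z) \<and> (\<forall>c v. D (c *s v) = c *s D v)"
    using vector_scalar_commute by blast
next
  fix z
  assume "\<exists>D. (f has_derivative D) (at z) \<and> (\<forall>c v. D (c *s v) = c *s D v)"
  then obtain D where D: "(f has_derivative D) (at z)" "\<And>c v. D (c *s v) = c *s D v" by blast
  have "linear D" using D(1) has_derivative_linear by blast
  then have "Vector_Spaces.linear (*s) (*s) D"
    using D(2) by unfold_locales (auto simp: linear_add vec.vector_space_assms)
  then have "D = (*v) (matrix D)" by (simp add: fun_eq_iff matrix_works)
  then show "\<exists>A. (f has_derivative (*v) A) (at z)" using D(1) by metis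
qed

lemma holomorphic_map_on_subset: "holomorphic_map_on f S \<Longrightarrow> T \<subseteq> S \<Longrightarrow> holomorphic_map_on f T"
  by (auto simp: holomorphic_map_on_def)

lemma holomorphic_map_on_transform:
  assumes "holomorphic_map_on f S" "open S" "\<And>z. z \<in> S \<Longrightarrow> g z = f z"
  shows "holomorphic_map_on g S"
  unfolding holomorphic_map_on_def
proof
  fix z assume z: "z \<in> S"
  then obtain A where "(f has_derivative (*v) A) (at z)" using assms(1) by (auto simp: holomorphic_map_on_def)
  then have "(g has_derivative (*v) A) (at z)"
    by (rule has_derivative_transform_within_open[OF _ assms(2) z]) (simp add: assms(3))
  then show "\<exists>A. (g has_derivative (*v) A) (at z)" by blast
qed

lemma holomorphic_map_on_frechet_derivative:
  assumes "holomorphic_map_on f S" "z \<in> S"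
  shows "(f has_derivative frechet_derivative f (at z)) (at z)"
    and "frechet_derivative f (at z) (c *s v) = c *s frechet_derivative f (at z) v"
    and "linear (frechet_derivative f (at z))"
proof -
  obtain D where D: "(f has_derivative D) (at z)" "\<And>c v. D (c *s v) = c *s D v"
    using assms unfolding holomorphic_map_on_iff by blast
  have "D = frechet_derivative f (at z)" using D(1) by (rule frechet_derivative_at)
  then show "(f has_derivative frechet_derivative f (at z)) (at z)"
    "frechet_derivative f (at z) (c *s v) = c *s frechet_derivative f (at z) v"
    "linear (frechet_derivative f (at z))"
    using D has_derivative_linear by blast+
qed

lemma holomorphic_map_on_imp_continuous_on: "holomorphic_map_on f S \<Longrightarrow> continuous_on S f"
  by (meson continuous_at_imp_continuous_on has_derivative_continuous holomorphic_map_on_frechet_derivative(1))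

lemma holomorphic_map_on_compose:
  assumes f: "holomorphic_map_on f S" and g: "holomorphic_map_on g T" and "f ` S \<subseteq> T"
  shows "holomorphic_map_on (\<lambda>z. g (f z)) S"
  unfolding holomorphic_map_on_iff
proof
  fix z assume z: "z \<in> S"
  obtain D where D: "(f has_derivative D) (at z)" "\<And>c v. D (c *s v) = c *s D v"
    using f z unfolding holomorphic_map_on_iff by blast
  obtain E where E: "(g has_derivative E) (at (f z))" "\<And>c v. E (c *s v) = c *s E v"
    using g z assms(3) unfolding holomorphic_map_on_iff by blast
  show "\<exists>D. ((\<lambda>z. g (f z)) has_derivative D) (at z) \<and> (\<forall>c v. D (c *s v) = c *s D v)"
    using has_derivative_compose[OF D(1) E(1)] D(2) E(2) by (intro exI[of _ "\<lambda>v. E (D v)"]) auto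
qed

lemma holomorphic_map_on_add:
  assumes "holomorphic_map_on f S" "holomorphic_map_on g S"
  shows "holomorphic_map_on (\<lambda>z. f z + g z) S"
  unfolding holomorphic_map_on_iff
proof
  fix z assume "z \<in> S"
  then obtain D E where "(f has_derivative D) (at z)" "\<And>c v. D (c *s v) = c *s D v"
    "(g has_derivative E) (at z)" "\<And>c v. E (c *s v) = c *s E v"
    using assms unfolding holomorphic_map_on_iff by blast
  then show "\<exists>D. ((\<lambda>z. f z + g z) has_derivative D) (at z) \<and> (\<forall>c v. D (c *s v) = c *s D v)"
    by (intro exI[of _ "\<lambda>v. D v + E v"] conjI has_derivative_add) (auto simp: vector_add_ldistrib)
qed

lemma holomorphic_map_on_cmult:
  assumes "holomorphic_map_on f S"
  shows "holomorphic_map_on (\<lambda>z. c *s f z) S"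
  unfolding holomorphic_map_on_iff
proof
  fix z assume z: "z \<in> S"
  obtain D where D: "(f has_derivative D) (at z)" "\<And>c v. D (c *s v) = c *s D v"
    using assms z unfolding holomorphic_map_on_iff by blast
  have "bounded_linear (\<lambda>v :: complex^'a. c *s v)"
    by (subst linear_conv_bounded_linear[symmetric], rule linearI)
       (auto simp: vec_eq_iff algebra_simps)
  from bounded_linear.has_derivative[OF this D(1)] D(2)
  show "\<exists>D. ((\<lambda>z. c *s f z) has_derivative D) (at z) \<and> (\<forall>a v. D (a *s v) = a *s D v)"
    by (intro exI[of _ "\<lambda>v. c *s D v"]) (auto simp: vec_eq_iff)
qed

lemma holomorphic_map_on_diff:
  assumes "holomorphic_map_on f S" "holomorphic_map_on g S"
  shows "holomorphic_map_on (\<lambda>z. f z - g z) S"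
  using holomorphic_map_on_add[OF assms(1) holomorphic_map_on_cmult[OF assms(2), of "-1"]]
  by (simp add: vec_eq_iff[symmetric] vector_sneg_minus1[symmetric])

lemma holomorphic_map_on_scale [simp]: "holomorphic_map_on (\<lambda>z. c *s z) S"
proof -
  have "holomorphic_map_on (\<lambda>z. z) S" unfolding holomorphic_map_on_iff by (auto intro!: exI[of _ "\<lambda>v. v"])
  then show ?thesis by (rule holomorphic_map_on_cmult)
qed

lemma holomorphic_map_on_const [simp]: "holomorphic_map_on (\<lambda>z. c) S"
  unfolding holomorphic_map_on_iff by (auto intro!: exI[of _ "\<lambda>v. 0"])

lemma holomorphic_map_on_sum:
  assumes "finite I" "\<And>i. i \<in> I \<Longrightarrow> holomorphic_map_on (f i) S"
  shows "holomorphic_map_on (\<lambda>z. \<Sum>i\<in>I. f i z) S"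
  using assms by (induction I rule: finite_induct) (auto intro: holomorphic_map_on_add)

lemma holomorphic_map_on_translate:
  assumes "holomorphic_map_on f S" "\<And>z. z \<in> T \<Longrightarrow> z + a \<in> S"
  shows "holomorphic_map_on (\<lambda>z. f (z + a)) T"
proof (rule holomorphic_map_on_compose[OF _ assms(1)])
  show "holomorphic_map_on (\<lambda>z. z + a) T"
    using holomorphic_map_on_add[OF holomorphic_map_on_scale[of 1 T] holomorphic_map_on_const[of a T]] by simp
qed (use assms(2) in auto)

lemma holomorphic_map_on_iff_cdiff_at:
  "holomorphic_map_on f S \<longleftrightarrow> (\<forall>z\<in>S. \<forall>i. cdiff_at (\<lambda>z. f z $ i) z)"
proof
  assume f: "holomorphic_map_on f S"
  show "\<forall>z\<in>S. \<forall>i. cdiff_at (\<lambda>z. f z $ i) z"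
  proof (intro ballI allI)
    fix z i assume "z \<in> S"
    then obtain D where D: "(f has_derivative D) (at z)" "\<And>c v. D (c *s v) = c *s D v"
      using f unfolding holomorphic_map_on_iff by blast
    show "cdiff_at (\<lambda>z. f z $ i) z"
      unfolding cdiff_at_def using bounded_linear.has_derivative[OF bounded_linear_vec_nth D(1)] D(2)
      by (intro exI[of _ "\<lambda>v. D v $ i"]) auto
  qed
next
  assume f: "\<forall>z\<in>S. \<forall>i. cdiff_at (\<lambda>z. f z $ i) z"
  show "holomorphic_map_on f S"
    unfolding holomorphic_map_on_iff
  proof
    fix z assume "z \<in> S"
    then have "\<forall>i. \<exists>D. ((\<lambda>z. f z $ i) has_derivative D) (at z) \<and> (\<forall>c v. D (c *s v) = c * D v)"
      using f unfolding cdiff_at_def by blast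
    then obtain D where D: "\<And>i. ((\<lambda>z. f z $ i) has_derivative D i) (at z)" "\<And>i c v. D i (c *s v) = c * D i v"
      by metis
    show "\<exists>D. (f has_derivative D) (at z) \<and> (\<forall>c v. D (c *s v) = c *s D v)"
      using has_derivative_vec_lambda[OF D(1)] D(2)
      by (intro exI[of _ "\<lambda>h. \<chi> i. D i h"]) (auto simp: vec_eq_iff)
  qed
qed

lemma cdiff_at_const: "cdiff_at (\<lambda>z. c) z"
  unfolding cdiff_at_def by (intro exI[of _ "\<lambda>_. 0"]) auto

lemma cdiff_at_mult:
  assumes "cdiff_at f z" "cdiff_at g z"
  shows "cdiff_at (\<lambda>z. f z * g z) z"
proof -
  obtain D E where "(f has_derivative D) (at z)" "\<And>c v. D (c *s v) = c * D v"
    "(g has_derivative E) (at z)" "\<And>c v. E (c *s v) = c * E v"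
    using assms unfolding cdiff_at_def by blast
  then show ?thesis unfolding cdiff_at_def
    by (intro exI[of _ "\<lambda>h. f z * E h + D h * g z"] conjI has_derivative_mult) (auto simp: algebra_simps)
qed

lemma cdiff_at_sum:
  assumes "\<And>i. i \<in> I \<Longrightarrow> cdiff_at (f i) z"
  shows "cdiff_at (\<lambda>z. \<Sum>i\<in>I. f i z) z"
proof -
  have "\<forall>i\<in>I. \<exists>D. (f i has_derivative D) (at z) \<and> (\<forall>c v. D (c *s v) = c * D v)"
    using assms unfolding cdiff_at_def by blast
  then obtain D where "\<And>i. i \<in> I \<Longrightarrow> (f i has_derivative D i) (at z)" "\<And>i c v. i \<in> I \<Longrightarrow> D i (c *s v) = c * D i v"
    by metis
  then show ?thesis unfolding cdiff_at_def
    by (intro exI[of _ "\<lambda>h. \<Sum>i\<in>I. D i h"]) (auto intro: has_derivative_sum simp: sum_distrib_left)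
qed

lemma cdiff_at_prod:
  assumes "\<And>i. i \<in> I \<Longrightarrow> cdiff_at (f i) z"
  shows "cdiff_at (\<lambda>z. \<Prod>i\<in>I. f i z) z"
  using assms by (induction I rule: infinite_finite_induct) (auto intro: cdiff_at_mult cdiff_at_const)

lemma cdiff_at_inverse:
  assumes "cdiff_at f z" "f z \<noteq> 0"
  shows "cdiff_at (\<lambda>z. inverse (f z)) z"
proof -
  obtain D where "(f has_derivative D) (at z)" "\<And>c v. D (c *s v) = c * D v"
    using assms unfolding cdiff_at_def by blast
  then show ?thesis unfolding cdiff_at_def
    using assms(2) by (intro exI[of _ "\<lambda>h. - (inverse (f z) * D h * inverse (f z))"])
      (auto intro: has_derivative_inverse)
qed

lemma cdiff_at_det:
  assumes "\<And>i j. cdiff_at (\<lambda>z. A z $ i $ j) z"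
  shows "cdiff_at (\<lambda>z. det (A z :: complex^'n^'n)) z"
  unfolding det_def by (intro cdiff_at_sum cdiff_at_mult cdiff_at_prod cdiff_at_const assms)

text \<open>Restriction to complex lines reduces several variables to one.\<close>

lemma slice_has_field_derivative:
  fixes f :: "complex^'n \<Rightarrow> complex^'n"
  assumes f: "(f has_derivative D) (at (z + \<zeta> *s v))" "\<And>c v. D (c *s v) = c *s D v"
  shows "((\<lambda>\<zeta>. f (z + \<zeta> *s v) $ i) has_field_derivative D v $ i) (at \<zeta>)"
proof -
  have "bounded_linear (\<lambda>\<zeta>. \<zeta> *s v)"
    by (subst linear_conv_bounded_linear[symmetric], rule linearI) (auto simp: vec_eq_iff algebra_simps)
  then have "((\<lambda>\<zeta>. z + \<zeta> *s v) has_derivative (\<lambda>h. h *s v)) (at \<zeta>)"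
    by (auto intro!: derivative_eq_intros bounded_linear_imp_has_derivative)
  from has_derivative_compose[OF this f(1)] f(2)
  have "((\<lambda>\<zeta>. f (z + \<zeta> *s v)) has_derivative (\<lambda>h. h *s D v)) (at \<zeta>)" by simp
  from bounded_linear.has_derivative[OF bounded_linear_vec_nth this]
  show ?thesis unfolding has_field_derivative_def by (rule has_derivative_eq_rhs) (simp add: fun_eq_iff)
qed

lemma slice_holomorphic_on:
  fixes f :: "complex^'n \<Rightarrow> complex^'n"
  assumes "holomorphic_map_on f S" "\<And>\<zeta>. \<zeta> \<in> T \<Longrightarrow> z + \<zeta> *s v \<in> S"
  shows "(\<lambda>\<zeta>. f (z + \<zeta> *s v) $ i) holomorphic_on T"
  unfolding holomorphic_on_def
proof
  fix \<zeta> assume "\<zeta> \<in> T"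
  then have "z + \<zeta> *s v \<in> S" using assms(2) by simp
  note D = holomorphic_map_on_frechet_derivative[OF assms(1) this]
  show "(\<lambda>\<zeta>. f (z + \<zeta> *s v) $ i) field_differentiable at \<zeta> within T"
    using slice_has_field_derivative[OF D(1,2)] field_differentiable_at_within field_differentiable_def by blast
qed


text \<open>The slice through \<open>z\<close> in direction \<open>v\<close> is holomorphic on the
  disc of radius \<open>R = \<rho> / norm v > 1\<close>. The one-variable bounds at \<zeta> = 1
  therefore control the value at \<open>z + v\<close>; the factor \<open>CARD('n)\<close> comes from
  summing over the components.\<close>

lemma slice_taylor:
  fixes f :: "complex^'n \<Rightarrow> complex^'n"
  assumes f: "holomorphic_map_on f (ball z \<rho>)" and b: "\<And>x. x \<in> ball z \<rho> \<Longrightarrow> norm (f x) \<le> M"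
    and "\<rho> > 0" and v: "norm v < \<rho>"
  shows "norm (frechet_derivative f (at z) v) \<le> real CARD('n) * (M * norm v / \<rho>)"
    and "norm (f (z + v) - f z - frechet_derivative f (at z) v) \<le>
           real CARD('n) * (M * (norm v / \<rho>)\<^sup>2 / (1 - norm v / \<rho>))"
proof -
  let ?D = "frechet_derivative f (at z)"
  have "z \<in> ball z \<rho>" using \<open>\<rho> > 0\<close> by simp
  note D = holomorphic_map_on_frechet_derivative[OF f this]
  have "M \<ge> 0" using order_trans[OF norm_ge_zero b[OF \<open>z \<in> ball z \<rho>\<close>]] .
  have *: "norm (?D v $ i) \<le> M * norm v / \<rho> \<and>
     norm ((f (z + v) - f z - ?D v) $ i) \<le> M * (norm v / \<rho>)\<^sup>2 / (1 - norm v / \<rho>)" for i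
  proof (cases "v = 0")
    case True
    then show ?thesis using linear_0[OF D(3)] by simp
  next
    case False
    define R where "R = \<rho> / norm v"
    have R: "R > 1" using False v by (simp add: R_def)
    define g where "g = (\<lambda>\<zeta>. f (z + \<zeta> *s v) $ i)"
    have in_ball: "z + \<zeta> *s v \<in> ball z \<rho>" if "norm \<zeta> < R" for \<zeta>
      using that False by (simp add: dist_norm norm_vector_scalar_mult R_def field_simps)
    have hol: "g holomorphic_on ball 0 R"
      unfolding g_def by (rule slice_holomorphic_on[OF f]) (use in_ball in auto)
    have bd: "norm (g \<zeta>) \<le> M" if "norm \<zeta> < R" for \<zeta>
      using b[OF in_ball[OF that]] Finite_Cartesian_Product.norm_nth_le[of "f (z + \<zeta> *s v)" i] by (simp add: g_def)
    have g1: "(deriv ^^ 1) g 0 = ?D v $ i"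
      using slice_has_field_derivative[where f = f and D = ?D and z = z and v = v and \<zeta> = 0 and i = i] D by (simp add: g_def DERIV_imp_deriv)
    have "norm (?D v $ i) \<le> M / R ^ 1"
      using taylor_coefficient_bound[OF hol _ bd, of 1] R g1 by simp
    moreover have "norm (g 1 - (\<Sum>j<2. (deriv ^^ j) g 0 / fact j * 1 ^ j)) \<le> M * (norm (1::complex) / R) ^ 2 / (1 - norm (1::complex) / R)"
      by (rule taylor_remainder_bound[OF hol _ bd]) (use R in auto)
    moreover have "(\<Sum>j<2. (deriv ^^ j) g 0 / fact j * 1 ^ j) = f z $ i + ?D v $ i"
      using g1 by (simp add: numeral_2_eq_2 g_def)
    ultimately show ?thesis
      by (simp add: R_def g_def power_divide diff_diff_eq)
  qed
  show "norm (?D v) \<le> real CARD('n) * (M * norm v / \<rho>)"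
    by (rule norm_le_card_times_component) (use * in blast)
  show "norm (f (z + v) - f z - ?D v) \<le> real CARD('n) * (M * (norm v / \<rho>)\<^sup>2 / (1 - norm v / \<rho>))"
    by (rule norm_le_card_times_component) (use * in blast)
qed

text \<open>By homogeneity it suffices to treat vectors short enough for
  \<open>slice_taylor\<close>; \<open>v\<close> is rescaled to length
  \<open>\<rho> / 2\<close>.\<close>

lemma holomorphic_map_derivative_bound:
  fixes f :: "complex^'n \<Rightarrow> complex^'n"
  assumes f: "holomorphic_map_on f (ball z \<rho>)" and b: "\<And>x. x \<in> ball z \<rho> \<Longrightarrow> norm (f x) \<le> M"
    and "\<rho> > 0"
  shows "norm (frechet_derivative f (at z) v) \<le> real CARD('n) * M / \<rho> * norm v"
proof (cases "v = 0")
  case False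
  have lin: "linear (frechet_derivative f (at z))"
    using holomorphic_map_on_frechet_derivative(3)[OF f] \<open>\<rho> > 0\<close> by simp
  define c where "c = \<rho> / (2 * norm v)"
  have c: "c > 0" using False \<open>\<rho> > 0\<close> by (simp add: c_def)
  have "c * norm (frechet_derivative f (at z) v) = norm (frechet_derivative f (at z) (c *\<^sub>R v))"
    using c by (simp add: linear_scale[OF lin])
  also have "\<dots> \<le> real CARD('n) * (M * norm (c *\<^sub>R v) / \<rho>)"
    by (rule slice_taylor(1)[OF f b \<open>\<rho> > 0\<close>]) (use False \<open>\<rho> > 0\<close> in \<open>auto simp: c_def\<close>)
  also have "\<dots> = c * (real CARD('n) * M / \<rho> * norm v)" using c by simp
  finally show ?thesis using c by (simp only: mult_le_cancel_left_pos)
next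
  case True
  then show ?thesis
    using linear_0[OF holomorphic_map_on_frechet_derivative(3)[OF f]] \<open>\<rho> > 0\<close> by simp
qed

text \<open>For \<open>norm v \<le> \<rho> / 2\<close> the denominator
  \<open>1 - norm v / \<rho>\<close> is at least one half, which accounts for the factor 2.\<close>

lemma holomorphic_map_taylor_bound:
  fixes f :: "complex^'n \<Rightarrow> complex^'n"
  assumes f: "holomorphic_map_on f (ball z \<rho>)" and b: "\<And>x. x \<in> ball z \<rho> \<Longrightarrow> norm (f x) \<le> M"
    and "\<rho> > 0" and v: "norm v \<le> \<rho> / 2"
  shows "norm (f (z + v) - f z - frechet_derivative f (at z) v) \<le> 2 * real CARD('n) * M / \<rho>\<^sup>2 * (norm v)\<^sup>2"
proof -
  have "M \<ge> 0" using order_trans[OF norm_ge_zero b[of z]] \<open>\<rho> > 0\<close> by simp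
  define t where "t = norm v / \<rho>"
  have t: "t \<le> 1 / 2" using v \<open>\<rho> > 0\<close> by (simp add: t_def field_simps)
  have "norm (f (z + v) - f z - frechet_derivative f (at z) v) \<le>
      real CARD('n) * (M * t\<^sup>2 / (1 - t))"
    unfolding t_def by (rule slice_taylor(2)[OF f b \<open>\<rho> > 0\<close>]) (use v \<open>\<rho> > 0\<close> in auto)
  also have "\<dots> \<le> real CARD('n) * (M * t\<^sup>2 / (1 / 2))"
    using t \<open>M \<ge> 0\<close> by (intro mult_left_mono divide_left_mono) auto
  also have "\<dots> = 2 * real CARD('n) * M / \<rho>\<^sup>2 * (norm v)\<^sup>2"
    by (simp add: t_def power_divide)
  finally show ?thesis .
qed

text \<open>Every point of \<open>cball 0 r\<close> carries a ball of radius \<open>R - r\<close>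
  inside \<open>ball 0 R\<close>, so the derivative bound is uniform there, and the mean value
  inequality on a convex set applies.\<close>

lemma holomorphic_map_lipschitz:
  fixes f :: "complex^'n \<Rightarrow> complex^'n"
  assumes f: "holomorphic_map_on f (ball 0 R)" and b: "\<And>x. x \<in> ball 0 R \<Longrightarrow> norm (f x) \<le> M"
    and "r < R" and x: "x \<in> cball 0 r" and y: "y \<in> cball 0 r"
  shows "norm (f x - f y) \<le> real CARD('n) * M / (R - r) * norm (x - y)"
proof (rule differentiable_bound[where S = "cball 0 r" and f' = "\<lambda>z :: complex^'n. frechet_derivative f (at z)"])
  fix z :: "complex^'n" assume z: "z \<in> cball 0 r"
  then have "z \<in> ball 0 R" using \<open>r < R\<close> by simp
  then show "(f has_derivative frechet_derivative f (at z)) (at z within cball 0 r)"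
    using holomorphic_map_on_frechet_derivative(1)[OF f] has_derivative_at_withinI by blast
  have sub: "ball z (R - r) \<subseteq> ball 0 R"
  proof
    fix y assume "y \<in> ball z (R - r)"
    then show "y \<in> ball 0 R"
      using z norm_triangle_ineq[of "y - z" z] by (auto simp: dist_norm norm_minus_commute)
  qed
  show "onorm (frechet_derivative f (at z)) \<le> real CARD('n) * M / (R - r)"
    by (rule onorm_le, rule holomorphic_map_derivative_bound)
       (use f sub b \<open>r < R\<close> in \<open>auto intro: holomorphic_map_on_subset\<close>)
qed (use x y in auto)

text \<open>A locally bounded pointwise limit is holomorphic: the second order Taylor estimate is uniform
  along the sequence and survives the limit.\<close>

lemma holomorphic_map_pointwise_limit:
  fixes f :: "nat \<Rightarrow> complex^'n \<Rightarrow> complex^'n"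
  assumes f: "\<And>m. holomorphic_map_on (f m) (ball z \<rho>)"
    and b: "\<And>m x. x \<in> ball z \<rho> \<Longrightarrow> norm (f m x) \<le> M" and "\<rho> > 0"
    and lim: "\<And>x. x \<in> ball z \<rho> \<Longrightarrow> (\<lambda>m. f m x) \<longlonglongrightarrow> g x"
  shows "\<exists>D. (g has_derivative D) (at z) \<and> (\<forall>c v. D (c *s v) = c *s D v)"
proof -
  let ?d = "\<lambda>m. frechet_derivative (f m) (at z)"
  define C where "C = 2 * real CARD('n) * M / \<rho>\<^sup>2"
  have "M \<ge> 0" using order_trans[OF norm_ge_zero b[of z 0]] \<open>\<rho> > 0\<close> by simp
  then have "C \<ge> 0" by (simp add: C_def)
  have zb: "z \<in> ball z \<rho>" using \<open>\<rho> > 0\<close> by simp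
  have lin: "linear (?d m)" "?d m (c *s v) = c *s ?d m v" for m c v
    using holomorphic_map_on_frechet_derivative(2,3)[OF f zb] by blast+
  have tay: "norm (f m (z + v) - f m z - ?d m v) \<le> C * (norm v)\<^sup>2" if "norm v \<le> \<rho> / 2" for m v
    unfolding C_def by (rule holomorphic_map_taylor_bound[OF f b \<open>\<rho> > 0\<close> that])
  have "convergent (\<lambda>m. ?d m v)" for v
  proof (rule Cauchy_convergent, rule CauchyI)
    fix e :: real assume "e > 0"
    define B where "B = C * (norm v)\<^sup>2 + 1"
    have "B > 0" using \<open>C \<ge> 0\<close> by (simp add: B_def add_nonneg_pos)
    \<comment> \<open>The difference quotients with step \<open>s\<close> converge as
      \<open>m\<close> grows, and their distance to the derivatives is of order \<open>s\<close>
      uniformly in \<open>m\<close>. The second entry of the minimum makes the two Taylor errors,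
      divided by \<open>s\<close>, contribute at most \<open>e / 2\<close> together.\<close>
    define s where "s = min (\<rho> / (2 * (norm v + 1))) (e / (4 * B))"
    have s: "s > 0" using \<open>\<rho> > 0\<close> \<open>e > 0\<close> \<open>B > 0\<close> by (simp add: s_def add_nonneg_pos)
    have sv: "norm (s *\<^sub>R v) \<le> \<rho> / 2"
    proof -
      have "s \<le> \<rho> / (2 * (norm v + 1))" by (simp add: s_def)
      from mult_right_mono[OF this norm_ge_zero[of v]]
      have "norm (s *\<^sub>R v) \<le> \<rho> / (2 * (norm v + 1)) * norm v"
        using s by simp
      also have "\<dots> \<le> \<rho> / 2 * (norm v / (norm v + 1))" by simp
      also have "\<dots> \<le> \<rho> / 2 * 1"
        using \<open>\<rho> > 0\<close> by (intro mult_left_mono) (auto simp: divide_le_eq_1 add_nonneg_pos)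
      finally show ?thesis by simp
    qed
    define h where "h m = f m (z + s *\<^sub>R v) - f m z" for m
    have "z + s *\<^sub>R v \<in> ball z \<rho>"
      using sv \<open>\<rho> > 0\<close> by (simp add: dist_norm)
    then have "h \<longlonglongrightarrow> g (z + s *\<^sub>R v) - g z"
      unfolding h_def using lim zb by (intro tendsto_diff) blast+
    then have "Cauchy h" by (rule LIMSEQ_imp_Cauchy)
    then obtain N where N: "\<And>m k. m \<ge> N \<Longrightarrow> k \<ge> N \<Longrightarrow> norm (h m - h k) < s * (e / 2)"
      using CauchyD[of h "s * (e / 2)"] s \<open>e > 0\<close> by auto
    show "\<exists>N. \<forall>m\<ge>N. \<forall>k\<ge>N. norm (?d m v - ?d k v) < e"
    proof (intro exI[of _ N] allI impI)
      fix m k assume mk: "m \<ge> N" "k \<ge> N"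
      have 1: "norm (h m - s *\<^sub>R ?d m v) \<le> C * (s * norm v)\<^sup>2" for m
        using tay[OF sv, of m] s by (simp add: h_def linear_scale[OF lin(1)])
      have "s *\<^sub>R (?d m v - ?d k v) = (h m - h k) - (h m - s *\<^sub>R ?d m v) + (h k - s *\<^sub>R ?d k v)"
        by (simp add: algebra_simps)
      also have "norm \<dots> \<le> norm (h m - h k) + norm (h m - s *\<^sub>R ?d m v) + norm (h k - s *\<^sub>R ?d k v)"
        by (meson add_right_mono norm_triangle_ineq norm_triangle_ineq4 order_trans)
      also have "\<dots> < s * (e / 2) + C * (s * norm v)\<^sup>2 + C * (s * norm v)\<^sup>2"
        using N[OF mk] 1[of m] 1[of k] by linarith
      also have "\<dots> = s * (e / 2 + 2 * s * (C * (norm v)\<^sup>2))"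
        by (simp add: power2_eq_square algebra_simps)
      also have "\<dots> \<le> s * (e / 2 + 2 * s * B)"
        using s by (intro mult_left_mono add_left_mono) (auto simp: B_def)
      also have "\<dots> \<le> s * e"
      proof (rule mult_left_mono)
        have "s * B \<le> e / (4 * B) * B" using \<open>B > 0\<close> by (intro mult_right_mono) (auto simp: s_def)
        then show "e / 2 + 2 * s * B \<le> e" using \<open>B > 0\<close> by simp
      qed (use s in auto)
      finally show "norm (?d m v - ?d k v) < e" using s by simp
    qed
  qed
  then obtain D where D: "\<And>v. (\<lambda>m. ?d m v) \<longlonglongrightarrow> D v"
    unfolding convergent_def by metis
  have scale: "D (c *s v) = c *s D v" for c v
  proof -
    have "(\<lambda>m. ?d m (c *s v)) \<longlonglongrightarrow> c *s D v"
      unfolding lin(2)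
    proof (rule vec_tendstoI)
      fix i
      have "(\<lambda>m. c * ?d m v $ i) \<longlonglongrightarrow> c * D v $ i" by (intro tendsto_intros D)
      then show "(\<lambda>m. (c *s ?d m v) $ i) \<longlonglongrightarrow> (c *s D v) $ i" by simp
    qed
    then show ?thesis using D LIMSEQ_unique by blast
  qed
  have "linear D"
  proof (rule linearI)
    fix u v and r :: real
    have "(\<lambda>m. ?d m u + ?d m v) \<longlonglongrightarrow> D u + D v" by (intro tendsto_intros D)
    then show "D (u + v) = D u + D v"
      using D[of "u + v"] LIMSEQ_unique by (auto simp: linear_add[OF lin(1)])
    show "D (r *\<^sub>R v) = r *\<^sub>R D v" by (simp add: scaleR_eq_vector_scalar_mult scale)
  qed
  then have "bounded_linear D" by (simp add: linear_conv_bounded_linear)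
  have "(g has_derivative D) (at z)"
  proof (rule has_derivative_if_quadratic[OF \<open>bounded_linear D\<close>])
    show "\<rho> / 2 > 0" using \<open>\<rho> > 0\<close> by simp
    fix v :: "complex^'n" assume v: "norm v < \<rho> / 2"
    then have "z + v \<in> ball z \<rho>" using \<open>\<rho> > 0\<close> by (simp add: dist_norm)
    then have "(\<lambda>m. norm (f m (z + v) - f m z - ?d m v)) \<longlonglongrightarrow> norm (g (z + v) - g z - D v)"
      by (intro tendsto_intros lim D zb)
    then show "norm (g (z + v) - g z - D v) \<le> C * (norm v)\<^sup>2"
      by (rule LIMSEQ_le_const2) (use tay v in \<open>auto intro!: exI[of _ 0]\<close>)
  qed
  then show ?thesis using scale by blast
qed


section \<open>Local bounds and holomorphic dependence of the derivative\<close>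

lemma holomorphic_map_on_bounded_locally:
  fixes f :: "complex^'n \<Rightarrow> complex^'n"
  assumes "holomorphic_map_on f (ball 0 R)" "r < R"
  obtains M where "M > 0" "\<And>z. z \<in> cball 0 r \<Longrightarrow> norm (f z) \<le> M"
proof -
  have "continuous_on (cball 0 r) f"
    using assms by (intro holomorphic_map_on_imp_continuous_on holomorphic_map_on_subset[OF assms(1)]) auto
  then have "compact (f ` cball 0 r)" by (intro compact_continuous_image compact_cball)
  then obtain B where "B > 0" "\<forall>x\<in>f ` cball 0 r. norm x \<le> B"
    using compact_imp_bounded bounded_pos by blast
  then show thesis using that by blast
qed

lemma holomorphic_map_on_lipschitz_locally:
  fixes f :: "complex^'n \<Rightarrow> complex^'n"
  assumes f: "holomorphic_map_on f (ball 0 R)" and "r < R"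
  obtains K where "K > 0" "\<And>x y. x \<in> cball 0 r \<Longrightarrow> y \<in> cball 0 r \<Longrightarrow> norm (f x - f y) \<le> K * norm (x - y)"
proof -
  define s where "s = (r + R) / 2"
  have s: "r < s" "s < R" using \<open>r < R\<close> by (auto simp: s_def)
  obtain M where M: "M > 0" "\<And>z. z \<in> cball 0 s \<Longrightarrow> norm (f z) \<le> M"
    using holomorphic_map_on_bounded_locally[OF f s(2)] by blast
  have f': "holomorphic_map_on f (ball 0 s)" using f s by (auto intro: holomorphic_map_on_subset)
  have "norm (f x - f y) \<le> real CARD('n) * M / (s - r) * norm (x - y)" if "x \<in> cball 0 r" "y \<in> cball 0 r" for x y
    by (rule holomorphic_map_lipschitz[OF f' _ s(1) that]) (use M(2) in auto)
  moreover have "real CARD('n) * M / (s - r) > 0" using M(1) s(1) by simp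
  ultimately show thesis using that by blast
qed

text \<open>Difference quotients in a fixed direction are holomorphic, converge pointwise to the
  derivative, and are bounded by the local Lipschitz constant; so the limit theorem for bounded
  sequences applies.\<close>

lemma holomorphic_map_on_directional_derivative:
  fixes f :: "complex^'n \<Rightarrow> complex^'n"
  assumes f: "holomorphic_map_on f (ball 0 R)"
  shows "holomorphic_map_on (\<lambda>z. frechet_derivative f (at z) v) (ball 0 R)"
  unfolding holomorphic_map_on_iff
proof
  fix z :: "complex^'n" assume z: "z \<in> ball 0 R"
  \<comment> \<open>One third of the distance to the sphere leaves room for a point of
    \<open>ball z \<rho>\<close> and a further shift of length at most \<rho>. The offset
    \<open>m0\<close> below ensures that all shifts \<open>t m *\<^sub>R v\<close> are that
    short.\<close>
  define \<rho> where "\<rho> = (R - norm z) / 3"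
  define r where "r = norm z + 2 * \<rho>"
  have \<rho>: "\<rho> > 0" "r < R" using z by (auto simp: \<rho>_def r_def field_simps)
  obtain K where K: "K > 0" "\<And>x y. x \<in> cball 0 r \<Longrightarrow> y \<in> cball 0 r \<Longrightarrow> norm (f x - f y) \<le> K * norm (x - y)"
    using holomorphic_map_on_lipschitz_locally[OF f \<rho>(2)] by blast
  obtain m0 :: nat where m0: "norm v / \<rho> < real m0" using reals_Archimedean2 by blast
  define t where "t m = 1 / real (Suc (m0 + m))" for m
  have t: "t m > 0" "t m * norm v \<le> \<rho>" for m
  proof -
    show "t m > 0" by (simp add: t_def)
    have "norm v \<le> \<rho> * real (Suc (m0 + m))"
      using m0 \<rho>(1) by (simp add: field_simps) (smt (verit) mult_nonneg_nonneg of_nat_0_le_iff)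
    then show "t m * norm v \<le> \<rho>" by (simp add: t_def field_simps)
  qed
  have tlim: "t \<longlonglongrightarrow> 0"
  proof -
    have "(\<lambda>m. 1 / real (Suc (m + m0))) \<longlonglongrightarrow> 0"
      by (rule LIMSEQ_ignore_initial_segment[OF lim_1_over_Suc])
    then show ?thesis by (simp add: t_def[abs_def] add.commute)
  qed
  define g where "g m x = complex_of_real (1 / t m) *s (f (x + t m *\<^sub>R v) - f x)" for m x
  have ball1: "x \<in> cball 0 r" "x + t m *\<^sub>R v \<in> cball 0 r" "x \<in> ball 0 R" "x + t m *\<^sub>R v \<in> ball 0 R"
    if "x \<in> ball z \<rho>" for x m
  proof -
    have "norm x \<le> norm z + \<rho>"
      using that norm_triangle_ineq[of "x - z" z] by (auto simp: dist_norm norm_minus_commute)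
    moreover have "norm (x + t m *\<^sub>R v) \<le> norm x + t m * norm v"
      using norm_triangle_ineq[of x "t m *\<^sub>R v"] t(1)[of m] by simp
    ultimately show "x \<in> cball 0 r" "x + t m *\<^sub>R v \<in> cball 0 r" "x \<in> ball 0 R" "x + t m *\<^sub>R v \<in> ball 0 R"
      using t(2)[of m] \<rho> by (auto simp: r_def)
  qed
  show "\<exists>D. ((\<lambda>z. frechet_derivative f (at z) v) has_derivative D) (at z) \<and> (\<forall>c v. D (c *s v) = c *s D v)"
  proof (rule holomorphic_map_pointwise_limit[of g z \<rho> "K * norm v"])
    fix m
    show "holomorphic_map_on (g m) (ball z \<rho>)"
      unfolding g_def
      by (intro holomorphic_map_on_cmult holomorphic_map_on_diff holomorphic_map_on_translate[OF f] holomorphic_map_on_subset[OF f])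
         (use ball1 in auto)
    fix x assume x: "x \<in> ball z \<rho>"
    have "norm (f (x + t m *\<^sub>R v) - f x) \<le> K * (t m * norm v)"
      using K(2)[OF ball1(2,1)[OF x], of m] t(1)[of m] by simp
    then have "1 / t m * norm (f (x + t m *\<^sub>R v) - f x) \<le> 1 / t m * (K * (t m * norm v))"
      using t(1)[of m] by (intro mult_left_mono) auto
    then show "norm (g m x) \<le> K * norm v"
      using t(1)[of m] unfolding g_def norm_vector_scalar_mult norm_of_real by simp
  next
    fix x assume x: "x \<in> ball z \<rho>"
    have D: "(f has_derivative frechet_derivative f (at x)) (at x)"
      using holomorphic_map_on_frechet_derivative(1)[OF f] ball1(3)[OF x] by blast
    have lin: "linear (frechet_derivative f (at x))" using D has_derivative_linear by blast
    have "((\<lambda>t. f (x + t *\<^sub>R v)) has_derivative (\<lambda>h. frechet_derivative f (at x) (h *\<^sub>R v))) (at 0)"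
      by (rule has_derivative_compose[where g = f and f = "\<lambda>t. x + t *\<^sub>R v"])
         (use D in \<open>auto intro!: derivative_eq_intros\<close>)
    then have "((\<lambda>t. f (x + t *\<^sub>R v)) has_vector_derivative frechet_derivative f (at x) v) (at 0)"
      by (simp add: has_vector_derivative_def linear_scale[OF lin])
    then have "((\<lambda>t. norm (f (x + t *\<^sub>R v) - f x - t *\<^sub>R frechet_derivative f (at x) v) / norm t) \<longlongrightarrow> 0) (at 0)"
      by (simp add: has_vector_derivative_def has_derivative_iff_norm)
    moreover have "filterlim t (at 0) sequentially"
      using tlim t(1) by (auto simp: filterlim_at less_imp_neq[symmetric])
    ultimately have "(\<lambda>m. norm (f (x + t m *\<^sub>R v) - f x - t m *\<^sub>R frechet_derivative f (at x) v) / norm (t m)) \<longlonglongrightarrow> 0"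
      by (rule filterlim_compose)
    moreover have "norm (f (x + t m *\<^sub>R v) - f x - t m *\<^sub>R frechet_derivative f (at x) v) / norm (t m) =
        norm (g m x - frechet_derivative f (at x) v)" for m
    proof -
      have "g m x - frechet_derivative f (at x) v =
          (1 / t m) *\<^sub>R (f (x + t m *\<^sub>R v) - f x - t m *\<^sub>R frechet_derivative f (at x) v)"
        using t(1)[of m] unfolding g_def scaleR_eq_vector_scalar_mult[symmetric]
        by (simp add: scaleR_right_diff_distrib)
      then show ?thesis using t(1)[of m] by simp
    qed
    ultimately show "(\<lambda>m. g m x) \<longlonglongrightarrow> frechet_derivative f (at x) v"
      by (simp add: LIM_zero_iff tendsto_norm_zero_iff)
  qed (use \<rho> in auto)
qed

lemma frechet_derivative_matrix:
  fixes f :: "complex^'n \<Rightarrow> complex^'n"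
  assumes f: "holomorphic_map_on f S" "z \<in> S"
  shows "matrix (frechet_derivative f (at z)) *v v = frechet_derivative f (at z) v"
proof -
  note D = holomorphic_map_on_frechet_derivative(2,3)[OF f]
  have "Vector_Spaces.linear (*s) (*s) (frechet_derivative f (at z))"
    using D by unfold_locales (auto simp: linear_add vec.vector_space_assms)
  then show ?thesis by (simp add: matrix_works)
qed

lemma cdiff_at_derivative_entry:
  fixes f :: "complex^'n \<Rightarrow> complex^'n"
  assumes f: "holomorphic_map_on f (ball 0 R)" "z \<in> ball 0 R"
  shows "cdiff_at (\<lambda>z. matrix (frechet_derivative f (at z)) $ i $ j) z"
  using holomorphic_map_on_directional_derivative[OF f(1)] f(2)
  by (simp add: matrix_def holomorphic_map_on_iff_cdiff_at)

lemma holomorphic_map_on_derivative_apply: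
  fixes f :: "complex^'n \<Rightarrow> complex^'n"
  assumes f: "holomorphic_map_on f (ball 0 R)" and p: "holomorphic_map_on p (ball 0 R)"
  shows "holomorphic_map_on (\<lambda>z. frechet_derivative f (at z) (p z)) (ball 0 R)"
proof -
  have "holomorphic_map_on (\<lambda>z. matrix (frechet_derivative f (at z)) *v p z) (ball 0 R)"
    unfolding holomorphic_map_on_iff_cdiff_at
  proof (intro ballI allI)
    fix z :: "complex^'n" and i assume z: "z \<in> ball 0 R"
    have "cdiff_at (\<lambda>z. p z $ j) z" for j
      using p z by (simp add: holomorphic_map_on_iff_cdiff_at)
    then show "cdiff_at (\<lambda>z. (matrix (frechet_derivative f (at z)) *v p z) $ i) z"
      unfolding matrix_vector_mult_def
      by (simp, intro cdiff_at_sum cdiff_at_mult cdiff_at_derivative_entry[OF f z])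
  qed
  then show ?thesis
    by (rule holomorphic_map_on_transform) (auto simp: frechet_derivative_matrix[OF f])
qed

text \<open>Cramer's rule writes the solution as a quotient of determinants whose entries depend
  holomorphically on the point.\<close>

lemma holomorphic_map_on_derivative_solve:
  fixes f :: "complex^'n \<Rightarrow> complex^'n"
  assumes f: "holomorphic_map_on f (ball 0 R)" and q: "holomorphic_map_on q (ball 0 R)"
    and inj: "\<And>z v. z \<in> ball 0 R \<Longrightarrow> frechet_derivative f (at z) v = 0 \<Longrightarrow> v = 0"
  obtains p where "holomorphic_map_on p (ball 0 R)"
    "\<And>z. z \<in> ball 0 R \<Longrightarrow> frechet_derivative f (at z) (p z) = q z"
proof -
  define A where "A z = matrix (frechet_derivative f (at z))" for z
  have A: "A z *v v = frechet_derivative f (at z) v" if "z \<in> ball 0 R" for z v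
    unfolding A_def by (rule frechet_derivative_matrix[OF f that])
  have entry: "cdiff_at (\<lambda>z. A z $ i $ j) z" if "z \<in> ball 0 R" for z i j
    unfolding A_def by (rule cdiff_at_derivative_entry[OF f that])
  have det: "det (A z) \<noteq> 0" if "z \<in> ball 0 R" for z
  proof -
    have "\<forall>x. A z *v x = 0 \<longrightarrow> x = 0" using A[OF that] inj[OF that] by simp
    then have "\<exists>B. B ** A z = mat 1" by (simp add: matrix_left_invertible_ker)
    then have "invertible (A z)" by (simp add: invertible_left_inverse)
    then show ?thesis by (simp add: invertible_det_nz)
  qed
  define p where "p z = (\<chi> k. det (\<chi> i j. if j = k then q z $ i else A z $ i $ j) * inverse (det (A z)))" for z
  show thesis
  proof (rule that[of p])
    show "holomorphic_map_on p (ball 0 R)"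
      unfolding holomorphic_map_on_iff_cdiff_at
    proof (intro ballI allI)
      fix z :: "complex^'n" and k assume z: "z \<in> ball 0 R"
      have qi: "cdiff_at (\<lambda>z. q z $ i) z" for i
        using q z by (simp add: holomorphic_map_on_iff_cdiff_at)
      have "cdiff_at (\<lambda>z. det (\<chi> i j. if j = k then q z $ i else A z $ i $ j)) z"
      proof (rule cdiff_at_det)
        fix i j
        show "cdiff_at (\<lambda>z. (\<chi> i j. if j = k then q z $ i else A z $ i $ j) $ i $ j) z"
          using qi[of i] entry[OF z, of i j] by (cases "j = k") simp_all
      qed
      moreover have "cdiff_at (\<lambda>z. inverse (det (A z))) z"
        by (intro cdiff_at_inverse cdiff_at_det entry z det)
      ultimately show "cdiff_at (\<lambda>z. p z $ k) z"
        unfolding p_def by (simp add: cdiff_at_mult)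
    qed
    fix z :: "complex^'n" assume z: "z \<in> ball 0 R"
    have "A z *v p z = q z"
      unfolding cramer[OF det[OF z]] by (simp add: p_def divide_inverse)
    then show "frechet_derivative f (at z) (p z) = q z" using A[OF z] by simp
  qed
qed

text \<open>A Schwarz type gain: \<open>\<zeta> \<mapsto> k (\<zeta> x) - k (\<zeta> y)\<close>
  vanishes to second order at 0 and can be followed up to the radius
  \<open>\<rho> = s / \<mu>\<close>, where the ordinary Lipschitz bound costs a factor \<rho>.
  Coming back to \<zeta> = 1 gains \<rho> twice, so one factor of order \<mu> remains. The midpoint
  \<open>s\<close> halves \<open>R - r\<close> twice, hence the 4.\<close>

lemma holomorphic_map_second_order_lipschitz:
  fixes k :: "complex^'n \<Rightarrow> complex^'n"
  assumes k: "holomorphic_map_on k (ball 0 R)" and b: "\<And>x. x \<in> ball 0 R \<Longrightarrow> norm (k x) \<le> M"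
    and k0: "(k has_derivative (\<lambda>_. 0)) (at 0)" and "0 < r" "r < R"
    and x: "norm x \<le> \<mu>" and y: "norm y \<le> \<mu>" and \<mu>: "\<mu> \<le> r"
  shows "norm (k x - k y) \<le> real CARD('n) * (4 * real CARD('n) * M / (R - r)\<^sup>2) * \<mu> * norm (x - y)"
proof (cases "\<mu> = 0")
  case True
  then show ?thesis using x y by simp
next
  case False
  then have "\<mu> > 0" using x norm_ge_zero[of x] by linarith
  define s where "s = (r + R) / 2"
  have s: "r < s" "s < R" "s - r = (R - r) / 2" "R - s = (R - r) / 2" using \<open>r < R\<close> by (auto simp: s_def field_simps)
  define L where "L = real CARD('n) * M / (R - s)"
  have "M \<ge> 0" using order_trans[OF norm_ge_zero b[of 0]] \<open>0 < r\<close> \<open>r < R\<close> by simp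
  then have "L \<ge> 0" using s by (simp add: L_def)
  define \<rho> where "\<rho> = s / \<mu>"
  have \<rho>: "\<rho> > 1" using \<open>\<mu> > 0\<close> \<mu> s by (simp add: \<rho>_def)
  have "norm ((k x - k y) $ i) \<le> 4 * real CARD('n) * M / (R - r)\<^sup>2 * \<mu> * norm (x - y)" for i
  proof -
    define g where "g = (\<lambda>\<zeta>. k (0 + \<zeta> *s x) $ i - k (0 + \<zeta> *s y) $ i)"
    have in_cball: "\<zeta> *s w \<in> cball 0 s" if "norm \<zeta> < \<rho>" "norm w \<le> \<mu>" for \<zeta> and w :: "complex^'n"
    proof -
      have "norm \<zeta> * norm w \<le> \<rho> * \<mu>" using that \<rho> by (intro mult_mono) auto
      then show ?thesis using \<open>\<mu> > 0\<close> by (simp add: norm_vector_scalar_mult \<rho>_def)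
    qed
    have cb: "cball 0 s \<subseteq> ball 0 R" using s by auto
    have hol: "g holomorphic_on ball 0 \<rho>"
      unfolding g_def
      by (intro holomorphic_on_diff slice_holomorphic_on[OF k])
         (use subsetD[OF cb in_cball] x y in auto)
    have bd: "norm (g \<zeta>) \<le> L * (\<rho> * norm (x - y))" if "norm \<zeta> < \<rho>" for \<zeta>
    proof -
      have "norm (g \<zeta>) \<le> norm (k (\<zeta> *s x) - k (\<zeta> *s y))"
        using Finite_Cartesian_Product.norm_nth_le[of "k (\<zeta> *s x) - k (\<zeta> *s y)" i] by (simp add: g_def)
      also have "\<dots> \<le> L * norm (\<zeta> *s x - \<zeta> *s y)"
        unfolding L_def by (rule holomorphic_map_lipschitz[OF k b s(2)]) (use in_cball[OF that] x y in auto)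
      also have "\<zeta> *s x - \<zeta> *s y = \<zeta> *s (x - y)" by (simp add: vec_eq_iff algebra_simps)
      also have "L * norm (\<zeta> *s (x - y)) \<le> L * (\<rho> * norm (x - y))"
        using that \<open>L \<ge> 0\<close> unfolding norm_vector_scalar_mult by (intro mult_left_mono mult_right_mono) auto
      finally show ?thesis .
    qed
    have k0': "(k has_derivative (\<lambda>_. 0)) (at (0 + 0 *s w))" for w :: "complex^'n"
      using k0 by simp
    have "(g has_field_derivative (0 $ i - 0 $ i)) (at 0)"
      unfolding g_def using slice_has_field_derivative[OF k0'] by (intro DERIV_diff) auto
    then have g1: "deriv g 0 = 0" by (simp add: DERIV_imp_deriv)
    have "norm (g 1 - (\<Sum>j<2. (deriv ^^ j) g 0 / fact j * 1 ^ j)) \<le>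
        L * (\<rho> * norm (x - y)) * (norm (1::complex) / \<rho>) ^ 2 / (1 - norm (1::complex) / \<rho>)"
      by (rule taylor_remainder_bound[OF hol _ bd]) (use \<rho> in auto)
    also have "(\<Sum>j<2. (deriv ^^ j) g 0 / fact j * 1 ^ j) = 0"
      using g1 by (simp add: numeral_2_eq_2 g_def)
    finally have "norm ((k x - k y) $ i) \<le> L * (\<rho> * norm (x - y)) * (1 / \<rho>) ^ 2 / (1 - 1 / \<rho>)"
      by (simp add: g_def)
    also have "\<dots> = L * norm (x - y) / (\<rho> - 1)"
      using \<rho> by (simp add: power2_eq_square field_simps)
    also have "\<dots> = L * norm (x - y) * \<mu> / (s - \<mu>)"
      using \<open>\<mu> > 0\<close> \<mu> s by (simp add: \<rho>_def field_simps)
    also have "\<dots> \<le> L * norm (x - y) * \<mu> / (s - r)"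
      using \<open>L \<ge> 0\<close> \<open>\<mu> > 0\<close> \<mu> s by (intro divide_left_mono) auto
    also have "\<dots> = 4 * real CARD('n) * M / (R - r)\<^sup>2 * \<mu> * norm (x - y)"
      using \<open>r < R\<close> unfolding L_def s(3,4) by (simp add: power2_eq_square field_simps)
    finally show ?thesis .
  qed
  from norm_le_card_times_component[of "k x - k y", OF this] show ?thesis by (simp add: mult.assoc)
qed


text \<open>Approximation on a smaller ball by the partial sums of the homogeneous expansion, which are
  holomorphic on the whole space.\<close>

lemma holomorphic_map_entire_approximation:
  fixes g :: "complex^'n \<Rightarrow> complex^'n"
  assumes g: "holomorphic_map_on g (ball 0 R)" and b: "\<And>x. x \<in> ball 0 R \<Longrightarrow> norm (g x) \<le> M"
    and r: "0 < r" "r < R" and "\<eta> > 0"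
    and g0: "g 0 = 0" "(g has_derivative (\<lambda>_. 0)) (at 0)"
  obtains Q where "holomorphic_map_on Q UNIV" "Q 0 = 0" "(Q has_derivative (\<lambda>_. 0)) (at 0)"
    "\<And>z. z \<in> cball 0 r \<Longrightarrow> norm (Q z - g z) \<le> \<eta>"
proof -
  \<comment> \<open>\<open>P k\<close> is the homogeneous part of degree \<open>k\<close>. Since
    only the germ of the slice at 0 enters, it is determined at every \<open>z\<close>, also outside
    the ball.\<close>
  define P where "P k z = (\<chi> i. (deriv ^^ k) (\<lambda>\<zeta>. g (0 + \<zeta> *s z) $ i) 0 / fact k)" for k z
  have "M \<ge> 0" using order_trans[OF norm_ge_zero b[of 0]] r by simp
  have rem: "norm ((g (\<zeta> *s z) - (\<Sum>j<k. \<zeta> ^ j *s P j z)) $ i) \<le> M * (norm \<zeta> / \<rho>) ^ k / (1 - norm \<zeta> / \<rho>)"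
    if \<rho>: "\<rho> > 0" "\<rho> * norm z \<le> R" and \<zeta>: "norm \<zeta> < \<rho>" for \<rho> z \<zeta> k i
  proof -
    have in_ball: "0 + \<zeta> *s z \<in> ball 0 R" if "norm \<zeta> < \<rho>" for \<zeta>
    proof (cases "z = 0")
      case False
      then have "norm \<zeta> * norm z < \<rho> * norm z" using that by (intro mult_strict_right_mono) auto
      then show ?thesis using \<rho>(2) by (simp add: norm_vector_scalar_mult)
    qed (use r in auto)
    have hol: "(\<lambda>\<zeta>. g (0 + \<zeta> *s z) $ i) holomorphic_on ball 0 \<rho>"
      by (rule slice_holomorphic_on[OF g]) (use in_ball in auto)
    have bd: "norm (g (0 + \<zeta> *s z) $ i) \<le> M" if "norm \<zeta> < \<rho>" for \<zeta>
      using b[OF in_ball[OF that]] Finite_Cartesian_Product.norm_nth_le[of "g (0 + \<zeta> *s z)" i] by simp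
    show ?thesis
      using taylor_remainder_bound[OF hol \<rho>(1) bd \<zeta>, of k] by (simp add: P_def mult.commute)
  qed
  \<comment> \<open>Strong induction: \<open>P k\<close> is the limit for \<open>t\<close> to 0 of
    \<open>g (t z)\<close> minus its terms of lower degree, divided by \<open>t ^ k\<close>. By
    induction these quotients are holomorphic near any given point, and the remainder estimate with
    \<open>l = k\<close> bounds them, while \<open>l = Suc k\<close> gives convergence.\<close>
  have P: "holomorphic_map_on (P k) UNIV" for k
  proof (induction k rule: less_induct)
    case (less k)
    show ?case
      unfolding holomorphic_map_on_iff
    proof
      fix z0 :: "complex^'n"
      define S where "S = norm z0 + 1"
      define \<rho> where "\<rho> = R / S"
      have S: "S > 0" by (simp add: S_def add_nonneg_pos)
      then have \<rho>: "\<rho> > 0" using r by (simp add: \<rho>_def)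
      have z: "\<rho> * norm z \<le> R" "norm z \<le> S" if "z \<in> ball z0 1" for z
      proof -
        show "norm z \<le> S"
          using that norm_triangle_ineq[of "z - z0" z0] by (auto simp: S_def dist_norm norm_minus_commute)
        then have "\<rho> * norm z \<le> \<rho> * S" using \<rho> by (intro mult_left_mono) auto
        then show "\<rho> * norm z \<le> R" using S by (simp add: \<rho>_def)
      qed
      define t where "t m = complex_of_real (\<rho> / 2 * (1 / real (Suc m)))" for m
      have nt: "norm (t m) = \<rho> / 2 * (1 / real (Suc m))" for m
        unfolding t_def norm_of_real using \<rho> by simp
      have t: "norm (t m) > 0" "norm (t m) \<le> \<rho> / 2" "norm (t m) < \<rho>" for m
      proof -
        show "norm (t m) > 0" unfolding nt using \<rho> by simp
        have "\<rho> / 2 * (1 / real (Suc m)) \<le> \<rho> / 2 * 1" using \<rho> by (intro mult_left_mono) auto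
        then show "norm (t m) \<le> \<rho> / 2" unfolding nt by simp
        then show "norm (t m) < \<rho>" using \<rho> by simp
      qed
      have tne: "t m \<noteq> 0" for m using t(1)[of m] by auto
      define f where "f m z = inverse (t m ^ k) *s (g (t m *s z) - (\<Sum>j<k. t m ^ j *s P j z))" for m z
      have rem': "norm ((g (t m *s z) - (\<Sum>j<l. t m ^ j *s P j z)) $ i) \<le> 2 * M * (norm (t m) / \<rho>) ^ l"
        if "z \<in> ball z0 1" for m z l i
      proof -
        have "M * (norm (t m) / \<rho>) ^ l / (1 - norm (t m) / \<rho>) \<le> M * (norm (t m) / \<rho>) ^ l / (1 / 2)"
          using \<open>M \<ge> 0\<close> \<rho> t(2)[of m] by (intro divide_left_mono) (auto simp: field_simps)
        then show ?thesis using rem[where k = l and i = i, OF \<rho> z(1)[OF that] t(3)[of m]] by simp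
      qed
      show "\<exists>D. (P k has_derivative D) (at z0) \<and> (\<forall>c v. D (c *s v) = c *s D v)"
      proof (rule holomorphic_map_pointwise_limit[of f z0 1 "real CARD('n) * (2 * M / \<rho> ^ k)"])
        fix m
        show "holomorphic_map_on (f m) (ball z0 1)"
          unfolding f_def
        proof (intro holomorphic_map_on_cmult holomorphic_map_on_diff holomorphic_map_on_sum
            holomorphic_map_on_compose[OF holomorphic_map_on_scale g])
          show "(*s) (t m) ` ball z0 1 \<subseteq> ball 0 R"
          proof clarify
            fix z assume "z \<in> ball z0 1"
            then have "norm (t m) * norm z \<le> \<rho> / 2 * S" using z(2) t(2) \<rho> by (intro mult_mono) auto
            then show "t m *s z \<in> ball 0 R" using S r by (simp add: norm_vector_scalar_mult \<rho>_def)
          qed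
          show "holomorphic_map_on (P j) (ball z0 1)" if "j \<in> {..<k}" for j
            using less[of j] that by (auto intro: holomorphic_map_on_subset)
        qed simp
        fix z assume z1: "z \<in> ball z0 1"
        show "norm (f m z) \<le> real CARD('n) * (2 * M / \<rho> ^ k)"
        proof (rule norm_le_card_times_component)
          fix i
          have "norm (f m z $ i) = norm ((g (t m *s z) - (\<Sum>j<k. t m ^ j *s P j z)) $ i) / norm (t m) ^ k"
            unfolding f_def vector_smult_component norm_mult norm_inverse norm_power by (simp add: field_simps)
          also have "\<dots> \<le> 2 * M * (norm (t m) / \<rho>) ^ k / norm (t m) ^ k"
            by (intro divide_right_mono rem' z1) simp
          also have "\<dots> = 2 * M / \<rho> ^ k" using tne[of m] by (simp add: power_divide)
          finally show "norm (f m z $ i) \<le> 2 * M / \<rho> ^ k" .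
        qed
      next
        fix z assume z1: "z \<in> ball z0 1"
        show "(\<lambda>m. f m z) \<longlonglongrightarrow> P k z"
        proof (rule vec_tendstoI, rule LIM_zero_cancel)
          fix i
          have le: "norm (f m z $ i - P k z $ i) \<le> M / \<rho> ^ k * (1 / real (Suc m))" for m
          proof -
            have "f m z $ i - P k z $ i = inverse (t m ^ k) * (g (t m *s z) - (\<Sum>j<Suc k. t m ^ j *s P j z)) $ i"
              using tne[of m] by (simp add: f_def algebra_simps)
            also have "norm \<dots> = norm ((g (t m *s z) - (\<Sum>j<Suc k. t m ^ j *s P j z)) $ i) / norm (t m) ^ k"
              unfolding norm_mult norm_inverse norm_power by (simp add: field_simps)
            also have "\<dots> \<le> 2 * M * (norm (t m) / \<rho>) ^ Suc k / norm (t m) ^ k"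
              by (intro divide_right_mono rem' z1) simp
            also have "\<dots> = 2 * M * (norm (t m) / \<rho>) / \<rho> ^ k" using tne[of m] by (simp add: power_divide)
            also have "\<dots> = M / \<rho> ^ k * (1 / real (Suc m))" unfolding nt using \<rho> by (simp add: field_simps del: of_nat_Suc)
            finally show ?thesis .
          qed
          have "(\<lambda>m. M / \<rho> ^ k * (1 / real (Suc m))) \<longlonglongrightarrow> M / \<rho> ^ k * 0"
            by (intro tendsto_mult_left lim_1_over_Suc)
          then have lim0: "(\<lambda>m. M / \<rho> ^ k * (1 / real (Suc m))) \<longlonglongrightarrow> 0" by (simp only: mult_zero_right)
          show "(\<lambda>m. f m z $ i - P k z $ i) \<longlonglongrightarrow> 0"
            by (rule Lim_null_comparison[OF _ lim0]) (intro always_eventually allI le)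
        qed
      qed simp
    qed
  qed
  define \<theta> where "\<theta> = r / R"
  have \<theta>: "0 < \<theta>" "\<theta> < 1" using r by (auto simp: \<theta>_def)
  have "(\<lambda>N. real CARD('n) * (M * \<theta> ^ N / (1 - \<theta>))) \<longlonglongrightarrow> real CARD('n) * (M * 0 / (1 - \<theta>))"
    using \<theta> by (intro tendsto_intros LIMSEQ_realpow_zero) auto
  then have "\<forall>\<^sub>F N in sequentially. real CARD('n) * (M * \<theta> ^ N / (1 - \<theta>)) < \<eta>"
    by (rule order_tendstoD(2)) (use \<open>\<eta> > 0\<close> in simp)
  then obtain N0 where N0: "\<And>N. N \<ge> N0 \<Longrightarrow> real CARD('n) * (M * \<theta> ^ N / (1 - \<theta>)) < \<eta>"
    unfolding eventually_sequentially by blast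
  \<comment> \<open>At least the terms of degree 0 and 1 are kept, so that \<open>Q - g\<close> is
    of second order at the origin and \<open>Q\<close> inherits the vanishing derivative of
    \<open>g\<close>.\<close>
  define N where "N = max N0 2"
  define Q where "Q z = (\<Sum>k<N. P k z)" for z
  have Qg: "norm (Q z - g z) \<le> real CARD('n) * (M * (1 / \<rho>) ^ N / (1 - 1 / \<rho>))"
    if "\<rho> > 1" "\<rho> * norm z \<le> R" for z \<rho>
  proof -
    have "norm (g z - Q z) \<le> real CARD('n) * (M * (1 / \<rho>) ^ N / (1 - 1 / \<rho>))"
    proof (rule norm_le_card_times_component)
      show "norm ((g z - Q z) $ i) \<le> M * (1 / \<rho>) ^ N / (1 - 1 / \<rho>)" for i
        using rem[of \<rho> z 1 N i] that by (simp add: Q_def)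
    qed
    then show ?thesis by (simp add: norm_minus_commute)
  qed
  have "Q 0 = g 0"
  proof -
    have "P k 0 = (if k = 0 then g 0 else 0)" for k
      by (simp add: P_def vec_eq_iff higher_deriv_const)
    then show ?thesis by (simp add: Q_def N_def)
  qed
  have "((\<lambda>z. Q z - g z) has_derivative (\<lambda>_. 0)) (at 0)"
  proof (rule has_derivative_if_quadratic[where \<rho> = "R / 2" and C = "2 * real CARD('n) * M / R\<^sup>2"])
    fix v :: "complex^'n" assume v: "norm v < R / 2"
    show "norm (Q (0 + v) - g (0 + v) - (Q 0 - g 0) - 0) \<le> 2 * real CARD('n) * M / R\<^sup>2 * (norm v)\<^sup>2"
    proof (cases "v = 0")
      case False
      define q where "q = norm v / R"
      have q: "0 < q" "q \<le> 1/2" using v r False by (auto simp: q_def field_simps)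
      have "norm (Q v - g v) \<le> real CARD('n) * (M * (1 / (1 / q)) ^ N / (1 - 1 / (1 / q)))"
      proof (rule Qg)
        show "1 / q > 1" using q by simp
        show "1 / q * norm v \<le> R" using False by (simp add: q_def)
      qed
      also have "\<dots> = real CARD('n) * (M * q ^ N / (1 - q))" by simp
      also have "\<dots> \<le> real CARD('n) * (M * q ^ 2 / (1 / 2))"
        using q \<open>M \<ge> 0\<close> by (intro mult_left_mono frac_le mult_nonneg_nonneg power_decreasing) (auto simp: N_def)
      also have "\<dots> = 2 * real CARD('n) * M / R\<^sup>2 * (norm v)\<^sup>2"
        by (simp add: q_def power_divide)
      finally show ?thesis using \<open>Q 0 = g 0\<close> by simp
    qed simp
  qed (use r in auto)
  from has_derivative_add[OF this g0(2)] have Qd: "(Q has_derivative (\<lambda>_. 0)) (at 0)" by simp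
  show thesis
  proof (rule that[of Q])
    show "holomorphic_map_on Q UNIV" unfolding Q_def[abs_def] by (intro holomorphic_map_on_sum P) auto
    show "Q 0 = 0" using \<open>Q 0 = g 0\<close> g0 by simp
    fix z :: "complex^'n" assume z: "z \<in> cball 0 r"
    have "norm (Q z - g z) \<le> real CARD('n) * (M * (1 / (1 / \<theta>)) ^ N / (1 - 1 / (1 / \<theta>)))"
    proof (rule Qg)
      show "1 / \<theta> > 1" using \<theta> by simp
      have "norm z / \<theta> \<le> r / \<theta>" using z \<theta> by (intro divide_right_mono) auto
      then show "1 / \<theta> * norm z \<le> R" using r by (simp add: \<theta>_def mult.commute)
    qed
    then show "norm (Q z - g z) \<le> \<eta>" using N0[of N] by (simp add: N_def)
  qed (rule Qd)
qed

subsection \<open>Growth estimates in the class \<open>\<M>\<^sub>n\<close>\<close>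

lemma hinner_add_right: "hinner x (y + w) = hinner x y + hinner x w"
  by (simp add: hinner_def sum.distrib algebra_simps)

lemma hinner_scale_right: "hinner x (c *s w) = cnj c * hinner x w"
  by (simp add: hinner_def sum_distrib_left algebra_simps)

lemma Re_hinner: "Re (hinner x w) = x \<bullet> w"
  by (simp add: hinner_def inner_vec_def inner_complex_def)

lemma hinner_self: "hinner x x = complex_of_real ((norm x)\<^sup>2)"
proof (rule complex_eqI)
  show "Re (hinner x x) = Re (complex_of_real ((norm x)\<^sup>2))"
    by (simp add: Re_hinner dot_square_norm)
  show "Im (hinner x x) = Im (complex_of_real ((norm x)\<^sup>2))"
    by (simp add: hinner_def mult.commute)
qed

text \<open>The Cayley transform turns positive real part into a self-map of the disc fixing 0, to
  which the Schwarz lemma applies. Both inequalities are then read off from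
  \<open>norm (P - 1) \<le> r * norm (P + 1)\<close>.\<close>

lemma caratheodory_bounds:
  fixes p :: "complex \<Rightarrow> complex"
  assumes hol: "p holomorphic_on ball 0 1" and p0: "p 0 = 1"
    and Re: "\<And>\<zeta>. norm \<zeta> < 1 \<Longrightarrow> Re (p \<zeta>) \<ge> 0" and \<zeta>: "norm \<zeta> < 1"
  shows "Re (p \<zeta>) \<ge> (1 - norm \<zeta>) / (1 + norm \<zeta>)" and "norm (p \<zeta>) \<le> (1 + norm \<zeta>) / (1 - norm \<zeta>)"
proof -
  define r where "r = norm \<zeta>"
  have r: "0 \<le> r" "r < 1" using \<zeta> by (auto simp: r_def)
  define c where "c = (1 - r) / (1 + r)"
  define C where "C = (1 + r) / (1 - r)"
  have C: "C > 0" using r by (simp add: C_def)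
  have *: "(1 + \<delta>) * c - \<delta> \<le> Re (p \<zeta>)" "norm (p \<zeta>) \<le> (1 + \<delta>) * C + \<delta>" if "\<delta> > 0" for \<delta> :: real
  proof -
    \<comment> \<open>The real part may vanish, so \<delta> is added to make it strictly positive;
      the quotient restores the value 1 at the origin. At the end \<delta> tends to 0.\<close>
    define P where "P x = (p x + of_real \<delta>) / of_real (1 + \<delta>)" for x
    have pP: "p x = of_real (1 + \<delta>) * P x - of_real \<delta>" for x
      using that by (simp add: P_def del: of_real_add)
    have ReP: "Re (P x) > 0" if "norm x < 1" for x
      using Re[OF that] \<open>\<delta> > 0\<close> by (simp add: P_def Re_divide_of_real)
    have P1: "P x + 1 \<noteq> 0" if "norm x < 1" for x
      using ReP[OF that] by (metis add_pos_pos plus_complex.simps(1) one_complex.simps(1) zero_complex.simps(1) zero_less_one less_irrefl)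
    have P0: "P 0 = 1" using that p0 by (simp add: P_def) (metis of_real_1 of_real_add of_real_eq_0_iff add_pos_pos zero_less_one less_irrefl divide_self)
    define \<omega> where "\<omega> x = (P x - 1) / (P x + 1)" for x
    have lt: "norm (P x - 1) < norm (P x + 1)" if "norm x < 1" for x
    proof -
      have "(norm (P x - 1))\<^sup>2 < (norm (P x + 1))\<^sup>2"
        using ReP[OF that] unfolding cmod_power2 by (simp add: power2_eq_square algebra_simps)
      then show ?thesis by (rule power2_less_imp_less) simp
    qed
    have "norm (\<omega> \<zeta>) \<le> norm \<zeta>"
    proof (rule Schwarz_Lemma(1))
      show "\<omega> holomorphic_on ball 0 1"
        unfolding \<omega>_def P_def using P1 that
        by (intro holomorphic_intros hol) (auto simp: P_def simp del: of_real_add)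
      show "\<omega> 0 = 0" by (simp add: \<omega>_def P0)
      show "norm (\<omega> x) < 1" if "norm x < 1" for x
        using lt[OF that] P1[OF that] by (simp add: \<omega>_def norm_divide)
    qed (rule \<zeta>)
    then have 1: "norm (P \<zeta> - 1) \<le> r * norm (P \<zeta> + 1)"
      using P1[OF \<zeta>] by (simp add: \<omega>_def norm_divide r_def field_simps)
    have "norm (P \<zeta>) - 1 \<le> norm (P \<zeta> - 1)" using norm_triangle_ineq2[of "P \<zeta>" 1] by simp
    also have "\<dots> \<le> r * (norm (P \<zeta>) + 1)"
      using 1 norm_triangle_ineq[of "P \<zeta>" 1] r(1) by (smt (verit) mult_left_mono norm_one)
    finally have nP: "norm (P \<zeta>) \<le> C" using r by (simp add: C_def field_simps)
    have RP: "c \<le> Re (P \<zeta>)"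
    proof -
      have "(norm (P \<zeta> - 1))\<^sup>2 \<le> (r * norm (P \<zeta> + 1))\<^sup>2" using 1 by (intro power_mono) auto
      then have "(Re (P \<zeta>) - 1)\<^sup>2 + (Im (P \<zeta>))\<^sup>2 \<le> r\<^sup>2 * ((Re (P \<zeta>) + 1)\<^sup>2 + (Im (P \<zeta>))\<^sup>2)"
        by (simp add: cmod_power2 power_mult_distrib)
      moreover have "r\<^sup>2 * (Im (P \<zeta>))\<^sup>2 \<le> 1 * (Im (P \<zeta>))\<^sup>2"
        using r by (intro mult_right_mono) (auto simp: power_le_one)
      ultimately have "(1 - Re (P \<zeta>))\<^sup>2 \<le> r\<^sup>2 * (Re (P \<zeta>) + 1)\<^sup>2"
        by (simp add: distrib_left power2_commute[of 1])
      then have "(1 - Re (P \<zeta>))\<^sup>2 \<le> (r * (Re (P \<zeta>) + 1))\<^sup>2"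
        by (simp only: power_mult_distrib)
      then have "1 - Re (P \<zeta>) \<le> r * (Re (P \<zeta>) + 1)"
        by (rule power2_le_imp_le) (use r ReP[OF \<zeta>] in auto)
      then show ?thesis using r by (simp add: c_def field_simps)
    qed
    show "(1 + \<delta>) * c - \<delta> \<le> Re (p \<zeta>)"
      using RP that unfolding pP by (simp del: of_real_add add: mult_left_mono)
    have "norm (p \<zeta>) \<le> norm (of_real (1 + \<delta>) * P \<zeta>) + norm (of_real \<delta> :: complex)"
      unfolding pP by (rule norm_triangle_ineq4)
    also have "\<dots> = (1 + \<delta>) * norm (P \<zeta>) + \<delta>" using that by (simp add: norm_mult del: of_real_add)
    also have "\<dots> \<le> (1 + \<delta>) * C + \<delta>" using nP that by simp
    finally show "norm (p \<zeta>) \<le> (1 + \<delta>) * C + \<delta>" .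
  qed
  have "c \<le> Re (p \<zeta>)"
  proof (rule field_le_epsilon)
    fix e :: real assume "e > 0"
    moreover have "e * c \<ge> 0" using \<open>e > 0\<close> r by (simp add: c_def)
    ultimately show "c \<le> Re (p \<zeta>) + e" using *(1)[of e] by (simp add: algebra_simps)
  qed
  then show "(1 - norm \<zeta>) / (1 + norm \<zeta>) \<le> Re (p \<zeta>)" by (simp add: c_def r_def)
  have "norm (p \<zeta>) \<le> C"
  proof (rule field_le_epsilon)
    fix e :: real assume "e > 0"
    have "norm (p \<zeta>) \<le> (1 + e / (C + 1)) * C + e / (C + 1)" using *(2)[of "e / (C + 1)"] \<open>e > 0\<close> C by simp
    also have "\<dots> = C + e / (C + 1) * (C + 1)" by (simp add: algebra_simps add_divide_distrib)
    finally show "norm (p \<zeta>) \<le> C + e" using C by simp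
  qed
  then show "norm (p \<zeta>) \<le> (1 + norm \<zeta>) / (1 - norm \<zeta>)" by (simp add: C_def r_def)
qed

lemma Hol_holomorphic: "f \<in> Hol \<Longrightarrow> holomorphic_map_on f (ball 0 1)"
  by (simp add: Hol_def)

lemma class_M_holomorphic: "h \<in> class_M \<Longrightarrow> holomorphic_map_on h (ball 0 1)"
  by (simp add: class_M_def Hol_def)

lemma hinner_slice_holomorphic_on:
  assumes "holomorphic_map_on f S" "\<And>\<zeta>. \<zeta> \<in> T \<Longrightarrow> z + \<zeta> *s v \<in> S"
  shows "(\<lambda>\<zeta>. hinner (f (z + \<zeta> *s v)) u) holomorphic_on T"
  unfolding hinner_def by (intro holomorphic_intros slice_holomorphic_on[OF assms])

text \<open>On the complex line spanned by the unit vector \<open>u\<close>, the inner product of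
  \<open>h (\<zeta> u)\<close> with \<open>\<zeta> u\<close> is minus the square of
  \<open>norm \<zeta>\<close> times a holomorphic function \<open>p\<close> with
  \<open>p 0 = 1\<close> and nonnegative real part. Caratheodory's inequalities for \<open>p\<close>
  are the claim.\<close>

lemma class_M_hinner_bounds:
  fixes h :: "complex^'n \<Rightarrow> complex^'n"
  assumes h: "h \<in> class_M" and z: "norm z < 1"
  shows "Re (hinner (h z) z) \<le> - ((1 - norm z) / (1 + norm z) * (norm z)\<^sup>2)"
    and "norm (hinner (h z) z) \<le> (1 + norm z) / (1 - norm z) * (norm z)\<^sup>2"
proof -
  have "Re (hinner (h z) z) \<le> - ((1 - norm z) / (1 + norm z) * (norm z)\<^sup>2) \<and>
    norm (hinner (h z) z) \<le> (1 + norm z) / (1 - norm z) * (norm z)\<^sup>2"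
  proof (cases "z = 0")
    case True
    then show ?thesis by (simp add: hinner_def)
  next
    case False
    define u where "u = (1 / norm z) *\<^sub>R z"
    have u: "norm u = 1" using False by (simp add: u_def)
    have zu: "z = complex_of_real (norm z) *s u"
      using False by (simp add: u_def scaleR_eq_vector_scalar_mult[symmetric])
    have in_ball: "0 + \<zeta> *s u \<in> ball 0 1" if "norm \<zeta> < 1" for \<zeta>
      using that u by (simp add: norm_vector_scalar_mult)
    define q where "q \<zeta> = hinner (h (0 + \<zeta> *s u)) u" for \<zeta>
    have hol: "q holomorphic_on ball 0 1"
      unfolding q_def[abs_def]
      by (rule hinner_slice_holomorphic_on[OF class_M_holomorphic[OF h]]) (use in_ball in auto)
    have q0: "q 0 = 0" using h by (simp add: q_def class_M_def hinner_def)
    have dh: "(h has_derivative (\<lambda>v. - v)) (at (0 + 0 *s u))" using h by (simp add: class_M_def)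
    have "((\<lambda>\<zeta>. h (0 + \<zeta> *s u) $ i) has_field_derivative (- u) $ i) (at 0)" for i
      by (rule slice_has_field_derivative[OF dh]) (simp add: vec_eq_iff)
    then have "(q has_field_derivative (\<Sum>i\<in>UNIV. (- u) $ i * cnj (u $ i))) (at 0)"
      unfolding q_def[abs_def] hinner_def by (intro DERIV_sum DERIV_cmult_right)
    moreover have "(\<Sum>i\<in>UNIV. (- u) $ i * cnj (u $ i)) = - hinner u u"
      by (simp add: hinner_def sum_negf)
    ultimately have dq: "deriv q 0 = -1" using u by (simp add: hinner_self DERIV_imp_deriv)
    \<comment> \<open>The quotient \<open>- q \<zeta> / \<zeta>\<close> with its removable
      singularity filled in; the normalization of \<open>h\<close> at 0 makes the value there equal
      to 1.\<close>
    define p where "p \<zeta> = - (if \<zeta> = 0 then deriv q 0 else (q \<zeta> - q 0) / (\<zeta> - 0))" for \<zeta>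
    have holp: "p holomorphic_on ball 0 1"
      unfolding p_def[abs_def] by (intro holomorphic_on_minus pole_lemma[OF hol]) (simp add: interior_open)
    have qp: "hinner (h (\<zeta> *s u)) (\<zeta> *s u) = - (complex_of_real ((norm \<zeta>)\<^sup>2) * p \<zeta>)" for \<zeta>
    proof (cases "\<zeta> = 0")
      case False
      have "complex_of_real ((norm \<zeta>)\<^sup>2) = \<zeta> * cnj \<zeta>" by (rule complex_norm_square)
      then show ?thesis using False q0 by (simp add: p_def q_def hinner_scale_right)
    qed (simp add: hinner_def)
    have Rep: "Re (p \<zeta>) \<ge> 0" if "norm \<zeta> < 1" for \<zeta>
    proof (cases "\<zeta> = 0")
      case False
      have "Re (hinner (h (\<zeta> *s u)) (\<zeta> *s u)) \<le> 0"
        using h in_ball[OF that] by (simp add: class_M_def)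
      then have "(norm \<zeta>)\<^sup>2 * Re (p \<zeta>) \<ge> 0" unfolding qp by simp
      then show ?thesis using False by (simp add: zero_le_mult_iff)
    qed (simp add: p_def dq)
    have "norm (complex_of_real (norm z)) < 1" using z by simp
    note cb = caratheodory_bounds[OF holp _ Rep this]
    have p0: "p 0 = 1" by (simp add: p_def dq)
    have eq: "hinner (h z) z = - (complex_of_real ((norm z)\<^sup>2) * p (complex_of_real (norm z)))"
      by (subst (1 2) zu, subst qp) simp
    have "(norm z)\<^sup>2 * ((1 - norm z) / (1 + norm z)) \<le> (norm z)\<^sup>2 * Re (p (complex_of_real (norm z)))"
      "(norm z)\<^sup>2 * norm (p (complex_of_real (norm z))) \<le> (norm z)\<^sup>2 * ((1 + norm z) / (1 - norm z))"
      using cb[OF p0] by (intro mult_left_mono; simp)+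
    then show ?thesis unfolding eq by (simp add: norm_mult mult.commute norm_power)
  qed
  then show "Re (hinner (h z) z) \<le> - ((1 - norm z) / (1 + norm z) * (norm z)\<^sup>2)"
    "norm (hinner (h z) z) \<le> (1 + norm z) / (1 - norm z) * (norm z)\<^sup>2" by auto
qed

text \<open>On \<open>\<bar>\<lambda>\<bar> = 1\<close> the numerical range of \<open>h\<close> at \<open>z + \<lambda> w\<close> is, up to the factor \<open>\<lambda>\<close>, the boundary
  value of a holomorphic function of \<open>\<lambda>\<close> whose value at the origin is the inner product of
  \<open>h z\<close> and \<open>w\<close>.\<close>

lemma class_M_norm_bound:
  fixes h :: "complex^'n \<Rightarrow> complex^'n"
  assumes h: "h \<in> class_M" and z: "norm z < 1"
  shows "norm (h z) \<le> 8 / (1 - norm z)\<^sup>2"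
proof (cases "h z = 0")
  case False
  define r where "r = norm z"
  have r: "0 \<le> r" "r < 1" using z by (auto simp: r_def)
  \<comment> \<open>A multiple of \<open>h z\<close>, so that its inner product with
    \<open>h z\<close> recovers the norm of \<open>h z\<close>. Its length
    \<open>(1 - r) / 2\<close> keeps \<open>z + \<zeta> w\<close> in the unit ball for
    \<open>norm \<zeta> < 2\<close> and at norm at most \<open>(1 + r) / 2\<close> on the unit
    circle.\<close>
  define w where "w = ((1 - r) / 2 / norm (h z)) *\<^sub>R h z"
  have w: "norm w = (1 - r) / 2" using False r by (simp add: w_def)
  define B where "B \<zeta> = \<zeta> * hinner (h (z + \<zeta> *s w)) z + hinner (h (z + \<zeta> *s w)) w" for \<zeta>
  have nzw: "norm (z + \<zeta> *s w) \<le> r + norm \<zeta> * ((1 - r) / 2)" for \<zeta>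
    using norm_triangle_ineq[of z "\<zeta> *s w"] by (simp add: norm_vector_scalar_mult w r_def)
  have "norm (z + \<zeta> *s w) < 1" if "norm \<zeta> < 2" for \<zeta>
  proof -
    have "norm \<zeta> * ((1 - r) / 2) < 2 * ((1 - r) / 2)" using that r by (intro mult_strict_right_mono) auto
    then show ?thesis using nzw[of \<zeta>] by simp
  qed
  then have hol: "B holomorphic_on ball 0 2"
    unfolding B_def
    by (intro holomorphic_intros hinner_slice_holomorphic_on[OF class_M_holomorphic[OF h]]) auto
  have "norm ((deriv ^^ 0) B 0) \<le> fact 0 * (4 / (1 - r)) / 1 ^ 0"
  proof (rule Cauchy_inequality)
    show "B holomorphic_on ball 0 1" using hol by (rule holomorphic_on_subset) auto
    show "continuous_on (cball 0 1) B"
      using hol by (intro holomorphic_on_imp_continuous_on) (auto intro: holomorphic_on_subset)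
    fix \<zeta> :: complex assume "norm (0 - \<zeta>) = 1"
    then have \<zeta>: "norm \<zeta> = 1" by simp
    define x where "x = z + \<zeta> *s w"
    have x: "norm x \<le> (1 + r) / 2" using nzw[of \<zeta>] \<zeta> by (simp add: x_def field_simps)
    then have x1: "norm x < 1" using r by simp
    have cz: "\<zeta> * cnj \<zeta> = 1" using \<zeta> by (simp add: complex_norm_square[symmetric])
    have "\<zeta> * hinner (h x) x = B \<zeta>"
      using cz unfolding B_def x_def[symmetric]
      by (subst (2) x_def) (simp add: hinner_add_right hinner_scale_right distrib_left mult.assoc[symmetric])
    then have "norm (B \<zeta>) = norm (hinner (h x) x)" using \<zeta> by (metis mult_1 norm_mult)
    also have "\<dots> \<le> (1 + norm x) / (1 - norm x) * (norm x)\<^sup>2"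
      by (rule class_M_hinner_bounds(2)[OF h x1])
    also have "\<dots> \<le> 2 / ((1 - r) / 2) * 1"
      using x x1 r by (intro mult_mono frac_le) (auto simp: power_le_one field_simps)
    finally show "norm (B \<zeta>) \<le> 4 / (1 - r)" by simp
  qed simp
  moreover have "B 0 = complex_of_real ((1 - r) / 2 * norm (h z))"
    using False by (simp add: B_def w_def scaleR_eq_vector_scalar_mult hinner_scale_right hinner_self power2_eq_square)
  ultimately have "\<bar>(1 - r) / 2 * norm (h z)\<bar> \<le> 4 / (1 - r)"
    by (simp only: norm_of_real funpow_0 fact_0 power_0 mult_1 div_by_1)
  then have "(1 - r) / 2 * norm (h z) \<le> 4 / (1 - r)" by linarith
  then have "(1 - r) / 2 * norm (h z) * (2 * (1 - r)) \<le> 4 / (1 - r) * (2 * (1 - r))"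
    using r by (intro mult_right_mono) auto
  moreover have "4 / (1 - r) * (2 * (1 - r)) = 8" using r by (simp add: field_simps)
  moreover have "(1 - r) / 2 * norm (h z) * (2 * (1 - r)) = norm (h z) * (1 - r)\<^sup>2"
    by (simp add: power2_eq_square)
  ultimately have "norm (h z) * (1 - r)\<^sup>2 \<le> 8" by linarith
  then show ?thesis using r by (simp add: r_def[symmetric] pos_le_divide_eq)
qed simp

text \<open>Everything follows from the growth bound on a slightly larger ball by Cauchy estimates,
  so one constant serves the whole class. The last estimate concerns \<open>h + id\<close>, which is
  of second order at 0; its factor \<mu> makes the nonlinear part of the flow integrable in
  time.\<close>

lemma class_M_uniform_bounds:
  assumes r: "0 < r" "r < 1"
  obtains C where "C > 0"
    "\<And>h x. h \<in> (class_M :: (complex^'n \<Rightarrow> complex^'n) set) \<Longrightarrow> norm x \<le> r \<Longrightarrow> norm (h x) \<le> C"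
    "\<And>h x y. h \<in> (class_M :: (complex^'n \<Rightarrow> complex^'n) set) \<Longrightarrow> norm x \<le> r \<Longrightarrow> norm y \<le> r \<Longrightarrow>
       norm (h x - h y) \<le> C * norm (x - y)"
    "\<And>h x y \<mu>. h \<in> (class_M :: (complex^'n \<Rightarrow> complex^'n) set) \<Longrightarrow> norm x \<le> \<mu> \<Longrightarrow> norm y \<le> \<mu> \<Longrightarrow> \<mu> \<le> r \<Longrightarrow>
       norm ((h x + x) - (h y + y)) \<le> C * \<mu> * norm (x - y)"
proof -
  define R where "R = (1 + r) / 2"
  have R: "r < R" "R < 1" using r by (auto simp: R_def)
  define M where "M = 8 / (1 - R)\<^sup>2"
  have "M > 0" using R by (simp add: M_def)
  have bd: "norm (h x) \<le> M" if "h \<in> class_M" "x \<in> ball 0 R" for h and x :: "complex^'n"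
  proof -
    have "norm (h x) \<le> 8 / (1 - norm x)\<^sup>2" using that R by (intro class_M_norm_bound) auto
    also have "\<dots> \<le> M" unfolding M_def using that R by (intro divide_left_mono power_mono mult_pos_pos) auto
    finally show ?thesis .
  qed
  have hol: "holomorphic_map_on h (ball 0 R)" if "h \<in> class_M" for h :: "complex^'n \<Rightarrow> complex^'n"
    using class_M_holomorphic[OF that] R by (auto intro: holomorphic_map_on_subset)
  define K1 where "K1 = real CARD('n) * M / (R - r)"
  define K2 where "K2 = real CARD('n) * (4 * real CARD('n) * (M + 1) / (R - r)\<^sup>2)"
  have K: "K1 \<ge> 0" "K2 \<ge> 0" using \<open>M > 0\<close> R by (auto simp: K1_def K2_def)
  show thesis
  proof (rule that[of "M + K1 + K2"])
    show "M + K1 + K2 > 0" using \<open>M > 0\<close> K by simp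
    fix h :: "complex^'n \<Rightarrow> complex^'n" and x :: "complex^'n" assume h: "h \<in> class_M" and x: "norm x \<le> r"
    show "norm (h x) \<le> M + K1 + K2" using bd[OF h, of x] x R K by simp
    show "norm (h x - h y) \<le> (M + K1 + K2) * norm (x - y)" if "norm y \<le> r" for y :: "complex^'n"
    proof -
      have "norm (h x - h y) \<le> K1 * norm (x - y)"
        unfolding K1_def by (rule holomorphic_map_lipschitz[OF hol[OF h] bd[OF h] R(1)]) (use x that in auto)
      also have "\<dots> \<le> (M + K1 + K2) * norm (x - y)" using K \<open>M > 0\<close> by (intro mult_right_mono) auto
      finally show ?thesis .
    qed
  next
    fix h :: "complex^'n \<Rightarrow> complex^'n" and x y :: "complex^'n" and \<mu>
    assume h: "h \<in> class_M" and x: "norm x \<le> \<mu>" and y: "norm y \<le> \<mu>" and \<mu>: "\<mu> \<le> r"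
    have "norm ((h x + x) - (h y + y)) \<le> K2 * \<mu> * norm (x - y)"
      unfolding K2_def
    proof (rule holomorphic_map_second_order_lipschitz[of "\<lambda>x. h x + x", OF _ _ _ r(1) R(1) x y \<mu>])
      show "holomorphic_map_on (\<lambda>x. h x + x) (ball 0 R)"
        using holomorphic_map_on_add[OF hol[OF h] holomorphic_map_on_scale[of 1]] by simp
      show "norm (h x + x) \<le> M + 1" if "x \<in> ball 0 R" for x
        using norm_triangle_ineq[of "h x" x] bd[OF h that] that R by simp
      have "((\<lambda>x. h x + x) has_derivative (\<lambda>v. - v + v)) (at 0)"
        using h by (intro has_derivative_add) (auto simp: class_M_def)
      then show "((\<lambda>x. h x + x) has_derivative (\<lambda>_. 0)) (at 0)" by simp
    qed
    also have "\<dots> \<le> (M + K1 + K2) * \<mu> * norm (x - y)"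
      using K \<open>M > 0\<close> order_trans[OF norm_ge_zero x] by (intro mult_right_mono) auto
    finally show "norm ((h x + x) - (h y + y)) \<le> (M + K1 + K2) * \<mu> * norm (x - y)" .
  qed
qed

subsection \<open>Trajectories of Herglotz fields\<close>

text \<open>The working form of Gronwall's inequality: a suitable weight \<open>k\<close> turns a
  differential inequality for the norm into monotonicity. The bound \<open>V\<close> makes the
  squared norm absolutely continuous.\<close>

lemma abs_continuous_weighted_norm_nonincreasing:
  fixes v :: "real \<Rightarrow> 'a::real_inner" and k :: "real \<Rightarrow> real"
  assumes v: "abs_continuous_on_interval a b v" "\<And>t. t \<in> {a..b} \<Longrightarrow> norm (v t) \<le> V" and "a \<le> b"
    and k: "\<And>t. (k has_real_derivative k' t) (at t)" "continuous_on UNIV k'"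
    and ae: "AE t in lebesgue. t \<in> {a<..<b} \<longrightarrow>
       (\<exists>d. (v has_vector_derivative d) (at t) \<and> k' t * (norm (v t))\<^sup>2 + 2 * k t * (v t \<bullet> d) \<le> 0)"
  shows "k b * (norm (v b))\<^sup>2 \<le> k a * (norm (v a))\<^sup>2"
proof -
  have "V \<ge> 0" using order_trans[OF norm_ge_zero v(2)[of a]] \<open>a \<le> b\<close> by simp
  have "continuous_on {a..b} k" "continuous_on {a..b} k'"
    using k by (auto intro: DERIV_continuous_on has_field_derivative_at_within continuous_on_subset)
  then have "bounded (k ` {a..b})" "bounded (k' ` {a..b})"
    by (auto intro: compact_imp_bounded compact_continuous_image)
  then obtain A A' where A: "A > 0" "A' > 0" "\<And>t. t \<in> {a..b} \<Longrightarrow> \<bar>k t\<bar> \<le> A" "\<And>t. t \<in> {a..b} \<Longrightarrow> \<bar>k' t\<bar> \<le> A'"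
    by (auto simp: bounded_pos)
  have klip: "\<bar>k s - k t\<bar> \<le> A' * \<bar>s - t\<bar>" if "s \<in> {a..b}" "t \<in> {a..b}" for s t
  proof -
    have "norm (k s - k t) \<le> A' * norm (s - t)"
      by (rule field_differentiable_bound[of "{a..b}" k k']) (use that A(4) has_field_derivative_at_within[OF k(1)] in auto)
    then show ?thesis by simp
  qed
  show ?thesis
  proof (rule abs_continuous_nonincreasing[where f = "\<lambda>t. k t * (norm (v t))\<^sup>2" and a = a and b = b])
    show "abs_continuous_on_interval a b (\<lambda>t. k t * (norm (v t))\<^sup>2)"
    proof (rule abs_continuous_on_interval_dominated[OF v(1), where C = "A * (2 * V)" and D = "A' * V\<^sup>2"])
      fix s t assume st: "s \<in> {a..b}" "t \<in> {a..b}"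
      have "norm (k s * (norm (v s))\<^sup>2 - k t * (norm (v t))\<^sup>2) =
          \<bar>k s * ((norm (v s))\<^sup>2 - (norm (v t))\<^sup>2) + (k s - k t) * (norm (v t))\<^sup>2\<bar>"
        by (simp add: algebra_simps)
      also have "\<dots> \<le> \<bar>k s\<bar> * \<bar>(norm (v s))\<^sup>2 - (norm (v t))\<^sup>2\<bar> + \<bar>k s - k t\<bar> * (norm (v t))\<^sup>2"
        by (rule order_trans[OF abs_triangle_ineq]) (simp add: abs_mult)
      also have "\<bar>(norm (v s))\<^sup>2 - (norm (v t))\<^sup>2\<bar> = \<bar>norm (v s) - norm (v t)\<bar> * (norm (v s) + norm (v t))"
        by (simp add: power2_eq_square square_diff_square_factored abs_mult)
      also have "\<bar>k s\<bar> * (\<bar>norm (v s) - norm (v t)\<bar> * (norm (v s) + norm (v t))) + \<bar>k s - k t\<bar> * (norm (v t))\<^sup>2 \<le>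
          A * (norm (v s - v t) * (V + V)) + (A' * \<bar>s - t\<bar>) * V\<^sup>2"
        using A(1,2,3) v(2) st klip[OF st] norm_triangle_ineq3[of "v s" "v t"] \<open>V \<ge> 0\<close>
        by (intro add_mono mult_mono power_mono mult_nonneg_nonneg) auto
      finally show "norm (k s * (norm (v s))\<^sup>2 - k t * (norm (v t))\<^sup>2) \<le>
          A * (2 * V) * norm (v s - v t) + A' * V\<^sup>2 * \<bar>s - t\<bar>"
        by (simp add: algebra_simps)
    qed (use A \<open>V \<ge> 0\<close> in auto)
    show "AE t in lebesgue. t \<in> {a<..<b} \<longrightarrow>
       (\<exists>D\<le>0. ((\<lambda>t. k t * (norm (v t))\<^sup>2) has_real_derivative D) (at t))"
      using ae
    proof (eventually_elim, intro impI)
      fix t assume "t \<in> {a<..<b} \<longrightarrow>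
         (\<exists>d. (v has_vector_derivative d) (at t) \<and> k' t * (norm (v t))\<^sup>2 + 2 * k t * (v t \<bullet> d) \<le> 0)"
        and "t \<in> {a<..<b}"
      then obtain d where d: "(v has_vector_derivative d) (at t)" "k' t * (norm (v t))\<^sup>2 + 2 * k t * (v t \<bullet> d) \<le> 0"
        by blast
      have "((\<lambda>t. v t \<bullet> v t) has_derivative (\<lambda>h. v t \<bullet> (h *\<^sub>R d) + (h *\<^sub>R d) \<bullet> v t)) (at t)"
        using d(1) unfolding has_vector_derivative_def by (intro has_derivative_inner)
      then have "((\<lambda>t. (norm (v t))\<^sup>2) has_real_derivative 2 * (v t \<bullet> d)) (at t)"
        unfolding has_field_derivative_def power2_norm_eq_inner
        by (rule has_derivative_eq_rhs) (simp add: fun_eq_iff inner_commute)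
      from DERIV_mult[OF k(1)[of t] this]
      have "((\<lambda>t. k t * (norm (v t))\<^sup>2) has_real_derivative k' t * (norm (v t))\<^sup>2 + 2 * k t * (v t \<bullet> d)) (at t)"
        by (simp add: algebra_simps)
      then show "\<exists>D\<le>0. ((\<lambda>t. k t * (norm (v t))\<^sup>2) has_real_derivative D) (at t)"
        using d(2) by blast
    qed
  qed (fact \<open>a \<le> b\<close>)
qed

text \<open>The relative deviation of \<open>v\<close> from the solution of \<open>v' = - v\<close>
  has a rate with total integral at most \<open>B / c\<close>. Hence
  \<open>exp (t - s) * norm (v t)\<close> changes by at most the factor \<open>exp (B / c)\<close>,
  in either direction.\<close>

lemma abs_continuous_exponential_comparison:
  fixes v :: "real \<Rightarrow> 'a::real_inner"
  assumes v: "abs_continuous_on_interval s b v" "\<And>t. t \<in> {s..b} \<Longrightarrow> norm (v t) \<le> V" and "s \<le> b" "c > 0" "B \<ge> 0"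
    and ae: "AE t in lebesgue. t \<in> {s<..<b} \<longrightarrow>
       (\<exists>d. (v has_vector_derivative d) (at t) \<and> norm (d + v t) \<le> B * exp (- c * (t - s)) * norm (v t))"
  shows "exp (b - s) * norm (v b) \<le> exp (B / c) * norm (v s)"
    and "norm (v s) \<le> exp (B / c) * (exp (b - s) * norm (v b))"
proof -
  define \<beta> where "\<beta> t = B * exp (- c * (t - s))" for t
  have dot: "\<bar>v t \<bullet> d + (norm (v t))\<^sup>2\<bar> \<le> \<beta> t * (norm (v t))\<^sup>2" if "norm (d + v t) \<le> \<beta> t * norm (v t)" for t d
  proof -
    have "\<bar>v t \<bullet> (d + v t)\<bar> \<le> norm (v t) * norm (d + v t)" by (rule Cauchy_Schwarz_ineq2)
    also have "\<dots> \<le> norm (v t) * (\<beta> t * norm (v t))" using that by (intro mult_left_mono) auto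
    finally show ?thesis by (simp add: inner_add_right dot_square_norm power2_eq_square mult_ac)
  qed
  \<comment> \<open>The weights are \<open>exp (2 * (t - s))\<close> times the exponential of an
    antiderivative of \<open>- 2 * \<beta>\<close> for \<open>k1\<close> and of
    \<open>2 * \<beta>\<close> for \<open>k2\<close>. The second one is used with a minus sign to
    bound the norm from below.\<close>
  define k1 where "k1 t = exp (2 * (t - s) + 2 * B / c * exp (- c * (t - s)))" for t
  define k2 where "k2 t = exp (2 * (t - s) - 2 * B / c * exp (- c * (t - s)))" for t
  have d1: "(k1 has_real_derivative k1 t * (2 - 2 * \<beta> t)) (at t)" for t
    unfolding k1_def[abs_def] \<beta>_def using \<open>c > 0\<close> by (auto intro!: derivative_eq_intros simp: algebra_simps)
  have d2: "(k2 has_real_derivative k2 t * (2 + 2 * \<beta> t)) (at t)" for t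
    unfolding k2_def[abs_def] \<beta>_def using \<open>c > 0\<close> by (auto intro!: derivative_eq_intros simp: algebra_simps)
  have d2': "((\<lambda>t. - k2 t) has_real_derivative - k2 t * (2 + 2 * \<beta> t)) (at t)" for t
    using DERIV_minus[OF d2[of t]] by simp
  have pos: "k1 t > 0" "k2 t > 0" for t by (auto simp: k1_def k2_def)
  have c1: "continuous_on UNIV (\<lambda>t. k1 t * (2 - 2 * \<beta> t))"
    unfolding k1_def \<beta>_def by (intro continuous_intros)
  have c2: "continuous_on UNIV (\<lambda>t. - k2 t * (2 + 2 * \<beta> t))"
    unfolding k2_def \<beta>_def by (intro continuous_intros)
  have "k1 b * (norm (v b))\<^sup>2 \<le> k1 s * (norm (v s))\<^sup>2"
  proof (rule abs_continuous_weighted_norm_nonincreasing[OF v \<open>s \<le> b\<close> d1 c1])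
    show "AE t in lebesgue. t \<in> {s<..<b} \<longrightarrow> (\<exists>d. (v has_vector_derivative d) (at t) \<and>
        k1 t * (2 - 2 * \<beta> t) * (norm (v t))\<^sup>2 + 2 * k1 t * (v t \<bullet> d) \<le> 0)"
      using ae
    proof (eventually_elim, intro impI)
      fix t assume "t \<in> {s<..<b} \<longrightarrow>
         (\<exists>d. (v has_vector_derivative d) (at t) \<and> norm (d + v t) \<le> B * exp (- c * (t - s)) * norm (v t))" "t \<in> {s<..<b}"
      then obtain d where d: "(v has_vector_derivative d) (at t)" "norm (d + v t) \<le> \<beta> t * norm (v t)"
        unfolding \<beta>_def by blast
      have "(1 - \<beta> t) * (norm (v t))\<^sup>2 + v t \<bullet> d \<le> 0" using dot[OF d(2)] by (simp add: algebra_simps)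
      then have "2 * k1 t * ((1 - \<beta> t) * (norm (v t))\<^sup>2 + v t \<bullet> d) \<le> 0"
        using pos(1)[of t] by (simp add: mult_le_0_iff)
      then show "\<exists>d. (v has_vector_derivative d) (at t) \<and>
          k1 t * (2 - 2 * \<beta> t) * (norm (v t))\<^sup>2 + 2 * k1 t * (v t \<bullet> d) \<le> 0"
        using d(1) by (intro exI[of _ d]) (simp add: algebra_simps)
    qed
  qed
  moreover have "exp (b - s) ^ 2 \<le> k1 b"
    unfolding k1_def using \<open>B \<ge> 0\<close> \<open>c > 0\<close> by (simp add: exp_double[symmetric])
  then have "exp (b - s) ^ 2 * (norm (v b))\<^sup>2 \<le> k1 b * (norm (v b))\<^sup>2" by (intro mult_right_mono) auto
  moreover have "k1 s = exp (B / c) ^ 2" by (simp add: k1_def exp_double[symmetric])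
  ultimately have "(exp (b - s) * norm (v b))\<^sup>2 \<le> (exp (B / c) * norm (v s))\<^sup>2"
    by (simp add: power_mult_distrib)
  then show "exp (b - s) * norm (v b) \<le> exp (B / c) * norm (v s)"
    by (rule power2_le_imp_le) simp
  have "- k2 b * (norm (v b))\<^sup>2 \<le> - k2 s * (norm (v s))\<^sup>2"
  proof (rule abs_continuous_weighted_norm_nonincreasing[OF v \<open>s \<le> b\<close> d2' c2])
    show "AE t in lebesgue. t \<in> {s<..<b} \<longrightarrow> (\<exists>d. (v has_vector_derivative d) (at t) \<and>
        - k2 t * (2 + 2 * \<beta> t) * (norm (v t))\<^sup>2 + 2 * - k2 t * (v t \<bullet> d) \<le> 0)"
      using ae
    proof (eventually_elim, intro impI)
      fix t assume "t \<in> {s<..<b} \<longrightarrow>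
         (\<exists>d. (v has_vector_derivative d) (at t) \<and> norm (d + v t) \<le> B * exp (- c * (t - s)) * norm (v t))" "t \<in> {s<..<b}"
      then obtain d where d: "(v has_vector_derivative d) (at t)" "norm (d + v t) \<le> \<beta> t * norm (v t)"
        unfolding \<beta>_def by blast
      have "(1 + \<beta> t) * (norm (v t))\<^sup>2 + v t \<bullet> d \<ge> 0" using dot[OF d(2)] by (simp add: algebra_simps)
      then have "2 * k2 t * ((1 + \<beta> t) * (norm (v t))\<^sup>2 + v t \<bullet> d) \<ge> 0"
        using pos(2)[of t] by (intro mult_nonneg_nonneg) auto
      then show "\<exists>d. (v has_vector_derivative d) (at t) \<and>
          - k2 t * (2 + 2 * \<beta> t) * (norm (v t))\<^sup>2 + 2 * - k2 t * (v t \<bullet> d) \<le> 0"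
        using d(1) by (intro exI[of _ d]) (simp add: algebra_simps)
    qed
  qed
  moreover have "k2 b \<le> exp (b - s) ^ 2"
    unfolding k2_def using \<open>B \<ge> 0\<close> \<open>c > 0\<close> by (simp add: exp_double[symmetric])
  then have "k2 b * (norm (v b))\<^sup>2 \<le> exp (b - s) ^ 2 * (norm (v b))\<^sup>2" by (intro mult_right_mono) auto
  moreover have "k2 s * exp (B / c) ^ 2 = 1" by (simp add: k2_def exp_double[symmetric] exp_add[symmetric])
  then have "(norm (v s))\<^sup>2 = exp (B / c) ^ 2 * (k2 s * (norm (v s))\<^sup>2)" by (simp add: mult.assoc[symmetric] mult.commute)
  moreover have "k2 s * (norm (v s))\<^sup>2 \<le> exp (b - s) ^ 2 * (norm (v b))\<^sup>2" using calculation by simp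
  then have "exp (B / c) ^ 2 * (k2 s * (norm (v s))\<^sup>2) \<le> exp (B / c) ^ 2 * (exp (b - s) ^ 2 * (norm (v b))\<^sup>2)"
    by (intro mult_left_mono) auto
  ultimately have "(norm (v s))\<^sup>2 \<le> exp (B / c) ^ 2 * (exp (b - s) ^ 2 * (norm (v b))\<^sup>2)"
    by linarith
  then have "(norm (v s))\<^sup>2 \<le> (exp (B / c) * (exp (b - s) * norm (v b)))\<^sup>2"
    by (simp add: power_mult_distrib)
  then show "norm (v s) \<le> exp (B / c) * (exp (b - s) * norm (v b))"
    by (rule power2_le_imp_le) simp
qed

text \<open>A Herglotz field modified on a null set of times, and extended to negative times, so that no
  exceptional times remain.\<close>

definition total_Herglotz_field :: "(complex^'n \<Rightarrow> real \<Rightarrow> complex^'n) \<Rightarrow> bool" where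
  "total_Herglotz_field G \<longleftrightarrow>
     (\<forall>z. G z \<in> borel_measurable lebesgue) \<and> (\<forall>t. (\<lambda>z. G z t) \<in> class_M)"

definition is_trajectory :: "(complex^'n \<Rightarrow> real \<Rightarrow> complex^'n) \<Rightarrow> real \<Rightarrow> (real \<Rightarrow> complex^'n) \<Rightarrow> bool" where
  "is_trajectory G s x \<longleftrightarrow>
     (\<forall>t\<ge>s. x t \<in> ball 0 1) \<and> (\<forall>T\<ge>s. abs_continuous_on_interval s T x) \<and>
     (AE t in lebesgue. t > s \<longrightarrow> (x has_vector_derivative G (x t) t) (at t))"

section \<open>Decay, comparison and uniqueness of trajectories\<close>

lemma is_trajectory_restart:
  assumes "is_trajectory G s x" "s \<le> a"
  shows "is_trajectory G a x"
  unfolding is_trajectory_def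
proof (intro conjI allI impI)
  show "x t \<in> ball 0 1" if "t \<ge> a" for t
    using assms that unfolding is_trajectory_def by auto
  show "abs_continuous_on_interval a T x" if "T \<ge> a" for T
    using assms that unfolding is_trajectory_def
    by (auto intro: abs_continuous_on_interval_subset[of s T])
  have "AE t in lebesgue. t > s \<longrightarrow> (x has_vector_derivative G (x t) t) (at t)"
    using assms unfolding is_trajectory_def by blast
  then show "AE t in lebesgue. t > a \<longrightarrow> (x has_vector_derivative G (x t) t) (at t)"
    by eventually_elim (use assms(2) in auto)
qed

lemma class_M_inner_le_0: "h \<in> class_M \<Longrightarrow> norm z < 1 \<Longrightarrow> z \<bullet> h z \<le> 0"
  by (auto simp: class_M_def Re_hinner inner_commute)

lemma trajectory_norm_nonincreasing:
  assumes G: "total_Herglotz_field G" and x: "is_trajectory G s x" and "s \<le> a" "a \<le> b"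
  shows "norm (x b) \<le> norm (x a)"
proof -
  have x': "is_trajectory G a x" using is_trajectory_restart[OF x \<open>s \<le> a\<close>] .
  have "1 * (norm (x b))\<^sup>2 \<le> 1 * (norm (x a))\<^sup>2"
  proof (rule abs_continuous_weighted_norm_nonincreasing[where V = 1 and k' = "\<lambda>_. 0"])
    show "abs_continuous_on_interval a b x" "\<And>t. t \<in> {a..b} \<Longrightarrow> norm (x t) \<le> 1"
      using x' \<open>a \<le> b\<close> unfolding is_trajectory_def by (auto simp: less_imp_le)
    have "AE t in lebesgue. t > a \<longrightarrow> (x has_vector_derivative G (x t) t) (at t)"
      using x' unfolding is_trajectory_def by blast
    then show "AE t in lebesgue. t \<in> {a<..<b} \<longrightarrow>
       (\<exists>d. (x has_vector_derivative d) (at t) \<and> 0 * (norm (x t))\<^sup>2 + 2 * 1 * (x t \<bullet> d) \<le> 0)"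
    proof (eventually_elim, intro impI)
      fix t assume t: "a < t \<longrightarrow> (x has_vector_derivative G (x t) t) (at t)" "t \<in> {a<..<b}"
      have "x t \<bullet> G (x t) t \<le> 0"
        using class_M_inner_le_0[of "\<lambda>z. G z t" "x t"] G x' t unfolding is_trajectory_def total_Herglotz_field_def by auto
      then show "\<exists>d. (x has_vector_derivative d) (at t) \<and> 0 * (norm (x t))\<^sup>2 + 2 * 1 * (x t \<bullet> d) \<le> 0"
        using t by (intro exI[of _ "G (x t) t"]) auto
    qed
  qed (use \<open>a \<le> b\<close> in auto)
  then show ?thesis by (simp add: power2_le_iff_abs_le)
qed

text \<open>The rate \<open>(1 - \<rho>) / (1 + \<rho>)\<close> at norm \<rho> decreases in \<rho>,
  and the norm never exceeds \<open>r\<close> again; so the rate belonging to \<open>r\<close> is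
  available at all times.\<close>

lemma trajectory_decay:
  assumes G: "total_Herglotz_field G" and x: "is_trajectory G s x" and xr: "norm (x s) \<le> r"
    and r: "0 < r" "r < 1" and "s \<le> t"
  shows "norm (x t) \<le> r * exp (- ((1 - r) / (1 + r)) * (t - s))"
proof -
  define c where "c = (1 - r) / (1 + r)"
  have xle: "norm (x u) \<le> r" if "s \<le> u" for u
    using trajectory_norm_nonincreasing[OF G x _ that] xr by simp
  have "exp (2 * c * (t - s)) * (norm (x t))\<^sup>2 \<le> exp (2 * c * (s - s)) * (norm (x s))\<^sup>2"
  proof (rule abs_continuous_weighted_norm_nonincreasing[where V = r and k' = "\<lambda>t. exp (2 * c * (t - s)) * (2 * c)"])
    show "abs_continuous_on_interval s t x" using x \<open>s \<le> t\<close> unfolding is_trajectory_def by auto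
    show "((\<lambda>t. exp (2 * c * (t - s))) has_real_derivative exp (2 * c * (t - s)) * (2 * c)) (at t)" for t
      by (auto intro!: derivative_eq_intros)
    show "continuous_on UNIV (\<lambda>t. exp (2 * c * (t - s)) * (2 * c))" by (intro continuous_intros)
    have "AE t in lebesgue. t > s \<longrightarrow> (x has_vector_derivative G (x t) t) (at t)"
      using x unfolding is_trajectory_def by blast
    then show "AE u in lebesgue. u \<in> {s<..<t} \<longrightarrow> (\<exists>d. (x has_vector_derivative d) (at u) \<and>
        exp (2 * c * (u - s)) * (2 * c) * (norm (x u))\<^sup>2 + 2 * exp (2 * c * (u - s)) * (x u \<bullet> d) \<le> 0)"
    proof (eventually_elim, intro impI)
      fix u assume u: "s < u \<longrightarrow> (x has_vector_derivative G (x u) u) (at u)" "u \<in> {s<..<t}"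
      have n: "norm (x u) \<le> r" using xle u by auto
      have "x u \<bullet> G (x u) u \<le> - ((1 - norm (x u)) / (1 + norm (x u)) * (norm (x u))\<^sup>2)"
        using class_M_hinner_bounds(1)[of "\<lambda>z. G z u" "x u"] G n r
        by (simp add: total_Herglotz_field_def Re_hinner inner_commute)
      moreover have "c * (norm (x u))\<^sup>2 \<le> (1 - norm (x u)) / (1 + norm (x u)) * (norm (x u))\<^sup>2"
        unfolding c_def using n r by (intro mult_right_mono frac_le) (auto simp: add_pos_nonneg)
      ultimately have "c * (norm (x u))\<^sup>2 + x u \<bullet> G (x u) u \<le> 0" by linarith
      then have "2 * exp (2 * c * (u - s)) * (c * (norm (x u))\<^sup>2 + x u \<bullet> G (x u) u) \<le> 0"
        by (simp add: mult_le_0_iff)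
      then show "\<exists>d. (x has_vector_derivative d) (at u) \<and>
        exp (2 * c * (u - s)) * (2 * c) * (norm (x u))\<^sup>2 + 2 * exp (2 * c * (u - s)) * (x u \<bullet> d) \<le> 0"
        using u by (intro exI[of _ "G (x u) u"]) (auto simp: algebra_simps)
    qed
  qed (use xle \<open>s \<le> t\<close> in auto)
  also have "\<dots> \<le> r\<^sup>2" using xr by (simp add: power_mono)
  also have "exp (2 * c * (t - s)) = (exp (c * (t - s)))\<^sup>2"
    by (simp add: exp_double[symmetric] mult.assoc)
  finally have "(exp (c * (t - s)) * norm (x t))\<^sup>2 \<le> r\<^sup>2" by (simp add: power_mult_distrib)
  then have "exp (c * (t - s)) * norm (x t) \<le> r" by (rule power2_le_imp_le) (use r in simp)
  then have "norm (x t) \<le> r / exp (c * (t - s))" by (simp add: pos_le_divide_eq mult.commute)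
  then show ?thesis unfolding c_def[symmetric] by (simp add: exp_minus divide_inverse)
qed


lemma is_trajectory_zero:
  assumes "total_Herglotz_field G"
  shows "is_trajectory G s (\<lambda>_. 0)"
  unfolding is_trajectory_def
proof (intro conjI allI impI)
  show "abs_continuous_on_interval s T (\<lambda>_. 0 :: complex^'n)" for T
    by (rule abs_continuous_on_interval_lipschitz[of 0]) (simp add: lipschitz_on_def)
  have "G 0 t = 0" for t using assms by (simp add: total_Herglotz_field_def class_M_def)
  then show "AE t in lebesgue. t > s \<longrightarrow> ((\<lambda>_. 0) has_vector_derivative G 0 t) (at t)" by simp
qed simp

text \<open>Both trajectories decay exponentially, and \<open>G + id\<close> has a Lipschitz
  constant proportional to their size. So the difference satisfies \<open>v' = - v\<close> up to an
  exponentially decaying relative error. The upper bound gives uniqueness and continuity, the lower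
  bound injectivity of the transition maps; \<open>E\<close> depends on \<open>r\<close>
  only.\<close>

lemma trajectory_difference_bounds:
  assumes r: "0 < r" "r < 1"
  obtains E where "E \<ge> 1"
    "\<And>G s x y t. total_Herglotz_field G \<Longrightarrow> is_trajectory G s x \<Longrightarrow> is_trajectory G s y \<Longrightarrow>
       norm (x s :: complex^'n) \<le> r \<Longrightarrow> norm (y s) \<le> r \<Longrightarrow> s \<le> t \<Longrightarrow>
       exp (t - s) * norm (x t - y t) \<le> E * norm (x s - y s) \<and>
       norm (x s - y s) \<le> E * (exp (t - s) * norm (x t - y t))"
proof -
  obtain C where C: "C > 0"
    "\<And>h x y \<mu>. h \<in> (class_M :: (complex^'n \<Rightarrow> complex^'n) set) \<Longrightarrow> norm x \<le> \<mu> \<Longrightarrow> norm y \<le> \<mu> \<Longrightarrow> \<mu> \<le> r \<Longrightarrow>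
       norm ((h x + x) - (h y + y)) \<le> C * \<mu> * norm (x - y)"
    using class_M_uniform_bounds[OF r] by metis
  define c where "c = (1 - r) / (1 + r)"
  have "c > 0" using r by (simp add: c_def)
  show thesis
  proof (rule that[of "exp (C * r / c)"])
    show "exp (C * r / c) \<ge> 1" using C(1) r \<open>c > 0\<close> by simp
    fix G s t and x y :: "real \<Rightarrow> complex^'n"
    assume G: "total_Herglotz_field G" and x: "is_trajectory G s x" and y: "is_trajectory G s y"
      and xr: "norm (x s) \<le> r" and yr: "norm (y s) \<le> r" and "s \<le> t"
    have dec: "norm (x u) \<le> r * exp (- c * (u - s))" "norm (y u) \<le> r * exp (- c * (u - s))" if "s \<le> u" for u
      using trajectory_decay[OF G x xr r that] trajectory_decay[OF G y yr r that] by (simp_all only: c_def)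
    define v where "v u = x u - y u" for u
    have vac: "abs_continuous_on_interval s t v"
    proof -
      have "abs_continuous_on_interval s t x" "abs_continuous_on_interval s t y"
        using x y \<open>s \<le> t\<close> unfolding is_trajectory_def by auto
      then show ?thesis unfolding v_def[abs_def] by (rule abs_continuous_on_interval_diff)
    qed
    have vb: "norm (v u) \<le> 2" if "u \<in> {s..t}" for u
    proof -
      have "norm (x u) < 1" "norm (y u) < 1" using x y that unfolding is_trajectory_def by auto
      then show ?thesis using norm_triangle_ineq4[of "x u" "y u"] by (simp add: v_def)
    qed
    have "AE t in lebesgue. t > s \<longrightarrow> (x has_vector_derivative G (x t) t) (at t)"
      "AE t in lebesgue. t > s \<longrightarrow> (y has_vector_derivative G (y t) t) (at t)"
      using x y unfolding is_trajectory_def by blast+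
    then have ae: "AE u in lebesgue. u \<in> {s<..<t} \<longrightarrow>
       (\<exists>d. (v has_vector_derivative d) (at u) \<and> norm (d + v u) \<le> C * r * exp (- c * (u - s)) * norm (v u))"
    proof (eventually_elim, intro impI)
      fix u assume u: "u > s \<longrightarrow> (x has_vector_derivative G (x u) u) (at u)"
        "u > s \<longrightarrow> (y has_vector_derivative G (y u) u) (at u)" "u \<in> {s<..<t}"
      have "norm ((G (x u) u + x u) - (G (y u) u + y u)) \<le> C * (r * exp (- c * (u - s))) * norm (x u - y u)"
      proof (rule C(2))
        show "(\<lambda>z. G z u) \<in> class_M" using G by (simp add: total_Herglotz_field_def)
        show "norm (x u) \<le> r * exp (- c * (u - s))" "norm (y u) \<le> r * exp (- c * (u - s))"
          using dec u by auto
        show "r * exp (- c * (u - s)) \<le> r" using u r \<open>c > 0\<close> by simp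
      qed
      moreover have "(v has_vector_derivative (G (x u) u - G (y u) u)) (at u)"
        unfolding v_def[abs_def] using u by (intro has_vector_derivative_diff) auto
      ultimately show "\<exists>d. (v has_vector_derivative d) (at u) \<and> norm (d + v u) \<le> C * r * exp (- c * (u - s)) * norm (v u)"
        by (intro exI[of _ "G (x u) u - G (y u) u"]) (simp add: v_def algebra_simps)
    qed
    have "C * r \<ge> 0" using C(1) r by simp
    from abs_continuous_exponential_comparison[OF vac vb \<open>s \<le> t\<close> \<open>c > 0\<close> this ae]
    show "exp (t - s) * norm (x t - y t) \<le> exp (C * r / c) * norm (x s - y s) \<and>
       norm (x s - y s) \<le> exp (C * r / c) * (exp (t - s) * norm (x t - y t))"
      by (simp add: v_def)
  qed
qed

lemma trajectory_unique:
  assumes G: "total_Herglotz_field G" and x: "is_trajectory G s x" and y: "is_trajectory G s y"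
    and eq: "x s = y s" and "s \<le> t"
  shows "x t = y t"
proof -
  define r where "r = (1 + norm (x s)) / 2"
  have n: "norm (x s) < 1" using x unfolding is_trajectory_def by auto
  have r: "0 < r" "r < 1" "norm (x s) \<le> r" using n by (auto simp: r_def intro: add_pos_nonneg)
  obtain E where E: "\<And>G s x y t. total_Herglotz_field G \<Longrightarrow> is_trajectory G s x \<Longrightarrow> is_trajectory G s y \<Longrightarrow>
       norm (x s :: complex^'a) \<le> r \<Longrightarrow> norm (y s) \<le> r \<Longrightarrow> s \<le> t \<Longrightarrow>
       exp (t - s) * norm (x t - y t) \<le> E * norm (x s - y s) \<and>
       norm (x s - y s) \<le> E * (exp (t - s) * norm (x t - y t))"
    using trajectory_difference_bounds[OF r(1,2)] by metis
  have "exp (t - s) * norm (x t - y t) \<le> 0"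
    using E[OF G x y r(3) _ \<open>s \<le> t\<close>] r(3) eq by simp
  then show ?thesis by (simp add: mult_le_0_iff)
qed

lemma trajectory_lipschitz:
  assumes r: "0 < r" "r < 1"
  obtains C where "C > 0"
    "\<And>G s x a b. total_Herglotz_field G \<Longrightarrow> is_trajectory G s x \<Longrightarrow> norm (x s :: complex^'n) \<le> r \<Longrightarrow>
       s \<le> a \<Longrightarrow> a \<le> b \<Longrightarrow> norm (x b - x a) \<le> C * (b - a)"
proof -
  obtain C where C: "C > 0"
    "\<And>h x. h \<in> (class_M :: (complex^'n \<Rightarrow> complex^'n) set) \<Longrightarrow> norm x \<le> r \<Longrightarrow> norm (h x) \<le> C"
    using class_M_uniform_bounds[OF r] by metis
  show thesis
  proof (rule that[OF C(1)])
    fix G s a b and x :: "real \<Rightarrow> complex^'n"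
    assume G: "total_Herglotz_field G" and x: "is_trajectory G s x" and xr: "norm (x s) \<le> r" and "s \<le> a" "a \<le> b"
    have "norm (x b - x a) \<le> C * b - C * a"
    proof (rule abs_continuous_increment_le[where g' = "\<lambda>_. C" and D = C])
      show "abs_continuous_on_interval a b x"
        using is_trajectory_restart[OF x \<open>s \<le> a\<close>] \<open>a \<le> b\<close> unfolding is_trajectory_def by blast
      show "C-lipschitz_on {a..b} ((*) C)"
        using C(1) by (auto simp: lipschitz_on_def dist_real_def abs_mult right_diff_distrib[symmetric])
      have "AE t in lebesgue. t > s \<longrightarrow> (x has_vector_derivative G (x t) t) (at t)"
        using x unfolding is_trajectory_def by blast
      then show "AE t in lebesgue. t \<in> {a<..<b} \<longrightarrow> (\<exists>d. norm d \<le> C \<and> (x has_vector_derivative d) (at t))"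
      proof (eventually_elim, intro impI)
        fix t assume t: "t > s \<longrightarrow> (x has_vector_derivative G (x t) t) (at t)" "t \<in> {a<..<b}"
        have "norm (x t) \<le> r" using trajectory_norm_nonincreasing[OF G x order_refl, of t] xr t \<open>s \<le> a\<close> by auto
        then have "norm (G (x t) t) \<le> C"
          using C(2)[of "\<lambda>z. G z t" "x t"] G by (simp add: total_Herglotz_field_def)
        then show "\<exists>d. norm d \<le> C \<and> (x has_vector_derivative d) (at t)" using t \<open>s \<le> a\<close> by auto
      qed
    qed (use \<open>a \<le> b\<close> in \<open>auto intro!: derivative_eq_intros\<close>)
    then show "norm (x b - x a) \<le> C * (b - a)" by (simp add: right_diff_distrib)
  qed
qed

lemma trajectory_lipschitz_on:
  assumes G: "total_Herglotz_field G" and x: "is_trajectory G s x"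
  obtains C where "C > 0" "\<And>T. C-lipschitz_on {s..T} x"
proof -
  define r where "r = (1 + norm (x s)) / 2"
  have n: "norm (x s) < 1" using x unfolding is_trajectory_def by auto
  have r: "0 < r" "r < 1" "norm (x s) \<le> r" using n by (auto simp: r_def intro: add_pos_nonneg)
  obtain C where C: "C > 0"
    "\<And>G s x a b. total_Herglotz_field G \<Longrightarrow> is_trajectory G s x \<Longrightarrow> norm (x s :: complex^'a) \<le> r \<Longrightarrow>
       s \<le> a \<Longrightarrow> a \<le> b \<Longrightarrow> norm (x b - x a) \<le> C * (b - a)"
    using trajectory_lipschitz[OF r(1,2)] by metis
  have "C-lipschitz_on {s..T} x" for T
    unfolding lipschitz_on_def
  proof (intro conjI ballI)
    fix a b assume ab: "a \<in> {s..T}" "b \<in> {s..T}"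
    show "dist (x a) (x b) \<le> C * dist a b"
      using C(2)[OF G x r(3), of a b] C(2)[OF G x r(3), of b a] ab
      by (cases "a \<le> b") (auto simp: dist_norm norm_minus_commute)
  qed (use C(1) in simp)
  then show thesis using that C(1) by blast
qed

text \<open>Along a trajectory \<open>e\<^sup>t x\<close> has derivative \<open>e\<^sup>t (x + G x)\<close>, which is of second order in \<open>x\<close> and hence
  decays like \<open>e\<^sup>-\<^sup>t\<close>.\<close>

lemma trajectory_normalized_increment:
  assumes r: "0 < r" "r < 1"
  obtains C where "C > 0"
    "\<And>G s x a b. total_Herglotz_field G \<Longrightarrow> is_trajectory G s x \<Longrightarrow> norm (x s :: complex^'n) \<le> r \<Longrightarrow>
       s \<le> a \<Longrightarrow> a \<le> b \<Longrightarrow>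
       norm (exp b *\<^sub>R x b - exp a *\<^sub>R x a) \<le> C * exp (2 * s) * (norm (x s))\<^sup>2 * (exp (- a) - exp (- b))"
proof -
  obtain C where C: "C > 0"
    "\<And>h x y \<mu>. h \<in> (class_M :: (complex^'n \<Rightarrow> complex^'n) set) \<Longrightarrow> norm x \<le> \<mu> \<Longrightarrow> norm y \<le> \<mu> \<Longrightarrow> \<mu> \<le> r \<Longrightarrow>
       norm ((h x + x) - (h y + y)) \<le> C * \<mu> * norm (x - y)"
    using class_M_uniform_bounds[OF r] by metis
  obtain E where E: "E \<ge> 1" "\<And>G s x y t. total_Herglotz_field G \<Longrightarrow> is_trajectory G s x \<Longrightarrow> is_trajectory G s y \<Longrightarrow>
       norm (x s :: complex^'n) \<le> r \<Longrightarrow> norm (y s) \<le> r \<Longrightarrow> s \<le> t \<Longrightarrow>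
       exp (t - s) * norm (x t - y t) \<le> E * norm (x s - y s) \<and>
       norm (x s - y s) \<le> E * (exp (t - s) * norm (x t - y t))"
    using trajectory_difference_bounds[OF r(1,2)] by metis
  show thesis
  proof (rule that[of "C * E\<^sup>2"])
    show "C * E\<^sup>2 > 0" using C(1) E(1) by simp
    fix G s a b and x :: "real \<Rightarrow> complex^'n"
    assume G: "total_Herglotz_field G" and x: "is_trajectory G s x" and xr: "norm (x s) \<le> r" and "s \<le> a" "a \<le> b"
    \<comment> \<open>The derivative of \<open>e\<^sup>t x\<close> at time \<open>t\<close> is at
      most \<open>N e\<^sup>-\<^sup>t\<close>: two factors \<open>e\<^sup>s\<^sup>-\<^sup>t\<close>
      from the quadratic bound against one factor \<open>e\<^sup>t\<close>.\<close>
    define N where "N = C * E\<^sup>2 * exp (2 * s) * (norm (x s))\<^sup>2"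
    have "N \<ge> 0" using C(1) by (simp add: N_def)
    \<comment> \<open>Comparison with the zero trajectory upgrades the decay rate \<open>c\<close>
      of \<open>trajectory_decay\<close> to the full rate 1.\<close>
    have dec: "norm (x u) \<le> E * norm (x s) * exp (s - u)" if "s \<le> u" for u
    proof -
      have "exp (u - s) * norm (x u) \<le> E * norm (x s)"
        using E(2)[OF G x is_trajectory_zero[OF G] xr _ that] r by simp
      then have "exp (s - u) * (exp (u - s) * norm (x u)) \<le> exp (s - u) * (E * norm (x s))"
        by (intro mult_left_mono) auto
      also have "exp (s - u) * (exp (u - s) * norm (x u)) = norm (x u)"
        by (simp add: mult.assoc[symmetric] exp_add[symmetric])
      finally show ?thesis by (simp add: mult_ac)
    qed
    obtain L where L: "L > 0" "\<And>T. L-lipschitz_on {a..T} x"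
      using trajectory_lipschitz_on[OF G is_trajectory_restart[OF x \<open>s \<le> a\<close>]] by blast
    have "norm (exp b *\<^sub>R x b - exp a *\<^sub>R x a) \<le> - N * exp (- b) - (- N * exp (- a))"
    proof (rule abs_continuous_increment_le[where g' = "\<lambda>t. N * exp (- t)" and D = "N * exp (- a)"])
      show "abs_continuous_on_interval a b (\<lambda>t. exp t *\<^sub>R x t)"
      proof (rule abs_continuous_on_interval_dominated[of a b x, where C = "exp b" and D = "exp b"])
        show "abs_continuous_on_interval a b x"
          using is_trajectory_restart[OF x \<open>s \<le> a\<close>] \<open>a \<le> b\<close> unfolding is_trajectory_def by blast
        fix u t assume ut: "u \<in> {a..b}" "t \<in> {a..b}"
        have "exp u *\<^sub>R x u - exp t *\<^sub>R x t = exp u *\<^sub>R (x u - x t) + (exp u - exp t) *\<^sub>R x t"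
          by (simp add: algebra_simps)
        then have "norm (exp u *\<^sub>R x u - exp t *\<^sub>R x t) \<le> exp u * norm (x u - x t) + \<bar>exp u - exp t\<bar> * norm (x t)"
          by (simp add: norm_triangle_le)
        also have "\<dots> \<le> exp b * norm (x u - x t) + (exp b * \<bar>u - t\<bar>) * 1"
        proof (intro add_mono mult_mono)
          have "norm (exp u - exp t) \<le> exp b * norm (u - t)"
            by (rule field_differentiable_bound[of "{a..b}" exp exp]) (use ut in \<open>auto intro: DERIV_exp has_field_derivative_at_within\<close>)
          then show "\<bar>exp u - exp t\<bar> \<le> exp b * \<bar>u - t\<bar>" by simp
          show "norm (x t) \<le> 1" using x ut \<open>s \<le> a\<close> unfolding is_trajectory_def by (auto simp: less_imp_le)
        qed (use ut in auto)
        finally show "norm (exp u *\<^sub>R x u - exp t *\<^sub>R x t) \<le> exp b * norm (x u - x t) + exp b * \<bar>u - t\<bar>" by simp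
      qed auto
      show "(N * exp (- a))-lipschitz_on {a..b} (\<lambda>t. - N * exp (- t))"
        unfolding lipschitz_on_def
      proof (intro conjI ballI)
        fix u t assume ut: "u \<in> {a..b}" "t \<in> {a..b}"
        have "norm (- N * exp (- u) - (- N * exp (- t))) \<le> N * exp (- a) * norm (u - t)"
          by (rule field_differentiable_bound[of "{a..b}" _ "\<lambda>t. N * exp (- t)"])
             (use ut \<open>N \<ge> 0\<close> in \<open>auto intro!: derivative_eq_intros mult_left_mono simp: abs_mult\<close>)
        then show "dist (- N * exp (- u)) (- N * exp (- t)) \<le> N * exp (- a) * dist u t" by (simp add: dist_norm)
      qed (use \<open>N \<ge> 0\<close> in simp)
      show "((\<lambda>t. - N * exp (- t)) has_real_derivative N * exp (- t)) (at t)" for t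
        by (auto intro!: derivative_eq_intros)
      have "AE t in lebesgue. t > s \<longrightarrow> (x has_vector_derivative G (x t) t) (at t)"
        using x unfolding is_trajectory_def by blast
      then show "AE t in lebesgue. t \<in> {a<..<b} \<longrightarrow>
          (\<exists>d. norm d \<le> N * exp (- t) \<and> ((\<lambda>t. exp t *\<^sub>R x t) has_vector_derivative d) (at t))"
      proof (eventually_elim, intro impI)
        fix t assume t: "t > s \<longrightarrow> (x has_vector_derivative G (x t) t) (at t)" "t \<in> {a<..<b}"
        then have "s < t" using \<open>s \<le> a\<close> by auto
        have xt: "norm (x t) \<le> r"
          using trajectory_norm_nonincreasing[OF G x order_refl, of t] xr \<open>s < t\<close> by auto
        have M: "(\<lambda>z. G z t) \<in> class_M" using G by (simp add: total_Herglotz_field_def)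
        have "G 0 t = 0" using M by (simp add: class_M_def)
        then have "norm (G (x t) t + x t) \<le> C * norm (x t) * norm (x t)"
          using C(2)[OF M, of "x t" "norm (x t)" 0] xt by simp
        also have "\<dots> \<le> C * (E * norm (x s) * exp (s - t)) * (E * norm (x s) * exp (s - t))"
          using dec[of t] \<open>s < t\<close> C(1) E(1) by (intro mult_mono mult_nonneg_nonneg) auto
        finally have "exp t * norm (G (x t) t + x t) \<le> exp t * (C * (E * norm (x s) * exp (s - t)) * (E * norm (x s) * exp (s - t)))"
          by (intro mult_left_mono) auto
        also have "\<dots> = C * E\<^sup>2 * (norm (x s))\<^sup>2 * (exp t * (exp (s - t) * exp (s - t)))"
          by (simp add: power2_eq_square mult_ac)
        also have "exp t * (exp (s - t) * exp (s - t)) = exp (2 * s) * exp (- t)"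
          by (simp add: exp_add[symmetric])
        also have "C * E\<^sup>2 * (norm (x s))\<^sup>2 * (exp (2 * s) * exp (- t)) = N * exp (- t)"
          by (simp add: N_def mult_ac)
        finally have b: "norm (exp t *\<^sub>R (G (x t) t + x t)) \<le> N * exp (- t)" by simp
        have "((\<lambda>t. exp t *\<^sub>R x t) has_vector_derivative (exp t *\<^sub>R G (x t) t + exp t *\<^sub>R x t)) (at t)"
          using t \<open>s < t\<close> by (intro has_vector_derivative_scaleR DERIV_exp) auto
        then show "\<exists>d. norm d \<le> N * exp (- t) \<and> ((\<lambda>t. exp t *\<^sub>R x t) has_vector_derivative d) (at t)"
          using b by (intro exI[of _ "exp t *\<^sub>R G (x t) t + exp t *\<^sub>R x t"]) (simp add: scaleR_add_right)
      qed
    qed (use \<open>a \<le> b\<close> in auto)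
    then show "norm (exp b *\<^sub>R x b - exp a *\<^sub>R x a) \<le> C * E\<^sup>2 * exp (2 * s) * (norm (x s))\<^sup>2 * (exp (- a) - exp (- b))"
      by (simp add: N_def algebra_simps)
  qed
qed

subsection \<open>Existence of trajectories\<close>

text \<open>Caratheodory's argument: approximate the curve by step functions.\<close>

lemma borel_measurable_along_curve:
  fixes G :: "'a::metric_space \<Rightarrow> real \<Rightarrow> 'b::euclidean_space"
  assumes G: "\<And>z. G z \<in> borel_measurable lebesgue" and y: "continuous_on UNIV y"
    and cont: "\<And>t. isCont (\<lambda>z. G z t) (y t)"
  shows "(\<lambda>t. G (y t) t) \<in> borel_measurable lebesgue"
proof (rule borel_measurable_LIMSEQ_metric)
  \<comment> \<open>Time rounded down to a grid. Along the rounded curve only countably many values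
    of the first argument occur, so measurability in time for each fixed point suffices.\<close>
  define q where "q k t = real_of_int \<lfloor>real (Suc k) * t\<rfloor> / real (Suc k)" for k t
  show "(\<lambda>t. G (y (q k t)) t) \<in> borel_measurable lebesgue" for k
    unfolding q_def
  proof (rule measurable_compose_countable'[where f = "\<lambda>i t. G (y (real_of_int i / real (Suc k))) t" and I = UNIV])
    show "(\<lambda>t. \<lfloor>real (Suc k) * t\<rfloor>) \<in> lebesgue \<rightarrow>\<^sub>M count_space UNIV"
      by (rule measurable_completion) measurable
  qed (use G in auto)
  fix t :: real
  have b: "\<bar>q k t - t\<bar> \<le> 1 / real (Suc k)" for k
  proof -
    have "\<bar>real_of_int \<lfloor>real (Suc k) * t\<rfloor> - real (Suc k) * t\<bar> \<le> 1" by linarith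
    then have "\<bar>real_of_int \<lfloor>real (Suc k) * t\<rfloor> - real (Suc k) * t\<bar> / real (Suc k) \<le> 1 / real (Suc k)"
      by (intro divide_right_mono) auto
    also have "\<bar>real_of_int \<lfloor>real (Suc k) * t\<rfloor> - real (Suc k) * t\<bar> / real (Suc k) = \<bar>q k t - t\<bar>"
    proof -
      have "(real_of_int \<lfloor>real (Suc k) * t\<rfloor> - real (Suc k) * t) / real (Suc k) = q k t - t"
        by (simp add: q_def diff_divide_distrib del: of_nat_Suc)
      then show ?thesis by (metis abs_divide abs_of_nat)
    qed
    finally show ?thesis .
  qed
  have "(\<lambda>k. q k t - t) \<longlonglongrightarrow> 0"
    by (rule Lim_null_comparison[OF _ lim_1_over_Suc]) (use b in auto)
  then have "(\<lambda>k. q k t) \<longlonglongrightarrow> t" by (simp add: LIM_zero_iff)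
  moreover have "isCont y t" using y by (simp add: continuous_on_eq_continuous_at)
  ultimately have "(\<lambda>k. y (q k t)) \<longlonglongrightarrow> y t" by (rule isCont_tendsto_compose[rotated])
  then show "(\<lambda>k. G (y (q k t)) t) \<longlonglongrightarrow> G (y t) t" by (rule isCont_tendsto_compose[OF cont])
qed

lemma indefinite_integral_lipschitz:
  fixes g :: "real \<Rightarrow> 'a::euclidean_space"
  assumes g: "g \<in> borel_measurable lebesgue" "\<And>t. norm (g t) \<le> M" and "s \<le> a" "a \<le> b"
  shows "norm (integral {s..b} g - integral {s..a} g) \<le> M * (b - a)"
proof -
  have int: "g integrable_on {u..v}" for u v
    using g by (intro bounded_measurable_integrable_interval) auto
  have "integral {s..a} g + integral {a..b} g = integral {s..b} g"
    using assms(3,4) int by (intro Henstock_Kurzweil_Integration.integral_combine) auto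
  then have "integral {s..b} g - integral {s..a} g = integral {a..b} g" by (simp add: algebra_simps)
  also have "norm \<dots> \<le> M * (b - a)"
  proof -
    have "norm (integral {a..b} g) \<le> integral {a..b} (\<lambda>_. M)"
      using g(2) int by (intro integral_norm_bound_integral) auto
    then show ?thesis using \<open>a \<le> b\<close> by (simp add: mult.commute)
  qed
  finally show ?thesis .
qed

text \<open>Picard iteration as a contraction for the norm with weight \<open>e\<^sup>-\<^sup>2\<^sup>K\<^sup>t\<close>, so that one application
  covers all times.\<close>

lemma caratheodory_existence:
  fixes H :: "'a::euclidean_space \<Rightarrow> real \<Rightarrow> 'a"
  assumes H: "\<And>z. H z \<in> borel_measurable lebesgue" "\<And>z t. norm (H z t) \<le> M"
    and lip: "\<And>z w t. norm (H z t - H w t) \<le> K * norm (z - w)" and "K > 0"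
  obtains y where "continuous_on UNIV y" "\<And>t. t \<ge> s \<Longrightarrow> y t = w + integral {s..t} (\<lambda>u. H (y u) u)"
proof -
  have "M \<ge> 0" using order_trans[OF norm_ge_zero H(2)] .
  \<comment> \<open>Clamping the time at \<open>s\<close> lets the iteration act on bounded
    continuous functions on the whole line. The fixed point variable \<open>u\<close> is the
    weighted curve, and \<open>Y u\<close> is the curve itself.\<close>
  define \<tau> where "\<tau> t = max s t - s" for t
  have \<tau>: "\<tau> t \<ge> 0" "continuous_on UNIV \<tau>" for t
    unfolding \<tau>_def by (auto intro!: continuous_intros)
  define Y where "Y u t = exp (2 * K * \<tau> t) *\<^sub>R apply_bcontfun u t" for u :: "real \<Rightarrow>\<^sub>C 'a" and t
  have Ycont: "continuous_on UNIV (Y u)" for u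
    unfolding Y_def using \<tau>(2) continuous_on_apply_bcontfun[of UNIV u] by (intro continuous_intros)
  have HYm: "(\<lambda>t. H (Y u t) t) \<in> borel_measurable lebesgue" for u
  proof (rule borel_measurable_along_curve[OF H(1) Ycont])
    fix t
    have "K-lipschitz_on UNIV (\<lambda>z. H z t)" using lip \<open>K > 0\<close> by (auto simp: lipschitz_on_def dist_norm)
    then show "isCont (\<lambda>z. H z t) (Y u t)"
      using lipschitz_on_continuous_on continuous_on_eq_continuous_at by blast
  qed
  have int: "(\<lambda>t. H (Y u t) t) integrable_on {a..b}" for u a b
    using HYm H(2) by (intro bounded_measurable_integrable_interval) auto
  define I where "I u t = integral {s..max s t} (\<lambda>t. H (Y u t) t)" for u t
  have Ilip: "norm (I u a - I u b) \<le> M * \<bar>a - b\<bar>" for u a b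
  proof -
    have *: "norm (I u b - I u a) \<le> M * (b - a)" if "a \<le> b" for a b
    proof -
      have "norm (I u b - I u a) \<le> M * (max s b - max s a)"
        unfolding I_def using that by (intro indefinite_integral_lipschitz[OF HYm H(2)]) auto
      also have "\<dots> \<le> M * (b - a)" using that \<open>M \<ge> 0\<close> by (intro mult_left_mono) auto
      finally show ?thesis .
    qed
    show ?thesis using *[of a b] *[of b a] by (cases "a \<le> b") (auto simp: norm_minus_commute)
  qed
  have Icont: "continuous_on UNIV (I u)" for u
    by (rule lipschitz_on_continuous_on[of M]) (use Ilip \<open>M \<ge> 0\<close> in \<open>auto simp: lipschitz_on_def dist_norm\<close>)
  define f where "f u t = exp (- 2 * K * \<tau> t) *\<^sub>R (w + I u t)" for u t
  have fb: "f u \<in> bcontfun" for u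
  proof (rule bcontfun_normI)
    show "continuous_on UNIV (f u)"
      unfolding f_def using \<tau>(2) Icont by (intro continuous_intros)
    fix t
    have "I u s = 0" by (simp add: I_def)
    have "norm (I u t) \<le> M * \<tau> t"
      using indefinite_integral_lipschitz[OF HYm H(2), of s s "max s t" u] by (simp add: I_def \<tau>_def)
    then have "norm (f u t) \<le> exp (- 2 * K * \<tau> t) * (norm w + M * \<tau> t)"
      unfolding f_def by (auto intro!: mult_left_mono norm_triangle_le)
    also have "\<dots> = exp (- 2 * K * \<tau> t) * norm w + M * (\<tau> t * exp (- 2 * K * \<tau> t))"
      by (simp add: algebra_simps)
    also have "\<dots> \<le> 1 * norm w + M * (1 / (2 * K))"
    proof (intro add_mono mult_right_mono mult_left_mono \<open>M \<ge> 0\<close>)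
      show "exp (- 2 * K * \<tau> t) \<le> 1" using \<tau>(1) \<open>K > 0\<close> by simp
      have "2 * K * \<tau> t \<le> exp (2 * K * \<tau> t)" using exp_ge_add_one_self[of "2 * K * \<tau> t"] by linarith
      then have "2 * K * \<tau> t * exp (- 2 * K * \<tau> t) \<le> exp (2 * K * \<tau> t) * exp (- 2 * K * \<tau> t)"
        by (intro mult_right_mono) auto
      then have "2 * K * (\<tau> t * exp (- 2 * K * \<tau> t)) \<le> 1" by (simp add: exp_add[symmetric] mult.assoc)
      then show "\<tau> t * exp (- 2 * K * \<tau> t) \<le> 1 / (2 * K)"
        using \<open>K > 0\<close> by (simp add: pos_le_divide_eq mult.commute)
    qed simp
    finally show "norm (f u t) \<le> 1 * norm w + M * (1 / (2 * K))" .
  qed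
  define T where "T u = Bcontfun (f u)" for u
  have T: "apply_bcontfun (T u) t = f u t" for u t by (simp add: T_def Bcontfun_inverse fb)
  have "\<exists>!u. T u = u"
  proof (rule banach_fix_type[of "1/2"])
    show "\<forall>u v. dist (T u) (T v) \<le> 1 / 2 * dist u v"
    proof (intro allI dist_bound)
      fix u v :: "real \<Rightarrow>\<^sub>C 'a" and t
      define D where "D = dist u v"
      have "I u t - I v t = integral {s..max s t} (\<lambda>\<sigma>. H (Y u \<sigma>) \<sigma> - H (Y v \<sigma>) \<sigma>)"
        unfolding I_def by (rule Henstock_Kurzweil_Integration.integral_diff[symmetric]) (rule int)+
      also have "norm \<dots> \<le> integral {s..max s t} (\<lambda>\<sigma>. K * D * exp (2 * K * (\<sigma> - s)))"
      proof (rule integral_norm_bound_integral)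
        show "(\<lambda>\<sigma>. H (Y u \<sigma>) \<sigma> - H (Y v \<sigma>) \<sigma>) integrable_on {s..max s t}" by (intro integrable_diff int)
        show "(\<lambda>\<sigma>. K * D * exp (2 * K * (\<sigma> - s))) integrable_on {s..max s t}"
          by (intro integrable_continuous_real continuous_intros)
        fix \<sigma> assume \<sigma>: "\<sigma> \<in> {s..max s t}"
        have "norm (H (Y u \<sigma>) \<sigma> - H (Y v \<sigma>) \<sigma>) \<le> K * norm (Y u \<sigma> - Y v \<sigma>)" by (rule lip)
        also have "Y u \<sigma> - Y v \<sigma> = exp (2 * K * \<tau> \<sigma>) *\<^sub>R (apply_bcontfun u \<sigma> - apply_bcontfun v \<sigma>)"
          by (simp add: Y_def scaleR_right_diff_distrib)
        also have "K * norm \<dots> \<le> K * (exp (2 * K * \<tau> \<sigma>) * D)"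
          using \<open>K > 0\<close> dist_bounded[of u \<sigma> v] by (auto simp: D_def dist_norm[of "apply_bcontfun u \<sigma>"] intro!: mult_left_mono)
        finally show "norm (H (Y u \<sigma>) \<sigma> - H (Y v \<sigma>) \<sigma>) \<le> K * D * exp (2 * K * (\<sigma> - s))"
          using \<sigma> by (simp add: \<tau>_def mult_ac)
      qed
      \<comment> \<open>The exponent \<open>2 * K\<close> is twice the Lipschitz constant, so
        integrating the weight yields the factor one half, which becomes the contraction
        constant.\<close>
      also have "\<dots> = D / 2 * (exp (2 * K * \<tau> t) - 1)"
      proof -
        have "((\<lambda>\<sigma>. K * D * exp (2 * K * (\<sigma> - s))) has_integral
            (D / 2 * exp (2 * K * (max s t - s)) - D / 2 * exp (2 * K * (s - s)))) {s..max s t}"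
          by (rule fundamental_theorem_of_calculus)
             (auto intro!: derivative_eq_intros simp: has_real_derivative_iff_has_vector_derivative[symmetric])
        from integral_unique[OF this] show ?thesis by (simp only:) (simp add: \<tau>_def algebra_simps)
      qed
      finally have I: "norm (I u t - I v t) \<le> D / 2 * (exp (2 * K * \<tau> t) - 1)" .
      have "D \<ge> 0" by (simp add: D_def)
      have "f u t - f v t = exp (- 2 * K * \<tau> t) *\<^sub>R (I u t - I v t)"
        by (simp add: f_def algebra_simps)
      then have "norm (f u t - f v t) = exp (- 2 * K * \<tau> t) * norm (I u t - I v t)" by simp
      also have "\<dots> \<le> exp (- 2 * K * \<tau> t) * (D / 2 * (exp (2 * K * \<tau> t) - 1))"
        using I by (intro mult_left_mono) auto
      also have "\<dots> = D / 2 * (exp (- 2 * K * \<tau> t) * exp (2 * K * \<tau> t)) - D / 2 * exp (- 2 * K * \<tau> t)"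
        by (simp add: algebra_simps)
      also have "exp (- 2 * K * \<tau> t) * exp (2 * K * \<tau> t) = 1" by (simp add: exp_add[symmetric])
      also have "D / 2 * 1 - D / 2 * exp (- 2 * K * \<tau> t) \<le> 1 / 2 * D" using \<open>D \<ge> 0\<close> by simp
      finally show "dist (apply_bcontfun (T u) t) (apply_bcontfun (T v) t) \<le> 1 / 2 * dist u v"
        unfolding T D_def dist_norm[of "f u t"] .
    qed
  qed auto
  then obtain u where u: "T u = u" by blast
  show thesis
  proof (rule that[of "Y u"])
    show "continuous_on UNIV (Y u)" by (rule Ycont)
    fix t assume "t \<ge> s"
    have "Y u t = exp (2 * K * \<tau> t) *\<^sub>R f u t" using T[of u t] u by (simp add: Y_def)
    also have "\<dots> = (exp (2 * K * \<tau> t) * exp (- 2 * K * \<tau> t)) *\<^sub>R (w + I u t)" by (simp only: f_def scaleR_scaleR)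
    also have "exp (2 * K * \<tau> t) * exp (- 2 * K * \<tau> t) = 1" by (simp add: exp_add[symmetric])
    finally show "Y u t = w + integral {s..t} (\<lambda>t. H (Y u t) t)" using \<open>t \<ge> s\<close> by (simp add: I_def)
  qed
qed

lemma closest_point_cball_0:
  fixes x :: "'a::euclidean_space"
  assumes "norm x \<ge> r" "r > 0"
  shows "closest_point (cball 0 r) x = (r / norm x) *\<^sub>R x"
proof (rule closest_point_unique[symmetric])
  have "norm x > 0" using assms by linarith
  show "(r / norm x) *\<^sub>R x \<in> cball 0 r" using assms by auto
  have eq: "dist x ((r / norm x) *\<^sub>R x) = norm x - r"
  proof -
    have "x - (r / norm x) *\<^sub>R x = (1 - r / norm x) *\<^sub>R x" by (simp add: algebra_simps)
    then have "dist x ((r / norm x) *\<^sub>R x) = \<bar>1 - r / norm x\<bar> * norm x" by (simp add: dist_norm)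
    also have "\<dots> = (1 - r / norm x) * norm x" using assms \<open>norm x > 0\<close> by simp
    also have "\<dots> = norm x - r" using \<open>norm x > 0\<close> by (simp add: left_diff_distrib)
    finally show ?thesis .
  qed
  show "\<forall>z\<in>cball 0 r. dist x ((r / norm x) *\<^sub>R x) \<le> dist x z"
  proof
    fix z :: 'a assume "z \<in> cball 0 r"
    then show "dist x ((r / norm x) *\<^sub>R x) \<le> dist x z"
      using norm_triangle_ineq2[of x z] eq by (simp add: dist_norm)
  qed
qed auto

text \<open>The field is Lipschitz only on smaller balls. Composing it with the nearest point
  projection onto a ball of radius \<open>r < 1\<close> makes it globally bounded and Lipschitz; the
  solution of the truncated equation never leaves that ball and so solves the original one.\<close>

lemma trajectory_exists:
  fixes G :: "complex^'n \<Rightarrow> real \<Rightarrow> complex^'n"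
  assumes G: "total_Herglotz_field G" and w: "norm w < 1"
  obtains x where "is_trajectory G s x" "x s = w"
proof -
  define r where "r = (1 + norm w) / 2"
  have r: "0 < r" "r < 1" "norm w \<le> r" using w by (auto simp: r_def intro: add_pos_nonneg)
  obtain C where C: "C > 0"
    "\<And>h x. h \<in> (class_M :: (complex^'n \<Rightarrow> complex^'n) set) \<Longrightarrow> norm x \<le> r \<Longrightarrow> norm (h x) \<le> C"
    "\<And>h x y. h \<in> (class_M :: (complex^'n \<Rightarrow> complex^'n) set) \<Longrightarrow> norm x \<le> r \<Longrightarrow> norm y \<le> r \<Longrightarrow>
       norm (h x - h y) \<le> C * norm (x - y)"
    using class_M_uniform_bounds[OF r(1,2)] by metis
  have M: "(\<lambda>z. G z t) \<in> class_M" for t using G by (simp add: total_Herglotz_field_def)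
  define \<pi> where "\<pi> = closest_point (cball (0::complex^'n) r)"
  have \<pi>: "norm (\<pi> z) \<le> r" "norm (\<pi> z - \<pi> z') \<le> norm (z - z')" for z z'
  proof -
    have "\<pi> z \<in> cball 0 r" unfolding \<pi>_def using r by (intro closest_point_in_set) auto
    then show "norm (\<pi> z) \<le> r" by simp
    show "norm (\<pi> z - \<pi> z') \<le> norm (z - z')"
      using closest_point_lipschitz[of "cball 0 r" z z'] r by (simp add: \<pi>_def dist_norm)
  qed
  have \<pi>_id: "\<pi> z = z" if "norm z \<le> r" for z
    unfolding \<pi>_def using that by (intro closest_point_self) simp
  define H where "H z t = G (\<pi> z) t" for z t
  have Hb: "norm (H z t) \<le> C" for z t unfolding H_def by (rule C(2)[OF M \<pi>(1)])
  have Hl: "norm (H z t - H z' t) \<le> C * norm (z - z')" for z z' t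
  proof -
    have "norm (H z t - H z' t) \<le> C * norm (\<pi> z - \<pi> z')" unfolding H_def by (rule C(3)[OF M \<pi>(1) \<pi>(1)])
    also have "\<dots> \<le> C * norm (z - z')" using \<pi>(2) C(1) by (intro mult_left_mono) auto
    finally show ?thesis .
  qed
  have Hm: "H z \<in> borel_measurable lebesgue" for z
    using G by (simp add: H_def[abs_def] total_Herglotz_field_def)
  obtain y where y: "continuous_on UNIV y" "\<And>t. t \<ge> s \<Longrightarrow> y t = w + integral {s..t} (\<lambda>u. H (y u) u)"
    using caratheodory_existence[OF Hm Hb Hl C(1), where s = s and w = w] by blast
  have ym: "(\<lambda>t. H (y t) t) \<in> borel_measurable lebesgue"
  proof (rule borel_measurable_along_curve[OF Hm y(1)])
    fix t
    have "C-lipschitz_on UNIV (\<lambda>z. H z t)" using Hl C(1) by (auto simp: lipschitz_on_def dist_norm)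
    then show "isCont (\<lambda>z. H z t) (y t)"
      using lipschitz_on_continuous_on continuous_on_eq_continuous_at by blast
  qed
  have ylip: "C-lipschitz_on {s..T} y" for T
    unfolding lipschitz_on_def
  proof (intro conjI ballI)
    fix a b assume ab: "a \<in> {s..T}" "b \<in> {s..T}"
    have *: "norm (y b - y a) \<le> C * (b - a)" if "s \<le> a" "a \<le> b" for a b
      using indefinite_integral_lipschitz[OF ym Hb that] y(2)[of a] y(2)[of b] that by simp
    show "dist (y a) (y b) \<le> C * dist a b"
      using *[of a b] *[of b a] ab by (cases "a \<le> b") (auto simp: dist_norm norm_minus_commute)
  qed (use C(1) in simp)
  have yac: "abs_continuous_on_interval s T y" for T
    by (rule abs_continuous_on_interval_lipschitz[OF ylip])
  have yd: "AE t in lebesgue. t > s \<longrightarrow> (y has_vector_derivative H (y t) t) (at t)"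
    using AE_indefinite_integral_has_vector_derivative[OF ym Hb, of s]
  proof (eventually_elim, intro impI)
    fix t assume t: "s < t \<longrightarrow> ((\<lambda>u. integral {s..u} (\<lambda>t. H (y t) t)) has_vector_derivative H (y t) t) (at t)" "s < t"
    then have "((\<lambda>u. w + integral {s..u} (\<lambda>t. H (y t) t)) has_vector_derivative 0 + H (y t) t) (at t)"
      by (intro has_vector_derivative_add has_vector_derivative_const) auto
    then show "(y has_vector_derivative H (y t) t) (at t)"
      using has_vector_derivative_transform_within_open[where S = "{s<..}" and g = y] t y(2) by simp
  qed
  have y0: "y s = w" using y(2)[of s] by simp
  have yr: "norm (y t) \<le> r" if "s \<le> t" for t
  proof -
    have "bounded (y ` {s..t})"
      by (intro compact_imp_bounded compact_continuous_image continuous_on_subset[OF y(1)]) auto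
    then obtain V where V: "\<And>u. u \<in> {s..t} \<Longrightarrow> norm (y u) \<le> V"
      unfolding bounded_iff by (metis imageI)
    have "1 * (norm (y t))\<^sup>2 \<le> 1 * (norm (y s))\<^sup>2"
    proof (rule abs_continuous_weighted_norm_nonincreasing[OF yac V that, where k' = "\<lambda>_. 0"])
      show "AE u in lebesgue. u \<in> {s<..<t} \<longrightarrow>
         (\<exists>d. (y has_vector_derivative d) (at u) \<and> 0 * (norm (y u))\<^sup>2 + 2 * 1 * (y u \<bullet> d) \<le> 0)"
        using yd
      proof (eventually_elim, intro impI)
        fix u assume u: "s < u \<longrightarrow> (y has_vector_derivative H (y u) u) (at u)" "u \<in> {s<..<t}"
        have neg: "\<pi> (y u) \<bullet> H (y u) u \<le> 0"
          unfolding H_def using class_M_inner_le_0[OF M, of "\<pi> (y u)"] \<pi>(1)[of "y u"] r by simp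
        \<comment> \<open>Outside the ball the projected point is a positive multiple of
          \<open>y u\<close>, so the sign of the inner product carries over from the projected
          point.\<close>
        have "y u \<bullet> H (y u) u \<le> 0"
        proof (cases "norm (y u) \<le> r")
          case True
          then show ?thesis using neg \<pi>_id by simp
        next
          case False
          then have "\<pi> (y u) = (r / norm (y u)) *\<^sub>R y u"
            unfolding \<pi>_def using r by (intro closest_point_cball_0) auto
          then have "r / norm (y u) * (y u \<bullet> H (y u) u) \<le> 0" using neg by simp
          moreover have "r / norm (y u) > 0" using False r by (auto intro!: divide_pos_pos)
          ultimately show ?thesis by (meson mult_le_0_iff not_le)
        qed
        then show "\<exists>d. (y has_vector_derivative d) (at u) \<and> 0 * (norm (y u))\<^sup>2 + 2 * 1 * (y u \<bullet> d) \<le> 0"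
          using u by (intro exI[of _ "H (y u) u"]) auto
      qed
    qed auto
    then have "norm (y t) \<le> norm (y s)" by (simp add: power2_le_iff_abs_le)
    then show ?thesis using y0 r by simp
  qed
  show thesis
  proof (rule that[of y])
    show "is_trajectory G s y"
      unfolding is_trajectory_def
    proof (intro conjI allI impI)
      show "y t \<in> ball 0 1" if "t \<ge> s" for t using yr[OF that] r by simp
      show "AE t in lebesgue. t > s \<longrightarrow> (y has_vector_derivative G (y t) t) (at t)"
        using yd
      proof (eventually_elim, intro impI)
        fix t assume t: "s < t \<longrightarrow> (y has_vector_derivative H (y t) t) (at t)" "s < t"
        then show "(y has_vector_derivative G (y t) t) (at t)"
          using \<pi>_id[of "y t"] yr[of t] by (simp add: H_def)
      qed
    qed (rule yac)
  qed (rule y0)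
qed

subsection \<open>Evolution families and Loewner chains\<close>

text \<open>The transition map of the overview. By uniqueness of trajectories the choice is
  immaterial for \<open>s \<le> t\<close> and \<open>norm w < 1\<close>, the only range in which it
  is evaluated.\<close>

definition evolution :: "(complex^'n \<Rightarrow> real \<Rightarrow> complex^'n) \<Rightarrow> real \<Rightarrow> real \<Rightarrow> complex^'n \<Rightarrow> complex^'n" where
  "evolution G s t w = (SOME x. is_trajectory G s x \<and> x s = w) t"

lemma evolution_trajectory:
  assumes "total_Herglotz_field G" "norm w < 1"
  shows "is_trajectory G s (\<lambda>t. evolution G s t w)" "evolution G s s w = w"
proof -
  have "\<exists>x. is_trajectory G s x \<and> x s = w" using trajectory_exists[OF assms, where s = s] by blast
  then have "is_trajectory G s (SOME x. is_trajectory G s x \<and> x s = w) \<and> (SOME x. is_trajectory G s x \<and> x s = w) s = w"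
    by (rule someI_ex)
  then show "is_trajectory G s (\<lambda>t. evolution G s t w)" "evolution G s s w = w"
    by (auto simp: evolution_def)
qed

lemma evolution_eq:
  assumes G: "total_Herglotz_field G" and x: "is_trajectory G s x" and "s \<le> t"
  shows "evolution G s t (x s) = x t"
proof -
  have "norm (x s) < 1" using x unfolding is_trajectory_def by auto
  note e = evolution_trajectory[OF G this, where s = s]
  show ?thesis by (rule trajectory_unique[OF G e(1) x e(2) \<open>s \<le> t\<close>])
qed

lemma norm_evolution_le:
  assumes "total_Herglotz_field G" "norm w < 1" "s \<le> t"
  shows "norm (evolution G s t w) \<le> norm w"
  using trajectory_norm_nonincreasing[OF assms(1) evolution_trajectory(1)[OF assms(1,2)] order_refl assms(3)]
    evolution_trajectory(2)[OF assms(1,2)] by simp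

lemma norm_evolution_less:
  assumes "total_Herglotz_field G" "norm w < 1" "s \<le> t"
  shows "norm (evolution G s t w) < 1"
  using norm_evolution_le[OF assms] assms(2) by simp

lemma evolution_compose:
  assumes G: "total_Herglotz_field G" and w: "norm w < 1" and "s \<le> a" "a \<le> t"
  shows "evolution G a t (evolution G s a w) = evolution G s t w"
  by (rule evolution_eq[OF G is_trajectory_restart[OF evolution_trajectory(1)[OF G w] \<open>s \<le> a\<close>] \<open>a \<le> t\<close>])

section \<open>Gluing and shifting fields in time\<close>

lemma is_trajectory_concat:
  assumes G1: "total_Herglotz_field G1" and G2: "total_Herglotz_field G2"
    and x: "is_trajectory G1 s x" and y: "is_trajectory G2 b y" and "y b = x b" "s \<le> b"
    and eq1: "\<And>z t. s < t \<Longrightarrow> t < b \<Longrightarrow> G z t = G1 z t" and eq2: "\<And>z t. b < t \<Longrightarrow> G z t = G2 z t"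
  shows "is_trajectory G s (\<lambda>t. if t \<le> b then x t else y t)"
  unfolding is_trajectory_def
proof (intro conjI allI impI)
  show "(if t \<le> b then x t else y t) \<in> ball 0 1" if "t \<ge> s" for t
    using x y that unfolding is_trajectory_def by auto
  obtain C1 where C1: "C1 > 0" "\<And>T. C1-lipschitz_on {s..T} x" using trajectory_lipschitz_on[OF G1 x] by blast
  obtain C2 where C2: "C2 > 0" "\<And>T. C2-lipschitz_on {b..T} y" using trajectory_lipschitz_on[OF G2 y] by blast
  show "abs_continuous_on_interval s T (\<lambda>t. if t \<le> b then x t else y t)" if "T \<ge> s" for T
  proof (rule abs_continuous_on_interval_subset)
    have "(max C1 C2)-lipschitz_on {s..max T b} (\<lambda>t. if t \<le> b then x t else y t)"
      using C1(2)[of b] C2(2)[of "max T b"] \<open>y b = x b\<close>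
      by (intro lipschitz_on_concat) (auto intro: lipschitz_on_le)
    then show "abs_continuous_on_interval s (max T b) (\<lambda>t. if t \<le> b then x t else y t)"
      by (rule abs_continuous_on_interval_lipschitz)
  qed auto
  have "AE t in lebesgue. t > s \<longrightarrow> (x has_vector_derivative G1 (x t) t) (at t)"
    "AE t in lebesgue. t > b \<longrightarrow> (y has_vector_derivative G2 (y t) t) (at t)"
    using x y unfolding is_trajectory_def by blast+
  \<comment> \<open>The glued curve may have a corner at the switching time, which is a null
    set.\<close>
  moreover have "AE t in lebesgue. t \<noteq> b"
    unfolding eventually_ae_filter_negligible by (intro exI[of _ "{b}"]) auto
  ultimately show "AE t in lebesgue. t > s \<longrightarrow>
      ((\<lambda>t. if t \<le> b then x t else y t) has_vector_derivative G (if t \<le> b then x t else y t) t) (at t)"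
  proof (eventually_elim, intro impI)
    fix t assume t: "t > s \<longrightarrow> (x has_vector_derivative G1 (x t) t) (at t)"
      "t > b \<longrightarrow> (y has_vector_derivative G2 (y t) t) (at t)" "t \<noteq> b" "t > s"
    show "((\<lambda>t. if t \<le> b then x t else y t) has_vector_derivative G (if t \<le> b then x t else y t) t) (at t)"
    proof (cases "t < b")
      case True
      have "(x has_vector_derivative G (x t) t) (at t)" using t True eq1[of t "x t"] by simp
      then have "((\<lambda>t. if t \<le> b then x t else y t) has_vector_derivative G (x t) t) (at t)"
        by (rule has_vector_derivative_transform_within_open[where S = "{..<b}"]) (use True in auto)
      then show ?thesis using True by simp
    next
      case False
      then have "b < t" using t by simp
      have "(y has_vector_derivative G (y t) t) (at t)" using t \<open>b < t\<close> eq2[of t "y t"] by simp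
      then have "((\<lambda>t. if t \<le> b then x t else y t) has_vector_derivative G (y t) t) (at t)"
        by (rule has_vector_derivative_transform_within_open[where S = "{b<..}"]) (use \<open>b < t\<close> in auto)
      then show ?thesis using \<open>b < t\<close> by simp
    qed
  qed
qed

text \<open>Both the needle variation and the continuation by \<open>-z\<close> arise by gluing
  fields. The fields need to agree only between \<open>s\<close> and \<open>b\<close> and after
  \<open>b\<close>, so the convention at the switching time is free.\<close>

lemma evolution_switch:
  assumes G: "total_Herglotz_field G" and G1: "total_Herglotz_field G1" and G2: "total_Herglotz_field G2"
    and w: "norm w < 1" and "s \<le> b"
    and eq1: "\<And>z t. s < t \<Longrightarrow> t < b \<Longrightarrow> G z t = G1 z t" and eq2: "\<And>z t. b < t \<Longrightarrow> G z t = G2 z t"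
  shows "s \<le> t \<Longrightarrow> t \<le> b \<Longrightarrow> evolution G s t w = evolution G1 s t w"
    and "b \<le> t \<Longrightarrow> evolution G s t w = evolution G2 b t (evolution G1 s b w)"
proof -
  note e1 = evolution_trajectory[OF G1 w, where s = s]
  have w': "norm (evolution G1 s b w) < 1" by (rule norm_evolution_less[OF G1 w \<open>s \<le> b\<close>])
  note e2 = evolution_trajectory[OF G2 w', where s = b]
  define x where "x t = (if t \<le> b then evolution G1 s t w else evolution G2 b t (evolution G1 s b w))" for t
  have x: "is_trajectory G s x"
    unfolding x_def[abs_def] by (rule is_trajectory_concat[OF G1 G2 e1(1) e2(1,2) \<open>s \<le> b\<close> eq1 eq2])
  have "x s = w" using \<open>s \<le> b\<close> e1(2) by (simp add: x_def)
  then have ev: "evolution G s t w = x t" if "s \<le> t" for t using evolution_eq[OF G x that] by simp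
  show "s \<le> t \<Longrightarrow> t \<le> b \<Longrightarrow> evolution G s t w = evolution G1 s t w"
    using ev by (simp add: x_def)
  show "b \<le> t \<Longrightarrow> evolution G s t w = evolution G2 b t (evolution G1 s b w)"
    using ev[of t] \<open>s \<le> b\<close> e2(2) by (cases "t = b") (auto simp: x_def)
qed

lemma total_Herglotz_field_switch:
  assumes "total_Herglotz_field G1" "total_Herglotz_field G2"
  shows "total_Herglotz_field (\<lambda>z t. if t \<le> b then G1 z t else G2 z t)"
  unfolding total_Herglotz_field_def
proof (intro conjI allI)
  show "(\<lambda>t. if t \<le> b then G1 z t else G2 z t) \<in> borel_measurable lebesgue" for z
    using assms measurable_If_set[of "G1 z" lebesgue borel "G2 z" "{..b}"]
    by (simp add: total_Herglotz_field_def)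
  show "(\<lambda>z. if t \<le> b then G1 z t else G2 z t) \<in> class_M" for t
    using assms by (cases "t \<le> b") (auto simp: total_Herglotz_field_def)
qed

lemma total_Herglotz_field_shift:
  assumes "total_Herglotz_field G"
  shows "total_Herglotz_field (\<lambda>z t. G z (t + c))"
  unfolding total_Herglotz_field_def
proof (intro conjI allI)
  fix z
  have "(\<lambda>t. c + (\<Sum>j\<in>Basis. (1 * (t \<bullet> j)) *\<^sub>R j)) \<in> lebesgue \<rightarrow>\<^sub>M (lebesgue :: real measure)"
    by (rule lebesgue_affine_measurable) simp
  then have "(\<lambda>t. t + c) \<in> lebesgue \<rightarrow>\<^sub>M (lebesgue :: real measure)" by (simp add: add.commute)
  moreover have "G z \<in> borel_measurable lebesgue" using assms by (simp add: total_Herglotz_field_def)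
  ultimately show "(\<lambda>t. G z (t + c)) \<in> borel_measurable lebesgue" by (rule measurable_compose)
qed (use assms in \<open>auto simp: total_Herglotz_field_def\<close>)

lemma evolution_shift:
  assumes G: "total_Herglotz_field G" and w: "norm w < 1" and "s \<le> t"
  shows "evolution (\<lambda>z t. G z (t + c)) s t w = evolution G (s + c) (t + c) w"
proof -
  note e = evolution_trajectory[OF G w, where s = "s + c"]
  define x where "x t = evolution G (s + c) (t + c) w" for t
  have "is_trajectory (\<lambda>z t. G z (t + c)) s x"
    unfolding is_trajectory_def
  proof (intro conjI allI impI)
    show "x t \<in> ball 0 1" if "t \<ge> s" for t using e(1) that unfolding is_trajectory_def x_def by auto
    obtain C where C: "C > 0" "\<And>T. C-lipschitz_on {s + c..T} (\<lambda>t. evolution G (s + c) t w)"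
      using trajectory_lipschitz_on[OF G e(1)] by blast
    have "C-lipschitz_on {s..T} x" for T
      unfolding lipschitz_on_def
    proof (intro conjI ballI)
      fix a b assume "a \<in> {s..T}" "b \<in> {s..T}"
      then have "dist (x a) (x b) \<le> C * dist (a + c) (b + c)"
        unfolding x_def by (intro lipschitz_onD[OF C(2)[of "T + c"]]) auto
      then show "dist (x a) (x b) \<le> C * dist a b" by simp
    qed (use C(1) in simp)
    then show "abs_continuous_on_interval s T x" for T by (rule abs_continuous_on_interval_lipschitz)
    have "AE t in lebesgue. t > s + c \<longrightarrow>
        ((\<lambda>t. evolution G (s + c) t w) has_vector_derivative G (evolution G (s + c) t w) t) (at t)"
      using e(1) unfolding is_trajectory_def by blast
    then obtain N where N: "negligible N" "\<And>t. t \<notin> N \<Longrightarrow> t > s + c \<Longrightarrow>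
        ((\<lambda>t. evolution G (s + c) t w) has_vector_derivative G (evolution G (s + c) t w) t) (at t)"
      unfolding eventually_ae_filter_negligible by blast
    show "AE t in lebesgue. t > s \<longrightarrow> (x has_vector_derivative G (x t) (t + c)) (at t)"
      unfolding eventually_ae_filter_negligible
    proof (intro exI conjI)
      show "negligible ((+) (- c) ` N)" using N(1) by (rule negligible_translation)
      show "{t. \<not> (t > s \<longrightarrow> (x has_vector_derivative G (x t) (t + c)) (at t))} \<subseteq> (+) (- c) ` N"
      proof (rule subsetI, rule ccontr)
        fix t assume t: "t \<in> {t. \<not> (t > s \<longrightarrow> (x has_vector_derivative G (x t) (t + c)) (at t))}" "t \<notin> (+) (- c) ` N"
        have "t + c \<notin> N"
        proof
          assume "t + c \<in> N"
          then have "- c + (t + c) \<in> (+) (- c) ` N" by (rule imageI)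
          then show False using t(2) by simp
        qed
        moreover have "t > s" using t(1) by blast
        ultimately have d: "((\<lambda>t. evolution G (s + c) t w) has_vector_derivative G (evolution G (s + c) (t + c) w) (t + c)) (at (t + c))"
          using N(2)[of "t + c"] by simp
        have "((\<lambda>t. t + c) has_vector_derivative 1) (at t)"
          by (auto intro!: derivative_eq_intros)
        from vector_diff_chain_at[OF this d] have "(x has_vector_derivative G (x t) (t + c)) (at t)"
          by (simp add: x_def[abs_def] o_def)
        then show False using t(1) by blast
      qed
    qed
  qed
  from evolution_eq[OF total_Herglotz_field_shift[OF G] this \<open>s \<le> t\<close>] e(2) show ?thesis by (simp add: x_def)
qed

section \<open>The constant field \<open>-z\<close> and the construction of Loewner chains\<close>

definition on_ball :: "(complex^'n \<Rightarrow> complex^'n) \<Rightarrow> complex^'n \<Rightarrow> complex^'n" where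
  "on_ball f z = (if z \<in> ball 0 1 then f z else 0)"

lemma on_ball_in_Hol: "holomorphic_map_on f (ball 0 1) \<Longrightarrow> on_ball f \<in> Hol"
  unfolding Hol_def
  using holomorphic_map_on_transform[of f "ball 0 1" "on_ball f"] by (auto simp: on_ball_def)

lemma neg_in_class_M: "on_ball (\<lambda>z. - z) \<in> (class_M :: (complex^'n \<Rightarrow> complex^'n) set)"
proof -
  have "holomorphic_map_on (\<lambda>z :: complex^'n. - z) (ball 0 1)"
    using holomorphic_map_on_scale[of "-1" "ball 0 1"] by (simp add: vector_sneg_minus1[symmetric])
  moreover have "(on_ball (\<lambda>z. - z) has_derivative (\<lambda>v. - v)) (at (0 :: complex^'n))"
  proof (rule has_derivative_transform_within_open[of "\<lambda>z. - z" _ _ _ "ball 0 1"])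
    show "((\<lambda>z. - z) has_derivative (\<lambda>v. - v)) (at (0 :: complex^'n))" by (auto intro!: derivative_eq_intros)
  qed (auto simp: on_ball_def)
  ultimately show ?thesis
    by (auto simp: class_M_def on_ball_in_Hol) (auto simp: on_ball_def Re_hinner)
qed

lemma total_Herglotz_field_autonomous:
  assumes "h \<in> class_M"
  shows "total_Herglotz_field (\<lambda>z t. h z)"
  using assms by (simp add: total_Herglotz_field_def)

lemma evolution_neg:
  assumes w: "norm (w :: complex^'n) < 1" and "s \<le> t"
  shows "evolution (\<lambda>z t. on_ball (\<lambda>z. - z) z) s t w = exp (- (t - s)) *\<^sub>R w"
proof -
  define x where "x t = exp (- (t - s)) *\<^sub>R w" for t
  have xb: "x t \<in> ball 0 1" if "t \<ge> s" for t
  proof -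
    have "norm (x t) \<le> 1 * norm w"
      using mult_right_mono[of "exp (- (t - s))" 1 "norm w"] that by (simp add: x_def)
    then show ?thesis using w by simp
  qed
  have xd: "(x has_vector_derivative - x t) (at t)" for t
    unfolding x_def[abs_def] by (auto intro!: derivative_eq_intros)
  have "is_trajectory (\<lambda>z t. on_ball (\<lambda>z. - z) z) s x"
    unfolding is_trajectory_def
  proof (intro conjI allI impI)
    show "x t \<in> ball 0 1" if "t \<ge> s" for t using xb that .
    have "1-lipschitz_on {s..T} x" for T
      unfolding lipschitz_on_def
    proof (intro conjI ballI)
      fix a b assume ab: "a \<in> {s..T}" "b \<in> {s..T}"
      have "norm (x a - x b) \<le> 1 * norm (a - b)"
      proof (rule differentiable_bound[of "{s..T}" x "\<lambda>t h. h *\<^sub>R (- x t)"])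
        fix t assume t: "t \<in> {s..T}"
        show "(x has_derivative (\<lambda>h. h *\<^sub>R - x t)) (at t within {s..T})"
          using xd[of t] has_derivative_at_withinI unfolding has_vector_derivative_def by blast
        show "onorm (\<lambda>h. h *\<^sub>R - x t) \<le> 1"
          using xb[of t] t by (intro onorm_le) (auto intro: mult_left_le)
      qed (use ab in auto)
      then show "dist (x a) (x b) \<le> 1 * dist a b" by (simp add: dist_norm)
    qed simp
    then show "abs_continuous_on_interval s T x" for T by (rule abs_continuous_on_interval_lipschitz)
    show "AE t in lebesgue. t > s \<longrightarrow> (x has_vector_derivative on_ball (\<lambda>z. - z) (x t)) (at t)"
      using xb xd by (intro always_eventually) (auto simp: on_ball_def)
  qed
  from evolution_eq[OF total_Herglotz_field_autonomous[OF neg_in_class_M] this \<open>s \<le> t\<close>]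
  show ?thesis by (simp add: x_def)
qed

text \<open>For \<open>s = 0\<close> this is the map \<open>f\<^sup>G\<close>; in general it is the value at time \<open>s\<close> of the Loewner chain
  whose transition maps are the evolution of \<open>G\<close>.\<close>

definition Loewner_chain :: "(complex^'n \<Rightarrow> real \<Rightarrow> complex^'n) \<Rightarrow> real \<Rightarrow> complex^'n \<Rightarrow> complex^'n" where
  "Loewner_chain G s w = lim (\<lambda>n. exp (real n) *\<^sub>R evolution G s (real n) w)"

text \<open>The increments of \<open>e\<^sup>t x\<close> are dominated by a multiple of
  \<open>e\<^sup>-\<^sup>a - e\<^sup>-\<^sup>b\<close>, which gives both the limit and the rate. The
  squared norm of \<open>w\<close> in the rate is what later yields the derivative of the chain at
  the origin.\<close>

lemma Loewner_chain_limit: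
  assumes r: "0 < r" "r < 1"
  obtains C where "C > 0"
    "\<And>G s w t. total_Herglotz_field G \<Longrightarrow> norm (w :: complex^'n) \<le> r \<Longrightarrow> s \<le> t \<Longrightarrow>
       norm (exp t *\<^sub>R evolution G s t w - Loewner_chain G s w) \<le> C * exp (2 * s) * (norm w)\<^sup>2 * exp (- t)"
proof -
  obtain C where C: "C > 0"
    "\<And>G s x a b. total_Herglotz_field G \<Longrightarrow> is_trajectory G s x \<Longrightarrow> norm (x s :: complex^'n) \<le> r \<Longrightarrow>
       s \<le> a \<Longrightarrow> a \<le> b \<Longrightarrow>
       norm (exp b *\<^sub>R x b - exp a *\<^sub>R x a) \<le> C * exp (2 * s) * (norm (x s))\<^sup>2 * (exp (- a) - exp (- b))"
    using trajectory_normalized_increment[OF r] by metis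
  show thesis
  proof (rule that[OF C(1)])
    fix G :: "complex^'n \<Rightarrow> real \<Rightarrow> complex^'n" and s t :: real and w :: "complex^'n"
    assume G: "total_Herglotz_field G" and wr: "norm w \<le> r" and "s \<le> t"
    then have w: "norm w < 1" using r by simp
    note e = evolution_trajectory[OF G w, where s = s]
    define X where "X t = exp t *\<^sub>R evolution G s t w" for t
    define N where "N = C * exp (2 * s) * (norm w)\<^sup>2"
    have "N \<ge> 0" using C(1) by (simp add: N_def)
    have inc: "norm (X b - X a) \<le> N * exp (- a)" if "s \<le> a" "a \<le> b" for a b
    proof -
      have "norm (X b - X a) \<le> N * (exp (- a) - exp (- b))"
        using C(2)[OF G e(1) _ that] e(2) wr by (simp add: X_def N_def)
      also have "\<dots> \<le> N * exp (- a)" using \<open>N \<ge> 0\<close> by (intro mult_left_mono) auto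
      finally show ?thesis .
    qed
    have "Cauchy (\<lambda>n. X (real n))"
    proof (rule metric_CauchyI)
      fix e :: real assume "e > 0"
      have "((\<lambda>a. 2 * N * exp (- a)) \<longlongrightarrow> 2 * N * 0) at_top"
        by (intro tendsto_mult_left filterlim_compose[OF exp_at_bot filterlim_uminus_at_bot_at_top])
      then have "\<forall>\<^sub>F a in at_top. 2 * N * exp (- a) < e" using \<open>e > 0\<close> by (intro order_tendstoD(2)) auto
      then obtain a0 where a0: "\<And>a. a \<ge> a0 \<Longrightarrow> 2 * N * exp (- a) < e" by (auto simp: eventually_at_top_linorder)
      obtain m :: nat where m: "real m \<ge> max s a0" using real_arch_simple by blast
      show "\<exists>M. \<forall>i\<ge>M. \<forall>j\<ge>M. dist (X (real i)) (X (real j)) < e"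
      proof (intro exI[of _ m] allI impI)
        fix i j assume "i \<ge> m" "j \<ge> m"
        then have "norm (X i - X m) \<le> N * exp (- real m)" "norm (X j - X m) \<le> N * exp (- real m)"
          using inc[of m] m by auto
        then show "dist (X (real i)) (X (real j)) < e"
          using a0[of m] m dist_triangle2[of "X (real i)" "X (real j)" "X (real m)"] by (simp add: dist_norm)
      qed
    qed
    then have conv: "(\<lambda>n. X (real n)) \<longlonglongrightarrow> Loewner_chain G s w"
      unfolding Loewner_chain_def X_def by (simp add: Cauchy_convergent_iff convergent_LIMSEQ_iff)
    have "(\<lambda>n. norm (X (real n) - X t)) \<longlonglongrightarrow> norm (Loewner_chain G s w - X t)"
      by (intro tendsto_intros conv)
    moreover obtain m :: nat where "real m \<ge> t" using real_arch_simple by blast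
    then have "norm (X (real n) - X t) \<le> N * exp (- t)" if "n \<ge> m" for n
      using inc[OF \<open>s \<le> t\<close>, of "real n"] that by (meson of_nat_le_iff order_trans)
    ultimately have "norm (Loewner_chain G s w - X t) \<le> N * exp (- t)" by (intro LIMSEQ_le_const2) auto
    then show "norm (exp t *\<^sub>R evolution G s t w - Loewner_chain G s w) \<le> C * exp (2 * s) * (norm w)\<^sup>2 * exp (- t)"
      by (simp add: X_def N_def norm_minus_commute)
  qed
qed

lemma Loewner_chain_tendsto:
  assumes G: "total_Herglotz_field G" and w: "norm w < 1"
  shows "((\<lambda>t. exp t *\<^sub>R evolution G s t w) \<longlongrightarrow> Loewner_chain G s w) at_top"
proof -
  define r where "r = (1 + norm w) / 2"
  have r: "0 < r" "r < 1" "norm w \<le> r" using w by (auto simp: r_def intro: add_pos_nonneg)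
  obtain C where C: "C > 0" "\<And>G s w t. total_Herglotz_field G \<Longrightarrow> norm (w :: complex^'a) \<le> r \<Longrightarrow> s \<le> t \<Longrightarrow>
       norm (exp t *\<^sub>R evolution G s t w - Loewner_chain G s w) \<le> C * exp (2 * s) * (norm w)\<^sup>2 * exp (- t)"
    using Loewner_chain_limit[OF r(1,2)] by metis
  have "((\<lambda>t. C * exp (2 * s) * (norm w)\<^sup>2 * exp (- t)) \<longlongrightarrow> C * exp (2 * s) * (norm w)\<^sup>2 * 0) at_top"
    by (intro tendsto_mult_left filterlim_compose[OF exp_at_bot filterlim_uminus_at_bot_at_top])
  then have "((\<lambda>t. C * exp (2 * s) * (norm w)\<^sup>2 * exp (- t)) \<longlongrightarrow> 0) at_top" by simp
  then have "((\<lambda>t. exp t *\<^sub>R evolution G s t w - Loewner_chain G s w) \<longlongrightarrow> 0) at_top"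
    by (rule Lim_null_comparison[rotated])
       (use C(2)[OF G r(3)] in \<open>auto simp: eventually_at_top_linorder intro!: exI[of _ s]\<close>)
  then show ?thesis by (simp add: LIM_zero_iff)
qed

lemma Loewner_chain_eqI:
  assumes G: "total_Herglotz_field G" and w: "norm w < 1"
    and lim: "((\<lambda>t. exp t *\<^sub>R evolution G s t w) \<longlongrightarrow> l) at_top"
  shows "Loewner_chain G s w = l"
  using tendsto_unique[OF _ Loewner_chain_tendsto[OF G w] lim] by simp

lemma Loewner_chain_switch:
  assumes G: "total_Herglotz_field G" and G1: "total_Herglotz_field G1" and G2: "total_Herglotz_field G2"
    and w: "norm w < 1" and "s \<le> b"
    and eq1: "\<And>z t. s < t \<Longrightarrow> t < b \<Longrightarrow> G z t = G1 z t" and eq2: "\<And>z t. b < t \<Longrightarrow> G z t = G2 z t"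
  shows "Loewner_chain G s w = Loewner_chain G2 b (evolution G1 s b w)"
proof (rule Loewner_chain_eqI[OF G w])
  have w': "norm (evolution G1 s b w) < 1" by (rule norm_evolution_less[OF G1 w \<open>s \<le> b\<close>])
  have ev: "\<forall>\<^sub>F t in at_top. evolution G2 b t (evolution G1 s b w) = evolution G s t w"
    using eventually_ge_at_top[of b]
  proof eventually_elim
    fix t assume "b \<le> t"
    then show "evolution G2 b t (evolution G1 s b w) = evolution G s t w"
      using evolution_switch(2)[OF G G1 G2 w \<open>s \<le> b\<close> eq1 eq2, of t] by simp
  qed
  show "((\<lambda>t. exp t *\<^sub>R evolution G s t w) \<longlongrightarrow> Loewner_chain G2 b (evolution G1 s b w)) at_top"
    by (rule Lim_transform_eventually[OF Loewner_chain_tendsto[OF G2 w', of b]])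
       (use ev in eventually_elim, simp)
qed

lemma Loewner_chain_evolution:
  assumes G: "total_Herglotz_field G" and w: "norm w < 1" and "s \<le> b"
  shows "Loewner_chain G b (evolution G s b w) = Loewner_chain G s w"
  using Loewner_chain_switch[OF G G G w \<open>s \<le> b\<close>] by simp

lemma Loewner_chain_neg:
  assumes w: "norm (w :: complex^'n) < 1"
  shows "Loewner_chain (\<lambda>z t. on_ball (\<lambda>z. - z) z) s w = exp s *\<^sub>R w"
proof (rule Loewner_chain_eqI[OF total_Herglotz_field_autonomous[OF neg_in_class_M] w])
  have "\<forall>\<^sub>F t in at_top. exp s *\<^sub>R w = exp t *\<^sub>R evolution (\<lambda>z t. on_ball (\<lambda>z. - z) z) s t w"
    using eventually_ge_at_top[of s]
  proof eventually_elim
    fix t assume "s \<le> t"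
    have "exp s = exp t * exp (- (t - s))" by (simp only: exp_add[symmetric]) simp
    then show "exp s *\<^sub>R w = exp t *\<^sub>R evolution (\<lambda>z t. on_ball (\<lambda>z. - z) z) s t w"
      by (simp only: evolution_neg[OF w \<open>s \<le> t\<close>] scaleR_scaleR)
  qed
  then show "((\<lambda>t. exp t *\<^sub>R evolution (\<lambda>z t. on_ball (\<lambda>z. - z) z) s t w) \<longlongrightarrow> exp s *\<^sub>R w) at_top"
    by (rule Lim_transform_eventually[OF tendsto_const])
qed

lemma Loewner_chain_shift:
  assumes G: "total_Herglotz_field G" and w: "norm w < 1"
  shows "Loewner_chain (\<lambda>z t. G z (t + c)) s w = exp (- c) *\<^sub>R Loewner_chain G (s + c) w"
proof (rule Loewner_chain_eqI[OF total_Herglotz_field_shift[OF G] w])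
  have "filterlim (\<lambda>t. t + c) at_top at_top" 
    using filterlim_tendsto_add_at_top[OF tendsto_const filterlim_ident, of c] by (simp add: add.commute)
  from filterlim_compose[OF Loewner_chain_tendsto[OF G w, of "s + c"] this]
  have "((\<lambda>t. exp (- c) *\<^sub>R exp (t + c) *\<^sub>R evolution G (s + c) (t + c) w) \<longlongrightarrow> exp (- c) *\<^sub>R Loewner_chain G (s + c) w) at_top"
    by (intro tendsto_intros)
  moreover have "\<forall>\<^sub>F t in at_top. exp (- c) *\<^sub>R exp (t + c) *\<^sub>R evolution G (s + c) (t + c) w =
      exp t *\<^sub>R evolution (\<lambda>z t. G z (t + c)) s t w"
    using eventually_ge_at_top[of s]
    by eventually_elim (simp add: evolution_shift[OF G w] exp_add[symmetric])
  ultimately show "((\<lambda>t. exp t *\<^sub>R evolution (\<lambda>z t. G z (t + c)) s t w) \<longlongrightarrow> exp (- c) *\<^sub>R Loewner_chain G (s + c) w) at_top"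
    by (rule Lim_transform_eventually)
qed


text \<open>The two-sided comparison of trajectories, multiplied by \<open>exp s\<close>, survives
  the limit. The lower bound is a quantitative form of univalence and gives the invertibility of the
  derivative.\<close>

lemma Loewner_chain_bounds:
  assumes r: "0 < r" "r < 1"
  obtains E where "E \<ge> 1"
    "\<And>G s w w'. total_Herglotz_field G \<Longrightarrow> norm (w :: complex^'n) \<le> r \<Longrightarrow> norm w' \<le> r \<Longrightarrow>
       norm (Loewner_chain G s w - Loewner_chain G s w') \<le> E * exp s * norm (w - w')"
    "\<And>G s w w'. total_Herglotz_field G \<Longrightarrow> norm (w :: complex^'n) \<le> r \<Longrightarrow> norm w' \<le> r \<Longrightarrow>
       exp s * norm (w - w') \<le> E * norm (Loewner_chain G s w - Loewner_chain G s w')"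
proof -
  obtain E where E: "E \<ge> 1" "\<And>G s x y t. total_Herglotz_field G \<Longrightarrow> is_trajectory G s x \<Longrightarrow> is_trajectory G s y \<Longrightarrow>
       norm (x s :: complex^'n) \<le> r \<Longrightarrow> norm (y s) \<le> r \<Longrightarrow> s \<le> t \<Longrightarrow>
       exp (t - s) * norm (x t - y t) \<le> E * norm (x s - y s) \<and>
       norm (x s - y s) \<le> E * (exp (t - s) * norm (x t - y t))"
    using trajectory_difference_bounds[OF r] by metis
  have *: "norm (Loewner_chain G s w - Loewner_chain G s w') \<le> E * exp s * norm (w - w') \<and>
      exp s * norm (w - w') \<le> E * norm (Loewner_chain G s w - Loewner_chain G s w')"
    if G: "total_Herglotz_field G" and wr: "norm w \<le> r" and w'r: "norm w' \<le> r" for G s and w w' :: "complex^'n"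
  proof -
    have w: "norm w < 1" "norm w' < 1" using r wr w'r by auto
    define d where "d t = norm (exp t *\<^sub>R evolution G s t w - exp t *\<^sub>R evolution G s t w')" for t
    have lim: "(d \<longlongrightarrow> norm (Loewner_chain G s w - Loewner_chain G s w')) at_top"
      unfolding d_def by (intro tendsto_intros Loewner_chain_tendsto G w)
    have est: "d t \<le> E * exp s * norm (w - w') \<and> exp s * norm (w - w') \<le> E * d t" if "s \<le> t" for t
    proof -
      note e = evolution_trajectory[OF G w(1), where s = s] evolution_trajectory[OF G w(2), where s = s]
      have dt: "d t = exp s * (exp (t - s) * norm (evolution G s t w - evolution G s t w'))"
        by (simp add: d_def scaleR_right_diff_distrib[symmetric] exp_diff)
      have *: "exp (t - s) * norm (evolution G s t w - evolution G s t w') \<le> E * norm (w - w')"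
        "norm (w - w') \<le> E * (exp (t - s) * norm (evolution G s t w - evolution G s t w'))"
        using E(2)[OF G e(1) e(3) _ _ that] e(2,4) wr w'r by auto
      have "exp s * (exp (t - s) * norm (evolution G s t w - evolution G s t w')) \<le> exp s * (E * norm (w - w'))"
        "exp s * norm (w - w') \<le> exp s * (E * (exp (t - s) * norm (evolution G s t w - evolution G s t w')))"
        using * by (intro mult_left_mono; simp)+
      then show ?thesis unfolding dt by (simp add: mult_ac)
    qed
    have "norm (Loewner_chain G s w - Loewner_chain G s w') \<le> E * exp s * norm (w - w')"
      by (rule tendsto_upperbound[OF lim]) (use est in \<open>auto simp: eventually_at_top_linorder\<close>)
    moreover have "exp s * norm (w - w') \<le> E * norm (Loewner_chain G s w - Loewner_chain G s w')"
      by (rule tendsto_lowerbound[OF tendsto_mult_left[OF lim]]) (use est in \<open>auto simp: eventually_at_top_linorder\<close>)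
    ultimately show ?thesis by blast
  qed
  show thesis by (rule that[OF E(1)]) (use * in blast)+
qed

lemma Loewner_chain_zero:
  assumes G: "total_Herglotz_field G"
  shows "Loewner_chain G s 0 = 0" and "s \<le> t \<Longrightarrow> evolution G s t 0 = 0"
proof -
  show ev: "evolution G s t 0 = 0" if "s \<le> t" for t
    using evolution_eq[OF G is_trajectory_zero[OF G] that] by simp
  have "\<forall>\<^sub>F t in at_top. 0 = exp t *\<^sub>R evolution G s t 0"
    using eventually_ge_at_top[of s] by eventually_elim (simp add: ev)
  then show "Loewner_chain G s 0 = 0"
    by (intro Loewner_chain_eqI[OF G]) (auto intro: Lim_transform_eventually[OF tendsto_const])
qed

text \<open>The rate of convergence evaluated at the starting time \<open>t = s\<close> already
  compares the chain with \<open>exp s *\<^sub>R w\<close> up to a quadratic error.\<close>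

lemma Loewner_chain_has_derivative_at_0:
  assumes G: "total_Herglotz_field G"
  shows "(Loewner_chain G s has_derivative (\<lambda>v. exp s *\<^sub>R v)) (at 0)"
proof -
  have half: "0 < (1/2 :: real)" "(1/2 :: real) < 1" by simp_all
  obtain C where C: "\<And>G s w t. total_Herglotz_field G \<Longrightarrow> norm (w :: complex^'a) \<le> 1/2 \<Longrightarrow> s \<le> t \<Longrightarrow>
       norm (exp t *\<^sub>R evolution G s t w - Loewner_chain G s w) \<le> C * exp (2 * s) * (norm w)\<^sup>2 * exp (- t)"
    using Loewner_chain_limit[OF half] by metis
  show ?thesis
  proof (rule has_derivative_if_quadratic[where \<rho> = "1/2" and C = "C * exp s"])
    show "bounded_linear ((*\<^sub>R) (exp s) :: complex^'a \<Rightarrow> complex^'a)" by (rule bounded_linear_scaleR_right)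
    fix v :: "complex^'a" assume v: "norm v < 1/2"
    have "norm (exp s *\<^sub>R v - Loewner_chain G s v) \<le> C * exp (2 * s) * (norm v)\<^sup>2 * exp (- s)"
      using C[OF G, of v s s] v evolution_trajectory(2)[OF G, of v s] by simp
    also have "\<dots> = C * (exp (2 * s) * exp (- s)) * (norm v)\<^sup>2" by (simp add: mult_ac)
    also have "exp (2 * s) * exp (- s) = exp s" by (simp add: exp_add[symmetric])
    finally show "norm (Loewner_chain G s (0 + v) - Loewner_chain G s 0 - exp s *\<^sub>R v) \<le> C * exp s * (norm v)\<^sup>2"
      by (simp add: Loewner_chain_zero(1)[OF G] norm_minus_commute)
  qed simp
qed

section \<open>Loewner chains and membership in \<open>class_S0\<close>\<close>

lemma compact_subset_unit_ball:
  fixes K :: "'a::euclidean_space set"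
  assumes "compact K" "K \<subseteq> ball 0 1"
  obtains r where "0 < r" "r < 1" "K \<subseteq> cball 0 r"
proof (cases "K = {}")
  case True
  then show thesis using that[of "1/2"] by simp
next
  case False
  obtain z where z: "z \<in> K" "\<And>y. y \<in> K \<Longrightarrow> norm y \<le> norm z"
    using continuous_attains_sup[OF assms(1) False, of norm] by (auto intro: continuous_intros)
  have "norm z < 1" using z(1) assms(2) by auto
  then show thesis
    by (intro that[of "(1 + norm z) / 2"]) (use z(2) in \<open>auto intro: add_pos_nonneg order_trans\<close>, fastforce)
qed

lemma AE_lebesgue_on_pos_iff:
  "(AE t in lebesgue_on {0<..}. P t) \<longleftrightarrow> (AE t in lebesgue. t > 0 \<longrightarrow> P t)" for P :: "real \<Rightarrow> bool"
  by (subst AE_restrict_space_iff) auto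

text \<open>The rate of convergence depends only on the radius, hence convergence is uniform on
  compact sets. In this way every glued field provides an admissible competitor for the extremal
  problem.\<close>

lemma Loewner_chain_in_class_S0:
  fixes G :: "complex^'n \<Rightarrow> real \<Rightarrow> complex^'n"
  assumes G: "total_Herglotz_field G"
  shows "on_ball (Loewner_chain G 0) \<in> class_S0"
proof -
  have "G z \<in> borel_measurable (lebesgue_on {0<..})" for z
    using G measurable_restrict_space1[of "G z" lebesgue borel] by (simp add: total_Herglotz_field_def)
  then have "Herglotz_field G"
    using G unfolding Herglotz_field_def total_Herglotz_field_def by auto
  moreover have "Loewner_flow G (evolution G 0)"
    unfolding Loewner_flow_def AE_lebesgue_on_pos_iff
    using evolution_trajectory[OF G, where s = 0] unfolding is_trajectory_def by auto
  moreover have "uniform_limit K (\<lambda>t z. exp t *\<^sub>R evolution G 0 t z) (on_ball (Loewner_chain G 0)) at_top"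
    if K: "compact K" "K \<subseteq> ball 0 1" for K
  proof -
    obtain r where r: "0 < r" "r < 1" "K \<subseteq> cball 0 r" using compact_subset_unit_ball[OF K] by blast
    obtain C where C: "C > 0" "\<And>G s w t. total_Herglotz_field G \<Longrightarrow> norm (w :: complex^'n) \<le> r \<Longrightarrow> s \<le> t \<Longrightarrow>
       norm (exp t *\<^sub>R evolution G s t w - Loewner_chain G s w) \<le> C * exp (2 * s) * (norm w)\<^sup>2 * exp (- t)"
      using Loewner_chain_limit[OF r(1,2)] by metis
    show ?thesis
    proof (rule uniform_limitI)
      fix e :: real assume "e > 0"
      have "((\<lambda>t. C * exp (- t)) \<longlongrightarrow> C * 0) at_top"
        by (intro tendsto_mult_left filterlim_compose[OF exp_at_bot filterlim_uminus_at_bot_at_top])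
      then have "\<forall>\<^sub>F t in at_top. C * exp (- t) < e" using \<open>e > 0\<close> by (intro order_tendstoD(2)) auto
      then show "\<forall>\<^sub>F t in at_top. \<forall>z\<in>K. dist (exp t *\<^sub>R evolution G 0 t z) (on_ball (Loewner_chain G 0) z) < e"
        using eventually_ge_at_top[of 0]
      proof (eventually_elim, intro ballI)
        fix t z assume t: "C * exp (- t) < e" "0 \<le> t" and z: "z \<in> K"
        have zr: "norm z \<le> r" "z \<in> ball 0 1" using z r K by auto
        have "norm (exp t *\<^sub>R evolution G 0 t z - Loewner_chain G 0 z) \<le> C * (norm z)\<^sup>2 * exp (- t)"
          using C(2)[OF G zr(1) t(2)] by simp
        also have "\<dots> \<le> C * 1 * exp (- t)"
          using zr r C(1) by (intro mult_right_mono mult_left_mono) (auto simp: power_le_one)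
        finally show "dist (exp t *\<^sub>R evolution G 0 t z) (on_ball (Loewner_chain G 0) z) < e"
          using t(1) zr(2) by (simp add: dist_norm on_ball_def)
      qed
    qed
  qed
  ultimately show ?thesis
    unfolding class_S0_def is_f_of_def by (auto simp: on_ball_def)
qed

text \<open>The good times differ from the half line by a null set and are therefore Lebesgue
  measurable; at all other times the field \<open>-z\<close> is inserted. Points outside the ball
  cause no trouble, since maps in \<open>class_M\<close> vanish there.\<close>

lemma total_Herglotz_field_of_Herglotz_field:
  fixes G :: "complex^'n \<Rightarrow> real \<Rightarrow> complex^'n"
  assumes G: "Herglotz_field G"
  obtains G' where "total_Herglotz_field G'"
    "AE t in lebesgue. t > 0 \<longrightarrow> (\<lambda>z. G z t) \<in> class_M \<and> (\<forall>z. G' z t = G z t)"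
proof -
  define A where "A = {t. t > 0 \<and> (\<lambda>z. G z t) \<in> class_M}"
  have ae: "AE t in lebesgue. t > 0 \<longrightarrow> (\<lambda>z. G z t) \<in> class_M"
    using G unfolding Herglotz_field_def AE_lebesgue_on_pos_iff by blast
  then obtain N where N: "negligible N" "{t. \<not> (t > 0 \<longrightarrow> (\<lambda>z. G z t) \<in> class_M)} \<subseteq> N"
    unfolding eventually_ae_filter_negligible by blast
  have "negligible ({0<..} - A)"
    by (rule negligible_subset[OF N(1)]) (use N(2) in \<open>auto simp: A_def\<close>)
  from negligible_imp_sets[OF this] have "{0<..} - ({0<..} - A) \<in> sets lebesgue"
    by (rule sets.Diff[rotated]) simp
  also have "{0<..} - ({0<..} - A) = A" by (auto simp: A_def)
  finally have A: "A \<in> sets lebesgue" .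
  define G' where "G' z t = (if t \<in> A then G z t else on_ball (\<lambda>z. - z) z)" for z t
  show thesis
  proof (rule that[of G'])
    show "total_Herglotz_field G'"
      unfolding total_Herglotz_field_def
    proof (intro conjI allI)
      show "(\<lambda>z. G' z t) \<in> class_M" for t
        using neg_in_class_M by (cases "t \<in> A") (auto simp: G'_def A_def)
      fix z
      show "G' z \<in> borel_measurable lebesgue"
      proof (cases "z \<in> ball 0 1")
        case True
        have "G z \<in> borel_measurable (lebesgue_on {0<..})" using G True unfolding Herglotz_field_def by blast
        then have "(\<lambda>t. if t \<in> {0<..} then G z t else 0) \<in> borel_measurable lebesgue"
          by (subst borel_measurable_if) auto
        then have "(\<lambda>t. if t \<in> A then (if t \<in> {0<..} then G z t else 0) else on_ball (\<lambda>z. - z) z) \<in> borel_measurable lebesgue"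
          using A by (intro measurable_If_set[where f = "\<lambda>t. if t \<in> {0<..} then G z t else 0"]) auto
        also have "(\<lambda>t. if t \<in> A then (if t \<in> {0<..} then G z t else 0) else on_ball (\<lambda>z. - z) z) = G' z"
          by (auto simp: G'_def A_def fun_eq_iff)
        finally show ?thesis .
      next
        case False
        then have "G' z = (\<lambda>t. 0)"
          by (auto simp: G'_def A_def on_ball_def fun_eq_iff class_M_def Hol_def)
        then show ?thesis by simp
      qed
    qed
    show "AE t in lebesgue. t > 0 \<longrightarrow> (\<lambda>z. G z t) \<in> class_M \<and> (\<forall>z. G' z t = G z t)"
      using ae by eventually_elim (auto simp: G'_def A_def)
  qed
qed

lemma is_f_of_eq_Loewner_chain:
  fixes G :: "complex^'n \<Rightarrow> real \<Rightarrow> complex^'n"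
  assumes G': "total_Herglotz_field G'" and ae: "AE t in lebesgue. t > 0 \<longrightarrow> (\<forall>z. G' z t = G z t)"
    and f: "is_f_of G f"
  shows "f = on_ball (Loewner_chain G' 0)"
proof
  fix z
  show "f z = on_ball (Loewner_chain G' 0) z"
  proof (cases "z \<in> ball 0 1")
    case True
    then have z: "norm z < 1" by simp
    obtain \<phi> where \<phi>: "Loewner_flow G \<phi>"
      and lim: "\<And>K. compact K \<Longrightarrow> K \<subseteq> ball 0 1 \<Longrightarrow> uniform_limit K (\<lambda>t z. exp t *\<^sub>R \<phi> t z) f at_top"
      using f unfolding is_f_of_def by blast
    have p: "\<phi> 0 z = z" "\<And>t. t \<ge> 0 \<Longrightarrow> \<phi> t z \<in> ball 0 1"
      "\<And>T. T \<ge> 0 \<Longrightarrow> abs_continuous_on_interval 0 T (\<lambda>t. \<phi> t z)"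
      "AE t in lebesgue. t > 0 \<longrightarrow> ((\<lambda>s. \<phi> s z) has_vector_derivative G (\<phi> t z) t) (at t)"
      using \<phi> True unfolding Loewner_flow_def AE_lebesgue_on_pos_iff by blast+
    have "is_trajectory G' 0 (\<lambda>t. \<phi> t z)"
      unfolding is_trajectory_def
    proof (intro conjI allI impI p)
      show "AE t in lebesgue. t > 0 \<longrightarrow> ((\<lambda>s. \<phi> s z) has_vector_derivative G' (\<phi> t z) t) (at t)"
        using p(4) ae by eventually_elim auto
    qed
    from evolution_eq[OF G' this] have ev: "evolution G' 0 t z = \<phi> t z" if "t \<ge> 0" for t
      using that p(1) by simp
    have "((\<lambda>t. exp t *\<^sub>R \<phi> t z) \<longlongrightarrow> f z) at_top"
      using tendsto_uniform_limitI[OF lim[of "{z}"], of z] True by simp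
    moreover have "\<forall>\<^sub>F t in at_top. exp t *\<^sub>R \<phi> t z = exp t *\<^sub>R evolution G' 0 t z"
      using eventually_ge_at_top[of 0] by eventually_elim (simp add: ev)
    ultimately have "((\<lambda>t. exp t *\<^sub>R evolution G' 0 t z) \<longlongrightarrow> f z) at_top"
      by (rule Lim_transform_eventually)
    then show ?thesis using Loewner_chain_eqI[OF G' z] True by (simp add: on_ball_def)
  next
    case False
    then show ?thesis using f unfolding is_f_of_def by (auto simp: on_ball_def)
  qed
qed

lemma class_S0_eq_Loewner_chain:
  assumes "f \<in> class_S0"
  obtains G where "total_Herglotz_field G" "f = on_ball (Loewner_chain G 0)"
proof -
  obtain G where G: "Herglotz_field G" "is_f_of G f" using assms unfolding class_S0_def by blast
  obtain G' where G': "total_Herglotz_field G'"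
    "AE t in lebesgue. t > 0 \<longrightarrow> (\<lambda>z. G z t) \<in> class_M \<and> (\<forall>z. G' z t = G z t)"
    using total_Herglotz_field_of_Herglotz_field[OF G(1)] by blast
  have "AE t in lebesgue. t > 0 \<longrightarrow> (\<forall>z. G' z t = G z t)" using G'(2) by eventually_elim auto
  from is_f_of_eq_Loewner_chain[OF G'(1) this G(2)] show thesis using that G'(1) by blast
qed

text \<open>Holomorphy of the evolution maps: continuing the field by \<open>-z\<close> after time \<open>t\<close> turns the evolution
  up to time \<open>t\<close> into a multiple of an element of \<^const>\<open>class_S0\<close>.\<close>

lemma evolution_holomorphic:
  fixes G :: "complex^'n \<Rightarrow> real \<Rightarrow> complex^'n"
  assumes S: "class_S0 \<subseteq> (Hol :: (complex^'n \<Rightarrow> complex^'n) set)"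
    and G: "total_Herglotz_field G" and "s \<le> t"
  shows "holomorphic_map_on (evolution G s t) (ball 0 1)"
proof -
  let ?N = "\<lambda>z t. on_ball (\<lambda>z. - z) z"
  define G1 where "G1 z u = G z (u + s)" for z u
  have G1: "total_Herglotz_field G1" unfolding G1_def[abs_def] by (rule total_Herglotz_field_shift[OF G])
  have N: "total_Herglotz_field ?N" by (rule total_Herglotz_field_autonomous[OF neg_in_class_M])
  define G2 where "G2 z u = (if u \<le> t - s then G1 z u else ?N z u)" for z u
  have G2: "total_Herglotz_field G2" unfolding G2_def[abs_def] by (rule total_Herglotz_field_switch[OF G1 N])
  have eq: "exp (s - t) *\<^sub>R on_ball (Loewner_chain G2 0) z = evolution G s t z" if "z \<in> ball 0 1" for z
  proof -
    have z: "norm z < 1" using that by simp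
    have "Loewner_chain G2 0 z = Loewner_chain ?N (t - s) (evolution G1 0 (t - s) z)"
      by (rule Loewner_chain_switch[OF G2 G1 N z]) (use \<open>s \<le> t\<close> in \<open>auto simp: G2_def\<close>)
    also have "\<dots> = exp (t - s) *\<^sub>R evolution G1 0 (t - s) z"
      using \<open>s \<le> t\<close> by (intro Loewner_chain_neg norm_evolution_less[OF G1 z]) simp
    also have "evolution G1 0 (t - s) z = evolution G s t z"
      unfolding G1_def[abs_def] using evolution_shift[OF G z, of 0 "t - s" s] \<open>s \<le> t\<close> by simp
    finally show ?thesis using that by (simp add: on_ball_def exp_add[symmetric])
  qed
  have "holomorphic_map_on (on_ball (Loewner_chain G2 0)) (ball 0 1)"
    using Loewner_chain_in_class_S0[OF G2] S by (intro Hol_holomorphic) blast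
  then have "holomorphic_map_on (\<lambda>z. complex_of_real (exp (s - t)) *s on_ball (Loewner_chain G2 0) z) (ball 0 1)"
    by (rule holomorphic_map_on_cmult)
  then show ?thesis
    by (rule holomorphic_map_on_transform) (use eq in \<open>auto simp: scaleR_eq_vector_scalar_mult\<close>)
qed

text \<open>Shifting time by \<open>s\<close> turns the chain at time \<open>s\<close> into
  \<open>exp s\<close> times a member of \<open>class_S0\<close>, whose holomorphy is part of the
  assumption.\<close>

lemma Loewner_chain_holomorphic:
  fixes G :: "complex^'n \<Rightarrow> real \<Rightarrow> complex^'n"
  assumes S: "class_S0 \<subseteq> (Hol :: (complex^'n \<Rightarrow> complex^'n) set)" and G: "total_Herglotz_field G"
  shows "holomorphic_map_on (Loewner_chain G s) (ball 0 1)"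
proof -
  define G1 where "G1 z u = G z (u + s)" for z u
  have G1: "total_Herglotz_field G1" unfolding G1_def[abs_def] by (rule total_Herglotz_field_shift[OF G])
  have eq: "exp s *\<^sub>R on_ball (Loewner_chain G1 0) z = Loewner_chain G s z" if "z \<in> ball 0 1" for z
    unfolding G1_def[abs_def]
    using Loewner_chain_shift[OF G, of z s 0] that by (simp add: on_ball_def exp_add[symmetric])
  have "holomorphic_map_on (on_ball (Loewner_chain G1 0)) (ball 0 1)"
    using Loewner_chain_in_class_S0[OF G1] S by (intro Hol_holomorphic) blast
  then have "holomorphic_map_on (\<lambda>z. complex_of_real (exp s) *s on_ball (Loewner_chain G1 0) z) (ball 0 1)"
    by (rule holomorphic_map_on_cmult)
  then show ?thesis
    by (rule holomorphic_map_on_transform) (use eq in \<open>auto simp: scaleR_eq_vector_scalar_mult\<close>)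
qed

subsection \<open>The compact-open topology and complex differentiability\<close>

lemma zero_in_Hol: "(\<lambda>z. 0) \<in> Hol"
  by (simp add: Hol_def)

lemma add_in_Hol: "f \<in> Hol \<Longrightarrow> g \<in> Hol \<Longrightarrow> (\<lambda>z. f z + g z) \<in> Hol"
  by (simp add: Hol_def holomorphic_map_on_add)

lemma diff_in_Hol: "f \<in> Hol \<Longrightarrow> g \<in> Hol \<Longrightarrow> (\<lambda>z. f z - g z) \<in> Hol"
  by (simp add: Hol_def holomorphic_map_on_diff)

lemma cmult_in_Hol: "f \<in> Hol \<Longrightarrow> (\<lambda>z. c *s f z) \<in> Hol"
  by (simp add: Hol_def holomorphic_map_on_cmult)

lemma Hol_bounded_on_cball:
  assumes "f \<in> Hol" "r < 1"
  obtains M where "M > 0" "\<And>z. z \<in> cball 0 r \<Longrightarrow> norm (f z) \<le> M"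
  using holomorphic_map_on_bounded_locally[OF Hol_holomorphic[OF assms(1)] assms(2)] by blast

lemma topspace_compact_open_topology: "topspace compact_open_topology = Hol"
proof -
  have "(Hol :: (complex^'n \<Rightarrow> complex^'n) set) \<in> {{f \<in> Hol. f ` K \<subseteq> W} | K W. compact K \<and> K \<subseteq> ball 0 1 \<and> open W}"
    by (intro CollectI exI[of _ "{}"] exI[of _ UNIV]) auto
  then show ?thesis
    unfolding compact_open_topology_def topology_generated_by_topspace by auto
qed

text \<open>Induction over the generation of the topology. For a subbasic set, the compact image of
  \<open>K\<close> has a positive distance \<eta> to the complement of \<open>W\<close>, and
  \<open>K\<close> lies in a closed ball of radius below 1.\<close>

lemma compact_open_topology_nhd:
  fixes V :: "(complex^'n \<Rightarrow> complex^'n) set"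
  assumes "openin compact_open_topology V" "f \<in> V"
  obtains r \<eta> where "0 < r" "r < 1" "\<eta> > 0"
    "\<And>g. g \<in> Hol \<Longrightarrow> (\<And>z. z \<in> cball 0 r \<Longrightarrow> norm (g z - f z) < \<eta>) \<Longrightarrow> g \<in> V"
proof -
  define P where "P f V \<longleftrightarrow> (\<exists>r \<eta>. 0 < r \<and> r < 1 \<and> \<eta> > 0 \<and>
    (\<forall>g\<in>Hol. (\<forall>z\<in>cball 0 r. norm (g z - f z) < \<eta>) \<longrightarrow> g \<in> V))" for f and V :: "(complex^'n \<Rightarrow> complex^'n) set"
  have "generate_topology_on {{f \<in> Hol. f ` K \<subseteq> W} | K W. compact K \<and> K \<subseteq> ball 0 1 \<and> open W} V"
    using assms(1) unfolding compact_open_topology_def openin_topology_generated_by_iff .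
  then have "\<forall>f\<in>V. P f V"
  proof induction
    case Empty
    show ?case by simp
  next
    case (Int A B)
    show ?case
    proof
      fix f assume f: "f \<in> A \<inter> B"
      obtain r1 \<eta>1 where 1: "0 < r1" "r1 < 1" "\<eta>1 > 0" "\<And>g. g \<in> Hol \<Longrightarrow> (\<forall>z\<in>cball 0 r1. norm (g z - f z) < \<eta>1) \<Longrightarrow> g \<in> A"
        using Int(3) f unfolding P_def by blast
      obtain r2 \<eta>2 where 2: "0 < r2" "r2 < 1" "\<eta>2 > 0" "\<And>g. g \<in> Hol \<Longrightarrow> (\<forall>z\<in>cball 0 r2. norm (g z - f z) < \<eta>2) \<Longrightarrow> g \<in> B"
        using Int(4) f unfolding P_def by blast
      show "P f (A \<inter> B)"
        unfolding P_def using 1 2 by (intro exI[of _ "max r1 r2"] exI[of _ "min \<eta>1 \<eta>2"]) auto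
    qed
  next
    case (UN K)
    show ?case
    proof
      fix f assume "f \<in> \<Union>K"
      then obtain A where A: "A \<in> K" "f \<in> A" by blast
      then have "P f A" using UN by blast
      then show "P f (\<Union>K)" unfolding P_def using A(1) by blast
    qed
  next
    case (Basis S)
    then obtain K W where KW: "S = {f \<in> Hol. f ` K \<subseteq> W}" "compact K" "K \<subseteq> ball 0 1" "open W" by blast
    show ?case
    proof
      fix f assume f: "f \<in> S"
      obtain r where r: "0 < r" "r < 1" "K \<subseteq> cball 0 r" using compact_subset_unit_ball[OF KW(2,3)] by blast
      have "continuous_on K f"
        using f KW(1,3) continuous_on_subset[OF holomorphic_map_on_imp_continuous_on[OF Hol_holomorphic]] by blast
      then have "compact (f ` K)" using KW(2) compact_continuous_image by blast
      moreover have "f ` K \<subseteq> W" using f KW(1) by auto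
      ultimately obtain \<eta> where \<eta>: "\<eta> > 0" "(\<Union>x\<in>f ` K. ball x \<eta>) \<subseteq> W"
        using compact_subset_open_imp_ball_epsilon_subset KW(4) by blast
      show "P f S"
        unfolding P_def
      proof (intro exI conjI ballI impI)
        fix g assume g: "g \<in> Hol" "\<forall>z\<in>cball 0 r. norm (g z - f z) < \<eta>"
        have "g z \<in> W" if "z \<in> K" for z
        proof -
          have "g z \<in> ball (f z) \<eta>"
            using g(2) that r(3) by (auto simp: dist_norm norm_minus_commute)
          then show ?thesis using \<eta>(2) that by blast
        qed
        then show "g \<in> S" using g(1) KW(1) by auto
      qed (use r \<eta> in auto)
    qed
  qed
  then have "P f V" using assms(2) by blast
  then show thesis unfolding P_def using that by blast
qed

text \<open>Closeness to \<open>f\<close> on a closed ball is enforced by finitely many subbasic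
  conditions: the ball is covered by small balls on which \<open>f\<close> varies by less than
  \<open>\<eta> / 4\<close>, and \<open>g\<close> has to map each of them near the value of
  \<open>f\<close> at the centre.\<close>

lemma openin_compact_open_topologyI:
  fixes V :: "(complex^'n \<Rightarrow> complex^'n) set"
  assumes V: "V \<subseteq> Hol" and nhd: "\<And>f. f \<in> V \<Longrightarrow> \<exists>r<1. \<exists>\<eta>>0. \<forall>g\<in>Hol. (\<forall>z\<in>cball 0 r. norm (g z - f z) < \<eta>) \<longrightarrow> g \<in> V"
  shows "openin compact_open_topology V"
proof (subst openin_subopen, intro ballI)
  fix f assume f: "f \<in> V"
  then obtain r \<eta> where r: "r < 1" "\<eta> > 0" "\<And>g. g \<in> Hol \<Longrightarrow> (\<forall>z\<in>cball 0 r. norm (g z - f z) < \<eta>) \<Longrightarrow> g \<in> V"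
    using nhd by blast
  have contf: "continuous_on (cball 0 r) f"
    using f V r(1) by (intro continuous_on_subset[OF holomorphic_map_on_imp_continuous_on[OF Hol_holomorphic]]) auto
  have "\<forall>z\<in>cball 0 r. \<exists>\<delta>>0. \<forall>y\<in>cball 0 r. dist y z \<le> \<delta> \<longrightarrow> dist (f y) (f z) < \<eta> / 4"
  proof
    fix z :: "complex^'n" assume "z \<in> cball 0 r"
    then obtain d where "d > 0" "\<And>y. y \<in> cball 0 r \<Longrightarrow> dist y z < d \<Longrightarrow> dist (f y) (f z) < \<eta> / 4"
      using contf r(2) unfolding continuous_on_iff by (metis zero_less_divide_iff zero_less_numeral)
    then show "\<exists>\<delta>>0. \<forall>y\<in>cball 0 r. dist y z \<le> \<delta> \<longrightarrow> dist (f y) (f z) < \<eta> / 4"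
      by (intro exI[of _ "d / 2"]) auto
  qed
  from bchoice[OF this] obtain \<delta> where \<delta>: "\<And>z. z \<in> cball 0 r \<Longrightarrow> \<delta> z > 0"
    "\<And>z y. z \<in> cball 0 r \<Longrightarrow> y \<in> cball 0 r \<Longrightarrow> dist y z \<le> \<delta> z \<Longrightarrow> dist (f y) (f z) < \<eta> / 4"
    by blast
  have "cball 0 r \<subseteq> (\<Union>z\<in>cball 0 r. ball z (\<delta> z))" using \<delta>(1) by force
  then obtain Z where Z: "Z \<subseteq> cball 0 r" "finite Z" "cball 0 r \<subseteq> (\<Union>z\<in>Z. ball z (\<delta> z))"
    by (rule compactE_image[OF compact_cball, of "cball 0 r" "\<lambda>z. ball z (\<delta> z)", rotated]) auto
  \<comment> \<open>The last factor makes the intersection an open set of \<open>Hol\<close> also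
    when \<open>Z\<close> is empty.\<close>
  define T where "T = (\<Inter>z\<in>Z. {g \<in> Hol. g ` (cball z (\<delta> z) \<inter> cball 0 r) \<subseteq> ball (f z) (\<eta> / 2)}) \<inter> topspace compact_open_topology"
  show "\<exists>T. openin compact_open_topology T \<and> f \<in> T \<and> T \<subseteq> V"
  proof (intro exI conjI)
    show "openin compact_open_topology T"
      unfolding T_def
    proof (rule openin_INT[OF Z(2)])
      fix z assume "z \<in> Z"
      show "openin compact_open_topology {g \<in> Hol. g ` (cball z (\<delta> z) \<inter> cball 0 r) \<subseteq> ball (f z) (\<eta> / 2)}"
        unfolding compact_open_topology_def
      proof (rule topology_generated_by_Basis, intro CollectI exI conjI)
        show "cball z (\<delta> z) \<inter> cball 0 r \<subseteq> ball 0 1" using r(1) by auto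
      qed (auto intro: compact_Int)
    qed
    show "f \<in> T"
      unfolding T_def topspace_compact_open_topology
    proof (intro IntI INT_I CollectI conjI image_subsetI)
      fix z y :: "complex^'n" assume z: "z \<in> Z" and y: "y \<in> cball z (\<delta> z) \<inter> cball 0 r"
      have "dist (f y) (f z) < \<eta> / 4" using \<delta>(2)[of z y] Z(1) z y by (auto simp: dist_commute)
      then show "f y \<in> ball (f z) (\<eta> / 2)" using r(2) by (simp add: dist_commute)
    qed (use f V in auto)
    show "T \<subseteq> V"
    proof
      fix g assume g: "g \<in> T"
      have "g \<in> Hol" using g by (simp add: T_def topspace_compact_open_topology)
      moreover have "norm (g y - f y) < \<eta>" if y: "y \<in> cball 0 r" for y :: "complex^'n"
      proof -
        obtain z where z: "z \<in> Z" "y \<in> ball z (\<delta> z)" using Z(3) y by blast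
        have "y \<in> cball z (\<delta> z) \<inter> cball 0 r" using z(2) y by simp
        then have "g y \<in> ball (f z) (\<eta> / 2)" using g z(1) unfolding T_def by blast
        moreover have "dist (f y) (f z) < \<eta> / 4" using \<delta>(2)[of z y] Z(1) z y by (auto simp: dist_commute)
        ultimately have "dist (g y) (f y) < \<eta>"
          using dist_triangle2[of "g y" "f y" "f z"] r(2) by (simp add: dist_commute)
        then show ?thesis by (simp add: dist_norm)
      qed
      ultimately show "g \<in> V" using r(3) by blast
    qed
  qed
qed

text \<open>Rescale \<open>f\<close> so that its supremum falls below \<eta>. The factor 2 and the
  auxiliary \<open>e\<close> make the scaled bound strict and cover the case
  \<open>M = 0\<close>.\<close>

lemma linear_functional_bound:
  fixes l :: "(complex^'n \<Rightarrow> complex^'n) \<Rightarrow> complex"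
  assumes scale: "\<And>c f. f \<in> Hol \<Longrightarrow> l (\<lambda>z. c *s f z) = c * l f"
    and small: "\<And>g. g \<in> Hol \<Longrightarrow> (\<And>z. z \<in> cball 0 r \<Longrightarrow> norm (g z) < \<eta>) \<Longrightarrow> norm (l g) < 1"
    and "\<eta> > 0" and f: "f \<in> Hol" "\<And>z. z \<in> cball 0 r \<Longrightarrow> norm (f z) \<le> M" and "M \<ge> 0"
  shows "norm (l f) \<le> 2 / \<eta> * M"
proof -
  have "norm (l f) * (\<eta> / 2) \<le> M"
  proof (rule field_le_epsilon)
    fix e :: real assume "e > 0"
    define c where "c = \<eta> / (2 * (M + e))"
    have c: "c > 0" using \<open>\<eta> > 0\<close> \<open>M \<ge> 0\<close> \<open>e > 0\<close> by (simp add: c_def)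
    have "norm (l (\<lambda>z. complex_of_real c *s f z)) < 1"
    proof (rule small[OF cmult_in_Hol[OF f(1)]])
      fix z :: "complex^'n" assume "z \<in> cball 0 r"
      then have "c * norm (f z) \<le> c * M" using f(2) c by (intro mult_left_mono) auto
      also have "\<dots> < c * (2 * (M + e))" using c \<open>M \<ge> 0\<close> \<open>e > 0\<close> by (intro mult_strict_left_mono) auto
      also have "\<dots> = \<eta>" using \<open>M \<ge> 0\<close> \<open>e > 0\<close> by (simp add: c_def)
      finally show "norm (complex_of_real c *s f z) < \<eta>" using c by (simp add: norm_vector_scalar_mult)
    qed
    then have "c * norm (l f) < 1" using scale[OF f(1)] c by (simp add: norm_mult)
    then show "norm (l f) * (\<eta> / 2) \<le> M + e"
      using \<open>M \<ge> 0\<close> \<open>e > 0\<close> unfolding c_def by (simp add: field_simps)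
  qed
  then show ?thesis using \<open>\<eta> > 0\<close> by (simp add: field_simps)
qed

lemma continuous_linear_functionalI:
  fixes l :: "(complex^'n \<Rightarrow> complex^'n) \<Rightarrow> complex"
  assumes add: "\<And>f g. f \<in> Hol \<Longrightarrow> g \<in> Hol \<Longrightarrow> l (\<lambda>z. f z + g z) = l f + l g"
    and scale: "\<And>c f. f \<in> Hol \<Longrightarrow> l (\<lambda>z. c *s f z) = c * l f"
    and "r < 1" and bound: "\<And>f M. f \<in> Hol \<Longrightarrow> (\<And>z. z \<in> cball 0 r \<Longrightarrow> norm (f z) \<le> M) \<Longrightarrow> M \<ge> 0 \<Longrightarrow> norm (l f) \<le> C * M"
  shows "continuous_linear_functional l"
  unfolding continuous_linear_functional_def
proof (intro conjI ballI allI add scale)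
  show "continuous_map compact_open_topology euclidean l"
    unfolding continuous_map_def topspace_compact_open_topology
  proof (intro conjI allI impI)
    fix U :: "complex set" assume "openin euclidean U"
    then have U: "open U" by simp
    show "openin compact_open_topology {f \<in> Hol. l f \<in> U}"
    proof (rule openin_compact_open_topologyI)
      fix f assume f: "f \<in> {f \<in> Hol. l f \<in> U}"
      then obtain e where e: "e > 0" "ball (l f) e \<subseteq> U" using U open_contains_ball by blast
      define \<eta> where "\<eta> = e / (\<bar>C\<bar> + 1)"
      have "\<eta> > 0" using e(1) by (simp add: \<eta>_def)
      have "g \<in> {f \<in> Hol. l f \<in> U}" if g: "g \<in> Hol" "\<forall>z\<in>cball 0 r. norm (g z - f z) < \<eta>" for g
      proof -
        have "l g = l (\<lambda>z. (g z - f z) + f z)" by simp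
        also have "\<dots> = l (\<lambda>z. g z - f z) + l f" using f g by (intro add diff_in_Hol) auto
        finally have "l g - l f = l (\<lambda>z. g z - f z)" by simp
        also have "norm \<dots> \<le> C * \<eta>"
          using f g \<open>\<eta> > 0\<close> by (intro bound diff_in_Hol) (auto simp: less_imp_le)
        also have "\<dots> \<le> \<bar>C\<bar> * \<eta>" using \<open>\<eta> > 0\<close> by (intro mult_right_mono) auto
        also have "\<dots> < e" using e(1) by (simp add: \<eta>_def field_simps)
        finally have "l g \<in> ball (l f) e" by (simp add: dist_norm norm_minus_commute)
        then show ?thesis using g e(2) by auto
      qed
      then show "\<exists>r<1. \<exists>\<eta>>0. \<forall>g\<in>Hol. (\<forall>z\<in>cball 0 r. norm (g z - f z) < \<eta>) \<longrightarrow> g \<in> {f \<in> Hol. l f \<in> U}"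
        using \<open>r < 1\<close> \<open>\<eta> > 0\<close> by blast
    qed auto
  qed auto
qed auto

section \<open>Complex derivatives of functionals on \<open>Hol\<close>\<close>

context
  fixes \<Phi> :: "(complex^'n \<Rightarrow> complex^'n) \<Rightarrow> complex" and U :: "(complex^'n \<Rightarrow> complex^'n) set"
    and F :: "complex^'n \<Rightarrow> complex^'n"
  assumes cd: "complex_differentiable_at \<Phi> U F" and F: "F \<in> Hol"
begin

lemma directional_derivative_locally_continuous:
  assumes H: "H \<in> Hol" and "e > 0"
  obtains r \<eta> where "0 < r" "r < 1" "\<eta> > 0"
    "\<And>f h. f \<in> Hol \<Longrightarrow> (\<And>z. z \<in> cball 0 r \<Longrightarrow> norm (f z - F z) < \<eta>) \<Longrightarrow> h \<in> Hol \<Longrightarrow>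
       (\<And>z. z \<in> cball 0 r \<Longrightarrow> norm (h z - H z) < \<eta>) \<Longrightarrow>
       norm (directional_derivative \<Phi> f h - directional_derivative \<Phi> F H) < e"
    "\<And>f h. f \<in> Hol \<Longrightarrow> (\<And>z. z \<in> cball 0 r \<Longrightarrow> norm (f z - F z) < \<eta>) \<Longrightarrow> h \<in> Hol \<Longrightarrow>
       ((\<lambda>\<delta>. (\<Phi> (\<lambda>z. f z + \<delta> *s h z) - \<Phi> f) / \<delta>) \<longlongrightarrow> directional_derivative \<Phi> f h) (at 0)"
proof -
  obtain V where V: "openin compact_open_topology V" "F \<in> V"
    and diff: "\<And>f h. f \<in> V \<Longrightarrow> h \<in> Hol \<Longrightarrow> differentiable_along \<Phi> f h"
    and cont: "continuous_map (prod_topology (subtopology compact_open_topology V) compact_open_topology)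
          euclidean (\<lambda>(f, h). directional_derivative \<Phi> f h)"
    using cd unfolding complex_differentiable_at_def by blast
  let ?X = "prod_topology (subtopology compact_open_topology V) (compact_open_topology :: (complex^'n \<Rightarrow> complex^'n) topology)"
  define B where "B = {x \<in> topspace ?X. (\<lambda>(f, h). directional_derivative \<Phi> f h) x \<in> ball (directional_derivative \<Phi> F H) e}"
  have "openin ?X B"
    unfolding B_def by (rule openin_continuous_map_preimage[OF cont]) simp
  moreover have "(F, H) \<in> B"
    using V F H \<open>e > 0\<close> by (simp add: B_def topspace_compact_open_topology)
  ultimately obtain A1 A2 where A: "openin (subtopology compact_open_topology V) A1"
    "openin compact_open_topology A2" "F \<in> A1" "H \<in> A2" "A1 \<times> A2 \<subseteq> B"
    unfolding openin_prod_topology_alt by meson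
  have A1: "openin compact_open_topology A1" "A1 \<subseteq> V"
    using A(1) V(1) by (auto simp: openin_open_subtopology)
  obtain r1 \<eta>1 where 1: "0 < r1" "r1 < 1" "\<eta>1 > 0"
    "\<And>g. g \<in> Hol \<Longrightarrow> (\<And>z. z \<in> cball 0 r1 \<Longrightarrow> norm (g z - F z) < \<eta>1) \<Longrightarrow> g \<in> A1"
    using compact_open_topology_nhd[OF A1(1) A(3)] by blast
  obtain r2 \<eta>2 where 2: "0 < r2" "r2 < 1" "\<eta>2 > 0"
    "\<And>g. g \<in> Hol \<Longrightarrow> (\<And>z. z \<in> cball 0 r2 \<Longrightarrow> norm (g z - H z) < \<eta>2) \<Longrightarrow> g \<in> A2"
    using compact_open_topology_nhd[OF A(2,4)] by blast
  show thesis
  proof (rule that[of "max r1 r2" "min \<eta>1 \<eta>2"])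
    fix f h :: "complex^'n \<Rightarrow> complex^'n"
    assume f: "f \<in> Hol" "\<And>z. z \<in> cball 0 (max r1 r2) \<Longrightarrow> norm (f z - F z) < min \<eta>1 \<eta>2" and h: "h \<in> Hol"
    have fA: "f \<in> A1" using f by (intro 1(4)) auto
    then have fV: "f \<in> V" using A1 by blast
    show "((\<lambda>\<delta>. (\<Phi> (\<lambda>z. f z + \<delta> *s h z) - \<Phi> f) / \<delta>) \<longlongrightarrow> directional_derivative \<Phi> f h) (at 0)"
    proof -
      obtain l where l: "((\<lambda>\<delta>. (\<Phi> (\<lambda>z. f z + \<delta> *s h z) - \<Phi> f) / \<delta>) \<longlongrightarrow> l) (at 0)"
        using diff[OF fV h] unfolding differentiable_along_def by blast
      then have "directional_derivative \<Phi> f h = l"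
        unfolding directional_derivative_def by (intro tendsto_Lim) simp_all
      with l show ?thesis by simp
    qed
    assume "\<And>z. z \<in> cball 0 (max r1 r2) \<Longrightarrow> norm (h z - H z) < min \<eta>1 \<eta>2"
    then have "h \<in> A2" using h by (intro 2(4)) auto
    then have "(f, h) \<in> B" using fA A(5) by blast
    then show "norm (directional_derivative \<Phi> f h - directional_derivative \<Phi> F H) < e"
      by (simp add: B_def dist_norm norm_minus_commute)
  qed (use 1 2 in auto)
qed

text \<open>Mean value inequality on the disc of radius \<open>norm \<epsilon>\<close> for
  \<open>s \<mapsto> \<Phi> (f + s k) - s L\<close>: its derivative is \<Lambda> at
  \<open>(f + s k, k)\<close> minus \<Lambda> at \<open>(F, H)\<close>, which is small by joint
  continuity. Base point and direction may both vary, and the error is uniform in them; additivity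
  and the needle variation depend on this.\<close>

lemma directional_derivative_increment:
  assumes H: "H \<in> Hol" and "e > 0"
  obtains r \<eta> where "0 < r" "r < 1" "\<eta> > 0"
    "\<And>f k \<epsilon>. f \<in> Hol \<Longrightarrow> k \<in> Hol \<Longrightarrow> (\<And>z. z \<in> cball 0 r \<Longrightarrow> norm (k z - H z) < \<eta>) \<Longrightarrow>
       (\<And>z s. z \<in> cball 0 r \<Longrightarrow> norm s \<le> norm \<epsilon> \<Longrightarrow> norm (f z + s *s k z - F z) < \<eta>) \<Longrightarrow>
       norm (\<Phi> (\<lambda>z. f z + \<epsilon> *s k z) - \<Phi> f - \<epsilon> * directional_derivative \<Phi> F H) \<le> e * norm \<epsilon>"
proof -
  obtain r \<eta> where r: "0 < r" "r < 1" "\<eta> > 0"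
    and near: "\<And>f h. f \<in> Hol \<Longrightarrow> (\<And>z. z \<in> cball 0 r \<Longrightarrow> norm (f z - F z) < \<eta>) \<Longrightarrow> h \<in> Hol \<Longrightarrow>
       (\<And>z. z \<in> cball 0 r \<Longrightarrow> norm (h z - H z) < \<eta>) \<Longrightarrow>
       norm (directional_derivative \<Phi> f h - directional_derivative \<Phi> F H) < e"
    and lim: "\<And>f h. f \<in> Hol \<Longrightarrow> (\<And>z. z \<in> cball 0 r \<Longrightarrow> norm (f z - F z) < \<eta>) \<Longrightarrow> h \<in> Hol \<Longrightarrow>
       ((\<lambda>\<delta>. (\<Phi> (\<lambda>z. f z + \<delta> *s h z) - \<Phi> f) / \<delta>) \<longlongrightarrow> directional_derivative \<Phi> f h) (at 0)"
  proof (rule directional_derivative_locally_continuous[OF assms], goal_cases)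
    case (1 r \<eta>)
    show ?case by (rule 1(1)[OF 1(2) 1(3) 1(4) 1(5) 1(6)])
  qed
  show thesis
  proof (rule that[OF r])
    fix f k :: "complex^'n \<Rightarrow> complex^'n" and \<epsilon> :: complex
    assume f: "f \<in> Hol" and k: "k \<in> Hol" "\<And>z. z \<in> cball 0 r \<Longrightarrow> norm (k z - H z) < \<eta>"
      and seg: "\<And>z s. z \<in> cball 0 r \<Longrightarrow> norm s \<le> norm \<epsilon> \<Longrightarrow> norm (f z + s *s k z - F z) < \<eta>"
    define L where "L = directional_derivative \<Phi> F H"
    define u where "u s = \<Phi> (\<lambda>z. f z + s *s k z) - s * L" for s
    define u' where "u' s = directional_derivative \<Phi> (\<lambda>z. f z + s *s k z) k - L" for s
    have "norm (u \<epsilon> - u 0) \<le> e * norm (\<epsilon> - 0)"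
    proof (rule field_differentiable_bound[of "cball 0 (norm \<epsilon>)" u u'])
      fix s :: complex assume "s \<in> cball 0 (norm \<epsilon>)"
      then have s: "norm s \<le> norm \<epsilon>" by simp
      define g where "g z = f z + s *s k z" for z
      have g_eq: "(\<lambda>z. f z + s *s k z) = g" by (simp add: g_def fun_eq_iff)
      have g: "g \<in> Hol" unfolding g_def[abs_def] by (intro add_in_Hol f cmult_in_Hol k)
      have gn: "norm (g z - F z) < \<eta>" if "z \<in> cball 0 r" for z
        using seg[OF that s] by (simp add: g_def)
      have sh: "(\<lambda>z. f z + (s + \<delta>) *s k z) = (\<lambda>z. g z + \<delta> *s k z)" for \<delta>
        by (simp add: g_def fun_eq_iff vector_sadd_rdistrib add.assoc)
      have "((\<lambda>\<delta>. \<Phi> (\<lambda>z. f z + \<delta> *s k z)) has_field_derivative directional_derivative \<Phi> g k) (at s)"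
        unfolding DERIV_def sh g_eq using lim[OF g gn k(1)] by simp
      then have "(u has_field_derivative u' s) (at s)"
        unfolding u_def[abs_def] u'_def g_eq by (auto intro!: derivative_eq_intros)
      then show "(u has_field_derivative u' s) (at s within cball 0 (norm \<epsilon>))"
        by (rule has_field_derivative_at_within)
      show "norm (u' s) \<le> e"
        using near[OF g gn k] unfolding u'_def L_def g_eq by (simp add: less_imp_le)
    qed auto
    then show "norm (\<Phi> (\<lambda>z. f z + \<epsilon> *s k z) - \<Phi> f - \<epsilon> * directional_derivative \<Phi> F H) \<le> e * norm \<epsilon>"
      by (simp add: u_def L_def algebra_simps)
  qed
qed

lemma directional_derivative_tendsto:
  assumes "h \<in> Hol"
  shows "((\<lambda>\<delta>. (\<Phi> (\<lambda>z. F z + \<delta> *s h z) - \<Phi> F) / \<delta>) \<longlongrightarrow> directional_derivative \<Phi> F h) (at 0)"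
proof -
  obtain r \<eta> where r: "\<eta> > 0"
    and lim: "\<And>f h. f \<in> Hol \<Longrightarrow> (\<And>z. z \<in> cball 0 r \<Longrightarrow> norm (f z - F z) < \<eta>) \<Longrightarrow> h \<in> Hol \<Longrightarrow>
       ((\<lambda>\<delta>. (\<Phi> (\<lambda>z. f z + \<delta> *s h z) - \<Phi> f) / \<delta>) \<longlongrightarrow> directional_derivative \<Phi> f h) (at 0)"
  proof (rule directional_derivative_locally_continuous[OF assms zero_less_one], goal_cases)
    case (1 r \<eta>)
    show ?case by (rule 1(1)[OF 1(4) 1(6)])
  qed
  show ?thesis by (rule lim[OF F _ assms]) (use r in simp)
qed

lemma directional_derivative_scale:
  assumes h: "h \<in> Hol"
  shows "directional_derivative \<Phi> F (\<lambda>z. c *s h z) = c * directional_derivative \<Phi> F h"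
proof -
  note lim = directional_derivative_tendsto[OF cmult_in_Hol[OF h, of c]]
  have "((\<lambda>\<delta>. (\<Phi> (\<lambda>z. F z + \<delta> *s (c *s h z)) - \<Phi> F) / \<delta>) \<longlongrightarrow> c * directional_derivative \<Phi> F h) (at 0)"
  proof (cases "c = 0")
    case True
    then show ?thesis by simp
  next
    case False
    have "filterlim (\<lambda>\<delta>. c * \<delta>) (at 0) (at (0::complex))"
      unfolding filterlim_at using False by (auto intro!: tendsto_eq_intros simp: eventually_at_filter)
    from filterlim_compose[OF directional_derivative_tendsto[OF h] this]
    have "((\<lambda>\<delta>. c * ((\<Phi> (\<lambda>z. F z + (c * \<delta>) *s h z) - \<Phi> F) / (c * \<delta>))) \<longlongrightarrow> c * directional_derivative \<Phi> F h) (at 0)"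
      by (intro tendsto_mult_left)
    then show ?thesis using False by (simp add: mult.commute)
  qed
  from LIM_unique[OF lim this] show ?thesis .
qed

text \<open>The increment along \<open>h + k\<close> is split into one along \<open>h\<close> from
  \<open>F\<close> and one along \<open>k\<close> from the displaced point
  \<open>F + \<delta> h\<close>. The uniform increment estimate gives an error of at most
  \<open>e / 2 * norm \<delta>\<close> for each.\<close>

lemma directional_derivative_add:
  assumes h: "h \<in> Hol" and k: "k \<in> Hol"
  shows "directional_derivative \<Phi> F (\<lambda>z. h z + k z) = directional_derivative \<Phi> F h + directional_derivative \<Phi> F k"
proof -
  let ?D = "directional_derivative \<Phi> F"
  have "norm (?D (\<lambda>z. h z + k z) - (?D h + ?D k)) \<le> e" if "e > 0" for e
  proof -
    have "e / 2 > 0" using that by simp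
    obtain r1 \<eta>1 where 1: "0 < r1" "r1 < 1" "\<eta>1 > 0"
      and inc1: "\<And>f k \<epsilon>. f \<in> Hol \<Longrightarrow> k \<in> Hol \<Longrightarrow> (\<And>z. z \<in> cball 0 r1 \<Longrightarrow> norm (k z - h z) < \<eta>1) \<Longrightarrow>
       (\<And>z s. z \<in> cball 0 r1 \<Longrightarrow> norm s \<le> norm \<epsilon> \<Longrightarrow> norm (f z + s *s k z - F z) < \<eta>1) \<Longrightarrow>
       norm (\<Phi> (\<lambda>z. f z + \<epsilon> *s k z) - \<Phi> f - \<epsilon> * ?D h) \<le> e / 2 * norm \<epsilon>"
    proof (rule directional_derivative_increment[OF h \<open>e / 2 > 0\<close>], goal_cases)
    case (1 r \<eta>)
    show ?case by (rule 1(1)[OF 1(2) 1(3) 1(4) 1(5)])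
  qed
    obtain r2 \<eta>2 where 2: "0 < r2" "r2 < 1" "\<eta>2 > 0"
      and inc2: "\<And>f k' \<epsilon>. f \<in> Hol \<Longrightarrow> k' \<in> Hol \<Longrightarrow> (\<And>z. z \<in> cball 0 r2 \<Longrightarrow> norm (k' z - k z) < \<eta>2) \<Longrightarrow>
       (\<And>z s. z \<in> cball 0 r2 \<Longrightarrow> norm s \<le> norm \<epsilon> \<Longrightarrow> norm (f z + s *s k' z - F z) < \<eta>2) \<Longrightarrow>
       norm (\<Phi> (\<lambda>z. f z + \<epsilon> *s k' z) - \<Phi> f - \<epsilon> * ?D k) \<le> e / 2 * norm \<epsilon>"
    proof (rule directional_derivative_increment[OF k \<open>e / 2 > 0\<close>], goal_cases)
    case (1 r \<eta>)
    show ?case by (rule 1(1)[OF 1(2) 1(3) 1(4) 1(5)])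
  qed
    define r where "r = max r1 r2"
    define \<eta> where "\<eta> = min \<eta>1 \<eta>2"
    have r: "r < 1" "\<eta> > 0" using 1 2 by (auto simp: r_def \<eta>_def)
    obtain Mh where Mh: "Mh > 0" "\<And>z. z \<in> cball 0 r \<Longrightarrow> norm (h z) \<le> Mh" using Hol_bounded_on_cball[OF h r(1)] by blast
    obtain Mk where Mk: "Mk > 0" "\<And>z. z \<in> cball 0 r \<Longrightarrow> norm (k z) \<le> Mk" using Hol_bounded_on_cball[OF k r(1)] by blast
    \<comment> \<open>So small that \<open>F + \<delta> h + s k\<close> stays within \<eta> of
      \<open>F\<close> on the ball for all parameters of modulus at most \<open>d\<close>.\<close>
    define d where "d = \<eta> / (2 * (Mh + Mk))"
    have "d > 0" using r Mh(1) Mk(1) by (simp add: d_def)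
    have small: "norm (\<delta> *s h z) + norm (s *s k z) < \<eta>" if "norm \<delta> \<le> d" "norm s \<le> d" "z \<in> cball 0 r" for \<delta> s z
    proof -
      have "norm (\<delta> *s h z) + norm (s *s k z) \<le> d * Mh + d * Mk"
        unfolding norm_vector_scalar_mult using that Mh(2) Mk(2) \<open>d > 0\<close> by (intro add_mono mult_mono) auto
      also have "\<dots> = d * (Mh + Mk)" by (simp add: algebra_simps)
      also have "\<dots> < d * (2 * (Mh + Mk))" using \<open>d > 0\<close> Mh(1) Mk(1) by (intro mult_strict_left_mono) auto
      also have "\<dots> = \<eta>" using Mh(1) Mk(1) by (simp add: d_def)
      finally show ?thesis .
    qed
    have est: "norm ((\<Phi> (\<lambda>z. F z + \<delta> *s (h z + k z)) - \<Phi> F) / \<delta> - (?D h + ?D k)) \<le> e"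
      if \<delta>: "\<delta> \<noteq> 0" "norm \<delta> \<le> d" for \<delta>
    proof -
      have g: "(\<lambda>z. F z + \<delta> *s h z) \<in> Hol" by (intro add_in_Hol F cmult_in_Hol h)
      have a1: "norm (\<Phi> (\<lambda>z. F z + \<delta> *s h z) - \<Phi> F - \<delta> * ?D h) \<le> e / 2 * norm \<delta>"
      proof (rule inc1[OF F h])
        fix z :: "complex^'n" and s :: complex assume "z \<in> cball 0 r1" "norm s \<le> norm \<delta>"
        then have "norm (s *s h z) + norm (0 *s k z) < \<eta>" using \<delta> \<open>d > 0\<close> by (intro small) (auto simp: r_def)
        then show "norm (F z + s *s h z - F z) < \<eta>1" by (simp add: \<eta>_def)
      qed (use 1 in simp)
      have a2: "norm (\<Phi> (\<lambda>z. (F z + \<delta> *s h z) + \<delta> *s k z) - \<Phi> (\<lambda>z. F z + \<delta> *s h z) - \<delta> * ?D k) \<le> e / 2 * norm \<delta>"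
      proof (rule inc2[OF g k])
        fix z :: "complex^'n" and s :: complex assume "z \<in> cball 0 r2" "norm s \<le> norm \<delta>"
        then have "norm (\<delta> *s h z) + norm (s *s k z) < \<eta>" using \<delta> by (intro small) (auto simp: r_def)
        then show "norm (F z + \<delta> *s h z + s *s k z - F z) < \<eta>2"
          using norm_triangle_ineq[of "\<delta> *s h z" "s *s k z"] by (simp add: \<eta>_def)
      qed (use 2 in simp)
      have eq: "(\<lambda>z. F z + \<delta> *s h z + \<delta> *s k z) = (\<lambda>z. F z + \<delta> *s (h z + k z))"
        by (simp add: fun_eq_iff vector_add_ldistrib)
      have "norm (\<Phi> (\<lambda>z. F z + \<delta> *s (h z + k z)) - \<Phi> F - \<delta> * (?D h + ?D k)) \<le> e * norm \<delta>"
        using norm_triangle_ineq[of "\<Phi> (\<lambda>z. F z + \<delta> *s h z) - \<Phi> F - \<delta> * ?D h"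
            "\<Phi> (\<lambda>z. (F z + \<delta> *s h z) + \<delta> *s k z) - \<Phi> (\<lambda>z. F z + \<delta> *s h z) - \<delta> * ?D k"] a1 a2
        unfolding eq by (simp add: algebra_simps)
      then have "norm (\<Phi> (\<lambda>z. F z + \<delta> *s (h z + k z)) - \<Phi> F - \<delta> * (?D h + ?D k)) / norm \<delta> \<le> e"
        using \<delta>(1) by (simp add: field_simps)
      moreover have "(\<Phi> (\<lambda>z. F z + \<delta> *s (h z + k z)) - \<Phi> F) / \<delta> - (?D h + ?D k) =
          (\<Phi> (\<lambda>z. F z + \<delta> *s (h z + k z)) - \<Phi> F - \<delta> * (?D h + ?D k)) / \<delta>"
        using \<delta>(1) by (simp add: field_simps)
      ultimately show ?thesis by (simp add: norm_divide)
    qed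
    have "((\<lambda>\<delta>. norm ((\<Phi> (\<lambda>z. F z + \<delta> *s (h z + k z)) - \<Phi> F) / \<delta> - (?D h + ?D k))) \<longlongrightarrow>
        norm (?D (\<lambda>z. h z + k z) - (?D h + ?D k))) (at 0)"
      by (intro tendsto_intros directional_derivative_tendsto add_in_Hol h k)
    moreover have "\<forall>\<^sub>F \<delta> in at 0. norm ((\<Phi> (\<lambda>z. F z + \<delta> *s (h z + k z)) - \<Phi> F) / \<delta> - (?D h + ?D k)) \<le> e"
      using est \<open>d > 0\<close> unfolding eventually_at by (intro exI[of _ d]) auto
    ultimately show ?thesis by (intro tendsto_upperbound) auto
  qed
  then have "norm (?D (\<lambda>z. h z + k z) - (?D h + ?D k)) \<le> 0"
    using field_le_epsilon[of "norm (?D (\<lambda>z. h z + k z) - (?D h + ?D k))" 0] by simp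
  then show ?thesis by simp
qed

text \<open>Continuity of the derivative at the zero direction gives a neighbourhood on which it is
  below 1, and homogeneity turns this into a bound. The closed ball of radius \<open>r\<close> plays
  the role of a support of the functional.\<close>

lemma directional_derivative_bound:
  obtains r C where "0 < r" "r < 1" "C > 0"
    "\<And>f M. f \<in> Hol \<Longrightarrow> (\<And>z. z \<in> cball 0 r \<Longrightarrow> norm (f z) \<le> M) \<Longrightarrow> M \<ge> 0 \<Longrightarrow>
       norm (directional_derivative \<Phi> F f) \<le> C * M"
proof -
  have D0: "directional_derivative \<Phi> F (\<lambda>z. 0) = 0"
    using directional_derivative_scale[OF zero_in_Hol, of 0] by simp
  obtain r \<eta> where r: "0 < r" "r < 1" "\<eta> > 0"
    and near: "\<And>f h. f \<in> Hol \<Longrightarrow> (\<And>z. z \<in> cball 0 r \<Longrightarrow> norm (f z - F z) < \<eta>) \<Longrightarrow> h \<in> Hol \<Longrightarrow>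
       (\<And>z. z \<in> cball 0 r \<Longrightarrow> norm (h z - 0) < \<eta>) \<Longrightarrow>
       norm (directional_derivative \<Phi> f h - directional_derivative \<Phi> F (\<lambda>z. 0)) < 1"
  proof (rule directional_derivative_locally_continuous[OF zero_in_Hol zero_less_one], goal_cases)
    case (1 r \<eta>)
    show ?case by (rule 1(1)[OF 1(2) 1(3) 1(4) 1(5)])
  qed
  show thesis
  proof (rule that[OF r(1,2)])
    show "2 / \<eta> > 0" using r by simp
    fix f :: "complex^'n \<Rightarrow> complex^'n" and M
    assume f: "f \<in> Hol" "\<And>z. z \<in> cball 0 r \<Longrightarrow> norm (f z) \<le> M" "M \<ge> 0"
    show "norm (directional_derivative \<Phi> F f) \<le> 2 / \<eta> * M"
    proof (rule linear_functional_bound[OF directional_derivative_scale _ r(3) f])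
      show "norm (directional_derivative \<Phi> F g) < 1" if "g \<in> Hol" "\<And>z. z \<in> cball 0 r \<Longrightarrow> norm (g z) < \<eta>" for g
        using near[OF F _ that(1)] that(2) r(3) D0 by simp
    qed
  qed
qed

text \<open>First order condition along a sequence whose directions \<open>k m\<close> merely
  converge to \<open>H\<close>: the increment of \<Phi> is \<epsilon> times the derivative at
  \<open>H\<close> up to an arbitrarily small multiple of \<epsilon>, and it has nonpositive real
  part.\<close>

lemma extremal_variation:
  assumes H: "H \<in> Hol" and k: "\<And>m. k m \<in> Hol"
    and lim: "\<And>r. r < 1 \<Longrightarrow> uniform_limit (cball 0 r) k H sequentially"
    and \<epsilon>: "\<And>m. \<epsilon> m > 0" "\<epsilon> \<longlonglongrightarrow> 0"
    and le: "\<And>m. Re (\<Phi> (\<lambda>z. F z + complex_of_real (\<epsilon> m) *s k m z)) \<le> Re (\<Phi> F)"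
  shows "Re (directional_derivative \<Phi> F H) \<le> 0"
proof (rule field_le_epsilon)
  fix e :: real assume "e > 0"
  obtain r \<eta> where r: "0 < r" "r < 1" "\<eta> > 0"
    and inc: "\<And>f k \<epsilon>. f \<in> Hol \<Longrightarrow> k \<in> Hol \<Longrightarrow> (\<And>z. z \<in> cball 0 r \<Longrightarrow> norm (k z - H z) < \<eta>) \<Longrightarrow>
       (\<And>z s. z \<in> cball 0 r \<Longrightarrow> norm s \<le> norm \<epsilon> \<Longrightarrow> norm (f z + s *s k z - F z) < \<eta>) \<Longrightarrow>
       norm (\<Phi> (\<lambda>z. f z + \<epsilon> *s k z) - \<Phi> f - \<epsilon> * directional_derivative \<Phi> F H) \<le> e * norm \<epsilon>"
  proof (rule directional_derivative_increment[OF H \<open>e > 0\<close>], goal_cases)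
    case (1 r \<eta>)
    show ?case by (rule 1(1)[OF 1(2) 1(3) 1(4) 1(5)])
  qed
  obtain M where M: "M > 0" "\<And>z. z \<in> cball 0 r \<Longrightarrow> norm (H z) \<le> M" using Hol_bounded_on_cball[OF H r(2)] by blast
  have "\<forall>\<^sub>F m in sequentially. \<forall>z\<in>cball 0 r. dist (k m z) (H z) < \<eta>"
    using lim[OF r(2)] r(3) unfolding uniform_limit_iff by blast
  \<comment> \<open>Since \<open>norm (k m z) \<le> M + \<eta>\<close> on the ball, this keeps the
    whole segment from \<open>F\<close> to \<open>F + \<epsilon> k\<close> within \<eta> of
    \<open>F\<close>.\<close>
  moreover have "\<forall>\<^sub>F m in sequentially. \<epsilon> m < \<eta> / (M + \<eta>)"
    by (rule order_tendstoD(2)[OF \<epsilon>(2)]) (use M(1) r(3) in simp)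
  ultimately have "\<forall>\<^sub>F m in sequentially. (\<forall>z\<in>cball 0 r. dist (k m z) (H z) < \<eta>) \<and> \<epsilon> m < \<eta> / (M + \<eta>)"
    by (rule eventually_conj)
  then obtain m where m: "\<And>z. z \<in> cball 0 r \<Longrightarrow> norm (k m z - H z) < \<eta>" "\<epsilon> m < \<eta> / (M + \<eta>)"
    unfolding eventually_sequentially dist_norm by blast
  let ?D = "directional_derivative \<Phi> F H"
  let ?P = "\<Phi> (\<lambda>z. F z + complex_of_real (\<epsilon> m) *s k m z)"
  have "norm (?P - \<Phi> F - complex_of_real (\<epsilon> m) * ?D) \<le> e * norm (complex_of_real (\<epsilon> m))"
  proof (rule inc[OF F k m(1)])
    fix z :: "complex^'n" and s :: complex
    assume z: "z \<in> cball 0 r" and s: "norm s \<le> norm (complex_of_real (\<epsilon> m))"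
    have "norm (k m z) \<le> M + \<eta>"
      using norm_triangle_ineq2[of "k m z" "H z"] m(1)[OF z] M(2)[OF z] by linarith
    then have "norm s * norm (k m z) \<le> \<epsilon> m * (M + \<eta>)"
      using s \<epsilon>(1)[of m] by (intro mult_mono) auto
    also have "\<dots> < \<eta>" using m(2) M(1) r(3) by (simp add: pos_less_divide_eq)
    finally show "norm (F z + s *s k m z - F z) < \<eta>" by (simp add: norm_vector_scalar_mult)
  qed
  then have "\<bar>Re (?P - \<Phi> F - complex_of_real (\<epsilon> m) * ?D)\<bar> \<le> e * \<epsilon> m"
    using abs_Re_le_cmod order_trans \<epsilon>(1)[of m] by fastforce
  then have "\<epsilon> m * Re ?D \<le> e * \<epsilon> m" using le[of m] by simp
  then show "Re ?D \<le> 0 + e" using \<epsilon>(1)[of m] by (simp add: mult.commute)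
qed

end

subsection \<open>Needle variations\<close>

text \<open>On a short time interval the trajectory stays within \<open>C * (b - a)\<close> of its
  start. By the Lipschitz bound the field along it may thus be replaced by the field at a fixed
  nearby \<open>z\<close>, with an error of second order when \<open>w = z\<close>. The free choice
  of \<open>z\<close> allows an approximation by a countable set.\<close>

lemma evolution_frozen_field:
  assumes r: "0 < r" "r < 1"
  obtains C where "C > 0"
    "\<And>(G :: complex^'n \<Rightarrow> real \<Rightarrow> complex^'n) a b w. total_Herglotz_field G \<Longrightarrow> norm w \<le> r \<Longrightarrow> a \<le> b \<Longrightarrow>
       norm (evolution G a b w - w) \<le> C * (b - a)"
    "\<And>(G :: complex^'n \<Rightarrow> real \<Rightarrow> complex^'n) a b w z. total_Herglotz_field G \<Longrightarrow> norm w \<le> r \<Longrightarrow> norm z \<le> r \<Longrightarrow> a \<le> b \<Longrightarrow>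
       norm (evolution G a b w - w - integral {a..b} (G z)) \<le> C * (C * (b - a) + norm (w - z)) * (b - a)"
    "\<And>h x y. h \<in> (class_M :: (complex^'n \<Rightarrow> complex^'n) set) \<Longrightarrow> norm x \<le> r \<Longrightarrow> norm y \<le> r \<Longrightarrow>
       norm (h x - h y) \<le> C * norm (x - y)"
    "\<And>h x. h \<in> (class_M :: (complex^'n \<Rightarrow> complex^'n) set) \<Longrightarrow> norm x \<le> r \<Longrightarrow> norm (h x) \<le> C"
proof -
  obtain C1 where C1: "C1 > 0"
    "\<And>G s x a b. total_Herglotz_field G \<Longrightarrow> is_trajectory G s x \<Longrightarrow> norm (x s :: complex^'n) \<le> r \<Longrightarrow>
       s \<le> a \<Longrightarrow> a \<le> b \<Longrightarrow> norm (x b - x a) \<le> C1 * (b - a)"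
    using trajectory_lipschitz[OF r] by metis
  obtain C2 where C2: "C2 > 0"
    "\<And>h x. h \<in> (class_M :: (complex^'n \<Rightarrow> complex^'n) set) \<Longrightarrow> norm x \<le> r \<Longrightarrow> norm (h x) \<le> C2"
    "\<And>h x y. h \<in> (class_M :: (complex^'n \<Rightarrow> complex^'n) set) \<Longrightarrow> norm x \<le> r \<Longrightarrow> norm y \<le> r \<Longrightarrow>
       norm (h x - h y) \<le> C2 * norm (x - y)"
    using class_M_uniform_bounds[OF r] by metis
  define C where "C = C1 + C2"
  have C: "C > 0" "C1 \<le> C" "C2 \<le> C" using C1(1) C2(1) by (auto simp: C_def)
  have lip: "norm (h x - h y) \<le> C * norm (x - y)"
    if "h \<in> class_M" "norm x \<le> r" "norm y \<le> r" for h and x y :: "complex^'n"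
    using C2(3)[OF that] C(3) mult_right_mono[OF C(3) norm_ge_zero[of "x - y"]] by linarith
  have inc: "norm (evolution G a b w - w) \<le> C * (b - a)"
    if G: "total_Herglotz_field G" and w: "norm w \<le> r" and "a \<le> b"
    for G :: "complex^'n \<Rightarrow> real \<Rightarrow> complex^'n" and a b :: real and w :: "complex^'n"
  proof -
    have w1: "norm w < 1" using w r by simp
    note e = evolution_trajectory[OF G w1, where s = a]
    have "norm (evolution G a b w - w) \<le> C1 * (b - a)"
      using C1(2)[OF G e(1) _ order_refl \<open>a \<le> b\<close>] w e(2) by simp
    also have "\<dots> \<le> C * (b - a)" using C(2) \<open>a \<le> b\<close> by (intro mult_right_mono) auto
    finally show ?thesis .
  qed
  show thesis
  proof (rule that[OF C(1) inc _ lip])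
    fix G :: "complex^'n \<Rightarrow> real \<Rightarrow> complex^'n" and a b :: real and w z :: "complex^'n"
    assume G: "total_Herglotz_field G" and w: "norm w \<le> r" and z: "norm z \<le> r" and "a \<le> b"
    have w1: "norm w < 1" using w r by simp
    note e = evolution_trajectory[OF G w1, where s = a]
    have Gm: "G z \<in> borel_measurable lebesgue" and M: "(\<lambda>z. G z t) \<in> class_M" for t
      using G by (auto simp: total_Herglotz_field_def)
    have Gb: "norm (G z t) \<le> C" for t using C2(2)[OF M z, of t] C(3) by simp
    define N where "N = C * (C * (b - a) + norm (w - z))"
    have "N \<ge> 0" unfolding N_def using C(1) \<open>a \<le> b\<close> by (intro mult_nonneg_nonneg add_nonneg_nonneg) auto
    define v where "v t = evolution G a t w - integral {a..t} (G z)" for t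
    have "norm (v b - v a) \<le> N * b - N * a"
    proof (rule abs_continuous_increment_le[where g' = "\<lambda>_. N" and D = N])
      have "C-lipschitz_on {a..b} (\<lambda>t. integral {a..t} (G z))"
        unfolding lipschitz_on_def
      proof (intro conjI ballI)
        fix s t assume st: "s \<in> {a..b}" "t \<in> {a..b}"
        show "dist (integral {a..s} (G z)) (integral {a..t} (G z)) \<le> C * dist s t"
          using indefinite_integral_lipschitz[OF Gm Gb, of a s t] indefinite_integral_lipschitz[OF Gm Gb, of a t s] st
          by (cases "s \<le> t") (auto simp: dist_norm norm_minus_commute)
      qed (use C(1) in simp)
      then show "abs_continuous_on_interval a b v"
        unfolding v_def[abs_def] using e(1) \<open>a \<le> b\<close>
        by (intro abs_continuous_on_interval_diff) (auto simp: is_trajectory_def abs_continuous_on_interval_lipschitz)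
      show "N-lipschitz_on {a..b} ((*) N)"
        using \<open>N \<ge> 0\<close> by (auto simp: lipschitz_on_def dist_real_def abs_mult right_diff_distrib[symmetric])
      have "AE t in lebesgue. t > a \<longrightarrow> ((\<lambda>t. evolution G a t w) has_vector_derivative G (evolution G a t w) t) (at t)"
        using e(1) unfolding is_trajectory_def by blast
      then show "AE t in lebesgue. t \<in> {a<..<b} \<longrightarrow> (\<exists>d. norm d \<le> N \<and> (v has_vector_derivative d) (at t))"
        using AE_indefinite_integral_has_vector_derivative[OF Gm Gb, of a]
      proof (eventually_elim, intro impI)
        fix t assume t: "t > a \<longrightarrow> ((\<lambda>t. evolution G a t w) has_vector_derivative G (evolution G a t w) t) (at t)"
          "t > a \<longrightarrow> ((\<lambda>s. integral {a..s} (G z)) has_vector_derivative G z t) (at t)" "t \<in> {a<..<b}"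
        have "(v has_vector_derivative (G (evolution G a t w) t - G z t)) (at t)"
          unfolding v_def[abs_def] using t by (intro has_vector_derivative_diff) auto
        moreover have "norm (G (evolution G a t w) t - G z t) \<le> N"
        proof -
          have "norm (evolution G a t w) \<le> r"
            using norm_evolution_le[OF G w1, of a t] t(3) w by auto
          then have "norm (G (evolution G a t w) t - G z t) \<le> C * norm (evolution G a t w - z)"
            using lip[OF M] z by simp
          also have "norm (evolution G a t w - z) \<le> norm (evolution G a t w - w) + norm (w - z)"
            using norm_triangle_ineq[of "evolution G a t w - w" "w - z"] by simp
          also have "norm (evolution G a t w - w) \<le> C * (t - a)"
            using inc[OF G w, of a t] t(3) by auto
          also have "C * (t - a) \<le> C * (b - a)" using t(3) C(1) by (intro mult_left_mono) auto
          finally show ?thesis using C(1) by (simp add: N_def mult_left_mono)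
        qed
        ultimately show "\<exists>d. norm d \<le> N \<and> (v has_vector_derivative d) (at t)" by blast
      qed
    qed (use \<open>a \<le> b\<close> in \<open>auto intro!: derivative_eq_intros\<close>)
    moreover have "v b - v a = evolution G a b w - w - integral {a..b} (G z)"
      using e(2) by (simp add: v_def)
    ultimately show "norm (evolution G a b w - w - integral {a..b} (G z)) \<le> C * (C * (b - a) + norm (w - z)) * (b - a)"
      by (simp add: N_def right_diff_distrib)
  next
    show "norm (h x) \<le> C" if "h \<in> class_M" "norm x \<le> r" for h and x :: "complex^'n"
      using C2(2)[OF that] C(3) by simp
  qed
qed

text \<open>Lebesgue points for a countable dense set of \<open>z\<close> serve all \<open>z\<close>, by equicontinuity of the class.\<close>

lemma AE_evolution_expansion:
  fixes G :: "complex^'n \<Rightarrow> real \<Rightarrow> complex^'n"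
  assumes G: "total_Herglotz_field G"
  shows "AE a in lebesgue. \<forall>r<1. \<forall>e>0. \<exists>d>0. \<forall>\<epsilon> w. 0 < \<epsilon> \<longrightarrow> \<epsilon> < d \<longrightarrow> norm w \<le> r \<longrightarrow>
    norm (evolution G a (a + \<epsilon>) w - w - \<epsilon> *\<^sub>R G w a) \<le> e * \<epsilon>"
proof -
  have Gm: "G z \<in> borel_measurable lebesgue" and M: "(\<lambda>z. G z t) \<in> class_M" for z t
    using G by (auto simp: total_Herglotz_field_def)
  obtain D :: "(complex^'n) set" where D: "countable D" "\<And>X. open X \<Longrightarrow> X \<noteq> {} \<Longrightarrow> \<exists>d\<in>D. d \<in> X"
    using countable_dense_exists by blast
  have "AE a in lebesgue. \<forall>z\<in>D \<inter> ball 0 1. \<forall>e>0. \<exists>d>0. \<forall>u v. u \<le> a \<longrightarrow> a \<le> v \<longrightarrow> v - u < d \<longrightarrow>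
           norm (integral {u..v} (G z) - (v - u) *\<^sub>R G z a) \<le> e * (v - u)"
  proof (subst AE_ball_countable)
    show "countable (D \<inter> ball 0 1)" using D(1) by blast
    show "\<forall>z\<in>D \<inter> ball 0 1. AE a in lebesgue. \<forall>e>0. \<exists>d>0. \<forall>u v. u \<le> a \<longrightarrow> a \<le> v \<longrightarrow> v - u < d \<longrightarrow>
           norm (integral {u..v} (G z) - (v - u) *\<^sub>R G z a) \<le> e * (v - u)"
    proof
      fix z assume "z \<in> D \<inter> ball 0 1"
      then have "norm (G z t) \<le> 8 / (1 - norm z)\<^sup>2" for t using class_M_norm_bound[OF M] by auto
      then show "AE a in lebesgue. \<forall>e>0. \<exists>d>0. \<forall>u v. u \<le> a \<longrightarrow> a \<le> v \<longrightarrow> v - u < d \<longrightarrow>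
           norm (integral {u..v} (G z) - (v - u) *\<^sub>R G z a) \<le> e * (v - u)"
        by (rule lebesgue_differentiation[OF Gm])
    qed
  qed
  then show ?thesis
  proof (eventually_elim, intro allI impI)
    fix a r e :: real
    assume a: "\<forall>z\<in>D \<inter> ball 0 1. \<forall>e>0. \<exists>d>0. \<forall>u v. u \<le> a \<longrightarrow> a \<le> v \<longrightarrow> v - u < d \<longrightarrow>
           norm (integral {u..v} (G z) - (v - u) *\<^sub>R G z a) \<le> e * (v - u)"
      and "r < 1" "e > 0"
    define R where "R = (1 + max r 0) / 2"
    have R: "0 < R" "R < 1" "r < R" using \<open>r < 1\<close> by (auto simp: R_def)
    obtain C where C: "C > 0"
      "\<And>w z a b. norm w \<le> R \<Longrightarrow> norm z \<le> R \<Longrightarrow> a \<le> b \<Longrightarrow>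
       norm (evolution G a b w - w - integral {a..b} (G z)) \<le> C * (C * (b - a) + norm (w - z)) * (b - a)"
      "\<And>x y t. norm x \<le> R \<Longrightarrow> norm y \<le> R \<Longrightarrow> norm (G x t - G y t) \<le> C * norm (x - y)"
    proof (rule evolution_frozen_field[where ?'n = 'n, OF R(1,2)], goal_cases)
      case (1 C)
      show ?case by (rule 1(1)[OF 1(2) 1(4)[OF G] 1(5)[OF M]])
    qed
    \<comment> \<open>The error budget is \<open>e / 2\<close> for freezing the field at a net point
      \<open>z\<close>, \<open>e / 4\<close> for the Lebesgue point at \<open>z\<close>, and
      \<open>e / 4\<close> for returning from \<open>z\<close> to \<open>w\<close>. The mesh
      \<delta> makes \<open>C * \<delta> \<le> e / 4\<close>, and the bound \<open>R - r\<close>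
      keeps the net in \<open>cball 0 R\<close>.\<close>
    define \<delta> where "\<delta> = min (R - r) (e / (4 * C))"
    have \<delta>: "\<delta> > 0" "C * \<delta> \<le> e / 4" 
    proof -
      show "\<delta> > 0" using R C(1) \<open>e > 0\<close> by (simp add: \<delta>_def)
      have "C * \<delta> \<le> C * (e / (4 * C))" using C(1) by (intro mult_left_mono) (auto simp: \<delta>_def)
      then show "C * \<delta> \<le> e / 4" using C(1) by simp
    qed
    have cover: "cball 0 r \<subseteq> (\<Union>z\<in>D \<inter> cball 0 R. ball z \<delta>)"
    proof
      fix w :: "complex^'n" assume w: "w \<in> cball 0 r"
      have "ball w \<delta> \<noteq> {}" using \<delta>(1) by simp
      then obtain z where z: "z \<in> D" "z \<in> ball w \<delta>" using D(2)[of "ball w \<delta>"] by blast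
      have "norm z \<le> norm w + dist w z" using norm_triangle_ineq[of "z - w" w] by (simp add: dist_norm norm_minus_commute)
      also have "\<dots> \<le> R" using w z(2) by (simp add: \<delta>_def)
      finally show "w \<in> (\<Union>z\<in>D \<inter> cball 0 R. ball z \<delta>)"
        using z by (intro UN_I[of z]) (auto simp: dist_commute)
    qed
    obtain Z where Z: "Z \<subseteq> D \<inter> cball 0 R" "finite Z" "cball 0 r \<subseteq> (\<Union>z\<in>Z. ball z \<delta>)"
      by (rule compactE_image[OF compact_cball _ cover]) auto
    have "\<forall>z\<in>Z. \<exists>d>0. \<forall>u v. u \<le> a \<longrightarrow> a \<le> v \<longrightarrow> v - u < d \<longrightarrow>
           norm (integral {u..v} (G z) - (v - u) *\<^sub>R G z a) \<le> e / 4 * (v - u)"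
    proof
      fix z assume "z \<in> Z"
      then have "z \<in> D \<inter> ball 0 1" using Z(1) R by auto
      moreover have "e / 4 > 0" using \<open>e > 0\<close> by simp
      ultimately show "\<exists>d>0. \<forall>u v. u \<le> a \<longrightarrow> a \<le> v \<longrightarrow> v - u < d \<longrightarrow>
           norm (integral {u..v} (G z) - (v - u) *\<^sub>R G z a) \<le> e / 4 * (v - u)" using a by blast
    qed
    from bchoice[OF this] obtain d where d: "\<And>z. z \<in> Z \<Longrightarrow> d z > 0"
      "\<And>z u v. z \<in> Z \<Longrightarrow> u \<le> a \<Longrightarrow> a \<le> v \<Longrightarrow> v - u < d z \<Longrightarrow>
           norm (integral {u..v} (G z) - (v - u) *\<^sub>R G z a) \<le> e / 4 * (v - u)"
      by blast
    define d0 where "d0 = Min (insert (e / (4 * C * C)) (d ` Z))"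
    have d0: "d0 > 0" "d0 \<le> e / (4 * C * C)" "\<And>z. z \<in> Z \<Longrightarrow> d0 \<le> d z"
      using Z(2) d(1) C(1) \<open>e > 0\<close> by (auto simp: d0_def)
    show "\<exists>d>0. \<forall>\<epsilon> w. 0 < \<epsilon> \<longrightarrow> \<epsilon> < d \<longrightarrow> norm w \<le> r \<longrightarrow>
      norm (evolution G a (a + \<epsilon>) w - w - \<epsilon> *\<^sub>R G w a) \<le> e * \<epsilon>"
    proof (intro exI[of _ d0] conjI d0(1) allI impI)
      fix \<epsilon> and w :: "complex^'n" assume \<epsilon>: "0 < \<epsilon>" "\<epsilon> < d0" and w: "norm w \<le> r"
      obtain z where z: "z \<in> Z" "w \<in> ball z \<delta>" using Z(3) w by force
      have zR: "norm z \<le> R" and wR: "norm w \<le> R" using z Z(1) w R by auto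
      have wz: "norm (w - z) \<le> \<delta>" using z(2) by (simp add: dist_norm norm_minus_commute)
      have "C * C * \<epsilon> \<le> C * C * (e / (4 * C * C))"
        using \<epsilon> d0(2) C(1) by (intro mult_left_mono) auto
      then have CC: "C * C * \<epsilon> \<le> e / 4" using C(1) by simp
      have Cw: "C * norm (w - z) \<le> e / 4" using mult_left_mono[OF wz, of C] C(1) \<delta>(2) by linarith
      have "norm (evolution G a (a + \<epsilon>) w - w - integral {a..a + \<epsilon>} (G z)) \<le> C * (C * \<epsilon> + norm (w - z)) * \<epsilon>"
        using C(2)[OF wR zR, of a "a + \<epsilon>"] \<epsilon>(1) by simp
      also have "\<dots> = (C * C * \<epsilon> + C * norm (w - z)) * \<epsilon>" by (simp add: algebra_simps)
      also have "\<dots> \<le> (e / 4 + e / 4) * \<epsilon>" using CC Cw \<epsilon>(1) by (intro mult_right_mono) auto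
      finally have 1: "norm (evolution G a (a + \<epsilon>) w - w - integral {a..a + \<epsilon>} (G z)) \<le> e / 2 * \<epsilon>" by simp
      have 2: "norm (integral {a..a + \<epsilon>} (G z) - \<epsilon> *\<^sub>R G z a) \<le> e / 4 * \<epsilon>"
        using d(2)[OF z(1), of a "a + \<epsilon>"] d0(3)[OF z(1)] \<epsilon> by simp
      have "norm (\<epsilon> *\<^sub>R G z a - \<epsilon> *\<^sub>R G w a) = \<epsilon> * norm (G w a - G z a)"
        using \<epsilon>(1) by (simp add: scaleR_right_diff_distrib[symmetric] norm_minus_commute)
      also have "\<dots> \<le> \<epsilon> * (e / 4)"
        using C(3)[OF wR zR, of a] Cw \<epsilon>(1) by (intro mult_left_mono) auto
      finally have 3: "norm (\<epsilon> *\<^sub>R G z a - \<epsilon> *\<^sub>R G w a) \<le> e / 4 * \<epsilon>" by (simp add: mult.commute)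
      have "evolution G a (a + \<epsilon>) w - w - \<epsilon> *\<^sub>R G w a =
        (evolution G a (a + \<epsilon>) w - w - integral {a..a + \<epsilon>} (G z)) + (integral {a..a + \<epsilon>} (G z) - \<epsilon> *\<^sub>R G z a) +
        (\<epsilon> *\<^sub>R G z a - \<epsilon> *\<^sub>R G w a)" by simp
      also have "norm \<dots> \<le> e / 2 * \<epsilon> + e / 4 * \<epsilon> + e / 4 * \<epsilon>"
        using 1 2 3 by (intro norm_triangle_mono) auto
      also have "\<dots> = e * \<epsilon>" by simp
      finally show "norm (evolution G a (a + \<epsilon>) w - w - \<epsilon> *\<^sub>R G w a) \<le> e * \<epsilon>" .
    qed
  qed
qed

text \<open>First order effect on the chain of replacing \<open>G\<close> by the constant field \<open>h\<close> on \<open>{a..a + \<epsilon>}\<close>.\<close>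

lemma needle_variation_expansion:
  fixes G :: "complex^'n \<Rightarrow> real \<Rightarrow> complex^'n"
  assumes S: "class_S0 \<subseteq> (Hol :: (complex^'n \<Rightarrow> complex^'n) set)"
    and G: "total_Herglotz_field G" and h: "h \<in> class_M"
    and a: "\<forall>r<1. \<forall>e>0. \<exists>d>0. \<forall>\<epsilon> w. 0 < \<epsilon> \<longrightarrow> \<epsilon> < d \<longrightarrow> norm w \<le> r \<longrightarrow>
      norm (evolution G a (a + \<epsilon>) w - w - \<epsilon> *\<^sub>R G w a) \<le> e * \<epsilon>"
    and "r < 1" "e > 0"
  shows "\<exists>d>0. \<forall>\<epsilon> w. 0 < \<epsilon> \<longrightarrow> \<epsilon> < d \<longrightarrow> norm w \<le> r \<longrightarrow>
    norm (Loewner_chain G (a + \<epsilon>) (evolution (\<lambda>z t. h z) a (a + \<epsilon>) w) - Loewner_chain G (a + \<epsilon>) (evolution G a (a + \<epsilon>) w)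
      - \<epsilon> *\<^sub>R frechet_derivative (Loewner_chain G a) (at w) (h w - G w a)) \<le> e * \<epsilon>"
proof -
  let ?F = "Loewner_chain G"
  let ?D = "\<lambda>w. frechet_derivative (?F a) (at w)"
  have Gh: "total_Herglotz_field (\<lambda>z t. h z)" by (rule total_Herglotz_field_autonomous[OF h])
  define r0 where "r0 = max r 0"
  define R where "R = (1 + r0) / 2"
  have R: "0 < R" "R < 1" "r0 < R" "0 \<le> r0" "r \<le> r0" using \<open>r < 1\<close> by (auto simp: R_def r0_def)
  obtain C where C: "C > 0"
    "\<And>(G :: complex^'n \<Rightarrow> real \<Rightarrow> complex^'n) a b w. total_Herglotz_field G \<Longrightarrow> norm w \<le> R \<Longrightarrow> a \<le> b \<Longrightarrow>
       norm (evolution G a b w - w) \<le> C * (b - a)"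
    "\<And>(G :: complex^'n \<Rightarrow> real \<Rightarrow> complex^'n) a b w z. total_Herglotz_field G \<Longrightarrow> norm w \<le> R \<Longrightarrow> norm z \<le> R \<Longrightarrow> a \<le> b \<Longrightarrow>
       norm (evolution G a b w - w - integral {a..b} (G z)) \<le> C * (C * (b - a) + norm (w - z)) * (b - a)"
  proof (rule evolution_frozen_field[where ?'n = 'n, OF R(1,2)], goal_cases)
    case (1 C)
    show ?case by (rule 1(1)[OF 1(2) 1(3) 1(4)])
  qed
  obtain E where E: "E \<ge> 1"
    "\<And>s w w'. norm (w :: complex^'n) \<le> R \<Longrightarrow> norm w' \<le> R \<Longrightarrow> norm (?F s w - ?F s w') \<le> E * exp s * norm (w - w')"
    using Loewner_chain_bounds[OF R(1,2)] G by metis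
  have holF: "holomorphic_map_on (?F s) (ball 0 1)" for s by (rule Loewner_chain_holomorphic[OF S G])
  have holFR: "holomorphic_map_on (?F s) (ball 0 R)" for s
    using holF[of s] R(2) by (auto intro: holomorphic_map_on_subset)
  define n where "n = real CARD('n)"
  have "n \<ge> 0" by (simp add: n_def)
  define B where "B = E * exp a"
  have "B \<ge> 0" using E(1) by (simp add: B_def)
  have FB: "norm (?F a x) \<le> B" if "norm x \<le> R" for x
  proof -
    have "norm (?F a x) \<le> B * norm x"
      using E(2)[OF that, of 0 a] R(1) by (simp add: Loewner_chain_zero(1)[OF G] B_def)
    also have "\<dots> \<le> B * 1" using that R(2) \<open>B \<ge> 0\<close> by (intro mult_left_mono) auto
    finally show ?thesis by simp
  qed
  define \<rho> where "\<rho> = R - r0"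
  have "\<rho> > 0" using R by (simp add: \<rho>_def)
  have sub: "ball w \<rho> \<subseteq> ball 0 R" if "norm w \<le> r0" for w :: "complex^'n"
  proof
    fix y assume "y \<in> ball w \<rho>"
    then show "y \<in> ball 0 R"
      using norm_triangle_ineq[of "y - w" w] that by (auto simp: \<rho>_def dist_norm norm_minus_commute)
  qed
  have tay: "norm (?F a (w + v) - ?F a w - ?D w v) \<le> 2 * n * B / \<rho>\<^sup>2 * (norm v)\<^sup>2"
    if "norm w \<le> r0" "norm v \<le> \<rho> / 2" for w v
    unfolding n_def
    by (rule holomorphic_map_taylor_bound[OF holomorphic_map_on_subset[OF holFR sub[OF that(1)]] _ \<open>\<rho> > 0\<close> that(2)])
       (use sub[OF that(1)] FB in \<open>auto simp: subset_iff less_imp_le\<close>)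
  have Db: "norm (?D w v) \<le> n * B / \<rho> * norm v" if "norm w \<le> r0" for w v
    unfolding n_def
    by (rule holomorphic_map_derivative_bound[OF holomorphic_map_on_subset[OF holFR sub[OF that(1)]] _ \<open>\<rho> > 0\<close>])
       (use sub[OF that(1)] FB in \<open>auto simp: subset_iff less_imp_le\<close>)
  \<comment> \<open>The chain at time \<open>b\<close> differs from the one at time \<open>a\<close>
    by a holomorphic map of size of order \<open>b - a\<close>. By Cauchy's estimate its Lipschitz
    constant is of the same order, so across two points at distance of order \<epsilon> it
    contributes only order \<epsilon> squared.\<close>
  have change: "norm ((?F b x - ?F a x) - (?F b y - ?F a y)) \<le> n * (E * exp (a + 1) * (C * (b - a))) / \<rho> * norm (x - y)"
    if b: "a \<le> b" "b \<le> a + 1" and x: "norm x \<le> r0" and y: "norm y \<le> r0" for b x y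
    unfolding n_def \<rho>_def
  proof (rule holomorphic_map_lipschitz[of "\<lambda>x. ?F b x - ?F a x" R])
    show "holomorphic_map_on (\<lambda>x. ?F b x - ?F a x) (ball 0 R)" by (intro holomorphic_map_on_diff holFR)
    fix u :: "complex^'n" assume "u \<in> ball 0 R"
    then have u: "norm u \<le> R" "norm u < 1" using R by auto
    have "norm (?F b u - ?F a u) = norm (?F b u - ?F b (evolution G a b u))"
      using Loewner_chain_evolution[OF G u(2) b(1)] by simp
    also have "\<dots> \<le> E * exp b * norm (u - evolution G a b u)"
      using norm_evolution_le[OF G u(2) b(1)] u by (intro E(2)) auto
    also have "\<dots> \<le> E * exp (a + 1) * (C * (b - a))"
      using C(2)[OF G u(1) b(1)] E(1) b by (intro mult_mono) (auto simp: norm_minus_commute)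
    finally show "norm (?F b u - ?F a u) \<le> E * exp (a + 1) * (C * (b - a))" .
  qed (use R x y in auto)
  define N1 where "N1 = n * (E * exp (a + 1) * C) / \<rho> * (2 * C)"
  define N2 where "N2 = 4 * n * B / \<rho>\<^sup>2 * C\<^sup>2"
  define N3 where "N3 = n * B / \<rho>"
  have N: "N1 \<ge> 0" "N2 \<ge> 0" "N3 \<ge> 0"
    using \<open>n \<ge> 0\<close> \<open>B \<ge> 0\<close> \<open>\<rho> > 0\<close> C(1) E(1) by (auto simp: N1_def N2_def N3_def)
  define e' where "e' = e / (4 * (N3 + 1))"
  have "e' > 0" using \<open>e > 0\<close> N by (simp add: e'_def)
  obtain d1 where d1: "d1 > 0" "\<And>\<epsilon> w. 0 < \<epsilon> \<Longrightarrow> \<epsilon> < d1 \<Longrightarrow> norm w \<le> r0 \<Longrightarrow>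
      norm (evolution G a (a + \<epsilon>) w - w - \<epsilon> *\<^sub>R G w a) \<le> e' * \<epsilon>"
  proof -
    have "r0 < 1" using R by simp
    then show ?thesis using a \<open>e' > 0\<close> that by meson
  qed
  \<comment> \<open>In turn the entries secure the expansion for \<open>G\<close>, the bound
    \<open>b \<le> a + 1\<close>, displacements of at most \<open>\<rho> / 2\<close> for the Taylor
    estimate, the quadratic error of the flow of \<open>h\<close>, and the remaining quadratic
    terms.\<close>
  define d where "d = Min {d1, 1, \<rho> / (2 * C), e' / C\<^sup>2, e / (4 * (N1 + N2 + 1))}"
  have d: "d > 0" "d \<le> d1" "d \<le> 1" "d \<le> \<rho> / (2 * C)" "d \<le> e' / C\<^sup>2" "d \<le> e / (4 * (N1 + N2 + 1))"
    using d1(1) \<open>\<rho> > 0\<close> C(1) \<open>e' > 0\<close> \<open>e > 0\<close> N by (auto simp: d_def)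
  show ?thesis
  proof (intro exI[of _ d] conjI d(1) allI impI)
    fix \<epsilon> and w :: "complex^'n" assume \<epsilon>: "0 < \<epsilon>" "\<epsilon> < d" and "norm w \<le> r"
    then have w: "norm w \<le> r0" "norm w \<le> R" "norm w < 1" using R by auto
    define b where "b = a + \<epsilon>"
    define x where "x = evolution (\<lambda>z t. h z) a b w"
    define y where "y = evolution G a b w"
    have ab: "a \<le> b" "b \<le> a + 1" "b - a = \<epsilon>" using \<epsilon> d(3) by (auto simp: b_def)
    have xw: "norm (x - w) \<le> C * \<epsilon>" "norm (y - w) \<le> C * \<epsilon>"
      using C(2)[OF Gh w(2) ab(1)] C(2)[OF G w(2) ab(1)] ab(3) by (auto simp: x_def y_def)
    have xy: "norm (x - y) \<le> 2 * C * \<epsilon>"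
      using norm_triangle_ineq4[of "x - w" "y - w"] xw by simp
    have xr: "norm x \<le> r0" "norm y \<le> r0"
      using norm_evolution_le[OF Gh w(3) ab(1)] norm_evolution_le[OF G w(3) ab(1)] w by (auto simp: x_def y_def)
    have lin: "linear (?D w)" using holomorphic_map_on_frechet_derivative(3)[OF holF] w by simp
    have "C * \<epsilon> \<le> C * (\<rho> / (2 * C))" using \<epsilon>(2) d(4) C(1) by (intro mult_left_mono) auto
    then have C\<rho>: "C * \<epsilon> \<le> \<rho> / 2" using C(1) by simp
    have 1: "norm ((?F b x - ?F a x) - (?F b y - ?F a y)) \<le> N1 * \<epsilon> * \<epsilon>"
    proof -
      have "norm ((?F b x - ?F a x) - (?F b y - ?F a y)) \<le> n * (E * exp (a + 1) * (C * \<epsilon>)) / \<rho> * norm (x - y)"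
        using change[OF ab(1,2) xr] ab(3) by simp
      also have "\<dots> \<le> n * (E * exp (a + 1) * (C * \<epsilon>)) / \<rho> * (2 * C * \<epsilon>)"
        using xy \<open>n \<ge> 0\<close> E(1) C(1) \<epsilon>(1) \<open>\<rho> > 0\<close> by (intro mult_left_mono) auto
      also have "\<dots> = N1 * \<epsilon> * \<epsilon>" by (simp add: N1_def)
      finally show ?thesis .
    qed
    have t1: "norm (?F a u - ?F a w - ?D w (u - w)) \<le> N2 / 2 * \<epsilon> * \<epsilon>" if "norm (u - w) \<le> C * \<epsilon>" for u
    proof -
      have "norm (?F a u - ?F a w - ?D w (u - w)) \<le> 2 * n * B / \<rho>\<^sup>2 * (norm (u - w))\<^sup>2"
        using tay[OF w(1), of "u - w"] that C\<rho> by simp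
      also have "\<dots> \<le> 2 * n * B / \<rho>\<^sup>2 * (C * \<epsilon>)\<^sup>2"
        using that \<open>n \<ge> 0\<close> \<open>B \<ge> 0\<close> by (intro mult_left_mono power_mono) auto
      also have "\<dots> = N2 / 2 * \<epsilon> * \<epsilon>" by (simp add: N2_def power2_eq_square)
      finally show ?thesis .
    qed
    have 2: "norm (?F a x - ?F a y - ?D w (x - y)) \<le> N2 * \<epsilon> * \<epsilon>"
    proof -
      have eq: "?F a x - ?F a y - ?D w (x - y) =
          (?F a x - ?F a w - ?D w (x - w)) - (?F a y - ?F a w - ?D w (y - w))"
        by (simp add: linear_diff[OF lin])
      show ?thesis
        unfolding eq using norm_triangle_ineq4[of "?F a x - ?F a w - ?D w (x - w)" "?F a y - ?F a w - ?D w (y - w)"] t1[OF xw(1)] t1[OF xw(2)]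
        by linarith
    qed
    have 3: "norm (?D w (x - y) - \<epsilon> *\<^sub>R ?D w (h w - G w a)) \<le> N3 * (2 * e' * \<epsilon>)"
    proof -
      have eq: "?D w (x - y) - \<epsilon> *\<^sub>R ?D w (h w - G w a) = ?D w ((x - w - \<epsilon> *\<^sub>R h w) - (y - w - \<epsilon> *\<^sub>R G w a))"
      proof -
        have "(x - w - \<epsilon> *\<^sub>R h w) - (y - w - \<epsilon> *\<^sub>R G w a) = (x - y) - \<epsilon> *\<^sub>R (h w - G w a)"
          by (simp add: scaleR_right_diff_distrib)
        then show ?thesis by (simp only: linear_diff[OF lin] linear_scale[OF lin])
      qed
      have "norm (x - w - \<epsilon> *\<^sub>R h w) \<le> C * (C * \<epsilon>) * \<epsilon>"
        using C(3)[OF Gh w(2) w(2) ab(1)] ab by (simp add: x_def)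
      also have "C * (C * \<epsilon>) = C\<^sup>2 * \<epsilon>" by (simp add: power2_eq_square)
      also have "C\<^sup>2 * \<epsilon> * \<epsilon> \<le> C\<^sup>2 * (e' / C\<^sup>2) * \<epsilon>"
        using \<epsilon> d(5) by (intro mult_right_mono mult_left_mono) auto
      also have "\<dots> = e' * \<epsilon>" using C(1) by simp
      finally have hx: "norm (x - w - \<epsilon> *\<^sub>R h w) \<le> e' * \<epsilon>" .
      have gy: "norm (y - w - \<epsilon> *\<^sub>R G w a) \<le> e' * \<epsilon>"
        using d1(2)[OF \<epsilon>(1) _ w(1)] \<epsilon>(2) d(2) by (simp add: y_def b_def)
      have "norm ((x - w - \<epsilon> *\<^sub>R h w) - (y - w - \<epsilon> *\<^sub>R G w a)) \<le> 2 * e' * \<epsilon>"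
        using norm_triangle_ineq4[of "x - w - \<epsilon> *\<^sub>R h w" "y - w - \<epsilon> *\<^sub>R G w a"] hx gy by simp
      then have "N3 * norm ((x - w - \<epsilon> *\<^sub>R h w) - (y - w - \<epsilon> *\<^sub>R G w a)) \<le> N3 * (2 * e' * \<epsilon>)"
        using N(3) by (intro mult_left_mono) auto
      then show ?thesis unfolding eq using Db[OF w(1)] by (simp only: N3_def) (meson order_trans)
    qed
    \<comment> \<open>Three sources of error: change of the chain between the two times, curvature
      of the chain at time \<open>a\<close>, and deviation of the two flows from their first order
      terms.\<close>
    have "?F b x - ?F b y - \<epsilon> *\<^sub>R ?D w (h w - G w a) =
        ((?F b x - ?F a x) - (?F b y - ?F a y)) + (?F a x - ?F a y - ?D w (x - y)) +
        (?D w (x - y) - \<epsilon> *\<^sub>R ?D w (h w - G w a))" by simp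
    also have "norm \<dots> \<le> N1 * \<epsilon> * \<epsilon> + N2 * \<epsilon> * \<epsilon> + N3 * (2 * e' * \<epsilon>)"
      using 1 2 3 by (intro norm_triangle_mono) auto
    also have "\<dots> = ((N1 + N2) * \<epsilon> + 2 * (N3 * e')) * \<epsilon>" by (simp add: algebra_simps)
    also have "\<dots> \<le> (e / 4 + 2 * (e / 4)) * \<epsilon>"
    proof (intro mult_right_mono add_mono mult_left_mono)
      have "(N1 + N2) * \<epsilon> \<le> (N1 + N2 + 1) * (e / (4 * (N1 + N2 + 1)))"
        using \<epsilon> d(6) N by (intro mult_mono) auto
      also have "\<dots> = e / 4" using N by (simp add: field_simps)
      finally show "(N1 + N2) * \<epsilon> \<le> e / 4" .
      have "N3 * e' \<le> (N3 + 1) * e'" using \<open>e' > 0\<close> by simp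
      also have "\<dots> = e / 4" using N unfolding e'_def by (simp add: field_simps)
      finally show "N3 * e' \<le> e / 4" .
    qed (use \<epsilon> in auto)
    also have "\<dots> \<le> e * \<epsilon>" using \<open>e > 0\<close> \<epsilon>(1) by simp
    finally show "norm (?F (a + \<epsilon>) (evolution (\<lambda>z t. h z) a (a + \<epsilon>) w) - ?F (a + \<epsilon>) (evolution G a (a + \<epsilon>) w)
      - \<epsilon> *\<^sub>R ?D w (h w - G w a)) \<le> e * \<epsilon>" by (simp add: x_def y_def b_def)
  qed
qed

subsection \<open>Nonconstancy of the pulled back functional\<close>

text \<open>The space of differences of normalized maps: two members of \<open>class_M\<close>, or
  of \<open>class_S0\<close> once this class lies in \<open>Hol\<close>, differ by an element of
  it.\<close>

definition second_order :: "(complex^'n \<Rightarrow> complex^'n) set" where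
  "second_order = {q \<in> Hol. q 0 = 0 \<and> (q has_derivative (\<lambda>_. 0)) (at 0)}"

lemma has_derivative_on_ball:
  assumes "(f has_derivative D) (at z)" "norm z < 1"
  shows "(on_ball f has_derivative D) (at z)"
  by (rule has_derivative_transform_within_open[OF assms(1), of "ball 0 1"]) (use assms(2) in \<open>auto simp: on_ball_def\<close>)

lemma second_orderI:
  assumes "holomorphic_map_on q (ball 0 1)" "q 0 = 0" "(q has_derivative (\<lambda>_. 0)) (at 0)"
  shows "on_ball q \<in> second_order"
  unfolding second_order_def
  using on_ball_in_Hol[OF assms(1)] assms(2) has_derivative_on_ball[OF assms(3)] by (simp add: on_ball_def)

lemma second_order_in_Hol: "q \<in> second_order \<Longrightarrow> q \<in> Hol"
  by (simp add: second_order_def)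

text \<open>The field \<open>-z\<close> contributes minus the squared norm of \<open>z\<close> to
  the real part of the inner product, which absorbs \<open>p / C\<close> as soon as \<open>p\<close>
  is bounded by \<open>C * norm z\<close> on the whole ball.\<close>

lemma class_M_perturbation:
  fixes p :: "complex^'n \<Rightarrow> complex^'n"
  assumes p: "p \<in> second_order" and b: "\<And>z. norm z < 1 \<Longrightarrow> norm (p z) \<le> C * norm z" and "C > 0"
  shows "(\<lambda>z. on_ball (\<lambda>z. - z) z + complex_of_real (1 / C) *s p z) \<in> class_M"
proof -
  let ?h = "\<lambda>z. on_ball (\<lambda>z. - z) z + complex_of_real (1 / C) *s p z"
  have N: "on_ball (\<lambda>z. - z) \<in> (Hol :: (complex^'n \<Rightarrow> complex^'n) set)" "(on_ball (\<lambda>z. - z) has_derivative (\<lambda>v. - v)) (at (0::complex^'n))"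
    using neg_in_class_M[where ?'n = 'n] by (auto simp: class_M_def)
  have "((\<lambda>z. complex_of_real (1 / C) *s p z) has_derivative (\<lambda>v. (1 / C) *\<^sub>R 0)) (at 0)"
    using p unfolding scaleR_eq_vector_scalar_mult[symmetric]
    by (intro has_derivative_scaleR_right) (simp add: second_order_def)
  from has_derivative_add[OF N(2) this] have "(?h has_derivative (\<lambda>v. - v)) (at 0)" by simp
  moreover have "Re (hinner (?h z) z) \<le> 0" if z: "z \<in> ball 0 1" for z
  proof -
    have "Re (hinner (?h z) z) = - (norm z)\<^sup>2 + 1 / C * (p z \<bullet> z)"
      using z unfolding Re_hinner scaleR_eq_vector_scalar_mult[symmetric]
      by (simp add: on_ball_def inner_add_left inner_diff_left power2_norm_eq_inner)
    also have "p z \<bullet> z \<le> norm (p z) * norm z" using Cauchy_Schwarz_ineq2[of "p z" z] by linarith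
    also have "\<dots> \<le> C * norm z * norm z" using b[of z] z by (intro mult_right_mono) auto
    finally show ?thesis using \<open>C > 0\<close> by (simp add: power2_eq_square divide_right_mono)
  qed
  moreover have "?h \<in> Hol" by (rule add_in_Hol[OF N(1) cmult_in_Hol[OF second_order_in_Hol[OF p]]])
  moreover have "?h 0 = 0" using p by (simp add: second_order_def on_ball_def)
  ultimately show ?thesis by (simp add: class_M_def)
qed

text \<open>Dividing the increment along a short ray by its parameter transfers a lower bound for
  differences to the derivative, up to an arbitrary \<open>e\<close>.\<close>

lemma has_derivative_norm_lower_bound:
  fixes f :: "'a::real_normed_vector \<Rightarrow> 'b::real_normed_vector"
  assumes f: "(f has_derivative D) (at z)" and "\<rho> > 0"
    and b: "\<And>y. norm (y - z) < \<rho> \<Longrightarrow> c * norm (y - z) \<le> norm (f y - f z)"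
  shows "c * norm v \<le> norm (D v)"
proof (cases "v = 0")
  case False
  have lin: "linear D" using f has_derivative_linear by blast
  have "c * norm v \<le> norm (D v) + e * norm v" if "e > 0" for e
  proof -
    have "\<forall>e>0. \<exists>d>0. \<forall>y. norm (y - z) < d \<longrightarrow> norm (f y - f z - D (y - z)) \<le> e * norm (y - z)"
      using f unfolding has_derivative_at_alt by simp
    then have "\<exists>d>0. \<forall>y. norm (y - z) < d \<longrightarrow> norm (f y - f z - D (y - z)) \<le> e * norm (y - z)"
      using that by simp
    then obtain d where d: "d > 0" "\<And>y. norm (y - z) < d \<Longrightarrow> norm (f y - f z - D (y - z)) \<le> e * norm (y - z)"
      by blast
    define t where "t = min d \<rho> / (2 * norm v)"
    have t: "t > 0" using d(1) \<open>\<rho> > 0\<close> False by (simp add: t_def)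
    have tv: "t * norm v < d" "t * norm v < \<rho>" using d(1) \<open>\<rho> > 0\<close> False by (auto simp: t_def)
    have "c * (t * norm v) \<le> norm (f (z + t *\<^sub>R v) - f z)"
      using b[of "z + t *\<^sub>R v"] t tv by simp
    also have "\<dots> \<le> norm (D (t *\<^sub>R v)) + norm (f (z + t *\<^sub>R v) - f z - D (t *\<^sub>R v))"
      using norm_triangle_ineq[of "D (t *\<^sub>R v)" "f (z + t *\<^sub>R v) - f z - D (t *\<^sub>R v)"] by simp
    also have "\<dots> \<le> t * norm (D v) + e * (t * norm v)"
      using d(2)[of "z + t *\<^sub>R v"] t tv by (simp add: linear_scale[OF lin])
    finally have "t * (c * norm v) \<le> t * (norm (D v) + e * norm v)" by (simp add: algebra_simps)
    then show ?thesis using t by simp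
  qed
  note * = this
  show ?thesis
  proof (rule field_le_epsilon)
    fix e :: real assume "e > 0"
    then show "c * norm v \<le> norm (D v) + e" using *[of "e / norm v"] False by simp
  qed
qed (use has_derivative_linear[OF f] linear_0 in simp)

text \<open>Injectivity comes from the lower bound and surjectivity onto the smaller ball from
  Brouwer's theorem. The lower bound also makes the derivative injective, so the inverse function
  theorem gives a differentiable inverse, whose derivative is again complex linear.\<close>

lemma inverse_holomorphic_on_ball:
  fixes \<psi> :: "complex^'n \<Rightarrow> complex^'n"
  assumes hol: "holomorphic_map_on \<psi> (ball 0 R)" and close: "\<And>x. norm x < R \<Longrightarrow> norm (\<psi> x - x) \<le> \<eta>"
    and lower: "\<And>x y. norm x < R \<Longrightarrow> norm y < R \<Longrightarrow> c * norm (x - y) \<le> norm (\<psi> x - \<psi> y)" and "c > 0"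
    and r: "r + 2 * \<eta> < R" "0 < r" "\<eta> > 0"
  obtains \<kappa> where "holomorphic_map_on \<kappa> (ball 0 r)" "\<And>y. norm y < r \<Longrightarrow> norm (\<kappa> y) < r + \<eta>"
    "\<And>x. norm x < R \<Longrightarrow> \<kappa> (\<psi> x) = x"
proof -
  have inj: "inj_on \<psi> (ball 0 R)"
  proof (rule inj_onI)
    fix x y :: "complex^'n" assume "x \<in> ball 0 R" "y \<in> ball 0 R" "\<psi> x = \<psi> y"
    then have "c * norm (x - y) \<le> 0" using lower[of x y] by simp
    then show "x = y" using \<open>c > 0\<close> by (simp add: mult_le_0_iff)
  qed
  define \<kappa> where "\<kappa> = inv_into (ball 0 R) \<psi>"
  have \<kappa>: "\<kappa> (\<psi> x) = x" if "norm x < R" for x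
    unfolding \<kappa>_def using inj that by (intro inv_into_f_f) auto
  have cont: "continuous_on (ball 0 R) \<psi>" by (rule holomorphic_map_on_imp_continuous_on[OF hol])
  \<comment> \<open>A solution of \<open>\<psi> x = y\<close> is a fixed point of
    \<open>x \<mapsto> x - (\<psi> x - y)\<close>, which maps \<open>cball 0 (r + \<eta>)\<close>
    into itself because \<psi> is within \<eta> of the identity. The same closeness bounds
    \<open>norm x\<close> by \<open>norm y + \<eta>\<close>.\<close>
  have surj: "\<exists>x. norm x < r + 2 * \<eta> \<and> norm x \<le> norm y + \<eta> \<and> \<psi> x = y" if y: "norm y < r" for y
  proof -
    have sub: "cball 0 (r + \<eta>) \<subseteq> ball (0::complex^'n) R" using r by auto
    have ne: "cball (0::complex^'n) (r + \<eta>) \<noteq> {}" using r by simp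
    have cn: "continuous_on (cball 0 (r + \<eta>)) (\<lambda>x. x - (\<psi> x - y))"
      by (intro continuous_intros continuous_on_subset[OF cont sub])
    have fm: "(\<lambda>x. x - (\<psi> x - y)) \<in> cball 0 (r + \<eta>) \<rightarrow> cball 0 (r + \<eta>)"
    proof
      fix x :: "complex^'n" assume "x \<in> cball 0 (r + \<eta>)"
      then have "norm (\<psi> x - x) \<le> \<eta>" using sub by (intro close) auto
      then show "x - (\<psi> x - y) \<in> cball 0 (r + \<eta>)"
        using norm_triangle_ineq4[of y "\<psi> x - x"] y by (simp add: algebra_simps)
    qed
    obtain x where x: "x \<in> cball 0 (r + \<eta>)" "x - (\<psi> x - y) = x"
      by (rule brouwer[OF compact_cball convex_cball ne cn fm])
    have "norm (\<psi> x - x) \<le> \<eta>" using x(1) sub by (intro close) auto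
    moreover have "\<psi> x = y" using x(2) by simp
    ultimately have "norm x \<le> norm y + \<eta>" using norm_triangle_ineq4[of y "\<psi> x - x"] by simp
    then show ?thesis using \<open>\<psi> x = y\<close> y r by (intro exI[of _ x]) auto
  qed
  show thesis
  proof (rule that[of \<kappa>])
    show "\<kappa> (\<psi> x) = x" if "norm x < R" for x using \<kappa>[OF that] .
    show "norm (\<kappa> y) < r + \<eta>" if "norm y < r" for y
    proof -
      obtain x where x: "norm x < r + 2 * \<eta>" "norm x \<le> norm y + \<eta>" "\<psi> x = y" using surj[OF \<open>norm y < r\<close>] by blast
      then have "\<kappa> y = x" using \<kappa>[of x] r by simp
      then show ?thesis using x(2) that by simp
    qed
    show "holomorphic_map_on \<kappa> (ball 0 r)"
      unfolding holomorphic_map_on_iff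
    proof
      fix y :: "complex^'n" assume "y \<in> ball 0 r"
      then obtain x where x: "norm x < r + 2 * \<eta>" "\<psi> x = y" using surj[of y] by auto
      then have xR: "x \<in> ball 0 R" using r by simp
      let ?D = "frechet_derivative \<psi> (at x)"
      note D = holomorphic_map_on_frechet_derivative[OF hol xR]
      have lowD: "c * norm v \<le> norm (?D v)" for v
      proof (rule has_derivative_norm_lower_bound[OF D(1), of "R - norm x"])
        show "R - norm x > 0" using xR by simp
        fix u assume "norm (u - x) < R - norm x"
        then have "norm u < R" using norm_triangle_ineq[of "u - x" x] by simp
        then show "c * norm (u - x) \<le> norm (\<psi> u - \<psi> x)" using lower xR by simp
      qed
      have "inj ?D"
      proof (rule injI)
        fix u v assume "?D u = ?D v"
        then have "c * norm (u - v) \<le> 0" using lowD[of "u - v"] by (simp add: linear_diff[OF D(3)])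
        then show "u = v" using \<open>c > 0\<close> by (simp add: mult_le_0_iff)
      qed
      then obtain D' where D': "linear D'" "D' \<circ> ?D = id" "?D \<circ> D' = id"
        using linear_injective_isomorphism[OF D(3)] by (auto simp: fun_eq_iff)
      have DD: "?D (D' v) = v" "D' (?D v) = v" for v using D' by (auto simp: fun_eq_iff)
      have "(\<kappa> has_derivative D') (at (\<psi> x))"
        by (rule has_derivative_inverse_strong[OF open_ball xR cont _ D(1) D'(3)]) (use \<kappa> in auto)
      moreover have "D' (a *s v) = a *s D' v" for a v
      proof -
        have "D' (a *s v) = D' (?D (a *s D' v))" using D(2)[of a "D' v"] DD(1)[of v] by simp
        then show ?thesis by (simp add: DD(2))
      qed
      ultimately show "\<exists>D. (\<kappa> has_derivative D) (at y) \<and> (\<forall>c v. D (c *s v) = c *s D v)"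
        using x(2) by blast
    qed
  qed
qed

text \<open>This is the operator \<open>T\<close> of the overview.\<close>

definition pullback :: "(complex^'n \<Rightarrow> real \<Rightarrow> complex^'n) \<Rightarrow> real \<Rightarrow> (complex^'n \<Rightarrow> complex^'n) \<Rightarrow> complex^'n \<Rightarrow> complex^'n" where
  "pullback G a p = on_ball (\<lambda>z. frechet_derivative (Loewner_chain G a) (at (evolution G 0 a z)) (p (evolution G 0 a z)))"

context
  fixes G :: "complex^'n \<Rightarrow> real \<Rightarrow> complex^'n"
  assumes S: "class_S0 \<subseteq> (Hol :: (complex^'n \<Rightarrow> complex^'n) set)" and G: "total_Herglotz_field G"
begin

lemma on_ball_compose_in_Hol:
  assumes "q \<in> Hol" "0 \<le> s"
  shows "on_ball (\<lambda>z. q (evolution G 0 s z)) \<in> Hol"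
proof (rule on_ball_in_Hol, rule holomorphic_map_on_compose[OF evolution_holomorphic[OF S G assms(2)] Hol_holomorphic[OF assms(1)]])
  show "evolution G 0 s ` ball 0 1 \<subseteq> ball 0 1"
    using norm_evolution_less[OF G _ assms(2)] by auto
qed

lemma Loewner_chain_derivative_lower_bound:
  assumes \<rho>: "0 < \<rho>" "\<rho> < 1"
  obtains c where "c > 0" "\<And>z v. norm z \<le> \<rho> \<Longrightarrow> c * norm v \<le> norm (frechet_derivative (Loewner_chain G a) (at z) v)"
proof -
  define R where "R = (1 + \<rho>) / 2"
  have R: "0 < R" "R < 1" "\<rho> < R" using \<rho> by (auto simp: R_def)
  obtain E where E: "E \<ge> 1" "\<And>s w w'. norm w \<le> R \<Longrightarrow> norm w' \<le> R \<Longrightarrow>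
       exp s * norm (w - w') \<le> E * norm (Loewner_chain G s w - Loewner_chain G s w')"
    using Loewner_chain_bounds[OF R(1,2)] G by metis
  show thesis
  proof (rule that[of "exp a / E"])
    show "exp a / E > 0" using E(1) by simp
    fix z v :: "complex^'n" assume z: "norm z \<le> \<rho>"
    have D: "(Loewner_chain G a has_derivative frechet_derivative (Loewner_chain G a) (at z)) (at z)"
      using holomorphic_map_on_frechet_derivative(1)[OF Loewner_chain_holomorphic[OF S G]] z \<rho> by simp
    show "exp a / E * norm v \<le> norm (frechet_derivative (Loewner_chain G a) (at z) v)"
    proof (rule has_derivative_norm_lower_bound[OF D, of "R - \<rho>"])
      fix y assume "norm (y - z) < R - \<rho>"
      then have "norm y \<le> R" using norm_triangle_ineq[of "y - z" z] z by simp
      then have "exp a * norm (y - z) \<le> E * norm (Loewner_chain G a y - Loewner_chain G a z)"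
        using z R by (intro E(2)) auto
      then show "exp a / E * norm (y - z) \<le> norm (Loewner_chain G a y - Loewner_chain G a z)"
        using E(1) by (simp add: field_simps)
    qed (use R in simp)
  qed
qed

lemma pullback_in_Hol:
  assumes "0 \<le> a" "holomorphic_map_on p (ball 0 1)"
  shows "pullback G a p \<in> Hol"
  unfolding pullback_def
proof (rule on_ball_in_Hol, rule holomorphic_map_on_compose[OF evolution_holomorphic[OF S G assms(1)]])
  show "holomorphic_map_on (\<lambda>w. frechet_derivative (Loewner_chain G a) (at w) (p w)) (ball 0 1)"
    by (rule holomorphic_map_on_derivative_apply[OF Loewner_chain_holomorphic[OF S G] assms(2)])
  show "evolution G 0 a ` ball 0 1 \<subseteq> ball 0 1"
    using norm_evolution_less[OF G _ assms(1)] by auto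
qed

lemma Loewner_chain_derivative_linear:
  assumes "norm w < 1"
  shows "linear (frechet_derivative (Loewner_chain G a) (at w))"
    "frechet_derivative (Loewner_chain G a) (at w) (c *s v) = c *s frechet_derivative (Loewner_chain G a) (at w) v"
  using holomorphic_map_on_frechet_derivative(2,3)[OF Loewner_chain_holomorphic[OF S G]] assms by auto

lemma pullback_add:
  assumes "0 \<le> a"
  shows "pullback G a (\<lambda>z. p z + q z) = (\<lambda>z. pullback G a p z + pullback G a q z)"
  using linear_add[OF Loewner_chain_derivative_linear(1)[OF norm_evolution_less[OF G _ assms]]]
  by (auto simp: pullback_def on_ball_def fun_eq_iff)

lemma pullback_diff:
  assumes "0 \<le> a"
  shows "pullback G a (\<lambda>z. p z - q z) = (\<lambda>z. pullback G a p z - pullback G a q z)"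
  using linear_diff[OF Loewner_chain_derivative_linear(1)[OF norm_evolution_less[OF G _ assms]]]
  by (auto simp: pullback_def on_ball_def fun_eq_iff)

lemma pullback_scale:
  assumes "0 \<le> a"
  shows "pullback G a (\<lambda>z. c *s p z) = (\<lambda>z. c *s pullback G a p z)"
  using Loewner_chain_derivative_linear(2)[OF norm_evolution_less[OF G _ assms]]
  by (auto simp: pullback_def on_ball_def fun_eq_iff)

section \<open>Linear functionals controlled on a closed ball\<close>

context
  fixes l :: "(complex^'n \<Rightarrow> complex^'n) \<Rightarrow> complex" and r C :: real
  assumes add: "\<And>f g. f \<in> Hol \<Longrightarrow> g \<in> Hol \<Longrightarrow> l (\<lambda>z. f z + g z) = l f + l g"
    and scale: "\<And>c f. f \<in> Hol \<Longrightarrow> l (\<lambda>z. c *s f z) = c * l f"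
    and r: "0 < r" "r < 1" and "C > 0"
    and bound: "\<And>f M. f \<in> Hol \<Longrightarrow> (\<And>z. z \<in> cball 0 r \<Longrightarrow> norm (f z) \<le> M) \<Longrightarrow> M \<ge> 0 \<Longrightarrow> norm (l f) \<le> C * M"
begin

lemma functional_diff: "f \<in> Hol \<Longrightarrow> g \<in> Hol \<Longrightarrow> l (\<lambda>z. f z - g z) = l f - l g"
  using add[of "\<lambda>z. f z - g z" g] diff_in_Hol[of f g] by simp

text \<open>Runge's theorem for the evolution maps in small steps backwards in time: the transition map
  between nearby times is invertible on a ball slightly larger than the support of \<open>l\<close>.\<close>

lemma functional_vanishes_backwards_step:
  obtains \<delta> where "\<delta> > 0"
    "\<And>s t. 0 \<le> s \<Longrightarrow> s \<le> t \<Longrightarrow> t - s \<le> \<delta> \<Longrightarrow>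
       \<forall>q\<in>second_order. l (on_ball (\<lambda>z. q (evolution G 0 t z))) = 0 \<Longrightarrow>
       \<forall>q\<in>second_order. l (on_ball (\<lambda>z. q (evolution G 0 s z))) = 0"
proof -
  \<comment> \<open>The gap between \<open>r\<close> and 1 is divided into six parts: the inverse
    lives on radius \<open>r + \<eta>\<close>, the transition map is controlled on radius
    \<open>r + 4 * \<eta>\<close>, and the margin \<open>r1 + 2 * \<eta> < R\<close> serves the
    inversion. The step length \<open>\<eta> / K\<close> used below is the same for all starting
    times, since \<open>K\<close> bounds displacements uniformly.\<close>
  define \<eta> where "\<eta> = (1 - r) / 6"
  have \<eta>: "\<eta> > 0" "r + 6 * \<eta> = 1" using r by (auto simp: \<eta>_def field_simps)
  define R where "R = r + 4 * \<eta>"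
  define r1 where "r1 = r + \<eta>"
  have R: "0 < R" "R < 1" "r1 + 2 * \<eta> < R" "0 < r1" "r < r1" using \<eta> r by (auto simp: R_def r1_def)
  obtain K where K: "K > 0" "\<And>a b w. norm w \<le> R \<Longrightarrow> a \<le> b \<Longrightarrow> norm (evolution G a b w - w) \<le> K * (b - a)"
  proof (rule evolution_frozen_field[where ?'n = 'n, OF R(1,2)], goal_cases)
    case (1 C)
    show ?case by (rule 1(1)[OF 1(2) 1(3)[OF G]])
  qed
  obtain E where E: "E \<ge> 1" "\<And>s x y t. is_trajectory G s x \<Longrightarrow> is_trajectory G s y \<Longrightarrow>
       norm (x s) \<le> R \<Longrightarrow> norm (y s) \<le> R \<Longrightarrow> s \<le> t \<Longrightarrow> norm (x s - y s) \<le> E * (exp (t - s) * norm (x t - y t))"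
    using trajectory_difference_bounds[OF R(1,2)] G by metis
  show thesis
  proof (rule that[of "\<eta> / K"], goal_cases)
    case 1
    show ?case using \<eta>(1) K(1) by simp
  next
    case (2 s t)
    note st = 2(1-3)
    have van: "l (on_ball (\<lambda>z. q (evolution G 0 t z))) = 0" if "q \<in> second_order" for q
      using 2(4) that by blast
    show ?case
    proof
    fix q :: "complex^'n \<Rightarrow> complex^'n"
    assume q: "q \<in> second_order"
    define \<psi> where "\<psi> = evolution G s t"
    have qH: "q \<in> Hol" by (rule second_order_in_Hol[OF q])
    have close: "norm (\<psi> x - x) \<le> \<eta>" if "norm x < R" for x
    proof -
      have "norm (\<psi> x - x) \<le> K * (t - s)" unfolding \<psi>_def using K(2)[OF _ st(2)] that by simp
      also have "\<dots> \<le> K * (\<eta> / K)" using st(3) K(1) by (intro mult_left_mono) auto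
      finally show ?thesis using K(1) by simp
    qed
    have lower: "1 / (E * exp (t - s)) * norm (x - y) \<le> norm (\<psi> x - \<psi> y)" if "norm x < R" "norm y < R" for x y
    proof -
      have x1: "norm x < 1" "norm y < 1" using that R by auto
      note ex = evolution_trajectory[OF G x1(1), where s = s] and ey = evolution_trajectory[OF G x1(2), where s = s]
      have "norm (x - y) \<le> E * (exp (t - s) * norm (\<psi> x - \<psi> y))"
        using E(2)[OF ex(1) ey(1) _ _ st(2)] ex(2) ey(2) that by (simp add: \<psi>_def)
      then show ?thesis using E(1) by (simp add: field_simps)
    qed
    have hol\<psi>: "holomorphic_map_on \<psi> (ball 0 R)"
      unfolding \<psi>_def
      by (rule holomorphic_map_on_subset[OF evolution_holomorphic[OF S G st(2)]]) (use R in auto)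
    have "1 / (E * exp (t - s)) > 0" using E(1) by simp
    obtain \<kappa> where \<kappa>: "holomorphic_map_on \<kappa> (ball 0 r1)" "\<And>y. norm y < r1 \<Longrightarrow> norm (\<kappa> y) < r1 + \<eta>"
      "\<And>x. norm x < R \<Longrightarrow> \<kappa> (\<psi> x) = x"
      using inverse_holomorphic_on_ball[OF hol\<psi> close lower \<open>1 / (E * exp (t - s)) > 0\<close> R(3,4) \<eta>(1)] by blast
    have \<kappa>_le: "norm (\<kappa> y) < R" if "norm y < r1" for y using \<kappa>(2)[OF that] R \<eta>(1) by simp
    \<comment> \<open>Composing \<open>g\<close> with the evolution up to \<open>t\<close>
      reproduces \<open>q\<close> composed with the evolution up to \<open>s\<close>, on
      \<open>cball 0 r\<close>. As \<open>g\<close> is holomorphic on \<open>ball 0 r1\<close> only,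
      the assumption at time \<open>t\<close> is applied to entire approximants \<open>Q\<close> of
      \<open>g\<close> restricted to the unit ball.\<close>
    define g where "g y = q (\<kappa> y)" for y
    have holg: "holomorphic_map_on g (ball 0 r1)"
      unfolding g_def[abs_def]
      by (rule holomorphic_map_on_compose[OF \<kappa>(1) Hol_holomorphic[OF qH]]) (use \<kappa>_le R in fastforce)
    obtain M where M: "M > 0" "\<And>z. z \<in> cball 0 R \<Longrightarrow> norm (q z) \<le> M" using Hol_bounded_on_cball[OF qH R(2)] by blast
    have gM: "norm (g y) \<le> M" if "y \<in> ball 0 r1" for y
      using M(2)[of "\<kappa> y"] \<kappa>_le[of y] that by (simp add: g_def)
    have "\<psi> 0 = 0" unfolding \<psi>_def using Loewner_chain_zero(2)[OF G st(2)] .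
    then have \<kappa>0: "\<kappa> 0 = 0" using \<kappa>(3)[of 0] R by simp
    have g0: "g 0 = 0" using q \<kappa>0 by (simp add: g_def second_order_def)
    have gd: "(g has_derivative (\<lambda>_. 0)) (at 0)"
    proof -
      have "(0::complex^'n) \<in> ball 0 r1" using R by simp
      note d = holomorphic_map_on_frechet_derivative(1)[OF \<kappa>(1) this]
      have "(q has_derivative (\<lambda>_. 0)) (at (\<kappa> 0))" using q \<kappa>0 by (simp add: second_order_def)
      from has_derivative_compose[OF d this] show ?thesis by (simp add: g_def[abs_def])
    qed
    have le: "norm (l (on_ball (\<lambda>z. q (evolution G 0 s z)))) \<le> C * e" if "e > 0" for e
    proof -
      obtain Q where Q: "holomorphic_map_on Q UNIV" "Q 0 = 0" "(Q has_derivative (\<lambda>_. 0)) (at 0)"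
        "\<And>z. z \<in> cball 0 r \<Longrightarrow> norm (Q z - g z) \<le> e"
      proof (rule holomorphic_map_entire_approximation[where M = M, OF holg _ r(1) R(5) \<open>e > 0\<close> g0 gd], goal_cases)
        case (1 x)
        show ?case by (rule gM[OF 1(2)])
      next
        case (2 Q)
        show ?case by (rule 2(1)[OF 2(2-5)])
      qed
      have Q2: "on_ball Q \<in> second_order"
        by (rule second_orderI[OF _ Q(2,3)]) (use Q(1) holomorphic_map_on_subset in blast)
      have t0: "0 \<le> t" using st by simp
      note H1 = on_ball_compose_in_Hol[OF qH st(1)] and H2 = on_ball_compose_in_Hol[OF second_order_in_Hol[OF Q2] t0]
      have "l (on_ball (\<lambda>z. q (evolution G 0 s z))) =
          l (\<lambda>z. on_ball (\<lambda>z. q (evolution G 0 s z)) z - on_ball (\<lambda>z. on_ball Q (evolution G 0 t z)) z)"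
        using functional_diff[OF H1 H2] van[OF Q2] by simp
      also have "norm \<dots> \<le> C * e"
      proof (rule bound[OF diff_in_Hol[OF H1 H2]])
        fix z :: "complex^'n" assume z: "z \<in> cball 0 r"
        then have z1: "norm z < 1" using r by simp
        define x where "x = evolution G 0 s z"
        define y where "y = evolution G 0 t z"
        have x: "norm x \<le> r" and y: "norm y \<le> r"
          using norm_evolution_le[OF G z1 st(1)] norm_evolution_le[OF G z1 t0] z by (auto simp: x_def y_def)
        have "y = \<psi> x" unfolding x_def y_def \<psi>_def using evolution_compose[OF G z1 st(1,2)] by simp
        moreover have "norm x < R" using x R \<eta>(1) by linarith
        ultimately have "\<kappa> y = x" using \<kappa>(3)[of x] by simp
        then have "q x = g y" by (simp add: g_def)
        moreover have "norm (Q y - g y) \<le> e" using Q(4)[of y] y by simp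
        ultimately have "norm (q x - Q y) \<le> e" by (simp add: norm_minus_commute)
        then show "norm (on_ball (\<lambda>z. q (evolution G 0 s z)) z - on_ball (\<lambda>z. on_ball Q (evolution G 0 t z)) z) \<le> e"
          using z1 y r by (simp add: on_ball_def x_def[symmetric] y_def[symmetric])
      qed (use that in simp)
      finally show ?thesis .
    qed
    have "norm (l (on_ball (\<lambda>z. q (evolution G 0 s z)))) \<le> 0"
    proof (rule field_le_epsilon)
      fix e :: real assume "e > 0"
      then show "norm (l (on_ball (\<lambda>z. q (evolution G 0 s z)))) \<le> 0 + e" using le[of "e / C"] \<open>C > 0\<close> by simp
    qed
    then show "l (on_ball (\<lambda>z. q (evolution G 0 s z))) = 0" by simp
    qed
  qed
qed

lemma functional_vanishes_at_start:
  assumes "0 \<le> a" and van: "\<And>q. q \<in> second_order \<Longrightarrow> l (on_ball (\<lambda>z. q (evolution G 0 a z))) = 0"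
    and q: "q \<in> second_order"
  shows "l q = 0"
proof -
  obtain \<delta> where \<delta>: "\<delta> > 0" "\<And>s t. 0 \<le> s \<Longrightarrow> s \<le> t \<Longrightarrow> t - s \<le> \<delta> \<Longrightarrow>
       \<forall>q\<in>second_order. l (on_ball (\<lambda>z. q (evolution G 0 t z))) = 0 \<Longrightarrow>
       \<forall>q\<in>second_order. l (on_ball (\<lambda>z. q (evolution G 0 s z))) = 0"
    using functional_vanishes_backwards_step by blast
  \<comment> \<open>The times \<open>a - k \<delta>\<close>, cut off at 0, form a chain of
    admissible steps that reaches 0 after finitely many of them.\<close>
  have step: "\<forall>q\<in>second_order. l (on_ball (\<lambda>z. q (evolution G 0 (max 0 (a - real k * \<delta>)) z))) = 0" for k
  proof (induction k)
    case 0
    then show ?case using van \<open>0 \<le> a\<close> by simp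
  next
    case (Suc k)
    have "max 0 (a - real k * \<delta>) - max 0 (a - real (Suc k) * \<delta>) \<le> \<delta>"
      "max 0 (a - real (Suc k) * \<delta>) \<le> max 0 (a - real k * \<delta>)"
      using \<delta>(1) by (auto simp: algebra_simps max_def)
    then show ?case using \<delta>(2)[of "max 0 (a - real (Suc k) * \<delta>)" "max 0 (a - real k * \<delta>)"] Suc by auto
  qed
  obtain k :: nat where "a / \<delta> \<le> real k" using real_arch_simple by blast
  then have "max 0 (a - real k * \<delta>) = 0" using \<delta>(1) by (simp add: field_simps)
  then have "l (on_ball (\<lambda>z. q (evolution G 0 0 z))) = 0" using step[of k] q by auto
  moreover have "on_ball (\<lambda>z. q (evolution G 0 0 z)) = q"
  proof
    fix z show "on_ball (\<lambda>z. q (evolution G 0 0 z)) z = q z"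
      using evolution_trajectory(2)[OF G, of z 0] second_order_in_Hol[OF q] by (auto simp: on_ball_def Hol_def)
  qed
  ultimately show ?thesis by simp
qed

text \<open>All members of the class vanish at 0 with derivative the identity, so any two of them
  differ by a second order map.\<close>

lemma functional_constant_on_class_S0:
  assumes van: "\<And>q. q \<in> second_order \<Longrightarrow> l q = 0"
  shows "l constant_on class_S0"
  unfolding constant_on_def
proof (cases "(class_S0 :: (complex^'n \<Rightarrow> complex^'n) set) = {}")
  case False
  then obtain f0 where f0: "f0 \<in> (class_S0 :: (complex^'n \<Rightarrow> complex^'n) set)" by blast
  have "l f = l f0" if f: "f \<in> class_S0" for f
  proof -
    have props: "f \<in> Hol" "f 0 = 0" "(f has_derivative (\<lambda>v. v)) (at 0)" if f: "f \<in> class_S0" for f :: "complex^'n \<Rightarrow> complex^'n"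
    proof -
      show "f \<in> Hol" using f S by blast
      obtain H where H: "total_Herglotz_field H" "f = on_ball (Loewner_chain H 0)" using class_S0_eq_Loewner_chain[OF f] by blast
      show "f 0 = 0" by (simp add: H(2) on_ball_def Loewner_chain_zero(1)[OF H(1)])
      show "(f has_derivative (\<lambda>v. v)) (at 0)"
        unfolding H(2) by (rule has_derivative_on_ball) (use Loewner_chain_has_derivative_at_0[OF H(1), of 0] in auto)
    qed
    have "((\<lambda>z. f z - f0 z) has_derivative (\<lambda>v. v - v)) (at 0)"
      by (intro has_derivative_diff props(3) f f0)
    then have "(\<lambda>z. f z - f0 z) \<in> second_order"
      using props[OF f] props[OF f0] by (simp add: second_order_def diff_in_Hol)
    from van[OF this] show ?thesis using functional_diff props(1) f f0 by simp
  qed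
  then show "\<exists>y. \<forall>f\<in>class_S0. l f = y" by blast
qed auto

text \<open>The evolution does not increase norms, so it maps \<open>cball 0 r\<close> into itself;
  values on that ball therefore control the pullback on the same ball, with \<open>N\<close>
  bounding the derivative of the chain there.\<close>

lemma pullback_bound:
  assumes "0 \<le> a"
  obtains N where "N > 0" "\<And>p M z. (\<And>w. w \<in> cball 0 r \<Longrightarrow> norm (p w) \<le> M) \<Longrightarrow> z \<in> cball 0 r \<Longrightarrow> norm (pullback G a p z) \<le> N * M"
proof -
  let ?F = "Loewner_chain G a"
  define R where "R = (1 + r) / 2"
  have R: "r < R" "R < 1" using r by (auto simp: R_def)
  obtain B where B: "B > 0" "\<And>z. z \<in> cball 0 R \<Longrightarrow> norm (?F z) \<le> B"
    using holomorphic_map_on_bounded_locally[OF Loewner_chain_holomorphic[OF S G] R(2)] by blast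
  define N where "N = real CARD('n) * B / (R - r)"
  have "N > 0" using B(1) R by (simp add: N_def)
  have D: "norm (frechet_derivative ?F (at w) v) \<le> N * norm v" if w: "norm w \<le> r" for w v
    unfolding N_def
  proof (rule holomorphic_map_derivative_bound)
    have sub: "ball w (R - r) \<subseteq> ball 0 R"
    proof
      fix y assume "y \<in> ball w (R - r)"
      then show "y \<in> ball 0 R"
        using norm_triangle_ineq[of "y - w" w] w by (auto simp: dist_norm norm_minus_commute)
    qed
    show "holomorphic_map_on ?F (ball w (R - r))"
      using sub subset_ball[of R 1 "0 :: complex^'n"] R
      by (intro holomorphic_map_on_subset[OF Loewner_chain_holomorphic[OF S G]]) auto
    show "norm (?F x) \<le> B" if "x \<in> ball w (R - r)" for x using B(2) sub that by (auto simp: subset_iff less_imp_le)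
  qed (use R in simp)
  show thesis
  proof (rule that[OF \<open>N > 0\<close>])
    fix p :: "complex^'n \<Rightarrow> complex^'n" and M and z :: "complex^'n"
    assume p: "\<And>w. w \<in> cball 0 r \<Longrightarrow> norm (p w) \<le> M" and z: "z \<in> cball 0 r"
    then have z1: "norm z < 1" using r by simp
    have w: "norm (evolution G 0 a z) \<le> r" using norm_evolution_le[OF G z1 assms] z by simp
    have "norm (pullback G a p z) \<le> N * norm (p (evolution G 0 a z))"
      using D[OF w] z1 by (simp add: pullback_def on_ball_def)
    also have "\<dots> \<le> N * M" using p[of "evolution G 0 a z"] w \<open>N > 0\<close> by (intro mult_left_mono) auto
    finally show "norm (pullback G a p z) \<le> N * M" .
  qed
qed

lemma continuous_linear_functional_pullback:
  assumes "0 \<le> a"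
  shows "continuous_linear_functional (\<lambda>p. l (pullback G a p))"
proof -
  obtain N where N: "N > 0" "\<And>p M z. (\<And>w. w \<in> cball 0 r \<Longrightarrow> norm (p w) \<le> M) \<Longrightarrow> z \<in> cball 0 r \<Longrightarrow> norm (pullback G a p z) \<le> N * M"
    using pullback_bound[OF assms] by blast
  show ?thesis
  proof (rule continuous_linear_functionalI[OF _ _ r(2), where C = "C * N"])
    show "l (pullback G a (\<lambda>z. f z + g z)) = l (pullback G a f) + l (pullback G a g)" if "f \<in> Hol" "g \<in> Hol" for f g
      unfolding pullback_add[OF assms] using that by (intro add pullback_in_Hol[OF assms] Hol_holomorphic)
    show "l (pullback G a (\<lambda>z. c *s f z)) = c * l (pullback G a f)" if "f \<in> Hol" for c f
      unfolding pullback_scale[OF assms] using that by (intro scale pullback_in_Hol[OF assms] Hol_holomorphic)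
    show "norm (l (pullback G a f)) \<le> C * N * M"
      if f: "f \<in> Hol" "\<And>z. z \<in> cball 0 r \<Longrightarrow> norm (f z) \<le> M" "M \<ge> 0" for f M
      using bound[OF pullback_in_Hol[OF assms Hol_holomorphic[OF f(1)]], of "N * M"] N(1) N(2)[OF f(2)] f(3)
      by (simp add: mult.assoc)
  qed
qed

lemma constant_on_class_S0_if_pullback_constant:
  assumes "0 \<le> a" and const: "(\<lambda>p. l (pullback G a p)) constant_on class_M"
  shows "l constant_on class_S0"
proof -
  let ?l = "\<lambda>p. l (pullback G a p)"
  obtain y where y: "\<And>h. h \<in> class_M \<Longrightarrow> ?l h = y" using const unfolding constant_on_def by blast
  have lin: "?l (\<lambda>z. f z + g z) = ?l f + ?l g" "?l (\<lambda>z. c *s f z) = c * ?l f" if "f \<in> Hol" "g \<in> Hol" for f g c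
    using continuous_linear_functional_pullback[OF \<open>0 \<le> a\<close>] that unfolding continuous_linear_functional_def by blast+
  \<comment> \<open>Constancy is tested on \<open>-z\<close> and on \<open>-z + p / K\<close>, both
    in \<open>class_M\<close>.\<close>
  have linear_bounded: "?l p = 0"
    if p: "p \<in> second_order" and "K > 0" "\<And>z. norm z < 1 \<Longrightarrow> norm (p z) \<le> K * norm z" for p K
  proof -
    let ?n = "on_ball (\<lambda>z. - z) :: complex^'n \<Rightarrow> complex^'n"
    have n: "?n \<in> class_M" by (rule neg_in_class_M)
    have "?l (\<lambda>z. ?n z + complex_of_real (1 / K) *s p z) = y"
      by (rule y[OF class_M_perturbation[OF p that(3) \<open>K > 0\<close>]])
    then have "?l ?n + complex_of_real (1 / K) * ?l p = y"
      using lin[of ?n "\<lambda>z. complex_of_real (1 / K) *s p z"] lin(2)[of p p] n second_order_in_Hol[OF p]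
      by (simp add: class_M_def cmult_in_Hol)
    then have "complex_of_real (1 / K) * ?l p = 0" using y[OF n] by simp
    then show ?thesis using \<open>K > 0\<close> by simp
  qed
  have all: "?l p = 0" if p: "p \<in> second_order" for p
  proof -
    have pH: "p \<in> Hol" by (rule second_order_in_Hol[OF p])
    obtain N where N: "N > 0" "\<And>p M z. (\<And>w. w \<in> cball 0 r \<Longrightarrow> norm (p w) \<le> M) \<Longrightarrow> z \<in> cball 0 r \<Longrightarrow> norm (pullback G a p z) \<le> N * M"
      using pullback_bound[OF \<open>0 \<le> a\<close>] by blast
    obtain K where K: "K > 0" "\<And>x y. x \<in> cball 0 r \<Longrightarrow> y \<in> cball 0 r \<Longrightarrow> norm (p x - p y) \<le> K * norm (x - y)"
      using holomorphic_map_on_lipschitz_locally[OF Hol_holomorphic[OF pH] r(2)] by blast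
    \<comment> \<open>A general \<open>p\<close> need not be bounded by a multiple of
      \<open>norm z\<close> up to the sphere, but its dilation
      \<open>z \<mapsto> p ((1 - t) z)\<close> is. On \<open>cball 0 r\<close>, which determines the
      functional, the dilation changes \<open>p\<close> by at most \<open>K * t\<close>.\<close>
    have dil: "norm (?l p) \<le> C * (N * (K * t))" if t: "0 < t" "t < 1" for t
    proof -
      define \<rho> where "\<rho> = 1 - t"
      have \<rho>: "0 < \<rho>" "\<rho> < 1" using t by (auto simp: \<rho>_def)
      define p1 where "p1 z = p (complex_of_real \<rho> *s z)" for z
      have n\<rho>: "norm (complex_of_real \<rho> *s z) = \<rho> * norm z" for z :: "complex^'n"
        using \<rho> by (simp add: norm_vector_scalar_mult)
      have n\<rho>1: "\<rho> * norm z < 1" if "norm z < 1" for z :: "complex^'n"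
        using that \<rho> mult_strict_mono[of \<rho> 1 "norm z" 1] by simp
      have holp1: "holomorphic_map_on p1 (ball 0 1)"
        unfolding p1_def[abs_def]
        by (rule holomorphic_map_on_compose[OF holomorphic_map_on_scale Hol_holomorphic[OF pH]]) (use n\<rho> n\<rho>1 in auto)
      have "((\<lambda>z. complex_of_real \<rho> *s z) has_derivative (\<lambda>v. complex_of_real \<rho> *s v)) (at (0::complex^'n))"
        unfolding scaleR_eq_vector_scalar_mult[symmetric] by (auto intro!: derivative_eq_intros)
      moreover have "(p has_derivative (\<lambda>_. 0)) (at (complex_of_real \<rho> *s 0))" using p by (simp add: second_order_def)
      ultimately have "(p1 has_derivative (\<lambda>_. 0)) (at 0)"
        unfolding p1_def[abs_def] by (rule has_derivative_compose)
      moreover have "p1 0 = 0" using p by (simp add: p1_def second_order_def)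
      ultimately have p2: "on_ball p1 \<in> second_order" by (intro second_orderI holp1)
      obtain K1 where K1: "K1 > 0" "\<And>x y. x \<in> cball 0 \<rho> \<Longrightarrow> y \<in> cball 0 \<rho> \<Longrightarrow> norm (p x - p y) \<le> K1 * norm (x - y)"
        using holomorphic_map_on_lipschitz_locally[OF Hol_holomorphic[OF pH] \<rho>(2)] by blast
      have "?l (on_ball p1) = 0"
      proof (rule linear_bounded[OF p2 K1(1)])
        fix z :: "complex^'n" assume z: "norm z < 1"
        have "norm (p (complex_of_real \<rho> *s z) - p 0) \<le> K1 * norm (complex_of_real \<rho> *s z - 0)"
          using z \<rho> by (intro K1(2)) (auto simp: n\<rho> mult_le_cancel_left1)
        also have "\<dots> \<le> K1 * norm z" using K1(1) \<rho> by (simp add: n\<rho> mult_left_le_one_le)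
        finally show "norm (on_ball p1 z) \<le> K1 * norm z"
          using z p by (simp add: on_ball_def p1_def second_order_def)
      qed
      then have "?l p = ?l p - ?l (on_ball p1)" by simp
      also have "\<dots> = l (pullback G a (\<lambda>z. p z - on_ball p1 z))"
        unfolding pullback_diff[OF \<open>0 \<le> a\<close>]
        by (rule functional_diff[symmetric])
           (intro pullback_in_Hol \<open>0 \<le> a\<close> Hol_holomorphic pH second_order_in_Hol[OF p2])+
      also have "norm \<dots> \<le> C * (N * (K * t))"
      proof (rule bound)
        show "pullback G a (\<lambda>z. p z - on_ball p1 z) \<in> Hol"
          by (intro pullback_in_Hol \<open>0 \<le> a\<close> Hol_holomorphic diff_in_Hol pH second_order_in_Hol[OF p2])
        fix z :: "complex^'n" assume z: "z \<in> cball 0 r"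
        show "norm (pullback G a (\<lambda>z. p z - on_ball p1 z) z) \<le> N * (K * t)"
        proof (rule N(2)[OF _ z])
          fix w :: "complex^'n" assume w: "w \<in> cball 0 r"
          have "\<rho> * norm w \<le> 1 * norm w" using \<rho> by (intro mult_right_mono) auto
          then have "norm (p w - p (complex_of_real \<rho> *s w)) \<le> K * norm (w - complex_of_real \<rho> *s w)"
            using w by (intro K(2)) (auto simp: n\<rho>)
          also have "w - complex_of_real \<rho> *s w = t *\<^sub>R w"
            unfolding scaleR_eq_vector_scalar_mult[symmetric] by (simp add: \<rho>_def algebra_simps)
          also have "K * norm (t *\<^sub>R w) \<le> K * t"
            using w r t K(1) by (simp add: mult_left_le)
          finally show "norm (p w - on_ball p1 w) \<le> K * t" using w r by (simp add: on_ball_def p1_def)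
        qed
      qed (use N(1) K(1) t in simp)
      finally show ?thesis .
    qed
    have "norm (?l p) \<le> 0"
    proof (rule field_le_epsilon)
      fix e :: real assume "e > 0"
      define t where "t = min (1/2) (e / (C * (N * K)))"
      have t: "0 < t" "t < 1" using \<open>e > 0\<close> \<open>C > 0\<close> N(1) K(1) by (auto simp: t_def)
      have "C * (N * (K * t)) = C * (N * K) * t" by simp
      also have "\<dots> \<le> C * (N * K) * (e / (C * (N * K)))"
        using \<open>C > 0\<close> N(1) K(1) by (intro mult_left_mono) (auto simp: t_def)
      also have "\<dots> = e" using \<open>C > 0\<close> N(1) K(1) by simp
      finally show "norm (?l p) \<le> 0 + e" using dil[OF t] by simp
    qed
    then show ?thesis by simp
  qed
  have van: "l (on_ball (\<lambda>z. q (evolution G 0 a z))) = 0" if q: "q \<in> second_order" for q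
  proof -
    let ?D = "\<lambda>z. frechet_derivative (Loewner_chain G a) (at z)"
    have qH: "holomorphic_map_on q (ball 0 1)" by (rule Hol_holomorphic[OF second_order_in_Hol[OF q]])
    \<comment> \<open>Solving for \<open>p\<close> under the derivative of the chain cancels the
      factor that \<open>pullback\<close> introduces, and turns the statement for
      \<open>pullback\<close> into one for plain composition with the evolution.\<close>
    obtain p where p: "holomorphic_map_on p (ball 0 1)" "\<And>z. z \<in> ball 0 1 \<Longrightarrow> ?D z (p z) = q z"
    proof (rule holomorphic_map_on_derivative_solve[OF Loewner_chain_holomorphic[OF S G] qH])
      fix z v :: "complex^'n" assume z: "z \<in> ball 0 1" and v: "?D z v = 0"
      define \<rho> where "\<rho> = (1 + norm z) / 2"
      have \<rho>: "0 < \<rho>" "\<rho> < 1" "norm z \<le> \<rho>" using z by (auto simp: \<rho>_def intro: add_pos_nonneg)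
      obtain c where c: "c > 0" "\<And>z v. norm z \<le> \<rho> \<Longrightarrow> c * norm v \<le> norm (?D z v)"
        using Loewner_chain_derivative_lower_bound[OF \<rho>(1,2)] by blast
      have "c * norm v \<le> 0" using c(2)[OF \<rho>(3), of v] v by simp
      then show "v = 0" using c(1) by (simp add: mult_le_0_iff)
    qed (rule that)
    have half: "0 < (1/2::real)" "(1/2::real) < 1" by simp_all
    obtain c where c: "c > 0" "\<And>z v. norm z \<le> 1/2 \<Longrightarrow> c * norm v \<le> norm (?D z v)"
      using Loewner_chain_derivative_lower_bound[OF half] by blast
    obtain B where B: "B > 0" "\<And>z. z \<in> cball 0 (1/2) \<Longrightarrow> norm (q z) \<le> B"
      using holomorphic_map_on_bounded_locally[OF qH half(2)] by blast
    define N where "N = 2 * real CARD('n) * B / (1/2)\<^sup>2"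
    have q2: "norm (q v) \<le> N * (norm v)\<^sup>2" if v: "norm v \<le> 1/4" for v
    proof -
      have "norm (q (0 + v) - q 0 - frechet_derivative q (at 0) v) \<le> 2 * real CARD('n) * B / (1/2)\<^sup>2 * (norm v)\<^sup>2"
      proof (rule holomorphic_map_taylor_bound)
        show "holomorphic_map_on q (ball 0 (1/2))" using qH by (rule holomorphic_map_on_subset) auto
      qed (use B v in auto)
      moreover have "frechet_derivative q (at 0) = (\<lambda>_. 0)"
        using q frechet_derivative_at[of q "\<lambda>_. 0" 0] by (simp add: second_order_def)
      ultimately show ?thesis using q by (simp add: N_def second_order_def)
    qed
    \<comment> \<open>Near the origin the derivative of the chain is bounded below by
      \<open>c\<close>, so \<open>p\<close> inherits the quadratic bound of \<open>q\<close> and is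
      of second order itself.\<close>
    have p2: "norm (p v) \<le> N / c * (norm v)\<^sup>2" if v: "norm v \<le> 1/4" for v
    proof -
      have "c * norm (p v) \<le> norm (?D v (p v))" using v by (intro c(2)) simp
      also have "\<dots> = norm (q v)" using p(2)[of v] v by simp
      also have "\<dots> \<le> N * (norm v)\<^sup>2" by (rule q2[OF v])
      finally show ?thesis using c(1) by (simp add: field_simps)
    qed
    have p0: "p 0 = 0" using p2[of 0] by simp
    have "(p has_derivative (\<lambda>_. 0)) (at 0)"
      by (rule has_derivative_if_quadratic[where \<rho> = "1/4" and C = "N / c"]) (use p2 p0 in auto)
    then have ps: "on_ball p \<in> second_order" using p(1) p0 by (intro second_orderI)
    have "pullback G a (on_ball p) = on_ball (\<lambda>z. q (evolution G 0 a z))"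
    proof
      fix z
      show "pullback G a (on_ball p) z = on_ball (\<lambda>z. q (evolution G 0 a z)) z"
      proof (cases "norm z < 1")
        case True
        then have "norm (evolution G 0 a z) < 1" by (rule norm_evolution_less[OF G _ \<open>0 \<le> a\<close>])
        then show ?thesis using p(2)[of "evolution G 0 a z"] True by (simp add: pullback_def on_ball_def)
      qed (simp add: pullback_def on_ball_def)
    qed
    then show ?thesis using all[OF ps] by simp
  qed
  show ?thesis
    by (rule functional_constant_on_class_S0, rule functional_vanishes_at_start[OF \<open>0 \<le> a\<close> van])
qed

end

end

subsection \<open>Variation of an extremal map\<close>

lemma needle_variation_inequality:
  fixes G :: "complex^'n \<Rightarrow> real \<Rightarrow> complex^'n" and \<Phi> :: "(complex^'n \<Rightarrow> complex^'n) \<Rightarrow> complex"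
  assumes S: "class_S0 \<subseteq> (Hol :: (complex^'n \<Rightarrow> complex^'n) set)" and G: "total_Herglotz_field G"
    and cd: "complex_differentiable_at \<Phi> U (on_ball (Loewner_chain G 0))"
    and ext: "\<And>f. f \<in> class_S0 \<Longrightarrow> Re (\<Phi> f) \<le> Re (\<Phi> (on_ball (Loewner_chain G 0)))"
    and "0 \<le> a" and h: "h \<in> class_M"
    and exp: "\<forall>r<1. \<forall>e>0. \<exists>d>0. \<forall>\<epsilon> w. 0 < \<epsilon> \<longrightarrow> \<epsilon> < d \<longrightarrow> norm w \<le> r \<longrightarrow>
      norm (evolution G a (a + \<epsilon>) w - w - \<epsilon> *\<^sub>R G w a) \<le> e * \<epsilon>"
  shows "Re (directional_derivative \<Phi> (on_ball (Loewner_chain G 0)) (pullback G a (\<lambda>z. h z - G z a))) \<le> 0"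
proof -
  define F where "F = on_ball (Loewner_chain G 0)"
  define H where "H = pullback G a (\<lambda>z. h z - G z a)"
  define \<epsilon> where "\<epsilon> m = 1 / real (Suc m)" for m
  have \<epsilon>: "\<epsilon> m > 0" for m by (simp add: \<epsilon>_def)
  have \<epsilon>0: "\<epsilon> \<longlonglongrightarrow> 0" unfolding \<epsilon>_def[abs_def] by (rule lim_1_over_Suc)
  \<comment> \<open>The needle field follows \<open>G\<close> up to \<open>a\<close>, then
    \<open>h\<close> for the duration \<epsilon>, then \<open>G\<close> again. It is built by two
    switches, so that the gluing rules apply once at each switching time.\<close>
  define G1 where "G1 z t = (if t \<le> a then G z t else h z)" for z t
  define Gm where "Gm m z t = (if t \<le> a + \<epsilon> m then G1 z t else G z t)" for m z t
  have Gh: "total_Herglotz_field (\<lambda>z t. h z)" by (rule total_Herglotz_field_autonomous[OF h])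
  have G1: "total_Herglotz_field G1"
    unfolding G1_def[abs_def] by (rule total_Herglotz_field_switch[OF G Gh])
  have Gm: "total_Herglotz_field (Gm m)" for m
    unfolding Gm_def[abs_def] by (rule total_Herglotz_field_switch[OF G1 G])
  define Fm where "Fm m = on_ball (Loewner_chain (Gm m) 0)" for m
  have Fm_S0: "Fm m \<in> class_S0" for m unfolding Fm_def by (rule Loewner_chain_in_class_S0[OF Gm])
  have FH: "F \<in> Hol" unfolding F_def using Loewner_chain_in_class_S0[OF G] S by blast
  \<comment> \<open>The exact difference quotients of the variation: \<open>F + \<epsilon> k\<close>
    is again the competitor \<open>Fm\<close>, and extremality applies to it without any
    remainder.\<close>
  define k where "k m z = complex_of_real (1 / \<epsilon> m) *s (Fm m z - F z)" for m z
  have kH: "k m \<in> Hol" for m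
    unfolding k_def[abs_def] using Fm_S0 S by (intro cmult_in_Hol diff_in_Hol FH) blast
  have GM: "(\<lambda>z. G z a) \<in> Hol" using G by (simp add: total_Herglotz_field_def class_M_def)
  have hH: "h \<in> Hol" using h by (simp add: class_M_def)
  have HH: "H \<in> Hol"
    unfolding H_def by (intro pullback_in_Hol[OF S G \<open>0 \<le> a\<close>] Hol_holomorphic diff_in_Hol hH GM)
  have Fm_eq: "Loewner_chain (Gm m) 0 z = Loewner_chain G (a + \<epsilon> m) (evolution (\<lambda>z t. h z) a (a + \<epsilon> m) (evolution G 0 a z))"
    if z: "norm z < 1" for m z
  proof -
    have b: "0 \<le> a + \<epsilon> m" "a \<le> a + \<epsilon> m" using \<open>0 \<le> a\<close> \<epsilon>[of m] by auto
    have "Loewner_chain (Gm m) 0 z = Loewner_chain G (a + \<epsilon> m) (evolution G1 0 (a + \<epsilon> m) z)"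
      by (rule Loewner_chain_switch[OF Gm G1 G z b(1)]) (auto simp: Gm_def)
    also have "evolution G1 0 (a + \<epsilon> m) z = evolution (\<lambda>z t. h z) a (a + \<epsilon> m) (evolution G 0 a z)"
      by (rule evolution_switch(2)[OF G1 G Gh z \<open>0 \<le> a\<close> _ _ b(2)]) (auto simp: G1_def)
    finally show ?thesis .
  qed
  have F_eq: "Loewner_chain G 0 z = Loewner_chain G (a + \<epsilon> m) (evolution G a (a + \<epsilon> m) (evolution G 0 a z))"
    if z: "norm z < 1" for m z
  proof -
    have b: "0 \<le> a + \<epsilon> m" "a \<le> a + \<epsilon> m" using \<open>0 \<le> a\<close> \<epsilon>[of m] by auto
    show ?thesis
      unfolding evolution_compose[OF G z \<open>0 \<le> a\<close> b(2)] by (rule Loewner_chain_evolution[OF G z b(1), symmetric])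
  qed
  have "Re (directional_derivative \<Phi> F H) \<le> 0"
  proof (rule extremal_variation[OF cd[folded F_def] FH HH kH _ \<epsilon> \<epsilon>0])
    fix r :: real assume "r < 1"
    show "uniform_limit (cball 0 r) k H sequentially"
    proof (rule uniform_limitI)
      fix e :: real assume "e > 0"
      then have "e / 2 > 0" by simp
      obtain d where d: "d > 0" "\<And>\<epsilon> w. 0 < \<epsilon> \<Longrightarrow> \<epsilon> < d \<Longrightarrow> norm w \<le> r \<Longrightarrow>
        norm (Loewner_chain G (a + \<epsilon>) (evolution (\<lambda>z t. h z) a (a + \<epsilon>) w) - Loewner_chain G (a + \<epsilon>) (evolution G a (a + \<epsilon>) w)
          - \<epsilon> *\<^sub>R frechet_derivative (Loewner_chain G a) (at w) (h w - G w a)) \<le> e / 2 * \<epsilon>"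
        using needle_variation_expansion[OF S G h exp \<open>r < 1\<close> \<open>e / 2 > 0\<close>] by auto
      have "\<forall>\<^sub>F m in sequentially. \<epsilon> m < d" using order_tendstoD(2)[OF \<epsilon>0 d(1)] .
      then show "\<forall>\<^sub>F m in sequentially. \<forall>z\<in>cball 0 r. dist (k m z) (H z) < e"
      proof eventually_elim
        case (elim m)
        show ?case
        proof
          fix z :: "complex^'n" assume "z \<in> cball 0 r"
          then have z: "norm z < 1" "norm z \<le> r" using \<open>r < 1\<close> by auto
          define w where "w = evolution G 0 a z"
          have w: "norm w \<le> r" using norm_evolution_le[OF G z(1) \<open>0 \<le> a\<close>] z(2) by (simp add: w_def)
          have Hz: "H z = frechet_derivative (Loewner_chain G a) (at w) (h w - G w a)"
            using z by (simp add: H_def pullback_def on_ball_def w_def)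
          have "Fm m z - F z - \<epsilon> m *\<^sub>R H z = \<epsilon> m *\<^sub>R (k m z - H z)"
            using \<epsilon>[of m] unfolding k_def scaleR_eq_vector_scalar_mult[symmetric] by (simp add: scaleR_diff_right)
          moreover have "norm (Fm m z - F z - \<epsilon> m *\<^sub>R H z) \<le> e / 2 * \<epsilon> m"
            using d(2)[OF \<epsilon> elim w] Fm_eq[OF z(1), of m] F_eq[OF z(1), of m] z
            by (simp add: Fm_def F_def on_ball_def w_def[symmetric] Hz)
          ultimately have "\<epsilon> m * norm (k m z - H z) \<le> \<epsilon> m * (e / 2)" using \<epsilon>[of m] by (simp add: mult.commute)
          then have "norm (k m z - H z) \<le> e / 2" using \<epsilon>[of m] by simp
          then show "dist (k m z) (H z) < e" using \<open>e > 0\<close> by (simp add: dist_norm)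
        qed
      qed
    qed
  next
    fix m
    have "(\<lambda>z. F z + complex_of_real (\<epsilon> m) *s k m z) = Fm m"
      using \<epsilon>[of m] by (simp add: k_def fun_eq_iff flip: scaleR_eq_vector_scalar_mult)
    then show "Re (\<Phi> (\<lambda>z. F z + complex_of_real (\<epsilon> m) *s k m z)) \<le> Re (\<Phi> F)"
      using ext[OF Fm_S0, of m] by (simp add: F_def)
  qed
  then show ?thesis by (simp add: F_def H_def)
qed

theorem theorem1p5:
  fixes U :: "(complex^'n \<Rightarrow> complex^'n) set"
    and \<Phi> L :: "(complex^'n \<Rightarrow> complex^'n) \<Rightarrow> complex"
    and F :: "complex^'n \<Rightarrow> complex^'n"
    and G :: "complex^'n \<Rightarrow> real \<Rightarrow> complex^'n"
  assumes "openin compact_open_topology U"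
    and "class_S0 \<subseteq> U"
    and "continuous_map (subtopology compact_open_topology U) euclidean \<Phi>"
    and "F \<in> class_S0"
    and "\<And>f. f \<in> class_S0 \<Longrightarrow> Re (\<Phi> f) \<le> Re (\<Phi> F)"
    and "complex_differentiable_at \<Phi> U F"
    and "\<And>h. h \<in> Hol \<Longrightarrow> L h = directional_derivative \<Phi> F h"
    and "\<not> L constant_on class_S0"
    and "Herglotz_field G"
    and "is_f_of G F"
  shows "AE t in lebesgue_on {0<..}. support_point class_M (\<lambda>z. G z t)"
proof -
  \<comment> \<open>Open sets of the compact-open topology consist of members of \<open>Hol\<close>.
    All holomorphy of chains and evolution maps is derived from this inclusion.\<close>
  have S: "class_S0 \<subseteq> (Hol :: (complex^'n \<Rightarrow> complex^'n) set)"
    using openin_subset[OF assms(1)] assms(2) by (simp add: topspace_compact_open_topology)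
  have FH: "F \<in> Hol" using S assms(4) by blast
  obtain G' where G': "total_Herglotz_field G'"
    and ae: "AE t in lebesgue. t > 0 \<longrightarrow> (\<lambda>z. G z t) \<in> class_M \<and> (\<forall>z. G' z t = G z t)"
    using total_Herglotz_field_of_Herglotz_field[OF assms(9)] by blast
  have "AE t in lebesgue. t > 0 \<longrightarrow> (\<forall>z. G' z t = G z t)" using ae by eventually_elim auto
  then have F: "F = on_ball (Loewner_chain G' 0)" by (rule is_f_of_eq_Loewner_chain[OF G' _ assms(10)])
  \<comment> \<open>\<open>D\<close> agrees with \<open>L\<close> on \<open>Hol\<close>, which
    contains \<open>class_S0\<close>; linearity and the bound are established for \<open>D\<close>,
    and nonconstancy is transferred from \<open>L\<close>.\<close>
  define D where "D = directional_derivative \<Phi> F"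
  have add: "D (\<lambda>z. f z + g z) = D f + D g" if "f \<in> Hol" "g \<in> Hol" for f g
    unfolding D_def by (rule directional_derivative_add[OF assms(6) FH that])
  have scale: "D (\<lambda>z. c *s f z) = c * D f" if "f \<in> Hol" for c f
    unfolding D_def by (rule directional_derivative_scale[OF assms(6) FH that])
  obtain r C where r: "0 < r" "r < 1" "C > 0"
    and bound: "\<And>f M. f \<in> Hol \<Longrightarrow> (\<And>z. z \<in> cball 0 r \<Longrightarrow> norm (f z) \<le> M) \<Longrightarrow> M \<ge> 0 \<Longrightarrow> norm (D f) \<le> C * M"
  proof (rule directional_derivative_bound[OF assms(6) FH], goal_cases)
    case (1 r C)
    show ?case by (rule 1(1)[OF 1(2-4)]) (use 1(5) in \<open>simp add: D_def\<close>)
  qed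
  have "D constant_on class_S0 \<Longrightarrow> L constant_on class_S0"
    unfolding constant_on_def D_def using assms(7) S by (metis subsetD)
  then have D: "\<not> D constant_on class_S0" using assms(8) by blast
  \<comment> \<open>A good time is one at which the total field agrees with \<open>G\<close> and the
    first order expansion of the flow holds. Neither exceptional set depends on the competitor
    \<open>h\<close>, so one null set serves all of \<open>class_M\<close>.\<close>
  show ?thesis
    unfolding AE_lebesgue_on_pos_iff
    using ae AE_evolution_expansion[OF G']
  proof eventually_elim
    case (elim a)
    show ?case
    proof
      assume "0 < a"
      then have a: "0 \<le> a" by simp
      have GM: "(\<lambda>z. G z a) \<in> class_M" and eq: "\<And>z. G' z a = G z a" using elim(1) \<open>0 < a\<close> by auto
      \<comment> \<open>The supporting functional at time \<open>a\<close>: the first variation of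
        \<Phi> as a function of the needle direction.\<close>
      let ?l = "\<lambda>p. D (pullback G' a p)"
      have "Re (?l h) \<le> Re (?l (\<lambda>z. G z a))" if h: "h \<in> class_M" for h
      proof -
        have Hol: "h \<in> Hol" "(\<lambda>z. G z a) \<in> Hol" using h GM by (auto simp: class_M_def)
        have "Re (D (pullback G' a (\<lambda>z. h z - G' z a))) \<le> 0"
          unfolding D_def F
          by (rule needle_variation_inequality[OF S G' assms(6)[unfolded F] assms(5)[unfolded F] a h elim(2)])
        moreover have "D (pullback G' a (\<lambda>z. h z - G' z a)) = ?l h - ?l (\<lambda>z. G z a)"
          unfolding eq pullback_diff[OF S G' a]
        proof (rule functional_diff[OF S G' _ _ r])
          show "pullback G' a h \<in> Hol" "pullback G' a (\<lambda>z. G z a) \<in> Hol"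
            by (intro pullback_in_Hol[OF S G' a] Hol_holomorphic Hol)+
        qed (fact add scale bound)+
        ultimately show ?thesis by simp
      qed
      moreover have "continuous_linear_functional ?l"
        by (rule continuous_linear_functional_pullback[OF S G' _ _ r _ a]) (fact add scale bound)+
      moreover have "\<not> ?l constant_on class_M"
      proof
        assume const: "?l constant_on class_M"
        have "D constant_on class_S0"
          by (rule constant_on_class_S0_if_pullback_constant[OF S G' _ _ r _ a]) (fact add scale bound const)+
        then show False using D by blast
      qed
      ultimately show "support_point class_M (\<lambda>z. G z a)"
        unfolding support_point_def using GM by blast
    qed
  qed
qed

end
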